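(* Let $\mathcal F$ be the set of finite cardinals (natural numbers), regarded as a discrete category with the functor $U\colon\mathcal F\to\mathbf{MCat}^{\mathbf 2}$ given by $U(n)=(j_n\colon n\hookrightarrow C(n))$. Then $\mathcal F$ over $\mathbf{MCat}^{\mathbf 2}$ cofibrantly KZ-generates a lax orthogonal factorisation system $(\mathsf L,\mathsf R)$ on the 2-category $\mathbf{MCat}$ of multicategories. The $\mathsf R$-algebras are the cloven opfibrations of multicategories.
   Context: Multicategories. $\mathbf{MCat}$ is the 2-category of small multicategories (non-symmetric coloured operads). For $n\ge0$, $n=\{0,\dots,n-1\}$ is regarded as a discrete multicategory (only identities). $C(n)$ is the multicategory with objects $0,\dots,n-1$ and an extra object $*$, whose only multimorphisms are identities and a single multimorphism $0,\dots,n-1\to *$; thus morphisms $C(n)\to\mathbb B$ correspond to multimorphisms $b_0,\dots,b_{n-1}\to b$ in $\mathbb B$. $j_n$ is the inclusion. Opfibrations. Given a morphism of multicategories $P\colon\mathbb E\to\mathbb B$ and a multimap $f\colon P(e_1),\dots,P(e_n)\to b$ in $\mathbb B$, an opcartesian lifting of $f$ is a multimap $\bar f\colon e_1,\dots,e_n\to e$ over $f$ such that for all $g\colon e_1,\dots,e_n\to x$ and $w\colon b\to P(x)$ with $P(g)=w\cdot f$ there is a unique $v\colon e\to x$ with $v\cdot\bar f=g$ and $P(v)=w$. $P$ is a cloven opfibration of multicategories if it is equipped with a choice of opcartesian lifting for each such multimap. The morphisms of cloven opfibrations are the morphisms of $\mathbf{MCat}^{\mathbf 2}$ that strictly preserve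 the chosen liftings; 2-cells are those of $\mathbf{MCat}^{\mathbf 2}$. AWFS. An (enriched over $\mathbf{Cat}$) algebraic weak factorisation system (AWFS) $(\mathsf L,\mathsf R)$ on a 2-category $\mathcal C$ is a 2-functorial factorisation $f=(A\xrightarrow{Lf}Kf\xrightarrow{Rf}B)$ of arrows, with 2-natural $\Sigma_f=(1,\sigma_f)\colon Lf\to L^2f$ and $\Pi_f=(\pi_f,1)\colon R^2f\to Rf$ making $\mathsf L=(L,\Phi,\Sigma)$ a 2-comonad and $\mathsf R=(R,\Lambda,\Pi)$ a 2-monad on $\mathcal C^{\mathbf 2}$ ($\Phi_f=(1,Rf)$, $\Lambda_f=(Lf,1)$), such that $(\sigma_f,\pi_f)\colon LRf\to RLf$ is a mixed distributive law. Then $\mathsf R$-algebras compose, giving an internal category $\mathsf R\text-\mathbb A\mathrm{lg}=(\mathsf R\text-\mathrm{Alg}\rightrightarrows\mathcal C)$ over $\mathbb S\mathrm q(\mathcal C)=(\mathcal C^{\mathbf 2}\rightrightarrows\mathcal C)$. It is lax orthogonal (a LOFS) if $\mathsf L$ and $\mathsf R$ are lax idempotent, where a 2-monad $(T,i,m)$ is lax idempotent if $Ti\dashv m$ with identity unit, and dually (reversing 1-cells) for 2-comonads. KZ-generation. A RALI structure on a morphism $p$ is a left adjoint $\ell\dashv p$ with identity unit (so $p\ell=1$). For $U\colon\mathcal J\to\mathcal C^{\mathbf 2}$ with $\mathcal J$ a small 2-category, $\mathcal J^{\pitchfork_{KZ}}$ is the 2-category over $\mathcal C^{\mathbf 2}$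 whose objects are morphisms $f\colon A\to B$ with a RALI structure, 2-natural in $j$, on the comparison functors $\mathcal C(\mathrm{cod}\,Uj,A)\to\mathcal C(\mathrm{dom}\,Uj,A)\times_{\mathcal C(\mathrm{dom}\,Uj,B)}\mathcal C(\mathrm{cod}\,Uj,B)$, whose morphisms are morphisms of $\mathcal C^{\mathbf 2}$ compatible with these structures (commuting with left adjoints and with the adjunctions), and whose 2-cells are those of $\mathcal C^{\mathbf 2}$; it is the arrow part of an internal category with object part $\mathcal C$, since RALIs are stable under pullback and composition. $\mathcal J$ cofibrantly KZ-generates $(\mathsf L,\mathsf R)$ if $\mathsf R\text-\mathbb A\mathrm{lg}\cong\mathcal J^{\pitchfork_{KZ}}$ as internal categories over $\mathbb S\mathrm q(\mathcal C)$. *)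

theory Defs
  imports Main "HOL-Library.FuncSet" "HOL-Library.Countable_Set"
begin

section \<open>Categories, functors, and 2-categories with explicit carriers\<close>

record ('o, 'm) cat =
  cobj :: "'o set"
  carr :: "'m set"
  cdom :: "'m \<Rightarrow> 'o"
  ccod :: "'m \<Rightarrow> 'o"
  cid :: "'o \<Rightarrow> 'm"
  ccomp :: "'m \<Rightarrow> 'm \<Rightarrow> 'm"

definition chom :: "('o, 'm, 'z) cat_scheme \<Rightarrow> 'o \<Rightarrow> 'o \<Rightarrow> 'm set" where
  "chom C x y = {f \<in> carr C. cdom C f = x \<and> ccod C f = y}"

locale category =
  fixes C :: "('o, 'm, 'z) cat_scheme"
  assumes dom_in: "f \<in> carr C \<Longrightarrow> cdom C f \<in> cobj C"
    and cod_in: "f \<in> carr C \<Longrightarrow> ccod C f \<in> cobj C"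
    and id_in: "x \<in> cobj C \<Longrightarrow> cid C x \<in> chom C x x"
    and comp_in: "f \<in> chom C x y \<Longrightarrow> g \<in> chom C y z \<Longrightarrow> ccomp C g f \<in> chom C x z"
    and id_left: "f \<in> chom C x y \<Longrightarrow> ccomp C (cid C y) f = f"
    and id_right: "f \<in> chom C x y \<Longrightarrow> ccomp C f (cid C x) = f"
    and assoc: "f \<in> chom C w x \<Longrightarrow> g \<in> chom C x y \<Longrightarrow> h \<in> chom C y z \<Longrightarrow>
      ccomp C (ccomp C h g) f = ccomp C h (ccomp C g f)"

record ('o, 'm, 'p, 'n) cfun =
  ob_map :: "'o \<Rightarrow> 'p"
  ar_map :: "'m \<Rightarrow> 'n"

locale functor_on =
  fixes C :: "('o, 'm, 'y) cat_scheme" and D :: "('p, 'n, 'z) cat_scheme"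
    and F :: "('o, 'm, 'p, 'n, 'w) cfun_scheme"
  assumes ob_map: "x \<in> cobj C \<Longrightarrow> ob_map F x \<in> cobj D"
    and ar_map: "f \<in> chom C x y \<Longrightarrow> x \<in> cobj C \<Longrightarrow> y \<in> cobj C \<Longrightarrow>
      ar_map F f \<in> chom D (ob_map F x) (ob_map F y)"
    and map_id: "x \<in> cobj C \<Longrightarrow> ar_map F (cid C x) = cid D (ob_map F x)"
    and map_comp: "f \<in> chom C x y \<Longrightarrow> g \<in> chom C y z \<Longrightarrow>
      ar_map F (ccomp C g f) = ccomp D (ar_map F g) (ar_map F f)"

text \<open>A 2-category: the underlying \<open>cat\<close> consists of the 0-cells and 1-cells. Both compositions are
  written in applicative order.\<close>

record ('o, 'a, 'c) twocat = "('o, 'a) cat" +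
  cell :: "'c set"
  src :: "'c \<Rightarrow> 'a"
  trg :: "'c \<Rightarrow> 'a"
  id2 :: "'a \<Rightarrow> 'c"
  vcomp :: "'c \<Rightarrow> 'c \<Rightarrow> 'c"
  hcomp :: "'c \<Rightarrow> 'c \<Rightarrow> 'c"

definition vcat :: "('o, 'a, 'c, 'z) twocat_scheme \<Rightarrow> ('a, 'c) cat" where
  "vcat C = \<lparr>cobj = carr C, carr = cell C, cdom = src C, ccod = trg C,
     cid = id2 C, ccomp = vcomp C\<rparr>"

definition hcat :: "('o, 'a, 'c, 'z) twocat_scheme \<Rightarrow> ('o, 'c) cat" where
  "hcat C = \<lparr>cobj = cobj C, carr = cell C, cdom = (\<lambda>\<theta>. cdom C (src C \<theta>)),
     ccod = (\<lambda>\<theta>. ccod C (src C \<theta>)), cid = (\<lambda>x. id2 C (cid C x)), ccomp = hcomp C\<rparr>"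

locale two_category = category C + v: category "vcat C" + h: category "hcat C"
  for C :: "('o, 'a, 'c, 'z) twocat_scheme" +
  assumes globular: "\<theta> \<in> cell C \<Longrightarrow>
      cdom C (trg C \<theta>) = cdom C (src C \<theta>) \<and> ccod C (trg C \<theta>) = ccod C (src C \<theta>)"
    and hcomp_bd: "\<theta> \<in> cell C \<Longrightarrow> \<phi> \<in> cell C \<Longrightarrow> ccod C (src C \<theta>) = cdom C (src C \<phi>) \<Longrightarrow>
      src C (hcomp C \<phi> \<theta>) = ccomp C (src C \<phi>) (src C \<theta>) \<and>
      trg C (hcomp C \<phi> \<theta>) = ccomp C (trg C \<phi>) (trg C \<theta>)"
    and hcomp_id: "f \<in> chom C x y \<Longrightarrow> g \<in> chom C y z \<Longrightarrow>
      hcomp C (id2 C g) (id2 C f) = id2 C (ccomp C g f)"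
    and interchange: "\<theta> \<in> cell C \<Longrightarrow> \<theta>' \<in> cell C \<Longrightarrow> \<phi> \<in> cell C \<Longrightarrow> \<phi>' \<in> cell C \<Longrightarrow>
      trg C \<theta> = src C \<theta>' \<Longrightarrow> trg C \<phi> = src C \<phi>' \<Longrightarrow> ccod C (src C \<theta>) = cdom C (src C \<phi>) \<Longrightarrow>
      hcomp C (vcomp C \<phi>' \<phi>) (vcomp C \<theta>' \<theta>) = vcomp C (hcomp C \<phi>' \<theta>') (hcomp C \<phi> \<theta>)"

definition hom_cat :: "('o, 'a, 'c, 'z) twocat_scheme \<Rightarrow> 'o \<Rightarrow> 'o \<Rightarrow> ('a, 'c) cat" where
  "hom_cat C x y = \<lparr>cobj = chom C x y, carr = {\<theta> \<in> cell C. src C \<theta> \<in> chom C x y},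
     cdom = src C, ccod = trg C, cid = id2 C, ccomp = vcomp C\<rparr>"

record ('o, 'a, 'c, 'p, 'b, 'd) tfun = "('o, 'a, 'p, 'b) cfun" +
  ce_map :: "'c \<Rightarrow> 'd"

locale two_functor = functor_on C D F
  for C :: "('o, 'a, 'c, 'y) twocat_scheme" and D :: "('p, 'b, 'd, 'z) twocat_scheme"
    and F :: "('o, 'a, 'c, 'p, 'b, 'd) tfun" +
  assumes ce_map: "\<theta> \<in> cell C \<Longrightarrow> ce_map F \<theta> \<in> cell D"
    and map_src: "\<theta> \<in> cell C \<Longrightarrow> src D (ce_map F \<theta>) = ar_map F (src C \<theta>)"
    and map_trg: "\<theta> \<in> cell C \<Longrightarrow> trg D (ce_map F \<theta>) = ar_map F (trg C \<theta>)"
    and map_id2: "f \<in> carr C \<Longrightarrow> ce_map F (id2 C f) = id2 D (ar_map F f)"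
    and map_vcomp: "\<theta> \<in> cell C \<Longrightarrow> \<phi> \<in> cell C \<Longrightarrow> trg C \<theta> = src C \<phi> \<Longrightarrow>
      ce_map F (vcomp C \<phi> \<theta>) = vcomp D (ce_map F \<phi>) (ce_map F \<theta>)"
    and map_hcomp: "\<theta> \<in> cell C \<Longrightarrow> \<phi> \<in> cell C \<Longrightarrow> ccod C (src C \<theta>) = cdom C (src C \<phi>) \<Longrightarrow>
      ce_map F (hcomp C \<phi> \<theta>) = hcomp D (ce_map F \<phi>) (ce_map F \<theta>)"

definition tfun_id :: "('o, 'a, 'c, 'o, 'a, 'c) tfun" where
  "tfun_id = \<lparr>ob_map = id, ar_map = id, ce_map = id\<rparr>"

definition tfun_comp ::
  "('p, 'b, 'd, 'q, 'e, 'f) tfun \<Rightarrow> ('o, 'a, 'c, 'p, 'b, 'd) tfun \<Rightarrow> ('o, 'a, 'c, 'q, 'e, 'f) tfun" where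
  "tfun_comp G F = \<lparr>ob_map = ob_map G \<circ> ob_map F, ar_map = ar_map G \<circ> ar_map F,
     ce_map = ce_map G \<circ> ce_map F\<rparr>"

definition tfun_eq_on :: "('o, 'a, 'c, 'z) twocat_scheme \<Rightarrow> ('o, 'a, 'c, 'p, 'b, 'd) tfun \<Rightarrow>
    ('o, 'a, 'c, 'p, 'b, 'd) tfun \<Rightarrow> bool" where
  "tfun_eq_on C F G \<longleftrightarrow> (\<forall>x\<in>cobj C. ob_map F x = ob_map G x) \<and>
     (\<forall>f\<in>carr C. ar_map F f = ar_map G f) \<and> (\<forall>\<theta>\<in>cell C. ce_map F \<theta> = ce_map G \<theta>)"

definition two_iso :: "('o, 'a, 'c, 'y) twocat_scheme \<Rightarrow> ('p, 'b, 'd, 'z) twocat_scheme \<Rightarrow>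
    ('o, 'a, 'c, 'p, 'b, 'd) tfun \<Rightarrow> bool" where
  "two_iso C D F \<longleftrightarrow> two_category C \<and> two_category D \<and> two_functor C D F \<and>
     bij_betw (ob_map F) (cobj C) (cobj D) \<and> bij_betw (ar_map F) (carr C) (carr D) \<and>
     bij_betw (ce_map F) (cell C) (cell D)"

text \<open>Isomorphism of 2-categories \<open>V : C \<rightarrow> S\<close> and \<open>W : D \<rightarrow> S\<close> over a 2-category \<open>S\<close>.\<close>

definition two_iso_over :: "('s, 't, 'u, 'x) twocat_scheme \<Rightarrow>
    ('o, 'a, 'c, 'y) twocat_scheme \<Rightarrow> ('o, 'a, 'c, 's, 't, 'u) tfun \<Rightarrow>
    ('p, 'b, 'd, 'z) twocat_scheme \<Rightarrow> ('p, 'b, 'd, 's, 't, 'u) tfun \<Rightarrow> bool" where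
  "two_iso_over S C V D W \<longleftrightarrow> two_functor C S V \<and> two_functor D S W \<and>
     (\<exists>F. two_iso C D F \<and> tfun_eq_on C (tfun_comp W F) V)"

definition pb_cat :: "('o, 'm, 'p, 'n, 'v) cfun_scheme \<Rightarrow> ('o, 'm, 'y) cat_scheme \<Rightarrow>
    ('q, 'k, 'p, 'n, 'w) cfun_scheme \<Rightarrow> ('q, 'k, 'z) cat_scheme \<Rightarrow> ('o \<times> 'q, 'm \<times> 'k) cat" where
  "pb_cat F A G B = \<lparr>
     cobj = {(x, y). x \<in> cobj A \<and> y \<in> cobj B \<and> ob_map F x = ob_map G y},
     carr = {(x, y). x \<in> carr A \<and> y \<in> carr B \<and> ar_map F x = ar_map G y},
     cdom = map_prod (cdom A) (cdom B),
     ccod = map_prod (ccod A) (ccod B),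
     cid = map_prod (cid A) (cid B),
     ccomp = (\<lambda>(x', y') (x, y). (ccomp A x' x, ccomp B y' y))\<rparr>"

definition pb_twocat :: "('o, 'a, 'c, 's, 't, 'u) tfun \<Rightarrow> ('o, 'a, 'c, 'y) twocat_scheme \<Rightarrow>
    ('p, 'b, 'd, 's, 't, 'u) tfun \<Rightarrow> ('p, 'b, 'd, 'z) twocat_scheme \<Rightarrow>
    ('o \<times> 'p, 'a \<times> 'b, 'c \<times> 'd) twocat" where
  "pb_twocat F A G B = cat.extend (pb_cat F A G B) \<lparr>
     cell = {(x, y). x \<in> cell A \<and> y \<in> cell B \<and> ce_map F x = ce_map G y},
     src = map_prod (src A) (src B),
     trg = map_prod (trg A) (trg B),
     id2 = map_prod (id2 A) (id2 B),
     vcomp = (\<lambda>(x', y') (x, y). (vcomp A x' x, vcomp B y' y)),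
     hcomp = (\<lambda>(x', y') (x, y). (hcomp A x' x, hcomp B y' y))\<rparr>"

definition discrete_twocat :: "'o set \<Rightarrow> ('o, 'o, 'o) twocat" where
  "discrete_twocat S = \<lparr>cobj = S, carr = S, cdom = id, ccod = id, cid = id, ccomp = (\<lambda>y x. x),
     cell = S, src = id, trg = id, id2 = id, vcomp = (\<lambda>y x. x), hcomp = (\<lambda>y x. x)\<rparr>"


section \<open>The 2-category of arrows\<close>

text \<open>\<open>Sq f h k g\<close> is the square \<open>(h, k) : f \<rightarrow> g\<close>, with \<open>g h = k f\<close>.\<close>

datatype 'a sq = Sq (sdom: 'a) (stop: 'a) (sbot: 'a) (scod: 'a)

datatype ('a, 'c) sqcell = SqCell (csrc: "'a sq") (ctop: 'c) (cbot: 'c) (ctrg: "'a sq")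

definition arrow_1cells :: "('o, 'a, 'c, 'z) twocat_scheme \<Rightarrow> 'a sq set" where
  "arrow_1cells C = {Sq f h k g | f h k g. f \<in> carr C \<and> g \<in> carr C \<and>
     h \<in> chom C (cdom C f) (cdom C g) \<and> k \<in> chom C (ccod C f) (ccod C g) \<and>
     ccomp C g h = ccomp C k f}"

definition arrow_2cells :: "('o, 'a, 'c, 'z) twocat_scheme \<Rightarrow> ('a, 'c) sqcell set" where
  "arrow_2cells C = {SqCell s \<alpha> \<beta> t | s \<alpha> \<beta> t. s \<in> arrow_1cells C \<and> t \<in> arrow_1cells C \<and>
     sdom s = sdom t \<and> scod s = scod t \<and>
     \<alpha> \<in> cell C \<and> src C \<alpha> = stop s \<and> trg C \<alpha> = stop t \<and>
     \<beta> \<in> cell C \<and> src C \<beta> = sbot s \<and> trg C \<beta> = sbot t \<and>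
     hcomp C (id2 C (scod s)) \<alpha> = hcomp C \<beta> (id2 C (sdom s))}"

definition sq_id :: "('o, 'a, 'c, 'z) twocat_scheme \<Rightarrow> 'a \<Rightarrow> 'a sq" where
  "sq_id C f = Sq f (cid C (cdom C f)) (cid C (ccod C f)) f"

definition sq_comp :: "('o, 'a, 'c, 'z) twocat_scheme \<Rightarrow> 'a sq \<Rightarrow> 'a sq \<Rightarrow> 'a sq" where
  "sq_comp C t s = Sq (sdom s) (ccomp C (stop t) (stop s)) (ccomp C (sbot t) (sbot s)) (scod t)"

definition arrow_twocat :: "('o, 'a, 'c, 'z) twocat_scheme \<Rightarrow> ('a, 'a sq, ('a, 'c) sqcell) twocat" where
  "arrow_twocat C = \<lparr>
     cobj = carr C,
     carr = arrow_1cells C,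
     cdom = sdom,
     ccod = scod,
     cid = sq_id C,
     ccomp = sq_comp C,
     cell = arrow_2cells C,
     src = csrc,
     trg = ctrg,
     id2 = (\<lambda>s. SqCell s (id2 C (stop s)) (id2 C (sbot s)) s),
     vcomp = (\<lambda>\<phi> \<theta>. SqCell (csrc \<theta>) (vcomp C (ctop \<phi>) (ctop \<theta>)) (vcomp C (cbot \<phi>) (cbot \<theta>)) (ctrg \<phi>)),
     hcomp = (\<lambda>\<phi> \<theta>. SqCell (sq_comp C (csrc \<phi>) (csrc \<theta>)) (hcomp C (ctop \<phi>) (ctop \<theta>))
        (hcomp C (cbot \<phi>) (cbot \<theta>)) (sq_comp C (ctrg \<phi>) (ctrg \<theta>)))\<rparr>"

definition arrow_dom :: "('o, 'a, 'c, 'z) twocat_scheme \<Rightarrow> ('a, 'a sq, ('a, 'c) sqcell, 'o, 'a, 'c) tfun" where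
  "arrow_dom C = \<lparr>ob_map = cdom C, ar_map = stop, ce_map = ctop\<rparr>"

definition arrow_cod :: "('o, 'a, 'c, 'z) twocat_scheme \<Rightarrow> ('a, 'a sq, ('a, 'c) sqcell, 'o, 'a, 'c) tfun" where
  "arrow_cod C = \<lparr>ob_map = ccod C, ar_map = sbot, ce_map = cbot\<rparr>"

text \<open>Vertical pasting of squares along a common horizontal edge.\<close>

definition sq_paste :: "('o, 'a, 'c, 'z) twocat_scheme \<Rightarrow> 'a sq \<Rightarrow> 'a sq \<Rightarrow> 'a sq" where
  "sq_paste C t s = Sq (ccomp C (sdom t) (sdom s)) (stop s) (sbot t) (ccomp C (scod t) (scod s))"

definition sqcell_paste :: "('o, 'a, 'c, 'z) twocat_scheme \<Rightarrow>
    ('a, 'c) sqcell \<Rightarrow> ('a, 'c) sqcell \<Rightarrow> ('a, 'c) sqcell" where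
  "sqcell_paste C \<phi> \<theta> = SqCell (sq_paste C (csrc \<phi>) (csrc \<theta>)) (ctop \<theta>) (cbot \<phi>)
     (sq_paste C (ctrg \<phi>) (ctrg \<theta>))"

definition sq_vid :: "('o, 'a, 'c, 'z) twocat_scheme \<Rightarrow> 'a \<Rightarrow> 'a sq" where
  "sq_vid C h = Sq (cid C (cdom C h)) h h (cid C (ccod C h))"

definition sqcell_vid :: "('o, 'a, 'c, 'z) twocat_scheme \<Rightarrow> 'c \<Rightarrow> ('a, 'c) sqcell" where
  "sqcell_vid C \<theta> = SqCell (sq_vid C (src C \<theta>)) \<theta> \<theta> (sq_vid C (trg C \<theta>))"


section \<open>Internal categories in 2-categories\<close>

record ('o, 'a, 'c, 'p, 'b, 'd) icat =
  iob :: "('o, 'a, 'c) twocat"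
  iar :: "('p, 'b, 'd) twocat"
  isrc :: "('p, 'b, 'd, 'o, 'a, 'c) tfun"
  itrg :: "('p, 'b, 'd, 'o, 'a, 'c) tfun"
  iid :: "('o, 'a, 'c, 'p, 'b, 'd) tfun"
  icmp :: "('p \<times> 'p, 'b \<times> 'b, 'd \<times> 'd, 'p, 'b, 'd) tfun"

text \<open>The category axioms for the structure 2-functors amount to having an ordinary category at each
  of the levels of 0-cells, 1-cells and 2-cells.\<close>

definition ilevel0 :: "('o, 'a, 'c, 'p, 'b, 'd) icat \<Rightarrow> ('o, 'p) cat" where
  "ilevel0 D = \<lparr>cobj = cobj (iob D), carr = cobj (iar D), cdom = ob_map (isrc D),
     ccod = ob_map (itrg D), cid = ob_map (iid D), ccomp = (\<lambda>y x. ob_map (icmp D) (y, x))\<rparr>"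

definition ilevel1 :: "('o, 'a, 'c, 'p, 'b, 'd) icat \<Rightarrow> ('a, 'b) cat" where
  "ilevel1 D = \<lparr>cobj = carr (iob D), carr = carr (iar D), cdom = ar_map (isrc D),
     ccod = ar_map (itrg D), cid = ar_map (iid D), ccomp = (\<lambda>y x. ar_map (icmp D) (y, x))\<rparr>"

definition ilevel2 :: "('o, 'a, 'c, 'p, 'b, 'd) icat \<Rightarrow> ('c, 'd) cat" where
  "ilevel2 D = \<lparr>cobj = cell (iob D), carr = cell (iar D), cdom = ce_map (isrc D),
     ccod = ce_map (itrg D), cid = ce_map (iid D), ccomp = (\<lambda>y x. ce_map (icmp D) (y, x))\<rparr>"

definition internal_category :: "('o, 'a, 'c, 'p, 'b, 'd) icat \<Rightarrow> bool" where
  "internal_category D \<longleftrightarrow>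
     two_category (iob D) \<and> two_category (iar D) \<and>
     two_functor (iar D) (iob D) (isrc D) \<and> two_functor (iar D) (iob D) (itrg D) \<and>
     two_functor (iob D) (iar D) (iid D) \<and>
     two_functor (pb_twocat (isrc D) (iar D) (itrg D) (iar D)) (iar D) (icmp D) \<and>
     category (ilevel0 D) \<and> category (ilevel1 D) \<and> category (ilevel2 D)"

definition internal_functor :: "('o, 'a, 'c, 'p, 'b, 'd) icat \<Rightarrow> ('o2, 'a2, 'c2, 'p2, 'b2, 'd2) icat \<Rightarrow>
    ('o, 'a, 'c, 'o2, 'a2, 'c2) tfun \<times> ('p, 'b, 'd, 'p2, 'b2, 'd2) tfun \<Rightarrow> bool" where
  "internal_functor D E = (\<lambda>(F0, F1).
     two_functor (iob D) (iob E) F0 \<and> two_functor (iar D) (iar E) F1 \<and>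
     functor_on (ilevel0 D) (ilevel0 E) \<lparr>ob_map = ob_map F0, ar_map = ob_map F1\<rparr> \<and>
     functor_on (ilevel1 D) (ilevel1 E) \<lparr>ob_map = ar_map F0, ar_map = ar_map F1\<rparr> \<and>
     functor_on (ilevel2 D) (ilevel2 E) \<lparr>ob_map = ce_map F0, ar_map = ce_map F1\<rparr>)"

definition internal_iso_over :: "('s, 't, 'u, 'x, 'y, 'z) icat \<Rightarrow>
    ('o, 'a, 'c, 'p, 'b, 'd) icat \<Rightarrow>
    ('o, 'a, 'c, 's, 't, 'u) tfun \<times> ('p, 'b, 'd, 'x, 'y, 'z) tfun \<Rightarrow>
    ('o2, 'a2, 'c2, 'p2, 'b2, 'd2) icat \<Rightarrow>
    ('o2, 'a2, 'c2, 's, 't, 'u) tfun \<times> ('p2, 'b2, 'd2, 'x, 'y, 'z) tfun \<Rightarrow> bool" where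
  "internal_iso_over S D V E W \<longleftrightarrow>
     internal_category S \<and> internal_category D \<and> internal_category E \<and>
     internal_functor D S V \<and> internal_functor E S W \<and>
     (\<exists>F0 F1. internal_functor D E (F0, F1) \<and>
        two_iso (iob D) (iob E) F0 \<and> two_iso (iar D) (iar E) F1 \<and>
        tfun_eq_on (iob D) (tfun_comp (fst W) F0) (fst V) \<and>
        tfun_eq_on (iar D) (tfun_comp (snd W) F1) (snd V))"

definition sq_icat :: "('o, 'a, 'c) twocat \<Rightarrow> ('o, 'a, 'c, 'a, 'a sq, ('a, 'c) sqcell) icat" where
  "sq_icat C = \<lparr>
     iob = C,
     iar = arrow_twocat C,
     isrc = arrow_dom C,
     itrg = arrow_cod C,
     iid = \<lparr>ob_map = cid C, ar_map = sq_vid C, ce_map = sqcell_vid C\<rparr>,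
     icmp = \<lparr>ob_map = (\<lambda>(g, f). ccomp C g f), ar_map = (\<lambda>(t, s). sq_paste C t s),
       ce_map = (\<lambda>(\<phi>, \<theta>). sqcell_paste C \<phi> \<theta>)\<rparr>\<rparr>"

text \<open>2-categories of structured objects over \<open>D\<close>: the objects are the pairs \<open>(x, structure)\<close> in
  \<open>S\<close>, the 1-cells and 2-cells are those of \<open>D\<close> satisfying \<open>M\<close> and \<open>N\<close>, tagged with their
  boundary.\<close>

definition structured_1cells :: "('o, 'a, 'c, 'z) twocat_scheme \<Rightarrow> ('o \<times> 'x) set \<Rightarrow>
    ('o \<times> 'x \<Rightarrow> 'a \<Rightarrow> 'o \<times> 'x \<Rightarrow> bool) \<Rightarrow> (('o \<times> 'x) \<times> 'a \<times> ('o \<times> 'x)) set" where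
  "structured_1cells D S M = {(X, u, Y). X \<in> S \<and> Y \<in> S \<and> u \<in> chom D (fst X) (fst Y) \<and> M X u Y}"

definition structured_twocat :: "('o, 'a, 'c, 'z) twocat_scheme \<Rightarrow> ('o \<times> 'x) set \<Rightarrow>
    ('o \<times> 'x \<Rightarrow> 'a \<Rightarrow> 'o \<times> 'x \<Rightarrow> bool) \<Rightarrow> ('o \<times> 'x \<Rightarrow> 'c \<Rightarrow> 'o \<times> 'x \<Rightarrow> bool) \<Rightarrow>
    ('o \<times> 'x, ('o \<times> 'x) \<times> 'a \<times> ('o \<times> 'x),
      (('o \<times> 'x) \<times> 'a \<times> ('o \<times> 'x)) \<times> 'c \<times> (('o \<times> 'x) \<times> 'a \<times> ('o \<times> 'x))) twocat" where
  "structured_twocat D S M N = \<lparr>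
     cobj = S,
     carr = structured_1cells D S M,
     cdom = fst,
     ccod = snd \<circ> snd,
     cid = (\<lambda>X. (X, cid D (fst X), X)),
     ccomp = (\<lambda>(Y, v, Z) (X, u, Y'). (X, ccomp D v u, Z)),
     cell = {((X, u, Y), \<theta>, (X', u', Y')).
        (X, u, Y) \<in> structured_1cells D S M \<and> (X', u', Y') \<in> structured_1cells D S M \<and>
        X = X' \<and> Y = Y' \<and> \<theta> \<in> cell D \<and> src D \<theta> = u \<and> trg D \<theta> = u' \<and> N X \<theta> Y},
     src = fst,
     trg = snd \<circ> snd,
     id2 = (\<lambda>(X, u, Y). ((X, u, Y), id2 D u, (X, u, Y))),
     vcomp = (\<lambda>(q, \<phi>, r) (p, \<theta>, q'). (p, vcomp D \<phi> \<theta>, r)),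
     hcomp = (\<lambda>((Y, v, Z), \<phi>, (Y', v', Z')) ((X, u, Y''), \<theta>, (X', u', Y''')).
        ((X, ccomp D v u, Z), hcomp D \<phi> \<theta>, (X', ccomp D v' u', Z')))\<rparr>"

definition structured_forget ::
  "('o \<times> 'x, ('o \<times> 'x) \<times> 'a \<times> ('o \<times> 'x),
      (('o \<times> 'x) \<times> 'a \<times> ('o \<times> 'x)) \<times> 'c \<times> (('o \<times> 'x) \<times> 'a \<times> ('o \<times> 'x)), 'o, 'a, 'c) tfun" where
  "structured_forget = \<lparr>ob_map = fst, ar_map = fst \<circ> snd, ce_map = fst \<circ> snd\<rparr>"

text \<open>An internal category over \<open>sq_icat C\<close> with object part \<open>C\<close>, whose arrow part is a 2-category
  \<open>A\<close> of structured arrows; \<open>idn\<close> and \<open>cmp\<close> give the structure on identities and composites.\<close>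

definition structured_icat :: "('o, 'a, 'c) twocat \<Rightarrow>
    ('a \<times> 'x, ('a \<times> 'x) \<times> 'a sq \<times> ('a \<times> 'x),
      (('a \<times> 'x) \<times> 'a sq \<times> ('a \<times> 'x)) \<times> ('a, 'c) sqcell \<times> (('a \<times> 'x) \<times> 'a sq \<times> ('a \<times> 'x))) twocat \<Rightarrow>
    ('o \<Rightarrow> 'a \<times> 'x) \<Rightarrow> ('a \<times> 'x \<Rightarrow> 'a \<times> 'x \<Rightarrow> 'a \<times> 'x) \<Rightarrow>
    ('o, 'a, 'c, 'a \<times> 'x, ('a \<times> 'x) \<times> 'a sq \<times> ('a \<times> 'x),
      (('a \<times> 'x) \<times> 'a sq \<times> ('a \<times> 'x)) \<times> ('a, 'c) sqcell \<times> (('a \<times> 'x) \<times> 'a sq \<times> ('a \<times> 'x))) icat" where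
  "structured_icat C A idn cmp =
    (let id1 = (\<lambda>h. (idn (cdom C h), sq_vid C h, idn (ccod C h)));
         cmp1 = (\<lambda>(Y, t, Y') (X, s, X'). (cmp Y X, sq_paste C t s, cmp Y' X'))
     in \<lparr>iob = C,
         iar = A,
         isrc = tfun_comp (arrow_dom C) structured_forget,
         itrg = tfun_comp (arrow_cod C) structured_forget,
         iid = \<lparr>ob_map = idn, ar_map = id1,
           ce_map = (\<lambda>\<theta>. (id1 (src C \<theta>), sqcell_vid C \<theta>, id1 (trg C \<theta>)))\<rparr>,
         icmp = \<lparr>ob_map = (\<lambda>(Y, X). cmp Y X), ar_map = (\<lambda>(t, s). cmp1 t s),
           ce_map = (\<lambda>((t, \<phi>, t'), (s, \<theta>, s')). (cmp1 t s, sqcell_paste C \<phi> \<theta>, cmp1 t' s'))\<rparr>\<rparr>)"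


section \<open>2-monads, 2-comonads and lax idempotency\<close>

definition two_nat :: "('o, 'a, 'c, 'y) twocat_scheme \<Rightarrow> ('p, 'b, 'd, 'z) twocat_scheme \<Rightarrow>
    ('o, 'a, 'c, 'p, 'b, 'd) tfun \<Rightarrow> ('o, 'a, 'c, 'p, 'b, 'd) tfun \<Rightarrow> ('o \<Rightarrow> 'b) \<Rightarrow> bool" where
  "two_nat C D F G \<tau> \<longleftrightarrow>
     (\<forall>x\<in>cobj C. \<tau> x \<in> chom D (ob_map F x) (ob_map G x)) \<and>
     (\<forall>u\<in>carr C. ccomp D (ar_map G u) (\<tau> (cdom C u)) = ccomp D (\<tau> (ccod C u)) (ar_map F u)) \<and>
     (\<forall>\<theta>\<in>cell C. hcomp D (ce_map G \<theta>) (id2 D (\<tau> (cdom C (src C \<theta>)))) =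
        hcomp D (id2 D (\<tau> (ccod C (src C \<theta>)))) (ce_map F \<theta>))"

locale two_monad = two_category D + two_functor D D T
  for D :: "('o, 'a, 'c, 'z) twocat_scheme" and T :: "('o, 'a, 'c, 'o, 'a, 'c) tfun"
    and \<eta> :: "'o \<Rightarrow> 'a" and \<mu> :: "'o \<Rightarrow> 'a" +
  assumes unit_nat: "two_nat D D tfun_id T \<eta>"
    and mult_nat: "two_nat D D (tfun_comp T T) T \<mu>"
    and unit_left: "x \<in> cobj D \<Longrightarrow> ccomp D (\<mu> x) (\<eta> (ob_map T x)) = cid D (ob_map T x)"
    and unit_right: "x \<in> cobj D \<Longrightarrow> ccomp D (\<mu> x) (ar_map T (\<eta> x)) = cid D (ob_map T x)"
    and mult_assoc: "x \<in> cobj D \<Longrightarrow>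
      ccomp D (\<mu> x) (\<mu> (ob_map T x)) = ccomp D (\<mu> x) (ar_map T (\<mu> x))"

locale two_comonad = two_category D + two_functor D D G
  for D :: "('o, 'a, 'c, 'z) twocat_scheme" and G :: "('o, 'a, 'c, 'o, 'a, 'c) tfun"
    and \<epsilon> :: "'o \<Rightarrow> 'a" and \<delta> :: "'o \<Rightarrow> 'a" +
  assumes counit_nat: "two_nat D D G tfun_id \<epsilon>"
    and comult_nat: "two_nat D D G (tfun_comp G G) \<delta>"
    and counit_left: "x \<in> cobj D \<Longrightarrow> ccomp D (\<epsilon> (ob_map G x)) (\<delta> x) = cid D (ob_map G x)"
    and counit_right: "x \<in> cobj D \<Longrightarrow> ccomp D (ar_map G (\<epsilon> x)) (\<delta> x) = cid D (ob_map G x)"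
    and comult_assoc: "x \<in> cobj D \<Longrightarrow>
      ccomp D (\<delta> (ob_map G x)) (\<delta> x) = ccomp D (ar_map G (\<delta> x)) (\<delta> x)"

text \<open>Adjunctions \<open>\<lambda> \<stileturn> \<rho>\<close> with identity unit between 2-natural transformations \<open>\<lambda> : F \<rightarrow> G\<close> and
  \<open>\<rho> : G \<rightarrow> F\<close>, the counit being a modification \<open>\<lambda> \<rho> \<rightarrow> 1\<close>.\<close>

definition adj_id_unit :: "('o, 'a, 'c, 'z) twocat_scheme \<Rightarrow> ('p, 'b, 'd, 'y) twocat_scheme \<Rightarrow>
    ('o, 'a, 'c, 'p, 'b, 'd) tfun \<Rightarrow> ('o, 'a, 'c, 'p, 'b, 'd) tfun \<Rightarrow>
    ('o \<Rightarrow> 'b) \<Rightarrow> ('o \<Rightarrow> 'b) \<Rightarrow> bool" where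
  "adj_id_unit C D F G l r \<longleftrightarrow>
     (\<forall>x\<in>cobj C. ccomp D (r x) (l x) = cid D (ob_map F x)) \<and>
     (\<exists>e. (\<forall>x\<in>cobj C. e x \<in> cell D \<and> src D (e x) = ccomp D (l x) (r x) \<and>
               trg D (e x) = cid D (ob_map G x) \<and>
               hcomp D (id2 D (r x)) (e x) = id2 D (r x) \<and>
               hcomp D (e x) (id2 D (l x)) = id2 D (l x)) \<and>
          (\<forall>u\<in>carr C. hcomp D (e (ccod C u)) (id2 D (ar_map G u)) =
               hcomp D (id2 D (ar_map G u)) (e (cdom C u))))"

definition lax_idempotent_monad :: "('o, 'a, 'c, 'z) twocat_scheme \<Rightarrow>
    ('o, 'a, 'c, 'o, 'a, 'c) tfun \<Rightarrow> ('o \<Rightarrow> 'a) \<Rightarrow> ('o \<Rightarrow> 'a) \<Rightarrow> bool" where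
  "lax_idempotent_monad D T \<eta> \<mu> \<longleftrightarrow> two_monad D T \<eta> \<mu> \<and>
     adj_id_unit D D T (tfun_comp T T) (\<lambda>x. ar_map T (\<eta> x)) \<mu>"

text \<open>Reversing 1-cells turns the left adjoint into the right adjoint.\<close>

definition lax_idempotent_comonad :: "('o, 'a, 'c, 'z) twocat_scheme \<Rightarrow>
    ('o, 'a, 'c, 'o, 'a, 'c) tfun \<Rightarrow> ('o \<Rightarrow> 'a) \<Rightarrow> ('o \<Rightarrow> 'a) \<Rightarrow> bool" where
  "lax_idempotent_comonad D G \<epsilon> \<delta> \<longleftrightarrow> two_comonad D G \<epsilon> \<delta> \<and>
     adj_id_unit D D G (tfun_comp G G) \<delta> (\<lambda>x. ar_map G (\<epsilon> x))"

definition mixed_distributive_law :: "('o, 'a, 'c, 'z) twocat_scheme \<Rightarrow>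
    ('o, 'a, 'c, 'o, 'a, 'c) tfun \<Rightarrow> ('o \<Rightarrow> 'a) \<Rightarrow> ('o \<Rightarrow> 'a) \<Rightarrow>
    ('o, 'a, 'c, 'o, 'a, 'c) tfun \<Rightarrow> ('o \<Rightarrow> 'a) \<Rightarrow> ('o \<Rightarrow> 'a) \<Rightarrow> ('o \<Rightarrow> 'a) \<Rightarrow> bool" where
  "mixed_distributive_law D G \<epsilon> \<delta> T \<eta> \<mu> d \<longleftrightarrow>
     two_nat D D (tfun_comp G T) (tfun_comp T G) d \<and>
     (\<forall>x\<in>cobj D.
        ccomp D (d x) (ar_map G (\<eta> x)) = \<eta> (ob_map G x) \<and>
        ccomp D (d x) (ar_map G (\<mu> x)) =
          ccomp D (\<mu> (ob_map G x)) (ccomp D (ar_map T (d x)) (d (ob_map T x))) \<and>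
        ccomp D (ar_map T (\<epsilon> x)) (d x) = \<epsilon> (ob_map T x) \<and>
        ccomp D (ar_map T (\<delta> x)) (d x) =
          ccomp D (d (ob_map G x)) (ccomp D (ar_map G (d x)) (\<delta> (ob_map T x))))"

definition alg_twocat :: "('o, 'a, 'c, 'z) twocat_scheme \<Rightarrow> ('o, 'a, 'c, 'o, 'a, 'c) tfun \<Rightarrow>
    ('o \<Rightarrow> 'a) \<Rightarrow> ('o \<Rightarrow> 'a) \<Rightarrow>
    ('o \<times> 'a, ('o \<times> 'a) \<times> 'a \<times> ('o \<times> 'a),
      (('o \<times> 'a) \<times> 'a \<times> ('o \<times> 'a)) \<times> 'c \<times> (('o \<times> 'a) \<times> 'a \<times> ('o \<times> 'a))) twocat" where
  "alg_twocat D T \<eta> \<mu> = structured_twocat D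
     {(x, a). x \<in> cobj D \<and> a \<in> chom D (ob_map T x) x \<and> ccomp D a (\<eta> x) = cid D x \<and>
        ccomp D a (ar_map T a) = ccomp D a (\<mu> x)}
     (\<lambda>(x, a) u (y, b). ccomp D u a = ccomp D b (ar_map T u))
     (\<lambda>(x, a) \<theta> (y, b). hcomp D \<theta> (id2 D a) = hcomp D (id2 D b) (ce_map T \<theta>))"


section \<open>Algebraic weak factorisation systems\<close>

record ('o, 'a, 'c) awfs_data =
  mid :: "('a, 'a sq, ('a, 'c) sqcell, 'o, 'a, 'c) tfun"
  lft :: "'a \<Rightarrow> 'a"
  rgt :: "'a \<Rightarrow> 'a"
  sig :: "'a \<Rightarrow> 'a"
  prj :: "'a \<Rightarrow> 'a"

definition Lfun :: "('o, 'a, 'c) awfs_data \<Rightarrow>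
    ('a, 'a sq, ('a, 'c) sqcell, 'a, 'a sq, ('a, 'c) sqcell) tfun" where
  "Lfun W = (let l = (\<lambda>s. Sq (lft W (sdom s)) (stop s) (ar_map (mid W) s) (lft W (scod s)))
     in \<lparr>ob_map = lft W, ar_map = l,
         ce_map = (\<lambda>\<theta>. SqCell (l (csrc \<theta>)) (ctop \<theta>) (ce_map (mid W) \<theta>) (l (ctrg \<theta>)))\<rparr>)"

definition Rfun :: "('o, 'a, 'c) awfs_data \<Rightarrow>
    ('a, 'a sq, ('a, 'c) sqcell, 'a, 'a sq, ('a, 'c) sqcell) tfun" where
  "Rfun W = (let r = (\<lambda>s. Sq (rgt W (sdom s)) (ar_map (mid W) s) (sbot s) (rgt W (scod s)))
     in \<lparr>ob_map = rgt W, ar_map = r,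
         ce_map = (\<lambda>\<theta>. SqCell (r (csrc \<theta>)) (ce_map (mid W) \<theta>) (cbot \<theta>) (r (ctrg \<theta>)))\<rparr>)"

definition Lcounit :: "('o, 'a, 'c) twocat \<Rightarrow> ('o, 'a, 'c) awfs_data \<Rightarrow> 'a \<Rightarrow> 'a sq" where
  "Lcounit C W f = Sq (lft W f) (cid C (cdom C f)) (rgt W f) f"

definition Lcomult :: "('o, 'a, 'c) twocat \<Rightarrow> ('o, 'a, 'c) awfs_data \<Rightarrow> 'a \<Rightarrow> 'a sq" where
  "Lcomult C W f = Sq (lft W f) (cid C (cdom C f)) (sig W f) (lft W (lft W f))"

definition Runit :: "('o, 'a, 'c) twocat \<Rightarrow> ('o, 'a, 'c) awfs_data \<Rightarrow> 'a \<Rightarrow> 'a sq" where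
  "Runit C W f = Sq f (lft W f) (cid C (ccod C f)) (rgt W f)"

definition Rmult :: "('o, 'a, 'c) twocat \<Rightarrow> ('o, 'a, 'c) awfs_data \<Rightarrow> 'a \<Rightarrow> 'a sq" where
  "Rmult C W f = Sq (rgt W (rgt W f)) (prj W f) (cid C (ccod C f)) (rgt W f)"

definition LRlaw :: "('o, 'a, 'c) awfs_data \<Rightarrow> 'a \<Rightarrow> 'a sq" where
  "LRlaw W f = Sq (lft W (rgt W f)) (sig W f) (prj W f) (rgt W (lft W f))"

definition awfs :: "('o, 'a, 'c) twocat \<Rightarrow> ('o, 'a, 'c) awfs_data \<Rightarrow> bool" where
  "awfs C W \<longleftrightarrow> two_category C \<and>
     two_functor (arrow_twocat C) C (mid W) \<and>
     two_nat (arrow_twocat C) C (arrow_dom C) (mid W) (lft W) \<and>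
     two_nat (arrow_twocat C) C (mid W) (arrow_cod C) (rgt W) \<and>
     (\<forall>f\<in>carr C. ccomp C (rgt W f) (lft W f) = f) \<and>
     two_comonad (arrow_twocat C) (Lfun W) (Lcounit C W) (Lcomult C W) \<and>
     two_monad (arrow_twocat C) (Rfun W) (Runit C W) (Rmult C W) \<and>
     mixed_distributive_law (arrow_twocat C) (Lfun W) (Lcounit C W) (Lcomult C W)
       (Rfun W) (Runit C W) (Rmult C W) (LRlaw W)"

definition lofs :: "('o, 'a, 'c) twocat \<Rightarrow> ('o, 'a, 'c) awfs_data \<Rightarrow> bool" where
  "lofs C W \<longleftrightarrow> awfs C W \<and>
     lax_idempotent_comonad (arrow_twocat C) (Lfun W) (Lcounit C W) (Lcomult C W) \<and>
     lax_idempotent_monad (arrow_twocat C) (Rfun W) (Runit C W) (Rmult C W)"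

definition Ralg :: "('o, 'a, 'c) twocat \<Rightarrow> ('o, 'a, 'c) awfs_data \<Rightarrow>
    ('a \<times> 'a sq, ('a \<times> 'a sq) \<times> 'a sq \<times> ('a \<times> 'a sq),
      (('a \<times> 'a sq) \<times> 'a sq \<times> ('a \<times> 'a sq)) \<times> ('a, 'c) sqcell \<times> (('a \<times> 'a sq) \<times> 'a sq \<times> ('a \<times> 'a sq))) twocat" where
  "Ralg C W = alg_twocat (arrow_twocat C) (Rfun W) (Runit C W) (Rmult C W)"

text \<open>By the unit law, an algebra structure on \<open>f : A \<rightarrow> B\<close> is a square \<open>(p, 1) : R f \<rightarrow> f\<close>. It
  provides each square \<open>(h, k) : L x \<rightarrow> f\<close> with the canonical filler \<open>p \<circ> K(h, k) \<circ> \<sigma>\<close>, and \<open>p\<close>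
  itself is the filler of \<open>(1, R f) : L f \<rightarrow> f\<close>. Given also a structure \<open>q\<close> on \<open>g\<close>, the
  structure on \<open>g f\<close> is the filler of \<open>(1, R (g f)) : L (g f) \<rightarrow> g f\<close> obtained by filling
  \<open>(f, R (g f)) : L (g f) \<rightarrow> g\<close> first, which gives \<open>d = q \<circ> K(f, 1)\<close>, and then filling
  \<open>(1, d) : L (g f) \<rightarrow> f\<close>.\<close>

definition Ralg_id :: "('o, 'a, 'c) twocat \<Rightarrow> ('o, 'a, 'c) awfs_data \<Rightarrow> 'o \<Rightarrow> 'a \<times> 'a sq" where
  "Ralg_id C W x = (cid C x, Sq (rgt W (cid C x)) (rgt W (cid C x)) (cid C x) (cid C x))"

definition Ralg_comp :: "('o, 'a, 'c) twocat \<Rightarrow> ('o, 'a, 'c) awfs_data \<Rightarrow>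
    'a \<times> 'a sq \<Rightarrow> 'a \<times> 'a sq \<Rightarrow> 'a \<times> 'a sq" where
  "Ralg_comp C W = (\<lambda>(g, b) (f, a).
     (let gf = ccomp C g f;
          d = ccomp C (stop b) (ar_map (mid W) (Sq gf f (cid C (ccod C g)) g));
          r = ccomp C (stop a) (ccomp C (ar_map (mid W) (Sq (lft W gf) (cid C (cdom C f)) d f)) (sig W gf))
      in (gf, Sq (rgt W gf) r (cid C (ccod C g)) gf)))"

definition Ralg_icat :: "('o, 'a, 'c) twocat \<Rightarrow> ('o, 'a, 'c) awfs_data \<Rightarrow>
    ('o, 'a, 'c, 'a \<times> 'a sq, ('a \<times> 'a sq) \<times> 'a sq \<times> ('a \<times> 'a sq),
      (('a \<times> 'a sq) \<times> 'a sq \<times> ('a \<times> 'a sq)) \<times> ('a, 'c) sqcell \<times> (('a \<times> 'a sq) \<times> 'a sq \<times> ('a \<times> 'a sq))) icat" where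
  "Ralg_icat C W = structured_icat C (Ralg C W) (Ralg_id C W) (Ralg_comp C W)"


section \<open>KZ-generation\<close>

definition precomp :: "('o, 'a, 'c, 'z) twocat_scheme \<Rightarrow> 'a \<Rightarrow> ('a, 'c, 'a, 'c) cfun" where
  "precomp C j = \<lparr>ob_map = (\<lambda>u. ccomp C u j), ar_map = (\<lambda>\<theta>. hcomp C \<theta> (id2 C j))\<rparr>"

definition postcomp :: "('o, 'a, 'c, 'z) twocat_scheme \<Rightarrow> 'a \<Rightarrow> ('a, 'c, 'a, 'c) cfun" where
  "postcomp C f = \<lparr>ob_map = (\<lambda>u. ccomp C f u), ar_map = (\<lambda>\<theta>. hcomp C (id2 C f) \<theta>)\<rparr>"

definition comparison_target :: "('o, 'a, 'c, 'z) twocat_scheme \<Rightarrow> 'a \<Rightarrow> 'a \<Rightarrow> ('a \<times> 'a, 'c \<times> 'c) cat" where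
  "comparison_target C j f =
     pb_cat (postcomp C f) (hom_cat C (cdom C j) (cdom C f)) (precomp C j) (hom_cat C (ccod C j) (ccod C f))"

definition comparison :: "('o, 'a, 'c, 'z) twocat_scheme \<Rightarrow> 'a \<Rightarrow> 'a \<Rightarrow> ('a, 'c, 'a \<times> 'a, 'c \<times> 'c) cfun" where
  "comparison C j f = \<lparr>
     ob_map = (\<lambda>d. (ob_map (precomp C j) d, ob_map (postcomp C f) d)),
     ar_map = (\<lambda>\<theta>. (ar_map (precomp C j) \<theta>, ar_map (postcomp C f) \<theta>))\<rparr>"

text \<open>A left adjoint, with identity unit, to a functor \<open>P : A \<rightarrow> B\<close>. All components are extensional,
  so that equal structures are equal as values.\<close>

record ('o, 'm, 'p, 'n) rali =
  ladj :: "('p, 'n, 'o, 'm) cfun"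
  counit :: "'o \<Rightarrow> 'm"

definition rali_structure :: "('o, 'm, 'y) cat_scheme \<Rightarrow> ('p, 'n, 'z) cat_scheme \<Rightarrow>
    ('o, 'm, 'p, 'n) cfun \<Rightarrow> ('o, 'm, 'p, 'n) rali \<Rightarrow> bool" where
  "rali_structure A B P Q \<longleftrightarrow>
     functor_on B A (ladj Q) \<and>
     ob_map (ladj Q) \<in> extensional (cobj B) \<and> ar_map (ladj Q) \<in> extensional (carr B) \<and>
     counit Q \<in> extensional (cobj A) \<and>
     (\<forall>b\<in>cobj B. ob_map P (ob_map (ladj Q) b) = b) \<and>
     (\<forall>v\<in>carr B. ar_map P (ar_map (ladj Q) v) = v) \<and>
     (\<forall>a\<in>cobj A. counit Q a \<in> chom A (ob_map (ladj Q) (ob_map P a)) a) \<and>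
     (\<forall>u\<in>carr A. ccomp A u (counit Q (cdom A u)) =
        ccomp A (counit Q (ccod A u)) (ar_map (ladj Q) (ar_map P u))) \<and>
     (\<forall>a\<in>cobj A. ar_map P (counit Q a) = cid B (ob_map P a)) \<and>
     (\<forall>b\<in>cobj B. counit Q (ob_map (ladj Q) b) = cid A (ob_map (ladj Q) b))"

type_synonym ('j, 'a, 'c) kz_structure = "'j \<Rightarrow> ('a, 'c, 'a \<times> 'a, 'c \<times> 'c) rali"

text \<open>The comparison functors are the components of a 2-natural transformation between 2-functors
  \<open>J\<^sup>o\<^sup>p \<rightarrow> Cat\<close>; the left adjoints have to be 2-natural and the counits have to form a
  modification.\<close>

definition kz_structure :: "('o, 'a, 'c) twocat \<Rightarrow> ('j, 'k, 'l) twocat \<Rightarrow>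
    ('j, 'k, 'l, 'a, 'a sq, ('a, 'c) sqcell) tfun \<Rightarrow> 'a \<Rightarrow> ('j, 'a, 'c) kz_structure \<Rightarrow> bool" where
  "kz_structure C J U f Q \<longleftrightarrow>
     Q \<in> extensional (cobj J) \<and>
     (\<forall>j\<in>cobj J. rali_structure (hom_cat C (ccod C (ob_map U j)) (cdom C f))
        (comparison_target C (ob_map U j) f) (comparison C (ob_map U j) f) (Q j)) \<and>
     (\<forall>x\<in>carr J. let j = cdom J x; k = ccod J x; s = stop (ar_map U x); t = sbot (ar_map U x) in
        (\<forall>(u, v)\<in>cobj (comparison_target C (ob_map U k) f).
           ob_map (ladj (Q j)) (ccomp C u s, ccomp C v t) = ccomp C (ob_map (ladj (Q k)) (u, v)) t) \<and>
        (\<forall>(\<alpha>, \<beta>)\<in>carr (comparison_target C (ob_map U k) f).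
           ar_map (ladj (Q j)) (hcomp C \<alpha> (id2 C s), hcomp C \<beta> (id2 C t)) =
             hcomp C (ar_map (ladj (Q k)) (\<alpha>, \<beta>)) (id2 C t)) \<and>
        (\<forall>d\<in>chom C (ccod C (ob_map U k)) (cdom C f).
           counit (Q j) (ccomp C d t) = hcomp C (counit (Q k) d) (id2 C t))) \<and>
     (\<forall>\<theta>\<in>cell J. let j = cdom J (src J \<theta>); k = ccod J (src J \<theta>);
                      \<theta>0 = ctop (ce_map U \<theta>); \<theta>1 = cbot (ce_map U \<theta>) in
        (\<forall>(u, v)\<in>cobj (comparison_target C (ob_map U k) f).
           ar_map (ladj (Q j)) (hcomp C (id2 C u) \<theta>0, hcomp C (id2 C v) \<theta>1) =
             hcomp C (id2 C (ob_map (ladj (Q k)) (u, v))) \<theta>1))"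

definition kz_morphism :: "('o, 'a, 'c) twocat \<Rightarrow> ('j, 'k, 'l) twocat \<Rightarrow>
    ('j, 'k, 'l, 'a, 'a sq, ('a, 'c) sqcell) tfun \<Rightarrow>
    'a \<times> ('j, 'a, 'c) kz_structure \<Rightarrow> 'a sq \<Rightarrow> 'a \<times> ('j, 'a, 'c) kz_structure \<Rightarrow> bool" where
  "kz_morphism C J U = (\<lambda>(f, Q) s (g, Q').
     let h = stop s; k = sbot s in
     (\<forall>j\<in>cobj J.
        (\<forall>(u, v)\<in>cobj (comparison_target C (ob_map U j) f).
           ccomp C h (ob_map (ladj (Q j)) (u, v)) = ob_map (ladj (Q' j)) (ccomp C h u, ccomp C k v)) \<and>
        (\<forall>(\<alpha>, \<beta>)\<in>carr (comparison_target C (ob_map U j) f).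
           hcomp C (id2 C h) (ar_map (ladj (Q j)) (\<alpha>, \<beta>)) =
             ar_map (ladj (Q' j)) (hcomp C (id2 C h) \<alpha>, hcomp C (id2 C k) \<beta>)) \<and>
        (\<forall>d\<in>chom C (ccod C (ob_map U j)) (cdom C f).
           hcomp C (id2 C h) (counit (Q j) d) = counit (Q' j) (ccomp C h d))))"

definition kz_twocat :: "('o, 'a, 'c) twocat \<Rightarrow> ('j, 'k, 'l) twocat \<Rightarrow>
    ('j, 'k, 'l, 'a, 'a sq, ('a, 'c) sqcell) tfun \<Rightarrow>
    ('a \<times> ('j, 'a, 'c) kz_structure,
      ('a \<times> ('j, 'a, 'c) kz_structure) \<times> 'a sq \<times> ('a \<times> ('j, 'a, 'c) kz_structure),
      (('a \<times> ('j, 'a, 'c) kz_structure) \<times> 'a sq \<times> ('a \<times> ('j, 'a, 'c) kz_structure)) \<times> ('a, 'c) sqcell \<times>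
        (('a \<times> ('j, 'a, 'c) kz_structure) \<times> 'a sq \<times> ('a \<times> ('j, 'a, 'c) kz_structure))) twocat" where
  "kz_twocat C J U = structured_twocat (arrow_twocat C)
     {(f, Q). f \<in> carr C \<and> kz_structure C J U f Q} (kz_morphism C J U) (\<lambda>_ _ _. True)"

text \<open>The comparison functor of an identity is invertible. The comparison functor of a composite
  \<open>g f\<close> is that of \<open>f\<close> followed by a pullback of that of \<open>g\<close>.\<close>

definition kz_id :: "('o, 'a, 'c) twocat \<Rightarrow> ('j, 'k, 'l) twocat \<Rightarrow>
    ('j, 'k, 'l, 'a, 'a sq, ('a, 'c) sqcell) tfun \<Rightarrow> 'o \<Rightarrow> 'a \<times> ('j, 'a, 'c) kz_structure" where
  "kz_id C J U x = (cid C x, \<lambda>j\<in>cobj J.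
     \<lparr>ladj = \<lparr>ob_map = restrict snd (cobj (comparison_target C (ob_map U j) (cid C x))),
              ar_map = restrict snd (carr (comparison_target C (ob_map U j) (cid C x)))\<rparr>,
      counit = restrict (id2 C) (chom C (ccod C (ob_map U j)) x)\<rparr>)"

definition kz_comp :: "('o, 'a, 'c) twocat \<Rightarrow> ('j, 'k, 'l) twocat \<Rightarrow>
    ('j, 'k, 'l, 'a, 'a sq, ('a, 'c) sqcell) tfun \<Rightarrow>
    'a \<times> ('j, 'a, 'c) kz_structure \<Rightarrow> 'a \<times> ('j, 'a, 'c) kz_structure \<Rightarrow>
    'a \<times> ('j, 'a, 'c) kz_structure" where
  "kz_comp C J U = (\<lambda>(g, Q') (f, Q). (ccomp C g f, \<lambda>j\<in>cobj J.
     \<lparr>ladj =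
       \<lparr>ob_map = (\<lambda>(u, w)\<in>cobj (comparison_target C (ob_map U j) (ccomp C g f)).
          ob_map (ladj (Q j)) (u, ob_map (ladj (Q' j)) (ccomp C f u, w))),
        ar_map = (\<lambda>(\<alpha>, \<gamma>)\<in>carr (comparison_target C (ob_map U j) (ccomp C g f)).
          ar_map (ladj (Q j)) (\<alpha>, ar_map (ladj (Q' j)) (hcomp C (id2 C f) \<alpha>, \<gamma>)))\<rparr>,
      counit = (\<lambda>d\<in>chom C (ccod C (ob_map U j)) (cdom C f).
        vcomp C (counit (Q j) d)
          (ar_map (ladj (Q j)) (id2 C (ccomp C d (ob_map U j)), counit (Q' j) (ccomp C f d))))\<rparr>))"

definition kz_icat :: "('o, 'a, 'c) twocat \<Rightarrow> ('j, 'k, 'l) twocat \<Rightarrow>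
    ('j, 'k, 'l, 'a, 'a sq, ('a, 'c) sqcell) tfun \<Rightarrow>
    ('o, 'a, 'c, 'a \<times> ('j, 'a, 'c) kz_structure,
      ('a \<times> ('j, 'a, 'c) kz_structure) \<times> 'a sq \<times> ('a \<times> ('j, 'a, 'c) kz_structure),
      (('a \<times> ('j, 'a, 'c) kz_structure) \<times> 'a sq \<times> ('a \<times> ('j, 'a, 'c) kz_structure)) \<times> ('a, 'c) sqcell \<times>
        (('a \<times> ('j, 'a, 'c) kz_structure) \<times> 'a sq \<times> ('a \<times> ('j, 'a, 'c) kz_structure))) icat" where
  "kz_icat C J U = structured_icat C (kz_twocat C J U) (kz_id C J U) (kz_comp C J U)"

definition cofibrantly_kz_generates :: "('o, 'a, 'c) twocat \<Rightarrow> ('j, 'k, 'l) twocat \<Rightarrow>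
    ('j, 'k, 'l, 'a, 'a sq, ('a, 'c) sqcell) tfun \<Rightarrow> ('o, 'a, 'c) awfs_data \<Rightarrow> bool" where
  "cofibrantly_kz_generates C J U W \<longleftrightarrow>
     two_category J \<and> two_functor J (arrow_twocat C) U \<and>
     internal_iso_over (sq_icat C) (Ralg_icat C W) (tfun_id, structured_forget)
       (kz_icat C J U) (tfun_id, structured_forget)"


section \<open>Multicategories\<close>

record ('o, 'm) multicat =
  mobj :: "'o set"
  marr :: "'m set"
  mdom :: "'m \<Rightarrow> 'o list"
  mcod :: "'m \<Rightarrow> 'o"
  mident :: "'o \<Rightarrow> 'm"
  mcomp :: "'m \<Rightarrow> 'm list \<Rightarrow> 'm"

definition composable :: "('o, 'm) multicat \<Rightarrow> 'm \<Rightarrow> 'm list \<Rightarrow> bool" where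
  "composable A g fs \<longleftrightarrow> g \<in> marr A \<and> set fs \<subseteq> marr A \<and> map (mcod A) fs = mdom A g"

locale multicategory =
  fixes A :: "('o, 'm) multicat"
  assumes mdom_in: "f \<in> marr A \<Longrightarrow> set (mdom A f) \<subseteq> mobj A"
    and mcod_in: "f \<in> marr A \<Longrightarrow> mcod A f \<in> mobj A"
    and mident_in: "x \<in> mobj A \<Longrightarrow>
      mident A x \<in> marr A \<and> mdom A (mident A x) = [x] \<and> mcod A (mident A x) = x"
    and mcomp_in: "composable A g fs \<Longrightarrow> mcomp A g fs \<in> marr A \<and>
      mdom A (mcomp A g fs) = concat (map (mdom A) fs) \<and> mcod A (mcomp A g fs) = mcod A g"
    and mcomp_mident_right: "f \<in> marr A \<Longrightarrow> mcomp A f (map (mident A) (mdom A f)) = f"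
    and mcomp_mident_left: "f \<in> marr A \<Longrightarrow> mcomp A (mident A (mcod A f)) [f] = f"
    and mcomp_assoc: "composable A h gs \<Longrightarrow> list_all2 (composable A) gs fss \<Longrightarrow>
      mcomp A (mcomp A h gs) (concat fss) = mcomp A h (map2 (mcomp A) gs fss)"
    and extensionality: "mdom A \<in> extensional (marr A)" "mcod A \<in> extensional (marr A)"
      "mident A \<in> extensional (mobj A)" "\<not> composable A g fs \<Longrightarrow> mcomp A g fs = undefined"

record ('o, 'm) multifun =
  fdom :: "('o, 'm) multicat"
  fcod :: "('o, 'm) multicat"
  fobj :: "'o \<Rightarrow> 'o"
  farr :: "'m \<Rightarrow> 'm"

locale multifunctor =
  fixes F :: "('o, 'm) multifun"
  assumes fobj_in: "x \<in> mobj (fdom F) \<Longrightarrow> fobj F x \<in> mobj (fcod F)"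
    and farr_in: "f \<in> marr (fdom F) \<Longrightarrow> farr F f \<in> marr (fcod F) \<and>
      mdom (fcod F) (farr F f) = map (fobj F) (mdom (fdom F) f) \<and>
      mcod (fcod F) (farr F f) = fobj F (mcod (fdom F) f)"
    and farr_mident: "x \<in> mobj (fdom F) \<Longrightarrow> farr F (mident (fdom F) x) = mident (fcod F) (fobj F x)"
    and farr_mcomp: "composable (fdom F) g fs \<Longrightarrow>
      farr F (mcomp (fdom F) g fs) = mcomp (fcod F) (farr F g) (map (farr F) fs)"
    and extensionality: "fobj F \<in> extensional (mobj (fdom F))" "farr F \<in> extensional (marr (fdom F))"

record ('o, 'm) multitrans =
  tsrc :: "('o, 'm) multifun"
  ttrg :: "('o, 'm) multifun"
  tcmp :: "'o \<Rightarrow> 'm"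

locale multitransformation =
  fixes t :: "('o, 'm) multitrans"
  assumes parallel: "fdom (tsrc t) = fdom (ttrg t)" "fcod (tsrc t) = fcod (ttrg t)"
    and tcmp_in: "x \<in> mobj (fdom (tsrc t)) \<Longrightarrow> tcmp t x \<in> marr (fcod (tsrc t)) \<and>
      mdom (fcod (tsrc t)) (tcmp t x) = [fobj (tsrc t) x] \<and>
      mcod (fcod (tsrc t)) (tcmp t x) = fobj (ttrg t) x"
    and naturality: "f \<in> marr (fdom (tsrc t)) \<Longrightarrow>
      mcomp (fcod (tsrc t)) (tcmp t (mcod (fdom (tsrc t)) f)) [farr (tsrc t) f] =
      mcomp (fcod (tsrc t)) (farr (ttrg t) f) (map (tcmp t) (mdom (fdom (tsrc t)) f))"
    and extensionality: "tcmp t \<in> extensional (mobj (fdom (tsrc t)))"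

text \<open>The type \<open>'u\<close> plays the role of the universe: a set of elements of \<open>'u\<close> is small when it has
  smaller cardinality than \<open>'u\<close>. If \<open>'u\<close> has inaccessible cardinality then the small sets are, up
  to bijection, the elements of a Grothendieck universe.\<close>

definition small :: "'u set \<Rightarrow> bool" where
  "small S \<longleftrightarrow> (card_of S, card_of (UNIV :: 'u set)) \<in> ordLess"

definition small_multicats :: "('u, 'u) multicat set" where
  "small_multicats = {A. multicategory A \<and> small (mobj A) \<and> small (marr A)}"

definition small_multifuns :: "('u, 'u) multifun set" where
  "small_multifuns = {F. multifunctor F \<and> fdom F \<in> small_multicats \<and> fcod F \<in> small_multicats}"

definition multifun_id :: "('u, 'u) multicat \<Rightarrow> ('u, 'u) multifun" where
  "multifun_id A = \<lparr>fdom = A, fcod = A, fobj = (\<lambda>x\<in>mobj A. x), farr = (\<lambda>f\<in>marr A. f)\<rparr>"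

definition multifun_comp :: "('u, 'u) multifun \<Rightarrow> ('u, 'u) multifun \<Rightarrow> ('u, 'u) multifun" where
  "multifun_comp G F = \<lparr>fdom = fdom F, fcod = fcod G,
     fobj = compose (mobj (fdom F)) (fobj G) (fobj F),
     farr = compose (marr (fdom F)) (farr G) (farr F)\<rparr>"

definition MCat :: "(('u, 'u) multicat, ('u, 'u) multifun, ('u, 'u) multitrans) twocat" where
  "MCat = \<lparr>
     cobj = small_multicats,
     carr = small_multifuns,
     cdom = fdom,
     ccod = fcod,
     cid = multifun_id,
     ccomp = multifun_comp,
     cell = {t. multitransformation t \<and> tsrc t \<in> small_multifuns \<and> ttrg t \<in> small_multifuns},
     src = tsrc,
     trg = ttrg,
     id2 = (\<lambda>F. \<lparr>tsrc = F, ttrg = F,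
        tcmp = (\<lambda>x\<in>mobj (fdom F). mident (fcod F) (fobj F x))\<rparr>),
     vcomp = (\<lambda>t' t. \<lparr>tsrc = tsrc t, ttrg = ttrg t',
        tcmp = (\<lambda>x\<in>mobj (fdom (tsrc t)). mcomp (fcod (tsrc t)) (tcmp t' x) [tcmp t x])\<rparr>),
     hcomp = (\<lambda>t' t. \<lparr>tsrc = multifun_comp (tsrc t') (tsrc t), ttrg = multifun_comp (ttrg t') (ttrg t),
        tcmp = (\<lambda>x\<in>mobj (fdom (tsrc t)).
          mcomp (fcod (tsrc t')) (tcmp t' (fobj (ttrg t) x)) [farr (tsrc t') (tcmp t x)])\<rparr>)\<rparr>"

text \<open>The multicategories \<open>n\<close> and \<open>C(n)\<close>, transported to the universe along an injection \<open>e\<close>: the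
  object \<open>i < n\<close> is \<open>e i\<close> and the extra object of \<open>C(n)\<close> is \<open>e n\<close>. The identity of an object is
  encoded by the same element as the object, and \<open>e (Suc n)\<close> encodes the multimorphism
  \<open>0, \<dots>, n - 1 \<rightarrow> *\<close>.\<close>

definition discrete_multicat :: "(nat \<Rightarrow> 'u) \<Rightarrow> nat \<Rightarrow> ('u, 'u) multicat" where
  "discrete_multicat e n = \<lparr>
     mobj = e ` {..<n},
     marr = e ` {..<n},
     mdom = (\<lambda>f\<in>e ` {..<n}. [f]),
     mcod = (\<lambda>f\<in>e ` {..<n}. f),
     mident = (\<lambda>x\<in>e ` {..<n}. x),
     mcomp = (\<lambda>g fs. if g \<in> e ` {..<n} \<and> fs = [g] then g else undefined)\<rparr>"

definition cone_multicat :: "(nat \<Rightarrow> 'u) \<Rightarrow> nat \<Rightarrow> ('u, 'u) multicat" where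
  "cone_multicat e n =
    (let md = (\<lambda>f\<in>e ` {..Suc n}. if f = e (Suc n) then map e [0..<n] else [f]);
         mc = (\<lambda>f\<in>e ` {..Suc n}. if f = e (Suc n) then e n else f)
     in \<lparr>mobj = e ` {..n},
         marr = e ` {..Suc n},
         mdom = md,
         mcod = mc,
         mident = (\<lambda>x\<in>e ` {..n}. x),
         mcomp = (\<lambda>g fs. if g \<in> e ` {..Suc n} \<and> set fs \<subseteq> e ` {..Suc n} \<and> map mc fs = md g
           then (if g = e (Suc n) then g else hd fs) else undefined)\<rparr>)"

definition cone_inclusion :: "(nat \<Rightarrow> 'u) \<Rightarrow> nat \<Rightarrow> ('u, 'u) multifun" where
  "cone_inclusion e n = \<lparr>fdom = discrete_multicat e n, fcod = cone_multicat e n,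
     fobj = (\<lambda>x\<in>e ` {..<n}. x), farr = (\<lambda>f\<in>e ` {..<n}. f)\<rparr>"

definition cone_family :: "(nat \<Rightarrow> 'u) \<Rightarrow>
    (nat, nat, nat, ('u, 'u) multifun, ('u, 'u) multifun sq,
      (('u, 'u) multifun, ('u, 'u) multitrans) sqcell) tfun" where
  "cone_family e = \<lparr>
     ob_map = cone_inclusion e,
     ar_map = (\<lambda>n. cid (arrow_twocat MCat) (cone_inclusion e n)),
     ce_map = (\<lambda>n. id2 (arrow_twocat MCat) (cid (arrow_twocat MCat) (cone_inclusion e n)))\<rparr>"


section \<open>Cloven opfibrations of multicategories\<close>

definition lifting_problem :: "('u, 'u) multifun \<Rightarrow> 'u list \<Rightarrow> 'u \<Rightarrow> bool" where
  "lifting_problem P es f \<longleftrightarrow>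
     set es \<subseteq> mobj (fdom P) \<and> f \<in> marr (fcod P) \<and> mdom (fcod P) f = map (fobj P) es"

definition opcartesian_lifting :: "('u, 'u) multifun \<Rightarrow> 'u list \<Rightarrow> 'u \<Rightarrow> 'u \<Rightarrow> bool" where
  "opcartesian_lifting P es f l \<longleftrightarrow>
     l \<in> marr (fdom P) \<and> mdom (fdom P) l = es \<and> farr P l = f \<and>
     (\<forall>g w. g \<in> marr (fdom P) \<longrightarrow> mdom (fdom P) g = es \<longrightarrow>
        w \<in> marr (fcod P) \<longrightarrow> mdom (fcod P) w = [mcod (fcod P) f] \<longrightarrow>
        mcod (fcod P) w = fobj P (mcod (fdom P) g) \<longrightarrow>
        farr P g = mcomp (fcod P) w [f] \<longrightarrow>
        (\<exists>!v. v \<in> marr (fdom P) \<and> mdom (fdom P) v = [mcod (fdom P) l] \<and>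
           mcod (fdom P) v = mcod (fdom P) g \<and> mcomp (fdom P) v [l] = g \<and> farr P v = w))"

definition cleavage :: "('u, 'u) multifun \<Rightarrow> ('u list \<times> 'u \<Rightarrow> 'u) \<Rightarrow> bool" where
  "cleavage P c \<longleftrightarrow> c \<in> extensional {(es, f). lifting_problem P es f} \<and>
     (\<forall>es f. lifting_problem P es f \<longrightarrow> opcartesian_lifting P es f (c (es, f)))"

definition cleavage_preserving :: "('u, 'u) multifun \<times> ('u list \<times> 'u \<Rightarrow> 'u) \<Rightarrow>
    ('u, 'u) multifun sq \<Rightarrow> ('u, 'u) multifun \<times> ('u list \<times> 'u \<Rightarrow> 'u) \<Rightarrow> bool" where
  "cleavage_preserving = (\<lambda>(P, c) s (P', c').
     \<forall>es f. lifting_problem P es f \<longrightarrow>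
       farr (stop s) (c (es, f)) = c' (map (fobj (stop s)) es, farr (sbot s) f))"

definition cloven_opfibrations ::
  "(('u, 'u) multifun \<times> ('u list \<times> 'u \<Rightarrow> 'u),
    (('u, 'u) multifun \<times> ('u list \<times> 'u \<Rightarrow> 'u)) \<times> ('u, 'u) multifun sq \<times>
      (('u, 'u) multifun \<times> ('u list \<times> 'u \<Rightarrow> 'u)),
    ((('u, 'u) multifun \<times> ('u list \<times> 'u \<Rightarrow> 'u)) \<times> ('u, 'u) multifun sq \<times>
      (('u, 'u) multifun \<times> ('u list \<times> 'u \<Rightarrow> 'u))) \<times>
    (('u, 'u) multifun, ('u, 'u) multitrans) sqcell \<times>
    ((('u, 'u) multifun \<times> ('u list \<times> 'u \<Rightarrow> 'u)) \<times> ('u, 'u) multifun sq \<times>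
      (('u, 'u) multifun \<times> ('u list \<times> 'u \<Rightarrow> 'u)))) twocat" where
  "cloven_opfibrations = structured_twocat (arrow_twocat MCat)
     {(P, c). P \<in> carr MCat \<and> cleavage P c} cleavage_preserving (\<lambda>_ _ _. True)"

end

theory Submission
 imports Defs
begin

text \<open>Every functor \<open>P\<close> has a free cloven opfibration \<open>R P\<close>, with \<open>P = R P \<cdot> L P\<close>. It is built from \<open>P\<close>
  by adjoining a lift for each lifting problem and a filler for each factorisation through
  a lift. A functor out of \<open>R P\<close> that preserves the chosen lifts is determined by its restriction along
  \<open>L P\<close>, and, by the universal property of the lifts, so is a 2-cell whose source preserves them,
  given its image below. All data and axioms of a lax orthogonal factorisation system
  follow from these two uniqueness properties, and its \<open>R\<close>-algebras are the cloven opfibrations.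
  For the KZ-generation, a RALI structure amounts to an arbitrary choice of universal arrows over
  identities. On the comparison functors of the inclusions \<open>n \<hookrightarrow> C(n)\<close> these are choices of functors
  \<open>C(n) \<rightarrow> E\<close> over lifting problems of arity \<open>n\<close>, and such a functor is universal exactly when the
  multimorphism it names is opcartesian.\<close>

section \<open>2-categories and internal categories\<close>

text \<open>Algebras, KZ structures and cloven opfibrations are all arrows of \<open>MCat\<close>
  with an extra structure that selects some squares and admits every 2-cell. The locale
  \<open>structured_arrows\<close> records this pattern. Its axioms are verified for cloven
  opfibrations and carried along bijections of structures to the other two, which spares a direct
  proof that algebras compose. The delicate direction leads from the algebra laws to a cleavage. An
  algebra on \<open>P\<close> is only a retraction \<open>p\<close> of \<open>L P\<close> over the
  base. Its candidate lifts are the images under \<open>p\<close> of formal lifts, and these are not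
  visibly opcartesian. Lax idempotency supplies a 2-cell from the identity to \<open>L P\<close>
  after \<open>p\<close>, the unit of an adjunction between \<open>p\<close> and \<open>L P\<close>.
  It carries a factorisation in the domain of \<open>P\<close> to one in the free multicategory,
  where lifts are opcartesian by construction. Associativity then says that \<open>p\<close>
  preserves the chosen lifts. Size is the other obstacle: terms must be coded as elements of
  \<open>'u\<close>, and the free multicategory on a finite \<open>P\<close> may be infinite. This
  is why countable sets have to be small and \<open>'u\<close> uncountable.\<close>

abbreviation "sqs \<equiv> arrow_1cells"
abbreviation "sq_cells \<equiv> arrow_2cells"

section \<open>Working rules for categories, functors and 2-categories\<close>

lemma categoryI:
 assumes "\<And>f. f \<in> carr C ==> cdom C f \<in> cobj C \<and> ccod C f \<in> cobj C"
  and "\<And>x. x \<in> cobj C ==> cid C x \<in> carr C \<and> cdom C (cid C x) = x \<and> ccod C (cid C x) = x"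
  and "\<And>f g. f \<in> carr C ==> g \<in> carr C ==> ccod C f = cdom C g ==>
   ccomp C g f \<in> carr C \<and> cdom C (ccomp C g f) = cdom C f \<and> ccod C (ccomp C g f) = ccod C g"
  and "\<And>f. f \<in> carr C ==> ccomp C (cid C (ccod C f)) f = f"
  and "\<And>f. f \<in> carr C ==> ccomp C f (cid C (cdom C f)) = f"
  and "\<And>f g h. f \<in> carr C ==> g \<in> carr C ==> h \<in> carr C ==> ccod C f = cdom C g ==> ccod C g = cdom C h ==>
   ccomp C (ccomp C h g) f = ccomp C h (ccomp C g f)"
 shows "category C"
 using assms by unfold_locales (auto simp: chom_def)

context category
begin

lemma dom_cod_in: "f \<in> carr C ==> cdom C f \<in> cobj C \<and> ccod C f \<in> cobj C"
 by (simp add: dom_in cod_in)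

lemma id_props: "x \<in> cobj C ==> cid C x \<in> carr C \<and> cdom C (cid C x) = x \<and> ccod C (cid C x) = x"
 using id_in by (simp add: chom_def)

lemma comp_props: "f \<in> carr C ==> g \<in> carr C ==> ccod C f = cdom C g ==>
  ccomp C g f \<in> carr C \<and> cdom C (ccomp C g f) = cdom C f \<and> ccod C (ccomp C g f) = ccod C g"
 using comp_in[of f "cdom C f" "ccod C f" g "ccod C g"] by (simp add: chom_def)

lemma id_left': "f \<in> carr C ==> y = ccod C f ==> ccomp C (cid C y) f = f"
 using id_left[of f "cdom C f" y] by (simp add: chom_def)

lemma id_right': "f \<in> carr C ==> x = cdom C f ==> ccomp C f (cid C x) = f"
 using id_right[of f x "ccod C f"] by (simp add: chom_def)

lemma assoc': "f \<in> carr C ==> g \<in> carr C ==> h \<in> carr C ==> ccod C f = cdom C g ==> ccod C g = cdom C h ==>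
  ccomp C (ccomp C h g) f = ccomp C h (ccomp C g f)"
 using assoc[of f "cdom C f" "cdom C g" g "cdom C h" h "ccod C h"] by (simp add: chom_def)

end

lemma functor_onI:
 assumes "\<And>x. x \<in> cobj C ==> ob_map F x \<in> cobj D"
  and "\<And>f. f \<in> carr C ==> ar_map F f \<in> carr D \<and> cdom D (ar_map F f) = ob_map F (cdom C f) \<and>
   ccod D (ar_map F f) = ob_map F (ccod C f)"
  and "\<And>x. x \<in> cobj C ==> ar_map F (cid C x) = cid D (ob_map F x)"
  and "\<And>f g. f \<in> carr C ==> g \<in> carr C ==> ccod C f = cdom C g ==>
   ar_map F (ccomp C g f) = ccomp D (ar_map F g) (ar_map F f)"
 shows "functor_on C D F"
 using assms by unfold_locales (auto simp: chom_def)

context functor_on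
begin

lemma ar_props: "f \<in> carr C ==> cdom C f \<in> cobj C ==> ccod C f \<in> cobj C ==>
  ar_map F f \<in> carr D \<and> cdom D (ar_map F f) = ob_map F (cdom C f) \<and>
   ccod D (ar_map F f) = ob_map F (ccod C f)"
 using ar_map[of f "cdom C f" "ccod C f"] by (simp add: chom_def)

lemma map_comp': "f \<in> carr C ==> g \<in> carr C ==> ccod C f = cdom C g ==>
  ar_map F (ccomp C g f) = ccomp D (ar_map F g) (ar_map F f)"
 using map_comp[of f "cdom C f" "ccod C f" g "ccod C g"] by (simp add: chom_def)

end

context two_category
begin

abbreviation comp1 (infixr "\<cdot>" 75) where "g \<cdot> f \<equiv> ccomp C g f"
abbreviation comph (infixr "\<star>" 75) where "\<phi> \<star> \<theta> \<equiv> hcomp C \<phi> \<theta>"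
abbreviation compv (infixr "\<bullet>" 73) where "\<phi> \<bullet> \<theta> \<equiv> vcomp C \<phi> \<theta>"
abbreviation ident2 ("\<iota>") where "\<iota> f \<equiv> id2 C f"

lemma
 shows dom_ob [simp]: "f \<in> carr C ==> cdom C f \<in> cobj C"
  and cod_ob [simp]: "f \<in> carr C ==> ccod C f \<in> cobj C"
 by (simp_all add: dom_cod_in)

lemma
 assumes "x \<in> cobj C"
 shows id_carr [simp]: "cid C x \<in> carr C"
  and dom_id [simp]: "cdom C (cid C x) = x"
  and cod_id [simp]: "ccod C (cid C x) = x"
 using assms by (simp_all add: id_props)

lemma
 assumes "f \<in> carr C" "g \<in> carr C" "ccod C f = cdom C g"
 shows comp_carr [simp]: "g \<cdot> f \<in> carr C"
  and dom_comp [simp]: "cdom C (g \<cdot> f) = cdom C f"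
  and cod_comp [simp]: "ccod C (g \<cdot> f) = ccod C g"
 using assms by (simp_all add: comp_props)

declare id_left' [simp] id_right' [simp] assoc' [simp]

lemma
 assumes "f \<in> carr C"
 shows id2_cell [simp]: "\<iota> f \<in> cell C"
  and src_id2 [simp]: "src C (\<iota> f) = f"
  and trg_id2 [simp]: "trg C (\<iota> f) = f"
 using assms v.id_props[of f] by (simp_all add: vcat_def)

lemma
 assumes "\<theta> \<in> cell C"
 shows src_carr [simp]: "src C \<theta> \<in> carr C"
  and trg_carr [simp]: "trg C \<theta> \<in> carr C"
  and dom_trg [simp]: "cdom C (trg C \<theta>) = cdom C (src C \<theta>)"
  and cod_trg [simp]: "ccod C (trg C \<theta>) = ccod C (src C \<theta>)"
 using assms v.dom_cod_in[of \<theta>] globular by (simp_all add: vcat_def)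

lemma
 assumes "\<theta> \<in> cell C" "\<phi> \<in> cell C" "trg C \<theta> = src C \<phi>"
 shows vcomp_cell [simp]: "\<phi> \<bullet> \<theta> \<in> cell C"
  and src_vcomp [simp]: "src C (\<phi> \<bullet> \<theta>) = src C \<theta>"
  and trg_vcomp [simp]: "trg C (\<phi> \<bullet> \<theta>) = trg C \<phi>"
 using assms v.comp_props[of \<theta> \<phi>] by (simp_all add: vcat_def)

lemma
 assumes "\<theta> \<in> cell C"
 shows vcomp_id_left [simp]: "f = trg C \<theta> ==> \<iota> f \<bullet> \<theta> = \<theta>"
  and vcomp_id_right [simp]: "f = src C \<theta> ==> \<theta> \<bullet> \<iota> f = \<theta>"
 using assms v.id_left'[of \<theta>] v.id_right'[of \<theta>] by (simp_all add: vcat_def)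

lemma vcomp_assoc [simp]: "\<theta> \<in> cell C ==> \<phi> \<in> cell C ==> \<psi> \<in> cell C ==> trg C \<theta> = src C \<phi> ==>
  trg C \<phi> = src C \<psi> ==> (\<psi> \<bullet> \<phi>) \<bullet> \<theta> = \<psi> \<bullet> \<phi> \<bullet> \<theta>"
 using v.assoc'[of \<theta> \<phi> \<psi>] by (simp add: vcat_def)

lemma
 assumes "\<theta> \<in> cell C" "\<phi> \<in> cell C" "ccod C (src C \<theta>) = cdom C (src C \<phi>)"
 shows hcomp_cell [simp]: "\<phi> \<star> \<theta> \<in> cell C"
  and src_hcomp [simp]: "src C (\<phi> \<star> \<theta>) = src C \<phi> \<cdot> src C \<theta>"
  and trg_hcomp [simp]: "trg C (\<phi> \<star> \<theta>) = trg C \<phi> \<cdot> trg C \<theta>"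
 using assms h.comp_props[of \<theta> \<phi>] hcomp_bd[of \<theta> \<phi>] by (simp_all add: hcat_def)

lemma
 assumes "\<theta> \<in> cell C"
 shows hcomp_id_left [simp]: "y = ccod C (src C \<theta>) ==> \<iota> (cid C y) \<star> \<theta> = \<theta>"
  and hcomp_id_right [simp]: "x = cdom C (src C \<theta>) ==> \<theta> \<star> \<iota> (cid C x) = \<theta>"
 using assms h.id_left'[of \<theta>] h.id_right'[of \<theta>] by (simp_all add: hcat_def)

lemma hcomp_assoc [simp]: "\<theta> \<in> cell C ==> \<phi> \<in> cell C ==> \<psi> \<in> cell C ==>
  ccod C (src C \<theta>) = cdom C (src C \<phi>) ==> ccod C (src C \<phi>) = cdom C (src C \<psi>) ==>
  (\<psi> \<star> \<phi>) \<star> \<theta> = \<psi> \<star> \<phi> \<star> \<theta>"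
 using h.assoc'[of \<theta> \<phi> \<psi>] by (simp add: hcat_def)

lemma hcomp_id2 [simp]: "f \<in> carr C ==> g \<in> carr C ==> ccod C f = cdom C g ==> \<iota> g \<star> \<iota> f = \<iota> (g \<cdot> f)"
 using hcomp_id[of f _ _ g] by (simp add: chom_def)

lemma hcomp_id2_assoc [simp]:
 assumes "f \<in> carr C" "g \<in> carr C" "\<theta> \<in> cell C" "ccod C f = cdom C g" "ccod C (src C \<theta>) = cdom C f"
 shows "\<iota> g \<star> \<iota> f \<star> \<theta> = \<iota> (g \<cdot> f) \<star> \<theta>"
 using hcomp_assoc[of \<theta> "\<iota> f" "\<iota> g"] assms by simp

lemma whisker_left_vcomp:
 assumes "g \<in> carr C" "\<theta> \<in> cell C" "\<phi> \<in> cell C" "trg C \<theta> = src C \<phi>" "ccod C (src C \<theta>) = cdom C g"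
 shows "\<iota> g \<star> (\<phi> \<bullet> \<theta>) = (\<iota> g \<star> \<phi>) \<bullet> (\<iota> g \<star> \<theta>)"
 using interchange[of \<theta> \<phi> "\<iota> g" "\<iota> g"] assms by simp

lemma whisker_right_vcomp:
 assumes "f \<in> carr C" "\<theta> \<in> cell C" "\<phi> \<in> cell C" "trg C \<theta> = src C \<phi>" "ccod C f = cdom C (src C \<theta>)"
 shows "(\<phi> \<bullet> \<theta>) \<star> \<iota> f = (\<phi> \<star> \<iota> f) \<bullet> (\<theta> \<star> \<iota> f)"
 using interchange[of "\<iota> f" "\<iota> f" \<theta> \<phi>] assms by simp

lemma sq_iff: "s \<in> sqs C \<longleftrightarrow> sdom s \<in> carr C \<and> scod s \<in> carr C \<and>
  stop s \<in> carr C \<and> cdom C (stop s) = cdom C (sdom s) \<and> ccod C (stop s) = cdom C (scod s) \<and>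
  sbot s \<in> carr C \<and> cdom C (sbot s) = ccod C (sdom s) \<and> ccod C (sbot s) = ccod C (scod s) \<and>
  scod s \<cdot> stop s = sbot s \<cdot> sdom s"
 by (cases s) (auto simp: arrow_1cells_def chom_def)

lemma arrow_2cells_iff: "\<theta> \<in> sq_cells C \<longleftrightarrow> csrc \<theta> \<in> sqs C \<and> ctrg \<theta> \<in> sqs C \<and>
  sdom (ctrg \<theta>) = sdom (csrc \<theta>) \<and> scod (ctrg \<theta>) = scod (csrc \<theta>) \<and>
  ctop \<theta> \<in> cell C \<and> src C (ctop \<theta>) = stop (csrc \<theta>) \<and> trg C (ctop \<theta>) = stop (ctrg \<theta>) \<and>
  cbot \<theta> \<in> cell C \<and> src C (cbot \<theta>) = sbot (csrc \<theta>) \<and> trg C (cbot \<theta>) = sbot (ctrg \<theta>) \<and>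
  \<iota> (scod (csrc \<theta>)) \<star> ctop \<theta> = cbot \<theta> \<star> \<iota> (sdom (csrc \<theta>))"
 by (cases \<theta>) (auto simp: arrow_2cells_def)

text \<open>Composites are normalised to the right, so an equation \<open>g \<cdot> f = k\<close>
  cannot rewrite inside a longer composite until it carries a trailing factor. The lemmas with
  suffix \<open>_assoc\<close> below are instances of this one and of its analogue for
  2-cells.\<close>

lemma comp_1_assoc_eq:
 assumes "g \<cdot> f = k" "f \<in> carr C" "g \<in> carr C" "ccod C f = cdom C g" "x \<in> carr C" "ccod C x = cdom C f"
 shows "g \<cdot> f \<cdot> x = k \<cdot> x"
 using assoc'[of x f g] assms by simp

lemma comp_2_assoc_eq:
 assumes "\<phi> \<star> \<theta> = \<psi>" "\<theta> \<in> cell C" "\<phi> \<in> cell C" "ccod C (src C \<theta>) = cdom C (src C \<phi>)" "x \<in> cell C"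
  "ccod C (src C x) = cdom C (src C \<theta>)"
 shows "\<phi> \<star> \<theta> \<star> x = \<psi> \<star> x"
 using hcomp_assoc[of x \<theta> \<phi>] assms by simp

end

text \<open>The horizontal category is assembled here: its ends are those of the source 1-cells and
  its identities are \<open>id2\<close> of identities, so unit laws, associativity and the
  boundaries of \<open>hcomp\<close> give it.\<close>

lemma two_categoryI:
 assumes "category C" "category (vcat C)"
  and "\<And>\<theta>. \<theta> \<in> cell C ==>
   cdom C (trg C \<theta>) = cdom C (src C \<theta>) \<and> ccod C (trg C \<theta>) = ccod C (src C \<theta>)"
  and "\<And>\<theta> \<phi>. \<theta> \<in> cell C ==> \<phi> \<in> cell C ==> ccod C (src C \<theta>) = cdom C (src C \<phi>) ==>
   hcomp C \<phi> \<theta> \<in> cell C \<and> src C (hcomp C \<phi> \<theta>) = ccomp C (src C \<phi>) (src C \<theta>) \<and>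
   trg C (hcomp C \<phi> \<theta>) = ccomp C (trg C \<phi>) (trg C \<theta>)"
  and "\<And>\<theta>. \<theta> \<in> cell C ==> hcomp C (id2 C (cid C (ccod C (src C \<theta>)))) \<theta> = \<theta>"
  and "\<And>\<theta>. \<theta> \<in> cell C ==> hcomp C \<theta> (id2 C (cid C (cdom C (src C \<theta>)))) = \<theta>"
  and "\<And>\<theta> \<phi> \<psi>. \<theta> \<in> cell C ==> \<phi> \<in> cell C ==> \<psi> \<in> cell C ==> ccod C (src C \<theta>) = cdom C (src C \<phi>) ==>
   ccod C (src C \<phi>) = cdom C (src C \<psi>) ==> hcomp C (hcomp C \<psi> \<phi>) \<theta> = hcomp C \<psi> (hcomp C \<phi> \<theta>)"
  and "\<And>f g. f \<in> carr C ==> g \<in> carr C ==> ccod C f = cdom C g ==>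
   hcomp C (id2 C g) (id2 C f) = id2 C (ccomp C g f)"
  and "\<And>\<theta> \<theta>' \<phi> \<phi>'. \<theta> \<in> cell C ==> \<theta>' \<in> cell C ==> \<phi> \<in> cell C ==> \<phi>' \<in> cell C ==>
   trg C \<theta> = src C \<theta>' ==> trg C \<phi> = src C \<phi>' ==> ccod C (src C \<theta>) = cdom C (src C \<phi>) ==>
   hcomp C (vcomp C \<phi>' \<phi>) (vcomp C \<theta>' \<theta>) = vcomp C (hcomp C \<phi>' \<theta>') (hcomp C \<phi> \<theta>)"
 shows "two_category C"
proof -
 interpret category C by fact
 interpret v: category "vcat C" by fact
 have sc: "\<theta> \<in> cell C ==> src C \<theta> \<in> carr C" for \<theta>
  using v.dom_cod_in[of \<theta>] by (simp add: vcat_def)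
 have i2: "f \<in> carr C ==> id2 C f \<in> cell C \<and> src C (id2 C f) = f" for f
  using v.id_props[of f] by (simp add: vcat_def)
 have h: "category (hcat C)"
  by (rule categoryI) (use assms(3-7) in \<open>auto simp: hcat_def sc i2 dom_cod_in id_props comp_props\<close>)
 show ?thesis
  by (intro two_category.intro two_category_axioms.intro h) (use assms in \<open>auto simp: chom_def\<close>)
qed

lemma two_functorI:
 assumes "\<And>x. x \<in> cobj C ==> ob_map F x \<in> cobj D"
  and "\<And>f. f \<in> carr C ==> ar_map F f \<in> carr D \<and> cdom D (ar_map F f) = ob_map F (cdom C f) \<and>
   ccod D (ar_map F f) = ob_map F (ccod C f)"
  and "\<And>x. x \<in> cobj C ==> ar_map F (cid C x) = cid D (ob_map F x)"
  and "\<And>f g. f \<in> carr C ==> g \<in> carr C ==> ccod C f = cdom C g ==>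
   ar_map F (ccomp C g f) = ccomp D (ar_map F g) (ar_map F f)"
  and "\<And>\<theta>. \<theta> \<in> cell C ==> ce_map F \<theta> \<in> cell D \<and> src D (ce_map F \<theta>) = ar_map F (src C \<theta>) \<and>
   trg D (ce_map F \<theta>) = ar_map F (trg C \<theta>)"
  and "\<And>f. f \<in> carr C ==> ce_map F (id2 C f) = id2 D (ar_map F f)"
  and "\<And>\<theta> \<phi>. \<theta> \<in> cell C ==> \<phi> \<in> cell C ==> trg C \<theta> = src C \<phi> ==>
   ce_map F (vcomp C \<phi> \<theta>) = vcomp D (ce_map F \<phi>) (ce_map F \<theta>)"
  and "\<And>\<theta> \<phi>. \<theta> \<in> cell C ==> \<phi> \<in> cell C ==> ccod C (src C \<theta>) = cdom C (src C \<phi>) ==>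
   ce_map F (hcomp C \<phi> \<theta>) = hcomp D (ce_map F \<phi>) (ce_map F \<theta>)"
 shows "two_functor C D F"
 by (intro two_functor.intro two_functor_axioms.intro functor_onI) (use assms in auto)

section \<open>The 2-category of arrows\<close>

lemma arrow_twocat_simps [simp]:
 "cobj (arrow_twocat C) = carr C" "carr (arrow_twocat C) = sqs C"
 "cdom (arrow_twocat C) = sdom" "ccod (arrow_twocat C) = scod"
 "cid (arrow_twocat C) = sq_id C" "ccomp (arrow_twocat C) = sq_comp C"
 "cell (arrow_twocat C) = sq_cells C" "src (arrow_twocat C) = csrc" "trg (arrow_twocat C) = ctrg"
 "id2 (arrow_twocat C) s = SqCell s (id2 C (stop s)) (id2 C (sbot s)) s"
 "vcomp (arrow_twocat C) \<phi> \<theta> =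
  SqCell (csrc \<theta>) (vcomp C (ctop \<phi>) (ctop \<theta>)) (vcomp C (cbot \<phi>) (cbot \<theta>)) (ctrg \<phi>)"
 "hcomp (arrow_twocat C) \<phi> \<theta> = SqCell (sq_comp C (csrc \<phi>) (csrc \<theta>)) (hcomp C (ctop \<phi>) (ctop \<theta>))
  (hcomp C (cbot \<phi>) (cbot \<theta>)) (sq_comp C (ctrg \<phi>) (ctrg \<theta>))"
 by (simp_all add: arrow_twocat_def)

context two_category
begin

lemma sq_comp_1cell:
 assumes "s \<in> sqs C" "t \<in> sqs C" "scod s = sdom t"
 shows "sq_comp C t s \<in> sqs C"
proof -
 have "scod t \<cdot> stop t \<cdot> stop s = (sbot t \<cdot> sdom t) \<cdot> stop s"
  using assms by (intro comp_1_assoc_eq) (simp_all add: sq_iff)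
 then show ?thesis
  using assms by (simp add: sq_iff sq_comp_def)
qed

lemma arrow_hcomp_2cell:
 assumes "\<theta> \<in> sq_cells C" "\<phi> \<in> sq_cells C" "scod (csrc \<theta>) = sdom (csrc \<phi>)"
 shows "SqCell (sq_comp C (csrc \<phi>) (csrc \<theta>)) (ctop \<phi> \<star> ctop \<theta>) (cbot \<phi> \<star> cbot \<theta>)
  (sq_comp C (ctrg \<phi>) (ctrg \<theta>)) \<in> sq_cells C"
proof -
 have "\<iota> (scod (csrc \<phi>)) \<star> ctop \<phi> \<star> ctop \<theta> = (cbot \<phi> \<star> \<iota> (sdom (csrc \<phi>))) \<star> ctop \<theta>"
  using assms by (intro comp_2_assoc_eq) (simp_all add: arrow_2cells_iff sq_iff)
 also have "\<dots> = cbot \<phi> \<star> cbot \<theta> \<star> \<iota> (sdom (csrc \<theta>))"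
  using assms by (simp add: arrow_2cells_iff sq_iff)
 finally have *: "\<iota> (scod (csrc \<phi>)) \<star> ctop \<phi> \<star> ctop \<theta> = cbot \<phi> \<star> cbot \<theta> \<star> \<iota> (sdom (csrc \<theta>))" .
 have "sq_comp C (csrc \<phi>) (csrc \<theta>) \<in> sqs C" "sq_comp C (ctrg \<phi>) (ctrg \<theta>) \<in> sqs C"
  using assms by (auto intro!: sq_comp_1cell simp: arrow_2cells_iff)
 then show ?thesis
  using assms * by (simp add: arrow_2cells_iff) (simp add: sq_comp_def sq_iff)
qed

lemma two_category_arrow: "two_category (arrow_twocat C)"
proof (rule two_categoryI)
 show "category (arrow_twocat C)"
  by (rule categoryI)
   (auto simp: sq_comp_1cell, auto simp: sq_iff sq_id_def sq_comp_def sq.expand)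
 have vc: "\<iota> (scod (csrc \<theta>)) \<star> (ctop \<phi> \<bullet> ctop \<theta>) = (cbot \<phi> \<bullet> cbot \<theta>) \<star> \<iota> (sdom (csrc \<theta>))"
  if "\<theta> \<in> sq_cells C" "\<phi> \<in> sq_cells C" "ctrg \<theta> = csrc \<phi>" for \<theta> \<phi>
  using that by (simp add: arrow_2cells_iff sq_iff whisker_left_vcomp whisker_right_vcomp)
 show "category (vcat (arrow_twocat C))"
  by (rule categoryI)
   (auto simp: vcat_def vc, auto simp: arrow_2cells_iff sq_iff sq_id_def sqcell.expand vc)
 show "hcomp (arrow_twocat C) (vcomp (arrow_twocat C) \<phi>' \<phi>) (vcomp (arrow_twocat C) \<theta>' \<theta>) =
   vcomp (arrow_twocat C) (hcomp (arrow_twocat C) \<phi>' \<theta>') (hcomp (arrow_twocat C) \<phi> \<theta>)"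
  if "\<theta> \<in> cell (arrow_twocat C)" "\<theta>' \<in> cell (arrow_twocat C)" "\<phi> \<in> cell (arrow_twocat C)"
   "\<phi>' \<in> cell (arrow_twocat C)" "trg (arrow_twocat C) \<theta> = src (arrow_twocat C) \<theta>'"
   "trg (arrow_twocat C) \<phi> = src (arrow_twocat C) \<phi>'"
   "ccod (arrow_twocat C) (src (arrow_twocat C) \<theta>) = cdom (arrow_twocat C) (src (arrow_twocat C) \<phi>)"
  for \<theta> \<theta>' \<phi> \<phi>'
  using that by (simp add: arrow_2cells_iff sq_iff interchange)
qed (simp_all add: arrow_hcomp_2cell, simp_all add: arrow_2cells_iff sq_iff sq_comp_def sq_id_def sqcell.expand sq.expand)

end

context two_functor
begin

lemma tfun_props:
 assumes "two_category C"
 shows "f \<in> carr C ==> ar_map F f \<in> carr D \<and> cdom D (ar_map F f) = ob_map F (cdom C f) \<and>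
   ccod D (ar_map F f) = ob_map F (ccod C f)"
  and "f \<in> carr C ==> g \<in> carr C ==> ccod C f = cdom C g ==>
   ar_map F (ccomp C g f) = ccomp D (ar_map F g) (ar_map F f)"
  and "\<theta> \<in> cell C ==> ce_map F \<theta> \<in> cell D \<and> src D (ce_map F \<theta>) = ar_map F (src C \<theta>) \<and>
   trg D (ce_map F \<theta>) = ar_map F (trg C \<theta>)"
proof -
 interpret two_category C by fact
 show "f \<in> carr C ==> ar_map F f \<in> carr D \<and> cdom D (ar_map F f) = ob_map F (cdom C f) \<and>
   ccod D (ar_map F f) = ob_map F (ccod C f)"
  using ar_props by simp
qed (simp_all add: map_comp' ce_map map_src map_trg)

end

lemma tfun_comp_simps [simp]:
 "ob_map (tfun_comp G F) x = ob_map G (ob_map F x)"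
 "ar_map (tfun_comp G F) f = ar_map G (ar_map F f)"
 "ce_map (tfun_comp G F) \<theta> = ce_map G (ce_map F \<theta>)"
 by (simp_all add: tfun_comp_def)

lemma tfun_id_simps [simp]: "ob_map tfun_id x = x" "ar_map tfun_id f = f" "ce_map tfun_id \<theta> = \<theta>"
 by (simp_all add: tfun_id_def)

lemma two_functor_comp:
 assumes "two_category C" "two_category D" "two_functor C D F" "two_functor D E G"
 shows "two_functor C E (tfun_comp G F)"
proof -
 interpret C: two_category C by fact
 interpret D: two_category D by fact
 interpret F: two_functor C D F by fact
 interpret G: two_functor D E G by fact
 note F = F.tfun_props[OF assms(1)] and G = G.tfun_props[OF assms(2)]
 show ?thesis
  by (rule two_functorI)
   (simp_all add: F G F.ob_map F.map_id F.map_id2 F.map_vcomp F.map_hcomp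
    G.ob_map G.map_id G.map_id2 G.map_vcomp G.map_hcomp)
qed

lemma two_functor_id: "two_functor C C tfun_id"
 by (rule two_functorI) simp_all

section \<open>The internal category of squares\<close>

lemma sq_icat_simps [simp]:
 "iob (sq_icat C) = C" "iar (sq_icat C) = arrow_twocat C"
 "isrc (sq_icat C) = arrow_dom C" "itrg (sq_icat C) = arrow_cod C"
 "ob_map (iid (sq_icat C)) = cid C" "ar_map (iid (sq_icat C)) = sq_vid C"
 "ce_map (iid (sq_icat C)) = sqcell_vid C"
 "ob_map (icmp (sq_icat C)) (g, f) = ccomp C g f"
 "ar_map (icmp (sq_icat C)) (t, s) = sq_paste C t s"
 "ce_map (icmp (sq_icat C)) (\<phi>, \<theta>) = sqcell_paste C \<phi> \<theta>"
 by (simp_all add: sq_icat_def)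

lemma arrow_dom_cod_simps [simp]:
 "ob_map (arrow_dom C) = cdom C" "ar_map (arrow_dom C) = stop" "ce_map (arrow_dom C) = ctop"
 "ob_map (arrow_cod C) = ccod C" "ar_map (arrow_cod C) = sbot" "ce_map (arrow_cod C) = cbot"
 by (simp_all add: arrow_dom_def arrow_cod_def)

lemma pb_twocat_simps [simp]:
 "cobj (pb_twocat F A G B) = {(x, y). x \<in> cobj A \<and> y \<in> cobj B \<and> ob_map F x = ob_map G y}"
 "carr (pb_twocat F A G B) = {(x, y). x \<in> carr A \<and> y \<in> carr B \<and> ar_map F x = ar_map G y}"
 "cdom (pb_twocat F A G B) = map_prod (cdom A) (cdom B)"
 "ccod (pb_twocat F A G B) = map_prod (ccod A) (ccod B)"
 "cid (pb_twocat F A G B) = map_prod (cid A) (cid B)"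
 "ccomp (pb_twocat F A G B) (x', y') (x, y) = (ccomp A x' x, ccomp B y' y)"
 "cell (pb_twocat F A G B) = {(x, y). x \<in> cell A \<and> y \<in> cell B \<and> ce_map F x = ce_map G y}"
 "src (pb_twocat F A G B) = map_prod (src A) (src B)"
 "trg (pb_twocat F A G B) = map_prod (trg A) (trg B)"
 "id2 (pb_twocat F A G B) = map_prod (id2 A) (id2 B)"
 "vcomp (pb_twocat F A G B) (\<phi>', \<psi>') (\<phi>, \<psi>) = (vcomp A \<phi>' \<phi>, vcomp B \<psi>' \<psi>)"
 "hcomp (pb_twocat F A G B) (\<phi>', \<psi>') (\<phi>, \<psi>) = (hcomp A \<phi>' \<phi>, hcomp B \<psi>' \<psi>)"
 by (simp_all add: pb_twocat_def pb_cat_def cat.defs)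

lemma ilevel_simps [simp]:
 "cobj (ilevel0 D) = cobj (iob D)" "carr (ilevel0 D) = cobj (iar D)"
 "cdom (ilevel0 D) = ob_map (isrc D)" "ccod (ilevel0 D) = ob_map (itrg D)"
 "cid (ilevel0 D) = ob_map (iid D)" "ccomp (ilevel0 D) y x = ob_map (icmp D) (y, x)"
 "cobj (ilevel1 D) = carr (iob D)" "carr (ilevel1 D) = carr (iar D)"
 "cdom (ilevel1 D) = ar_map (isrc D)" "ccod (ilevel1 D) = ar_map (itrg D)"
 "cid (ilevel1 D) = ar_map (iid D)" "ccomp (ilevel1 D) t s = ar_map (icmp D) (t, s)"
 "cobj (ilevel2 D) = cell (iob D)" "carr (ilevel2 D) = cell (iar D)"
 "cdom (ilevel2 D) = ce_map (isrc D)" "ccod (ilevel2 D) = ce_map (itrg D)"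
 "cid (ilevel2 D) = ce_map (iid D)" "ccomp (ilevel2 D) \<phi> \<theta> = ce_map (icmp D) (\<phi>, \<theta>)"
 by (simp_all add: ilevel0_def ilevel1_def ilevel2_def)

context two_category
begin

lemma sq_vid_1cell: "h \<in> carr C ==> sq_vid C h \<in> sqs C"
 by (simp add: sq_iff sq_vid_def)

lemma sqcell_vid_2cell: "\<theta> \<in> cell C ==> sqcell_vid C \<theta> \<in> sq_cells C"
 by (simp add: arrow_2cells_iff sqcell_vid_def sq_vid_1cell) (simp add: sq_vid_def)

lemma sq_paste_1cell:
 assumes "s \<in> sqs C" "t \<in> sqs C" "sbot s = stop t"
 shows "sq_paste C t s \<in> sqs C"
proof -
 have "scod t \<cdot> stop t \<cdot> sdom s = (sbot t \<cdot> sdom t) \<cdot> sdom s"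
  using assms by (intro comp_1_assoc_eq) (simp_all add: sq_iff)
 then show ?thesis
  using assms by (auto simp: sq_iff sq_paste_def)
qed

text \<open>The equation of the upper cell is whiskered by the codomain side of the lower one, that
  of the lower cell by the domain side of the upper one. The two results meet in the common cell
  \<open>cbot \<theta> = ctop \<phi>\<close>.\<close>

lemma sqcell_paste_2cell:
 assumes "\<theta> \<in> sq_cells C" "\<phi> \<in> sq_cells C" "cbot \<theta> = ctop \<phi>"
 shows "sqcell_paste C \<phi> \<theta> \<in> sq_cells C"
proof -
 have bd: "sbot (csrc \<theta>) = stop (csrc \<phi>)" "sbot (ctrg \<theta>) = stop (ctrg \<phi>)"
  using assms by (auto simp: arrow_2cells_iff)
 have "\<iota> (scod (csrc \<phi>)) \<star> ctop \<phi> \<star> \<iota> (sdom (csrc \<theta>)) = (cbot \<phi> \<star> \<iota> (sdom (csrc \<phi>))) \<star> \<iota> (sdom (csrc \<theta>))"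
  using assms bd by (intro comp_2_assoc_eq) (simp_all add: arrow_2cells_iff sq_iff)
 moreover have "\<iota> (scod (csrc \<phi>) \<cdot> scod (csrc \<theta>)) \<star> ctop \<theta> = \<iota> (scod (csrc \<phi>)) \<star> \<iota> (scod (csrc \<theta>)) \<star> ctop \<theta>"
  using assms bd by (subst hcomp_id2_assoc) (simp_all add: arrow_2cells_iff sq_iff)
 ultimately have "\<iota> (scod (csrc \<phi>) \<cdot> scod (csrc \<theta>)) \<star> ctop \<theta> = cbot \<phi> \<star> \<iota> (sdom (csrc \<phi>) \<cdot> sdom (csrc \<theta>))"
  using assms bd by (simp add: arrow_2cells_iff sq_iff del: hcomp_id2_assoc)
 moreover have "sq_paste C (csrc \<phi>) (csrc \<theta>) \<in> sqs C" "sq_paste C (ctrg \<phi>) (ctrg \<theta>) \<in> sqs C"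
  using assms bd by (auto intro!: sq_paste_1cell simp: arrow_2cells_iff)
 ultimately show ?thesis
  using assms bd by (simp add: arrow_2cells_iff sqcell_paste_def) (simp add: sq_paste_def sq_iff)
qed

lemma two_functor_arrow_dom: "two_functor (arrow_twocat C) C (arrow_dom C)"
 by (rule two_functorI) (auto simp: arrow_2cells_iff, auto simp: sq_iff sq_id_def sq_comp_def)

lemma two_functor_arrow_cod: "two_functor (arrow_twocat C) C (arrow_cod C)"
 by (rule two_functorI) (auto simp: arrow_2cells_iff, auto simp: sq_iff sq_id_def sq_comp_def)

end

locale two_category' = two_category C for C :: "('o, 'a, 'c) twocat"
begin

lemma sq_ilevel0: "category (ilevel0 (sq_icat C))"
 by (rule categoryI) simp_all

lemma sq_ilevel1: "category (ilevel1 (sq_icat C))"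
 by (rule categoryI)
  (auto simp: sq_vid_1cell sq_paste_1cell, auto simp: sq_iff sq_vid_def sq_paste_def sq.expand)

lemma sq_ilevel2: "category (ilevel2 (sq_icat C))"
proof (rule categoryI)
 show "ccomp (ilevel2 (sq_icat C)) (ccomp (ilevel2 (sq_icat C)) \<psi> \<phi>) \<theta> =
   ccomp (ilevel2 (sq_icat C)) \<psi> (ccomp (ilevel2 (sq_icat C)) \<phi> \<theta>)"
  if "\<theta> \<in> carr (ilevel2 (sq_icat C))" "\<phi> \<in> carr (ilevel2 (sq_icat C))" "\<psi> \<in> carr (ilevel2 (sq_icat C))"
   "ccod (ilevel2 (sq_icat C)) \<theta> = cdom (ilevel2 (sq_icat C)) \<phi>"
   "ccod (ilevel2 (sq_icat C)) \<phi> = cdom (ilevel2 (sq_icat C)) \<psi>" for \<theta> \<phi> \<psi>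
 proof -
  have "sbot (csrc \<theta>) = stop (csrc \<phi>)" "sbot (csrc \<phi>) = stop (csrc \<psi>)"
   using that by (auto simp: arrow_2cells_iff)
  then show ?thesis
   using that by (auto simp: arrow_2cells_iff sq_iff sqcell_paste_def sq_paste_def)
 qed
qed (auto simp: sqcell_vid_2cell sqcell_paste_2cell, auto simp: arrow_2cells_iff sq_iff
   sqcell_vid_def sq_vid_def sqcell_paste_def sq_paste_def sq.expand sqcell.expand)

lemma sq_paste_interchange:
 assumes "s \<in> sqs C" "t \<in> sqs C" "s' \<in> sqs C" "t' \<in> sqs C"
  "scod s = sdom s'" "scod t = sdom t'" "sbot s = stop t" "sbot s' = stop t'"
 shows "sq_paste C (sq_comp C t' t) (sq_comp C s' s) = sq_comp C (sq_paste C t' s') (sq_paste C t s)"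
 using assms by (simp add: sq_paste_def sq_comp_def)

lemma internal_category_sq: "internal_category (sq_icat C)"
proof -
 have "two_functor C (arrow_twocat C) (iid (sq_icat C))"
  by (rule two_functorI) (auto simp: sq_vid_1cell sqcell_vid_2cell,
    auto simp: sq_vid_def sqcell_vid_def sq_comp_def sq_id_def)
 moreover have "two_functor (pb_twocat (arrow_dom C) (arrow_twocat C) (arrow_cod C) (arrow_twocat C))
   (arrow_twocat C) (icmp (sq_icat C))"
 proof (rule two_functorI, goal_cases)
  case (2 p) then show ?case
   by (cases p) (auto simp: sq_paste_1cell, auto simp: sq_paste_def)
 next
  case (4 p q) then show ?case
   by (cases p; cases q) (auto simp: sq_paste_interchange)
 next
  case (5 P)
  then obtain \<phi> \<theta> where P: "P = (\<phi>, \<theta>)" "\<phi> \<in> sq_cells C" "\<theta> \<in> sq_cells C" "cbot \<theta> = ctop \<phi>"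
   by (cases P) auto
  then show ?case
   by (simp add: sqcell_paste_2cell) (simp add: sqcell_paste_def)
 next
  case (8 P Q) then show ?case
   by (cases P; cases Q) (simp add: sqcell_paste_def sq_paste_def sq_comp_def)
 qed (auto simp: sqcell_paste_def sq_paste_def sq_id_def)
 ultimately show ?thesis
  using two_category_axioms two_category_arrow two_functor_arrow_dom two_functor_arrow_cod
   sq_ilevel0 sq_ilevel1 sq_ilevel2
  by (simp add: internal_category_def)
qed

end

section \<open>2-categories of structured objects\<close>

lemma structured_twocat_simps [simp]:
 "cobj (structured_twocat D S M N) = S" "carr (structured_twocat D S M N) = structured_1cells D S M"
 "cdom (structured_twocat D S M N) = fst" "ccod (structured_twocat D S M N) p = snd (snd p)"
 "cid (structured_twocat D S M N) X = (X, cid D (fst X), X)"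
 "ccomp (structured_twocat D S M N) q p = (fst p, ccomp D (fst (snd q)) (fst (snd p)), snd (snd q))"
 "src (structured_twocat D S M N) = fst" "trg (structured_twocat D S M N) P = snd (snd P)"
 "id2 (structured_twocat D S M N) p = (p, id2 D (fst (snd p)), p)"
 "vcomp (structured_twocat D S M N) Q P = (fst P, vcomp D (fst (snd Q)) (fst (snd P)), snd (snd Q))"
 "hcomp (structured_twocat D S M N) Q P =
  ((fst (fst P), ccomp D (fst (snd (fst Q))) (fst (snd (fst P))), snd (snd (fst Q))),
   hcomp D (fst (snd Q)) (fst (snd P)),
   (fst (snd (snd P)), ccomp D (fst (snd (snd (snd Q)))) (fst (snd (snd (snd P)))), snd (snd (snd (snd Q)))))"
 by (simp_all add: structured_twocat_def split: prod.splits)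

lemma structured_cell_iff: "P \<in> cell (structured_twocat D S M N) \<longleftrightarrow>
  fst P \<in> structured_1cells D S M \<and> snd (snd P) \<in> structured_1cells D S M \<and>
  fst (snd (snd P)) = fst (fst P) \<and> snd (snd (snd (snd P))) = snd (snd (fst P)) \<and>
  fst (snd P) \<in> cell D \<and> src D (fst (snd P)) = fst (snd (fst P)) \<and>
  trg D (fst (snd P)) = fst (snd (snd (snd P))) \<and> N (fst (fst P)) (fst (snd P)) (snd (snd (fst P)))"
 by (cases P) (auto simp: structured_twocat_def)

lemma strict_1cell_iff: "p \<in> structured_1cells D S M \<longleftrightarrow> fst p \<in> S \<and> snd (snd p) \<in> S \<and>
  fst (snd p) \<in> carr D \<and> cdom D (fst (snd p)) = fst (fst p) \<and> ccod D (fst (snd p)) = fst (snd (snd p)) \<and>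
  M (fst p) (fst (snd p)) (snd (snd p))"
 by (cases p) (auto simp: structured_1cells_def chom_def)

lemma structured_forget_simps [simp]:
 "ob_map structured_forget X = fst X" "ar_map structured_forget p = fst (snd p)"
 "ce_map structured_forget P = fst (snd P)"
 by (simp_all add: structured_forget_def)

lemma structured_icat_simps [simp]:
 "iob (structured_icat C A idn cmp) = C" "iar (structured_icat C A idn cmp) = A"
 "isrc (structured_icat C A idn cmp) = tfun_comp (arrow_dom C) structured_forget"
 "itrg (structured_icat C A idn cmp) = tfun_comp (arrow_cod C) structured_forget"
 "ob_map (iid (structured_icat C A idn cmp)) = idn"
 "ar_map (iid (structured_icat C A idn cmp)) h = (idn (cdom C h), sq_vid C h, idn (ccod C h))"
 "ce_map (iid (structured_icat C A idn cmp)) \<theta> =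
  ((idn (cdom C (src C \<theta>)), sq_vid C (src C \<theta>), idn (ccod C (src C \<theta>))), sqcell_vid C \<theta>,
   (idn (cdom C (trg C \<theta>)), sq_vid C (trg C \<theta>), idn (ccod C (trg C \<theta>))))"
 "ob_map (icmp (structured_icat C A idn cmp)) (Y, X) = cmp Y X"
 "ar_map (icmp (structured_icat C A idn cmp)) (q, p) =
  (cmp (fst q) (fst p), sq_paste C (fst (snd q)) (fst (snd p)), cmp (snd (snd q)) (snd (snd p)))"
 "ce_map (icmp (structured_icat C A idn cmp)) (Q, P) =
  ((cmp (fst (fst Q)) (fst (fst P)), sq_paste C (fst (snd (fst Q))) (fst (snd (fst P))),
    cmp (snd (snd (fst Q))) (snd (snd (fst P)))),
   sqcell_paste C (fst (snd Q)) (fst (snd P)),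
   (cmp (fst (snd (snd Q))) (fst (snd (snd P))), sq_paste C (fst (snd (snd (snd Q)))) (fst (snd (snd (snd P)))),
    cmp (snd (snd (snd (snd Q)))) (snd (snd (snd (snd P))))))"
 by (simp_all add: structured_icat_def Let_def split: prod.splits)

text \<open>KZ structures and cloven opfibrations take all 2-cells of arrows by definition. For the
  algebras of a lax idempotent monad the same is a theorem, \<open>Ralg_eq\<close>.\<close>

abbreviation all_cells :: "'a => 'b => 'c => bool" where "all_cells \<equiv> \<lambda>_ _ _. True"

lemma (in two_category) two_category_structured:
 assumes "\<And>X. X \<in> S ==> fst X \<in> cobj C \<and> M X (cid C (fst X)) X"
  and "\<And>X u Y v Z. (X, u, Y) \<in> structured_1cells C S M ==> (Y, v, Z) \<in> structured_1cells C S M ==>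
   M X (v \<cdot> u) Z"
 shows "two_category (structured_twocat C S M all_cells)"
proof -
 have comp: "(fst p, ccomp C (fst (snd q)) (fst (snd p)), snd (snd q)) \<in> structured_1cells C S M"
  if "p \<in> structured_1cells C S M" "q \<in> structured_1cells C S M" "snd (snd p) = fst q" for p q
  using that assms(2)[of "fst p" "fst (snd p)" "fst q" "fst (snd q)" "snd (snd q)"]
  by (cases p; cases q) (auto simp: strict_1cell_iff)
 have id: "(X, cid C (fst X), X) \<in> structured_1cells C S M" if "X \<in> S" for X
  using that assms(1)[of X] by (simp add: strict_1cell_iff)
 show ?thesis
 proof (rule two_categoryI)
  show "category (structured_twocat C S M all_cells)"
   by (rule categoryI) (auto simp: comp id, auto simp: strict_1cell_iff)
  show "category (vcat (structured_twocat C S M all_cells))"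
   by (rule categoryI)
    (auto simp: vcat_def structured_cell_iff, auto simp: strict_1cell_iff)
 next
  fix P Q
  assume a: "P \<in> cell (structured_twocat C S M all_cells)" "Q \<in> cell (structured_twocat C S M all_cells)"
   "ccod (structured_twocat C S M all_cells) (src (structured_twocat C S M all_cells) P) =
   cdom (structured_twocat C S M all_cells) (src (structured_twocat C S M all_cells) Q)"
  then show "hcomp (structured_twocat C S M all_cells) Q P \<in> cell (structured_twocat C S M all_cells) \<and>
   src (structured_twocat C S M all_cells) (hcomp (structured_twocat C S M all_cells) Q P) =
    ccomp (structured_twocat C S M all_cells) (src (structured_twocat C S M all_cells) Q)
     (src (structured_twocat C S M all_cells) P) \<and>
   trg (structured_twocat C S M all_cells) (hcomp (structured_twocat C S M all_cells) Q P) =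
    ccomp (structured_twocat C S M all_cells) (trg (structured_twocat C S M all_cells) Q)
     (trg (structured_twocat C S M all_cells) P)"
   using comp[of "fst P" "fst Q"] comp[of "snd (snd P)" "snd (snd Q)"]
   by (simp add: structured_cell_iff) (simp add: strict_1cell_iff)
 qed (auto simp: structured_cell_iff, auto simp: strict_1cell_iff interchange)
qed

section \<open>Arrows with structure\<close>

text \<open>What it takes to have an internal category over the squares of \<open>C\<close> with
  object part \<open>C\<close>: the squares selected by \<open>M\<close> are closed under both
  pastings, and structures compose along \<open>cmp\<close> with units \<open>idn\<close>. Algebras,
  KZ structures and cloven opfibrations all fit, so internal categories are built from this locale
  only.\<close>

locale structured_arrows = two_category' C for C :: "('o, 'a, 'c) twocat" +
 fixes S :: "('a \<times> 'x) set" and M :: "'a \<times> 'x => 'a sq => 'a \<times> 'x => bool"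
  and idn :: "'o => 'a \<times> 'x" and cmp :: "'a \<times> 'x => 'a \<times> 'x => 'a \<times> 'x"
 assumes S_carr: "X \<in> S ==> fst X \<in> carr C"
  and M_id: "X \<in> S ==> M X (sq_id C (fst X)) X"
  and M_comp: "(X, s, Y) \<in> structured_1cells (arrow_twocat C) S M ==>
   (Y, t, Z) \<in> structured_1cells (arrow_twocat C) S M ==> M X (sq_comp C t s) Z"
  and idn: "x \<in> cobj C ==> idn x \<in> S \<and> fst (idn x) = cid C x"
  and M_idn: "h \<in> carr C ==> M (idn (cdom C h)) (sq_vid C h) (idn (ccod C h))"
  and cmp: "X \<in> S ==> Y \<in> S ==> ccod C (fst X) = cdom C (fst Y) ==>
   cmp Y X \<in> S \<and> fst (cmp Y X) = ccomp C (fst Y) (fst X)"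
  and M_cmp: "(X, s, X') \<in> structured_1cells (arrow_twocat C) S M ==>
   (Y, t, Y') \<in> structured_1cells (arrow_twocat C) S M ==> sbot s = stop t ==>
   M (cmp Y X) (sq_paste C t s) (cmp Y' X')"
  and cmp_idn_left: "X \<in> S ==> cmp (idn (ccod C (fst X))) X = X"
  and cmp_idn_right: "X \<in> S ==> cmp X (idn (cdom C (fst X))) = X"
  and cmp_assoc: "X \<in> S ==> Y \<in> S ==> Z \<in> S ==> ccod C (fst X) = cdom C (fst Y) ==>
   ccod C (fst Y) = cdom C (fst Z) ==> cmp (cmp Z Y) X = cmp Z (cmp Y X)"
begin

abbreviation struct_twocat where
 "struct_twocat \<equiv> structured_twocat (arrow_twocat C) S M all_cells"

abbreviation struct_icat where
 "struct_icat \<equiv> structured_icat C struct_twocat idn cmp"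

abbreviation strict where
 "strict X s Y \<equiv> (X, s, Y) \<in> structured_1cells (arrow_twocat C) S M"

lemma strict_iff: "strict X s Y \<longleftrightarrow> X \<in> S \<and> Y \<in> S \<and> s \<in> sqs C \<and> sdom s = fst X \<and>
  scod s = fst Y \<and> M X s Y"
 by (auto simp: strict_1cell_iff)

lemma strict_id: "X \<in> S ==> strict X (sq_id C (fst X)) X"
 using S_carr by (simp add: strict_1cell_iff M_id) (simp add: sq_id_def sq_iff)

lemma strict_comp: "strict X s Y ==> strict Y t Z ==> strict X (sq_comp C t s) Z"
 using M_comp[of X s Y t Z] by (simp add: strict_1cell_iff sq_comp_1cell) (simp add: sq_comp_def)

lemma strict_idn:
 assumes "h \<in> carr C"
 shows "strict (idn (cdom C h)) (sq_vid C h) (idn (ccod C h))"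
 using assms by (simp add: strict_1cell_iff M_idn idn sq_vid_1cell) (simp add: sq_vid_def)

lemma strict_cmp:
 assumes "strict X s X'" "strict Y t Y'" "sbot s = stop t"
 shows "strict (cmp Y X) (sq_paste C t s) (cmp Y' X')"
proof -
 have "ccod C (fst X) = cdom C (fst Y)" "ccod C (fst X') = cdom C (fst Y')"
  using assms by (auto simp: strict_1cell_iff sq_iff)
 then show ?thesis
  using assms M_cmp[of X s X' Y t Y'] cmp[of X Y] cmp[of X' Y']
  by (simp add: strict_1cell_iff sq_paste_1cell) (simp add: sq_paste_def)
qed

lemma two_category_struct: "two_category struct_twocat"
proof (rule two_category.two_category_structured[OF two_category_arrow])
 fix X u Y v Z assume "strict X u Y" "strict Y v Z"
 then show "M X (ccomp (arrow_twocat C) v u) Z"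
  using M_comp by simp
qed (simp add: S_carr M_id)

lemma two_functor_forget: "two_functor struct_twocat (arrow_twocat C) structured_forget"
 by (rule two_functorI)
  (auto simp: S_carr structured_cell_iff, auto simp: strict_1cell_iff)

lemma struct_ilevel0: "category (ilevel0 struct_icat)"
 by (rule categoryI) (auto simp: S_carr idn cmp cmp_idn_left cmp_idn_right cmp_assoc)

text \<open>The laws hold componentwise: for the squares by \<open>sq_ilevel1\<close>, for the
  structures at the two ends by the axioms on \<open>idn\<close> and \<open>cmp\<close>.\<close>

lemma struct_ilevel1: "category (ilevel1 struct_icat)"
proof -
 interpret sq: category "ilevel1 (sq_icat C)" by (rule sq_ilevel1)
 have p: "(cmp (fst q) (fst p), sq_paste C (fst (snd q)) (fst (snd p)), cmp (snd (snd q)) (snd (snd p)))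
   \<in> structured_1cells (arrow_twocat C) S M"
  if "p \<in> structured_1cells (arrow_twocat C) S M" "q \<in> structured_1cells (arrow_twocat C) S M"
   "sbot (fst (snd p)) = stop (fst (snd q))" for p q
  using that strict_cmp[of "fst p" _ "snd (snd p)" "fst q" _ "snd (snd q)"] by simp
 have bd: "cdom C (fst (fst p)) = cdom C (stop (fst (snd p)))"
  "cdom C (fst (snd (snd p))) = ccod C (stop (fst (snd p)))"
  "ccod C (fst (fst p)) = cdom C (sbot (fst (snd p)))"
  "ccod C (fst (snd (snd p))) = ccod C (sbot (fst (snd p)))"
  "stop (fst (snd p)) \<in> carr C" "sbot (fst (snd p)) \<in> carr C"
  "fst (snd p) \<in> sqs C" "fst p \<in> S" "snd (snd p) \<in> S"
  if "p \<in> structured_1cells (arrow_twocat C) S M" for p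
  using that by (auto simp: strict_1cell_iff sq_iff)
 show ?thesis
 proof (rule categoryI, goal_cases)
  case (1 p) then show ?case by (simp add: bd)
 next
  case (2 h) then show ?case using strict_idn[of h] by (auto simp: sq_vid_def)
 next
  case (3 p q) then show ?case using p[of p q] by (auto simp: sq_paste_def)
 next
  case (4 p) then show ?case
   using bd[of p] cmp_idn_left[of "fst p"] cmp_idn_left[of "snd (snd p)"] sq.id_left'[of "fst (snd p)"]
   by (simp add: prod_eq_iff)
 next
  case (5 p) then show ?case
   using bd[of p] cmp_idn_right[of "fst p"] cmp_idn_right[of "snd (snd p)"] sq.id_right'[of "fst (snd p)"]
   by (simp add: prod_eq_iff)
 next
  case (6 p q r) then show ?case
   using bd[of p] bd[of q] bd[of r] cmp_assoc[of "fst p" "fst q" "fst r"]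
    cmp_assoc[of "snd (snd p)" "snd (snd q)" "snd (snd r)"]
    sq.assoc'[of "fst (snd p)" "fst (snd q)" "fst (snd r)"]
   by simp
 qed
qed

text \<open>A 2-cell consists of two tagged squares and a cell between them, handled by
  \<open>struct_ilevel1\<close> and \<open>sq_ilevel2\<close>. The one extra point is
  \<open>h\<close>: composable cells have composable sources and composable targets.\<close>

lemma struct_ilevel2: "category (ilevel2 struct_icat)"
proof -
 interpret sq: category "ilevel2 (sq_icat C)" by (rule sq_ilevel2)
 interpret l1: category "ilevel1 struct_icat" by (rule struct_ilevel1)
 have bd: "fst P \<in> structured_1cells (arrow_twocat C) S M"
  "snd (snd P) \<in> structured_1cells (arrow_twocat C) S M"
  "fst (snd P) \<in> sq_cells C" "csrc (fst (snd P)) = fst (snd (fst P))"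
  "ctrg (fst (snd P)) = fst (snd (snd (snd P)))" "fst (snd (snd P)) = fst (fst P)"
  "snd (snd (snd (snd P))) = snd (snd (fst P))" "ctop (fst (snd P)) \<in> cell C" "cbot (fst (snd P)) \<in> cell C"
  "src C (ctop (fst (snd P))) = stop (fst (snd (fst P)))" "src C (cbot (fst (snd P))) = sbot (fst (snd (fst P)))"
  "trg C (ctop (fst (snd P))) = stop (fst (snd (snd (snd P))))"
  "trg C (cbot (fst (snd P))) = sbot (fst (snd (snd (snd P))))"
  if "P \<in> cell struct_twocat" for P
  using that by (auto simp: structured_cell_iff arrow_2cells_iff)
 have h: "sbot (fst (snd (fst P))) = stop (fst (snd (fst Q)))"
  "sbot (fst (snd (snd (snd P)))) = stop (fst (snd (snd (snd Q))))"
  if "P \<in> cell struct_twocat" "Q \<in> cell struct_twocat" "cbot (fst (snd P)) = ctop (fst (snd Q))" for P Q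
  using bd[OF that(1)] bd[OF that(2)] that(3) by metis+
 show ?thesis
 proof (rule categoryI, goal_cases)
  case (1 P) then show ?case by (simp add: bd)
 next
  case (2 \<theta>) then show ?case
   using strict_idn[of "src C \<theta>"] strict_idn[of "trg C \<theta>"]
   by (simp add: structured_cell_iff sqcell_vid_2cell) (simp add: sqcell_vid_def)
 next
  case (3 P Q)
  then have PQ: "P \<in> cell struct_twocat" "Q \<in> cell struct_twocat"
   and e: "cbot (fst (snd P)) = ctop (fst (snd Q))" by simp_all
  have "ar_map (icmp struct_icat) (fst Q, fst P) \<in> structured_1cells (arrow_twocat C) S M"
   "ar_map (icmp struct_icat) (snd (snd Q), snd (snd P)) \<in> structured_1cells (arrow_twocat C) S M"
   using l1.comp_props[of "fst P" "fst Q"] l1.comp_props[of "snd (snd P)" "snd (snd Q)"]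
    h[OF PQ e] bd(1,2)[OF PQ(1)] bd(1,2)[OF PQ(2)] by (simp_all del: structured_icat_simps(9))
  moreover have "sqcell_paste C (fst (snd Q)) (fst (snd P)) \<in> sq_cells C"
   by (rule sqcell_paste_2cell[OF bd(3)[OF PQ(1)] bd(3)[OF PQ(2)] e])
  ultimately show ?case
   using bd(4-7)[OF PQ(1)] bd(4-7)[OF PQ(2)] by (simp add: structured_cell_iff) (simp add: sqcell_paste_def)
 next
  case (4 P) then show ?case
   using bd[of P] l1.id_left'[of "fst P"] l1.id_left'[of "snd (snd P)"] sq.id_left'[of "fst (snd P)"]
   by (simp add: prod_eq_iff)
 next
  case (5 P) then show ?case
   using bd[of P] l1.id_right'[of "fst P"] l1.id_right'[of "snd (snd P)"] sq.id_right'[of "fst (snd P)"]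
   by (simp add: prod_eq_iff)
 next
  case (6 P Q R) then show ?case
   using bd[of P] bd[of Q] bd[of R] h[of P Q] h[of Q R] l1.assoc'[of "fst P" "fst Q" "fst R"]
    l1.assoc'[of "snd (snd P)" "snd (snd Q)" "snd (snd R)"]
    sq.assoc'[of "fst (snd P)" "fst (snd Q)" "fst (snd R)"]
   by simp
 qed
qed

lemma internal_category_struct: "internal_category struct_icat"
proof -
 interpret sqi: two_functor C "arrow_twocat C" "iid (sq_icat C)"
  using internal_category_sq by (simp add: internal_category_def)
 interpret sqc: two_functor "pb_twocat (arrow_dom C) (arrow_twocat C) (arrow_cod C) (arrow_twocat C)"
   "arrow_twocat C" "icmp (sq_icat C)"
  using internal_category_sq by (simp add: internal_category_def)
 interpret l1: category "ilevel1 struct_icat" by (rule struct_ilevel1)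
 interpret l2: category "ilevel2 struct_icat" by (rule struct_ilevel2)
 have "two_functor C struct_twocat (iid struct_icat)"
 proof (rule two_functorI, goal_cases)
  case (2 f) then show ?case using l1.id_props[of f] by (auto simp: idn)
 next
  case (5 \<theta>) then show ?case using l2.id_props[of \<theta>] by simp
 qed (use sqi.map_id sqi.map_comp' sqi.map_id2 sqi.map_vcomp sqi.map_hcomp in \<open>auto simp: idn\<close>)
 moreover have "two_functor (pb_twocat (tfun_comp (arrow_dom C) structured_forget) struct_twocat
   (tfun_comp (arrow_cod C) structured_forget) struct_twocat) struct_twocat (icmp struct_icat)"
  (is "two_functor ?P _ _")
 proof (rule two_functorI, goal_cases)
  case (1 X) then show ?case by (cases X) (auto simp: cmp)
 next
  case (2 f) then show ?case
   using l1.comp_props[of "snd f" "fst f"] by (cases f) auto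
 next
  case (3 X) then show ?case
   using sqc.map_id[of "map_prod fst fst X"] S_carr[of "fst X"] S_carr[of "snd X"] by (cases X) (simp add: cmp)
 next
  case (4 f g) then show ?case
   using sqc.map_comp'[of "map_prod (fst \<circ> snd) (fst \<circ> snd) f" "map_prod (fst \<circ> snd) (fst \<circ> snd) g"]
   by (cases f; cases g) (auto simp: strict_1cell_iff)
 next
  case (5 P) then show ?case
   using l2.comp_props[of "snd P" "fst P"] by (cases P) auto
 next
  case (6 f) then show ?case
   using sqc.map_id2[of "map_prod (fst \<circ> snd) (fst \<circ> snd) f"]
   by (cases f) (auto simp: strict_1cell_iff)
 next
  case (7 P Q) then show ?case
   using sqc.map_vcomp[of "map_prod (fst \<circ> snd) (fst \<circ> snd) P" "map_prod (fst \<circ> snd) (fst \<circ> snd) Q"]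
   by (cases P; cases Q) (auto simp: structured_cell_iff)
 next
  case (8 P Q) then show ?case
   by (cases P; cases Q) (simp add: structured_cell_iff sqcell_paste_def sq_paste_def sq_comp_def)
 qed
 ultimately show ?thesis
  using two_category_axioms two_category_struct struct_ilevel0 struct_ilevel1 struct_ilevel2
   two_functor_comp[OF two_category_struct two_category_arrow two_functor_forget two_functor_arrow_dom]
   two_functor_comp[OF two_category_struct two_category_arrow two_functor_forget two_functor_arrow_cod]
  by (simp add: internal_category_def)
qed

lemma internal_functor_forget:
 "internal_functor struct_icat (sq_icat C) (tfun_id, structured_forget)"
proof -
 have "functor_on (ilevel0 struct_icat) (ilevel0 (sq_icat C)) \<lparr>ob_map = id, ar_map = fst\<rparr>"
  by (rule functor_onI) (auto simp: S_carr idn cmp)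
 moreover have "functor_on (ilevel1 struct_icat) (ilevel1 (sq_icat C)) \<lparr>ob_map = id, ar_map = fst \<circ> snd\<rparr>"
  by (rule functor_onI) (auto simp: strict_1cell_iff)
 moreover have "functor_on (ilevel2 struct_icat) (ilevel2 (sq_icat C)) \<lparr>ob_map = id, ar_map = fst \<circ> snd\<rparr>"
  by (rule functor_onI) (auto simp: structured_cell_iff)
 ultimately show ?thesis
  using two_functor_forget two_functor_id[of C]
  by (simp add: internal_functor_def tfun_id_def structured_forget_def)
qed

end

section \<open>Isomorphisms of structured arrows and transfer along them\<close>

definition structured_iso :: "('o, 'a, 'c) twocat =>
  ('a \<times> 'x) set => ('a \<times> 'x => 'a sq => 'a \<times> 'x => bool) => ('o => 'a \<times> 'x) => ('a \<times> 'x => 'a \<times> 'x => 'a \<times> 'x) =>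
  ('a \<times> 'y) set => ('a \<times> 'y => 'a sq => 'a \<times> 'y => bool) => ('o => 'a \<times> 'y) => ('a \<times> 'y => 'a \<times> 'y => 'a \<times> 'y) =>
  ('a \<times> 'x => 'a \<times> 'y) => bool" where
 "structured_iso C S M idn cmp S' M' idn' cmp' F \<longleftrightarrow>
  bij_betw F S S' \<and> (\<forall>X\<in>S. fst (F X) = fst X) \<and>
  (\<forall>X\<in>S. \<forall>Y\<in>S. \<forall>s\<in>sqs C. sdom s = fst X \<longrightarrow> scod s = fst Y \<longrightarrow>
    M X s Y = M' (F X) s (F Y)) \<and>
  (\<forall>x\<in>cobj C. F (idn x) = idn' x) \<and>
  (\<forall>X\<in>S. \<forall>Y\<in>S. ccod C (fst X) = cdom C (fst Y) \<longrightarrow> F (cmp Y X) = cmp' (F Y) (F X))"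

lemma structured_iso_inv:
 assumes "structured_arrows C S M idn cmp" "structured_iso C S M idn cmp S' M' idn' cmp' F"
 shows "structured_iso C S' M' idn' cmp' S M idn cmp (inv_into S F)"
proof -
 interpret structured_arrows C S M idn cmp by fact
 have F: "bij_betw F S S'" "\<And>X. X \<in> S ==> fst (F X) = fst X"
  using assms(2) by (auto simp: structured_iso_def)
 have inv: "inv_into S F X \<in> S" "F (inv_into S F X) = X" if "X \<in> S'" for X
  using F(1) that by (auto simp: bij_betw_def inv_into_into f_inv_into_f)
 have inv': "inv_into S F (F X) = X" if "X \<in> S" for X
  using F(1) that by (simp add: bij_betw_inv_into_left)
 have f: "fst (inv_into S F X) = fst X" if "X \<in> S'" for X
  using F(2)[of "inv_into S F X"] inv[OF that] by simp
 have "inv_into S F (idn' x) = idn x" if "x \<in> cobj C" for x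
  using assms(2) inv'[of "idn x"] idn[OF that] that by (simp add: structured_iso_def)
 moreover have "inv_into S F (cmp' Y X) = cmp (inv_into S F Y) (inv_into S F X)"
  if "X \<in> S'" "Y \<in> S'" "ccod C (fst X) = cdom C (fst Y)" for X Y
  using assms(2) inv'[of "cmp (inv_into S F Y) (inv_into S F X)"] cmp[of "inv_into S F X" "inv_into S F Y"]
   that inv f by (simp add: structured_iso_def)
 moreover have "M' X s Y = M (inv_into S F X) s (inv_into S F Y)"
  if "X \<in> S'" "Y \<in> S'" "s \<in> sqs C" "sdom s = fst X" "scod s = fst Y" for X s Y
  using assms(2) that inv f by (simp add: structured_iso_def)
 ultimately show ?thesis
  using bij_betw_inv_into[OF F(1)] f by (simp add: structured_iso_def)
qed

lemma structured_iso_trans: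
 assumes "structured_arrows C S M idn cmp"
  "structured_iso C S M idn cmp S' M' idn' cmp' F" "structured_iso C S' M' idn' cmp' S'' M'' idn'' cmp'' G"
 shows "structured_iso C S M idn cmp S'' M'' idn'' cmp'' (G \<circ> F)"
proof -
 have "F X \<in> S'" if "X \<in> S" for X
  using assms(2) that by (auto simp: structured_iso_def bij_betw_def)
 then show ?thesis
  using assms(2,3) by (auto simp: structured_iso_def intro: bij_betw_trans)
qed

text \<open>The axioms are pulled back along the inverse bijection \<open>G\<close>, which respects
  selected squares, identities and composites. Algebras and KZ structures obtain their compositions
  in this way from cloven opfibrations.\<close>

lemma structured_arrows_transfer:
 assumes "structured_arrows C S M idn cmp" "structured_iso C S M idn cmp S' M' idn' cmp' F"
 shows "structured_arrows C S' M' idn' cmp'"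
proof -
 interpret structured_arrows C S M idn cmp by fact
 define G where "G = inv_into S F"
 have iso: "structured_iso C S' M' idn' cmp' S M idn cmp G"
  unfolding G_def by (rule structured_iso_inv[OF assms])
 have G: "G X \<in> S" "fst (G X) = fst X" "F (G X) = X" if "X \<in> S'" for X
  using iso that assms(2) by (auto simp: structured_iso_def bij_betw_def G_def f_inv_into_f)
 have F: "F X \<in> S'" "fst (F X) = fst X" "G (F X) = X" if "X \<in> S" for X
  using assms(2) that by (auto simp: structured_iso_def bij_betw_def G_def)
 have st: "(X, s, Y) \<in> structured_1cells (arrow_twocat C) S' M' \<longleftrightarrow> X \<in> S' \<and> Y \<in> S' \<and> strict (G X) s (G Y)"
  for X s Y
 proof (cases "X \<in> S' \<and> Y \<in> S'")
  case True then show ?thesis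
   using iso G[of X] G[of Y] by (auto simp: strict_1cell_iff structured_iso_def)
 qed (auto simp: strict_1cell_iff)
 have idn': "idn' x \<in> S'" "G (idn' x) = idn x" "fst (idn' x) = cid C x" if "x \<in> cobj C" for x
  using assms(2) F[of "idn x"] idn[OF that] iso that by (auto simp: structured_iso_def)
 have S': "fst X \<in> carr C" if "X \<in> S'" for X
  using G(1,2)[OF that] S_carr[of "G X"] by simp
 have cmp': "cmp' Y X \<in> S'" "G (cmp' Y X) = cmp (G Y) (G X)" "fst (cmp' Y X) = fst Y \<cdot> fst X"
  if "X \<in> S'" "Y \<in> S'" "ccod C (fst X) = cdom C (fst Y)" for X Y
 proof -
  have "cmp (G Y) (G X) \<in> S" using cmp[of "G X" "G Y"] G that by simp
  moreover have "F (cmp (G Y) (G X)) = cmp' Y X"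
   using assms(2) G that by (simp add: structured_iso_def)
  ultimately show "cmp' Y X \<in> S'" "G (cmp' Y X) = cmp (G Y) (G X)" "fst (cmp' Y X) = fst Y \<cdot> fst X"
   using F cmp[of "G X" "G Y"] G that by (metis, metis, metis)
 qed
 show ?thesis
 proof (unfold_locales, goal_cases)
  case (1 X) then show ?case using G S_carr by metis
 next
  case (2 X) then show ?case using st[of X "sq_id C (fst X)" X] strict_id[of "G X"] G by (simp add: strict_1cell_iff)
 next
  case (3 X s Y t Z)
  then have "X \<in> S'" "Z \<in> S'" "strict (G X) (sq_comp C t s) (G Z)"
   using strict_comp[of "G X" s "G Y" t "G Z"] by (simp_all add: st)
  then have "(X, sq_comp C t s, Z) \<in> structured_1cells (arrow_twocat C) S' M'"
   by (simp add: st)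
  then show ?case by (simp add: strict_1cell_iff)
 next
  case (4 x) then show ?case using idn'[of x] G[of "idn' x"] idn[of x] by simp
 next
  case (5 h) then show ?case
   using st[of "idn' (cdom C h)" "sq_vid C h" "idn' (ccod C h)"] strict_idn[of h] idn' by (simp add: strict_1cell_iff)
 next
  case (6 X Y) then show ?case
   using cmp'[of X Y] G[of X] G[of Y] G(2)[of "cmp' Y X"] cmp[of "G X" "G Y"] by simp
 next
  case (7 X s X' Y t Y')
  then have "ccod C (fst X) = cdom C (fst Y)" "ccod C (fst X') = cdom C (fst Y')"
   by (auto simp: strict_1cell_iff sq_iff)
  moreover have "strict (cmp (G Y) (G X)) (sq_paste C t s) (cmp (G Y') (G X'))"
   using 7 strict_cmp[of "G X" s "G X'" "G Y" t "G Y'"] by (simp add: st)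
  ultimately have "(cmp' Y X, sq_paste C t s, cmp' Y' X') \<in> structured_1cells (arrow_twocat C) S' M'"
   using 7 cmp'(1,2)[of X Y] cmp'(1,2)[of X' Y'] by (simp add: st)
  then show ?case by (simp add: strict_1cell_iff)
 next
  case (8 X) then show ?case
   using cmp'[of X "idn' (ccod C (fst X))"] G(3)[of "cmp' (idn' (ccod C (fst X))) X"] idn' cmp_idn_left[of "G X"]
    G[of X] S_carr[of "G X"] by simp
 next
  case (9 X) then show ?case
   using cmp'[of "idn' (cdom C (fst X))" X] G(3)[of "cmp' X (idn' (cdom C (fst X)))"] idn' cmp_idn_right[of "G X"]
    G[of X] S_carr[of "G X"] by simp
 next
  case (10 X Y Z)
  then have "G (cmp' (cmp' Z Y) X) = G (cmp' Z (cmp' Y X))"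
   using cmp'[of X Y] cmp'[of Y Z] cmp'(2)[of X "cmp' Z Y"] cmp'(2)[of "cmp' Y X" Z]
    cmp_assoc[of "G X" "G Y" "G Z"] G(1,2) S' by simp
  moreover have "cmp' (cmp' Z Y) X \<in> S'" "cmp' Z (cmp' Y X) \<in> S'"
   using 10 cmp'[of X Y] cmp'[of Y Z] cmp'(1)[of X "cmp' Z Y"] cmp'(1)[of "cmp' Y X" Z] S' by simp_all
  ultimately show ?case by (metis G(3))
 qed
qed

text \<open>Squares and 2-cells are kept; only the structures at their ends are relabelled. On the
  object part of the internal categories the isomorphism is the identity of
  \<open>C\<close>.\<close>

definition structured_map where
 "structured_map F = (let F1 = (\<lambda>(X, s, Y). (F X, s, F Y)) in
  \<lparr>ob_map = F, ar_map = F1, ce_map = (\<lambda>(p, \<theta>, q). (F1 p, \<theta>, F1 q))\<rparr>)"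

lemma structured_map_simps [simp]:
 "ob_map (structured_map F) X = F X"
 "ar_map (structured_map F) p = (F (fst p), fst (snd p), F (snd (snd p)))"
 "ce_map (structured_map F) P = ((F (fst (fst P)), fst (snd (fst P)), F (snd (snd (fst P)))), fst (snd P),
  (F (fst (snd (snd P))), fst (snd (snd (snd P))), F (snd (snd (snd (snd P))))))"
 by (simp_all add: structured_map_def Let_def split: prod.splits)

locale structured_arrows_iso = A: structured_arrows C S M idn cmp + B: structured_arrows C S' M' idn' cmp'
 for C :: "('o, 'a, 'c) twocat" and S :: "('a \<times> 'x) set" and M idn cmp
  and S' :: "('a \<times> 'y) set" and M' idn' cmp' +
 fixes F
 assumes iso: "structured_iso C S M idn cmp S' M' idn' cmp' F"
begin

lemma map_in: "X \<in> S ==> F X \<in> S'" "X \<in> S ==> fst (F X) = fst X"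
 using iso by (auto simp: structured_iso_def bij_betw_def)

lemma map_strict:
 assumes "X \<in> S" "Y \<in> S"
 shows "B.strict (F X) s (F Y) \<longleftrightarrow> A.strict X s Y"
 using assms iso map_in by (auto simp: strict_1cell_iff structured_iso_def)

lemma map_1cell:
 "p \<in> structured_1cells (arrow_twocat C) S M ==>
  (F (fst p), fst (snd p), F (snd (snd p))) \<in> structured_1cells (arrow_twocat C) S' M'"
 using map_strict[of "fst p" "snd (snd p)" "fst (snd p)"] by (simp add: strict_1cell_iff)

lemma two_functor_map: "two_functor A.struct_twocat B.struct_twocat (structured_map F)"
proof (rule two_functorI, goal_cases)
 case (5 P) then show ?case using map_1cell[of "fst P"] map_1cell[of "snd (snd P)"]
  by (simp add: structured_cell_iff)
qed (auto simp: map_1cell, auto simp: map_in strict_1cell_iff structured_cell_iff)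

lemma two_iso_map: "two_iso A.struct_twocat B.struct_twocat (structured_map F)"
proof -
 have b: "bij_betw F S S'" using iso by (simp add: structured_iso_def)
 then have inj: "F X = F Y \<longleftrightarrow> X = Y" if "X \<in> S" "Y \<in> S" for X Y
  using that by (auto simp: bij_betw_def inj_on_def)
 have b1: "bij_betw (ar_map (structured_map F)) (carr A.struct_twocat) (carr B.struct_twocat)"
 proof (rule bij_betwI')
  fix q assume "q \<in> carr B.struct_twocat"
  then have q: "B.strict (fst q) (fst (snd q)) (snd (snd q))" by simp
  then have "fst q \<in> F ` S" "snd (snd q) \<in> F ` S"
   using b by (auto simp: bij_betw_def strict_1cell_iff)
  then obtain X Y where "X \<in> S" "Y \<in> S" "fst q = F X" "snd (snd q) = F Y"
   by blast
  moreover from this have "A.strict X (fst (snd q)) Y"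
   using q map_strict[of X Y "fst (snd q)"] by simp
  ultimately show "\<exists>p\<in>carr A.struct_twocat. q = ar_map (structured_map F) p"
   by (intro bexI[of _ "(X, fst (snd q), Y)"]) (simp_all add: prod_eq_iff)
 next
  fix p assume "p \<in> carr A.struct_twocat" then show "ar_map (structured_map F) p \<in> carr B.struct_twocat"
   by (simp add: map_1cell)
 qed (use inj in \<open>auto simp: strict_1cell_iff\<close>)
 have "bij_betw (ce_map (structured_map F)) (cell A.struct_twocat) (cell B.struct_twocat)"
 proof (rule bij_betwI')
  fix Q assume Q: "Q \<in> cell B.struct_twocat"
  then have "fst Q \<in> ar_map (structured_map F) ` carr A.struct_twocat"
   "snd (snd Q) \<in> ar_map (structured_map F) ` carr A.struct_twocat"
   using bij_betw_imp_surj_on[OF b1] by (simp_all add: structured_cell_iff)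
  then obtain p q where p: "p \<in> carr A.struct_twocat" "q \<in> carr A.struct_twocat"
   "fst Q = ar_map (structured_map F) p" "snd (snd Q) = ar_map (structured_map F) q"
   by blast
  then have "fst q = fst p" "snd (snd q) = snd (snd p)"
   using Q inj by (auto simp: structured_cell_iff strict_1cell_iff)
  then show "\<exists>P\<in>cell A.struct_twocat. Q = ce_map (structured_map F) P"
   using p Q by (intro bexI[of _ "(p, fst (snd Q), q)"]) (auto simp: prod_eq_iff structured_cell_iff)
 next
  fix P assume "P \<in> cell A.struct_twocat" then show "ce_map (structured_map F) P \<in> cell B.struct_twocat"
   using two_functor.ce_map[OF two_functor_map] by blast
 qed (use inj in \<open>auto simp: structured_cell_iff strict_1cell_iff\<close>)
 then show ?thesis
  using A.two_category_struct B.two_category_struct two_functor_map b b1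
  by (simp add: two_iso_def structured_map_def Let_def)
qed

lemma tfun_eq_map: "tfun_eq_on A.struct_twocat (tfun_comp structured_forget (structured_map F)) structured_forget"
 by (auto simp: tfun_eq_on_def map_in)

lemma two_iso_over_map:
 "two_iso_over (arrow_twocat C) A.struct_twocat structured_forget B.struct_twocat structured_forget"
 using A.two_functor_forget B.two_functor_forget two_iso_map tfun_eq_map by (auto simp: two_iso_over_def)

lemma internal_iso_over_map:
 "internal_iso_over (sq_icat C) A.struct_icat (tfun_id, structured_forget)
  B.struct_icat (tfun_id, structured_forget)"
proof -
 have i: "F (idn x) = idn' x" if "x \<in> cobj C" for x
  using iso that by (simp add: structured_iso_def)
 have c: "F (cmp Y X) = cmp' (F Y) (F X)" if "X \<in> S" "Y \<in> S" "ccod C (fst X) = cdom C (fst Y)" for X Y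
  using iso that by (simp add: structured_iso_def)
 have bd: "ccod C (fst (fst p)) = cdom C (fst (fst q)) \<and> ccod C (fst (snd (snd p))) = cdom C (fst (snd (snd q)))"
  if "p \<in> carr A.struct_twocat" "q \<in> carr A.struct_twocat" "sbot (fst (snd p)) = stop (fst (snd q))" for p q
  using that by (auto simp: strict_1cell_iff A.sq_iff)
 have "functor_on (ilevel0 A.struct_icat) (ilevel0 B.struct_icat) \<lparr>ob_map = id, ar_map = F\<rparr>"
  by (rule functor_onI) (auto simp: map_in i c)
 moreover have l1: "functor_on (ilevel1 A.struct_icat) (ilevel1 B.struct_icat)
   \<lparr>ob_map = id, ar_map = ar_map (structured_map F)\<rparr>"
 proof (rule functor_onI, goal_cases)
  case (2 p) then show ?case
   using two_functor.tfun_props(1)[OF two_functor_map A.two_category_struct, of p] by simp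
 next
  case (4 p q) then show ?case
   using bd[of p q] c[of "fst p" "fst q"] c[of "snd (snd p)" "snd (snd q)"] by (simp add: strict_1cell_iff)
 qed (auto simp: i)
 moreover have "functor_on (ilevel2 A.struct_icat) (ilevel2 B.struct_icat)
   \<lparr>ob_map = id, ar_map = ce_map (structured_map F)\<rparr>"
 proof (rule functor_onI, goal_cases)
  case (2 P) then show ?case
   using two_functor.tfun_props(3)[OF two_functor_map A.two_category_struct, of P] by simp
 next
  case (4 P Q)
  have "sbot (fst (snd (fst P))) = stop (fst (snd (fst Q)))"
   "sbot (fst (snd (snd (snd P)))) = stop (fst (snd (snd (snd Q))))"
   using 4 by (auto simp: structured_cell_iff A.arrow_2cells_iff)
  then show ?case
   using 4 functor_on.map_comp'[OF l1, of "fst P" "fst Q"]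
    functor_on.map_comp'[OF l1, of "snd (snd P)" "snd (snd Q)"] by (simp add: structured_cell_iff)
 qed (auto simp: i)
 ultimately have "internal_functor A.struct_icat B.struct_icat (tfun_id, structured_map F)"
  using two_functor_map two_functor_id[of C]
  by (simp add: internal_functor_def structured_map_def Let_def tfun_id_def)
 moreover have "two_iso C C tfun_id"
  using A.two_category_axioms two_functor_id[of C] by (simp add: two_iso_def tfun_id_def)
 moreover have "tfun_eq_on C (tfun_comp tfun_id tfun_id) tfun_id"
  by (simp add: tfun_eq_on_def)
 ultimately show ?thesis
  using A.internal_category_sq A.internal_category_struct B.internal_category_struct
   A.internal_functor_forget B.internal_functor_forget two_iso_map tfun_eq_map
  by (auto simp: internal_iso_over_def)
qed

end

context two_category
begin

abbreviation "dom_id f \<equiv> cid C (cdom C f)"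
abbreviation "cod_id f \<equiv> cid C (ccod C f)"
abbreviation "arrows \<equiv> arrow_twocat C"

end

context structured_arrows
begin

definition str :: "'a \<times> 'x => 'a => 'a => 'a \<times> 'x => bool" where
 "str X h k Y \<longleftrightarrow> strict X (Sq (fst X) h k (fst Y)) Y"

lemma str_iff: "str X h k Y \<longleftrightarrow> X \<in> S \<and> Y \<in> S \<and> h \<in> carr C \<and> k \<in> carr C \<and>
  cdom C h = cdom C (fst X) \<and> ccod C h = cdom C (fst Y) \<and> cdom C k = ccod C (fst X) \<and>
  ccod C k = ccod C (fst Y) \<and> fst Y \<cdot> h = k \<cdot> fst X \<and> M X (Sq (fst X) h k (fst Y)) Y"
 using S_carr[of X] S_carr[of Y] by (auto simp: str_def strict_iff sq_iff)

lemma strD: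
 assumes "str X h k Y"
 shows "X \<in> S" "Y \<in> S" "h \<in> carr C" "k \<in> carr C" "fst X \<in> carr C" "fst Y \<in> carr C"
  "cdom C h = cdom C (fst X)" "ccod C h = cdom C (fst Y)" "cdom C k = ccod C (fst X)"
  "ccod C k = ccod C (fst Y)" "fst Y \<cdot> h = k \<cdot> fst X"
 using assms S_carr by (auto simp: str_iff)

lemma str_comp:
 assumes "str X h k Y" "str Y h' k' Z"
 shows "str X (h' \<cdot> h) (k' \<cdot> k) Z"
 using strict_comp[of X _ Y _ Z, OF assms[unfolded str_def]] by (simp add: str_def sq_comp_def)

lemma str_id: "X \<in> S ==> str X (dom_id (fst X)) (cod_id (fst X)) X"
 using strict_id[of X] by (simp add: str_def sq_id_def)

lemma str_cmp:
 assumes "str X h k X'" "str Y k l Y'"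
 shows "str (cmp Y X) h l (cmp Y' X')"
 using strict_cmp[of X _ X' Y _ Y', OF assms[unfolded str_def]] strD[OF assms(1)] strD[OF assms(2)]
 by (simp add: str_def sq_paste_def cmp)

end

text \<open>\<open>fr f\<close> is the free structured arrow on \<open>f\<close> and \<open>str X h k Y\<close> says that \<open>(h, k)\<close> is a structure
  preserving square. Only the source \<open>t\<close> of the 2-cell in \<open>kz\<close> has to preserve structure: this makes
  the factorisation lax orthogonal. The last axiom recognises as algebra structures those retractions
  of \<open>L f\<close> that satisfy the consequences of the algebra laws listed in its premises.\<close>

locale free_arrows = structured_arrows C S M idn cmp
 for C :: "('o, 'a, 'c) twocat" and S :: "('a \<times> 'x) set" and M idn cmp +
 fixes L :: "'a => 'a" and fr :: "'a => 'a \<times> 'x"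
 assumes fr_in [simp]: "f \<in> carr C ==> fr f \<in> S"
  and L_carr [simp]: "f \<in> carr C ==> L f \<in> carr C"
  and dom_L [simp]: "f \<in> carr C ==> cdom C (L f) = cdom C f"
  and cod_L [simp]: "f \<in> carr C ==> ccod C (L f) = cdom C (fst (fr f))"
  and cod_R [simp]: "f \<in> carr C ==> ccod C (fst (fr f)) = ccod C f"
  and R_L [simp]: "f \<in> carr C ==> ccomp C (fst (fr f)) (L f) = f"
  and ext_ex: "f \<in> carr C ==> X \<in> S ==> Sq f h k (fst X) \<in> sqs C ==>
   \<exists>t. str (fr f) t k X \<and> ccomp C t (L f) = h"
  and ext_unique: "f \<in> carr C ==> str (fr f) t k X ==> str (fr f) t' k X ==>
   ccomp C t (L f) = ccomp C t' (L f) ==> t = t'"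
  and kz: "f \<in> carr C ==> str (fr f) t k X ==> t' \<in> carr C ==> cdom C t' = cdom C (fst (fr f)) ==>
   ccod C t' = cdom C (fst X) ==> \<alpha> \<in> cell C ==> src C \<alpha> = ccomp C t (L f) ==> trg C \<alpha> = ccomp C t' (L f) ==>
   \<beta> \<in> cell C ==> src C \<beta> = ccomp C (fst X) t ==> trg C \<beta> = ccomp C (fst X) t' ==>
   hcomp C \<beta> (id2 C (L f)) = hcomp C (id2 C (fst X)) \<alpha> ==>
   \<exists>!\<gamma>. \<gamma> \<in> cell C \<and> src C \<gamma> = t \<and> trg C \<gamma> = t' \<and> hcomp C \<gamma> (id2 C (L f)) = \<alpha> \<and>
    hcomp C (id2 C (fst X)) \<gamma> = \<beta>"
  and str_terminal: "X \<in> S ==> str X (fst X) (cod_id (fst X)) (idn (ccod C (fst X)))"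
  and str_reflect: "X \<in> S ==> Y \<in> S ==> str (fr (fst X)) p (cod_id (fst X)) X ==>
   ccomp C p (L (fst X)) = dom_id (fst X) ==> Sq (fst X) h k (fst Y) \<in> sqs C ==>
   str (fr (fst X)) (ccomp C h p) k Y ==> str X h k Y"
  and str_id_eq: "str X (dom_id (fst X)) (cod_id (fst X)) Y ==> fst X = fst Y ==> X = Y"
  and alg_str: "f \<in> carr C ==> p \<in> carr C ==> cdom C p = cdom C (fst (fr f)) ==> ccod C p = cdom C f ==>
   ccomp C f p = fst (fr f) ==> ccomp C p (L f) = dom_id f ==>
   \<gamma> \<in> cell C ==> src C \<gamma> = dom_id (fst (fr f)) ==> trg C \<gamma> = ccomp C (L f) p ==>
   hcomp C \<gamma> (id2 C (L f)) = id2 C (L f) ==> hcomp C (id2 C (fst (fr f))) \<gamma> = id2 C (fst (fr f)) ==>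
   hcomp C (id2 C p) \<gamma> = id2 C p ==>
   (\<And>q r. str (fr (fst (fr f))) q (cod_id f) (fr f) ==>
    str (fr (fst (fr f))) r (cod_id f) (fr f) ==>
    ccomp C q (L (fst (fr f))) = dom_id (fst (fr f)) ==>
    ccomp C r (L (fst (fr f))) = ccomp C (L f) p ==> ccomp C p q = ccomp C p r) ==>
   \<exists>X. fst X = f \<and> str (fr f) p (cod_id f) X"
begin

section \<open>The 2-functorial factorisation\<close>

definition R :: "'a => 'a" where "R f = fst (fr f)"

abbreviation "unit_sq f \<equiv> Sq f (L f) (cod_id f) (R f)"
abbreviation "counit_sq f \<equiv> Sq (L f) (dom_id f) (R f) f"

lemma fst_fr [simp]: "fst (fr f) = R f" by (simp add: R_def)

declare cod_L [unfolded fst_fr, simp] cod_R [unfolded fst_fr, simp] R_L [unfolded fst_fr, simp]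

lemma R_carr [simp]: "f \<in> carr C ==> R f \<in> carr C"
 using S_carr[of "fr f"] by simp

lemma R_L_assoc [simp]: "f \<in> carr C ==> x \<in> carr C ==> ccod C x = cdom C f ==> R f \<cdot> L f \<cdot> x = f \<cdot> x"
 by (rule comp_1_assoc_eq) simp_all

text \<open>Both cells solve the problem in \<open>kz\<close> that \<open>\<gamma>\<close> poses.
  The equations between 2-cells in the development of monad, comonad and algebras are obtained from
  this rule: it suffices that the common source preserves structure.\<close>

lemma cell_unique:
 assumes "f \<in> carr C" "str (fr f) t k X" "\<gamma> \<in> cell C" "\<delta> \<in> cell C" "src C \<gamma> = t" "src C \<delta> = t"
  "trg C \<gamma> = trg C \<delta>" "\<gamma> \<star> \<iota> (L f) = \<delta> \<star> \<iota> (L f)" "\<iota> (fst X) \<star> \<gamma> = \<iota> (fst X) \<star> \<delta>"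
 shows "\<gamma> = \<delta>"
proof -
 note s = strD[OF assms(2)]
 have cd: "cdom C (src C \<gamma>) = cdom C (R f)" "ccod C (src C \<gamma>) = cdom C (fst X)"
  using assms(1,5) s by simp_all
 have "cdom C (trg C \<gamma>) = cdom C (R f)" "ccod C (trg C \<gamma>) = cdom C (fst X)"
  using cd assms(3) by simp_all
 then have "\<exists>!\<epsilon>. \<epsilon> \<in> cell C \<and> src C \<epsilon> = t \<and> trg C \<epsilon> = trg C \<gamma> \<and> \<epsilon> \<star> \<iota> (L f) = \<gamma> \<star> \<iota> (L f) \<and>
   \<iota> (fst X) \<star> \<epsilon> = \<iota> (fst X) \<star> \<gamma>"
  using assms s cd by (intro kz[of f t k X]) simp_all
 then show ?thesis
  using assms by metis
qed

definition ext where "ext f X h k = (THE t. str (fr f) t k X \<and> t \<cdot> L f = h)"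

lemma ext:
 assumes "f \<in> carr C" "X \<in> S" "Sq f h k (fst X) \<in> sqs C"
 shows "str (fr f) (ext f X h k) k X" "ext f X h k \<cdot> L f = h"
proof -
 have "\<exists>!t. str (fr f) t k X \<and> t \<cdot> L f = h"
  using ext_ex[OF assms] ext_unique[OF assms(1)] by metis
 from theI'[OF this] show "str (fr f) (ext f X h k) k X" "ext f X h k \<cdot> L f = h"
  by (simp_all add: ext_def)
qed

text \<open>The square is continued by the unit of its codomain and then extended over the free
  arrow. Functoriality becomes uniqueness of extensions.\<close>

definition Kar where "Kar s = ext (sdom s) (fr (scod s)) (L (scod s) \<cdot> stop s) (sbot s)"

lemma Kar_aux:
 assumes "s \<in> sqs C"
 shows "Sq (sdom s) (L (scod s) \<cdot> stop s) (sbot s) (fst (fr (scod s))) \<in> sqs C"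
 using assms by (simp add: sq_iff)

lemma
 assumes "s \<in> sqs C"
 shows str_Kar: "str (fr (sdom s)) (Kar s) (sbot s) (fr (scod s))"
  and Kar_L [simp]: "f = sdom s ==> Kar s \<cdot> L f = L (scod s) \<cdot> stop s"
 using assms ext[of "sdom s" "fr (scod s)", OF _ _ Kar_aux[OF assms]]
 by (simp_all add: Kar_def sq_iff)

lemma
 assumes "s \<in> sqs C"
 shows Kar_carr [simp]: "Kar s \<in> carr C"
  and dom_Kar [simp]: "cdom C (Kar s) = cdom C (R (sdom s))"
  and cod_Kar [simp]: "ccod C (Kar s) = cdom C (R (scod s))"
  and R_Kar [simp]: "g = scod s ==> R g \<cdot> Kar s = sbot s \<cdot> R (sdom s)"
 using strD[OF str_Kar[OF assms]] by simp_all

lemma sq_ends: "s \<in> sqs C ==> sdom s \<in> carr C \<and> scod s \<in> carr C \<and> stop s \<in> carr C \<and> sbot s \<in> carr C"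
 by (simp add: sq_iff)

lemma Kar_L_assoc [simp]:
 assumes "s \<in> sqs C" "f = sdom s" "x \<in> carr C" "ccod C x = cdom C f"
 shows "Kar s \<cdot> L f \<cdot> x = L (scod s) \<cdot> stop s \<cdot> x"
 using assms comp_1_assoc_eq[OF Kar_L[OF assms(1,2)], of x] by (simp add: sq_iff)

lemma R_Kar_assoc [simp]:
 assumes "s \<in> sqs C" "g = scod s" "x \<in> carr C" "ccod C x = cdom C (R (sdom s))"
 shows "R g \<cdot> Kar s \<cdot> x = sbot s \<cdot> R (sdom s) \<cdot> x"
 using assms comp_1_assoc_eq[OF R_Kar[OF assms(1,2)], of x] by (simp add: sq_iff)

lemma Kar_eqI:
 assumes "s \<in> sqs C" "str (fr (sdom s)) t (sbot s) (fr (scod s))"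
  "t \<cdot> L (sdom s) = L (scod s) \<cdot> stop s"
 shows "Kar s = t"
 using assms ext_unique[OF _ str_Kar[OF assms(1)] assms(2)] sq_ends by simp

text \<open>The action of \<open>K\<close> on a 2-cell is fixed by its restriction along
  \<open>L\<close> and its image under \<open>R\<close>. A unique cell of this kind exists by
  \<open>kz\<close>, because the source \<open>Kar (csrc \<theta>)\<close> preserves
  structure.\<close>

definition is_Kce where
 "is_Kce \<theta> \<gamma> \<longleftrightarrow> \<gamma> \<in> cell C \<and> src C \<gamma> = Kar (csrc \<theta>) \<and> trg C \<gamma> = Kar (ctrg \<theta>) \<and>
  \<gamma> \<star> \<iota> (L (sdom (csrc \<theta>))) = \<iota> (L (scod (csrc \<theta>))) \<star> ctop \<theta> \<and>
  \<iota> (R (scod (csrc \<theta>))) \<star> \<gamma> = cbot \<theta> \<star> \<iota> (R (sdom (csrc \<theta>)))"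

definition Kce where "Kce \<theta> = (THE \<gamma>. is_Kce \<theta> \<gamma>)"

lemma is_Kce_ex1:
 assumes "\<theta> \<in> sq_cells C"
 shows "\<exists>!\<gamma>. is_Kce \<theta> \<gamma>"
proof -
 have "\<exists>!\<gamma>. \<gamma> \<in> cell C \<and> src C \<gamma> = Kar (csrc \<theta>) \<and> trg C \<gamma> = Kar (ctrg \<theta>) \<and>
  \<gamma> \<star> \<iota> (L (sdom (csrc \<theta>))) = \<iota> (L (scod (csrc \<theta>))) \<star> ctop \<theta> \<and>
  \<iota> (fst (fr (scod (csrc \<theta>)))) \<star> \<gamma> = cbot \<theta> \<star> \<iota> (R (sdom (csrc \<theta>)))"
  using assms
  by (intro kz[OF _ str_Kar]) (simp_all add: arrow_2cells_iff, simp_all add: sq_iff)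
 then show ?thesis by (simp add: is_Kce_def)
qed

lemma Kce_eqI: "\<theta> \<in> sq_cells C ==> is_Kce \<theta> \<gamma> ==> Kce \<theta> = \<gamma>"
 unfolding Kce_def using is_Kce_ex1 by (intro the1_equality)

lemma
 assumes "\<theta> \<in> sq_cells C"
 shows Kce_cell [simp]: "Kce \<theta> \<in> cell C"
  and src_Kce [simp]: "src C (Kce \<theta>) = Kar (csrc \<theta>)"
  and trg_Kce [simp]: "trg C (Kce \<theta>) = Kar (ctrg \<theta>)"
  and Kce_L [simp]: "f = sdom (csrc \<theta>) ==> Kce \<theta> \<star> \<iota> (L f) = \<iota> (L (scod (csrc \<theta>))) \<star> ctop \<theta>"
  and R_Kce [simp]: "g = scod (csrc \<theta>) ==> \<iota> (R g) \<star> Kce \<theta> = cbot \<theta> \<star> \<iota> (R (sdom (csrc \<theta>)))"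
 using theI'[OF is_Kce_ex1[OF assms]] by (simp_all add: is_Kce_def Kce_def)

lemma arrow_2cellsD:
 assumes "\<theta> \<in> sq_cells C"
 shows "csrc \<theta> \<in> sqs C" "ctrg \<theta> \<in> sqs C" "sdom (ctrg \<theta>) = sdom (csrc \<theta>)"
  "scod (ctrg \<theta>) = scod (csrc \<theta>)" "ctop \<theta> \<in> cell C" "src C (ctop \<theta>) = stop (csrc \<theta>)"
  "trg C (ctop \<theta>) = stop (ctrg \<theta>)" "cbot \<theta> \<in> cell C" "src C (cbot \<theta>) = sbot (csrc \<theta>)"
  "trg C (cbot \<theta>) = sbot (ctrg \<theta>)" "sdom (csrc \<theta>) \<in> carr C" "scod (csrc \<theta>) \<in> carr C"
  "stop (csrc \<theta>) \<in> carr C" "sbot (csrc \<theta>) \<in> carr C" "stop (ctrg \<theta>) \<in> carr C" "sbot (ctrg \<theta>) \<in> carr C"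
  "cdom C (stop (csrc \<theta>)) = cdom C (sdom (csrc \<theta>))" "ccod C (stop (csrc \<theta>)) = cdom C (scod (csrc \<theta>))"
  "cdom C (sbot (csrc \<theta>)) = ccod C (sdom (csrc \<theta>))" "ccod C (sbot (csrc \<theta>)) = ccod C (scod (csrc \<theta>))"
  "\<iota> (scod (csrc \<theta>)) \<star> ctop \<theta> = cbot \<theta> \<star> \<iota> (sdom (csrc \<theta>))"
 using assms by (auto simp: arrow_2cells_iff sq_iff)

lemma Kce_L_assoc [simp]:
 assumes "\<theta> \<in> sq_cells C" "f = sdom (csrc \<theta>)" "x \<in> cell C" "ccod C (src C x) = cdom C f"
 shows "Kce \<theta> \<star> \<iota> (L f) \<star> x = \<iota> (L (scod (csrc \<theta>))) \<star> ctop \<theta> \<star> x"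
 using assms arrow_2cellsD[OF assms(1)] comp_2_assoc_eq[OF Kce_L[OF assms(1,2)], of x] by simp

lemma R_Kce_assoc [simp]:
 assumes "\<theta> \<in> sq_cells C" "g = scod (csrc \<theta>)" "x \<in> cell C" "ccod C (src C x) = cdom C (R (sdom (csrc \<theta>)))"
 shows "\<iota> (R g) \<star> Kce \<theta> \<star> x = cbot \<theta> \<star> \<iota> (R (sdom (csrc \<theta>))) \<star> x"
 using assms arrow_2cellsD[OF assms(1)] comp_2_assoc_eq[OF R_Kce[OF assms(1,2)], of x] by simp

definition mid_fun :: "('a, 'a sq, ('a, 'c) sqcell, 'o, 'a, 'c) tfun" where
 "mid_fun = \<lparr>ob_map = (\<lambda>f. cdom C (R f)), ar_map = Kar, ce_map = Kce\<rparr>"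

lemma mid_fun_simps [simp]: "ob_map mid_fun f = cdom C (R f)" "ar_map mid_fun = Kar" "ce_map mid_fun = Kce"
 by (simp_all add: mid_fun_def)

lemma sq_id_1cell: "f \<in> carr C ==> sq_id C f \<in> sqs C"
 by (simp add: sq_iff sq_id_def)

lemma Kar_id: "f \<in> carr C ==> Kar (sq_id C f) = dom_id (R f)"
 by (rule Kar_eqI) (use str_id[of "fr f"] in \<open>simp_all add: sq_id_1cell, simp_all add: sq_id_def\<close>)

lemma Kar_comp:
 assumes "s \<in> sqs C" "t \<in> sqs C" "scod s = sdom t"
 shows "Kar (sq_comp C t s) = Kar t \<cdot> Kar s"
proof (rule Kar_eqI[OF sq_comp_1cell[OF assms]])
 show "str (fr (sdom (sq_comp C t s))) (Kar t \<cdot> Kar s) (sbot (sq_comp C t s)) (fr (scod (sq_comp C t s)))"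
  using str_comp[OF str_Kar[OF assms(1)]] str_Kar[OF assms(2)] assms(3) by (simp add: sq_comp_def)
 show "(Kar t \<cdot> Kar s) \<cdot> L (sdom (sq_comp C t s)) = L (scod (sq_comp C t s)) \<cdot> stop (sq_comp C t s)"
  using assms sq_ends[OF assms(1)] sq_ends[OF assms(2)]
  by (simp add: sq_comp_def) (simp add: sq_iff)
qed

lemma two_functor_mid: "two_functor arrows C mid_fun"
proof -
 interpret A: two_category "arrows" by (rule two_category_arrow)
 show ?thesis
 proof (rule two_functorI, goal_cases)
  case (6 s)
  then have s: "s \<in> sqs C" by simp
  have "is_Kce (id2 arrows s) (\<iota> (Kar s))"
   using s by (simp add: is_Kce_def) (simp add: sq_iff)
  then show ?case
   using A.id2_cell[of s] s by (simp add: Kce_eqI)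
 next
  case (7 \<theta> \<phi>)
  then have c: "\<theta> \<in> sq_cells C" "\<phi> \<in> sq_cells C" "ctrg \<theta> = csrc \<phi>" by simp_all
  have "is_Kce (vcomp arrows \<phi> \<theta>) (Kce \<phi> \<bullet> Kce \<theta>)"
   using c(3) arrow_2cellsD[OF c(1)] arrow_2cellsD[OF c(2)] c(1,2)
   by (simp add: is_Kce_def whisker_left_vcomp whisker_right_vcomp)
  then show ?case
   using A.vcomp_cell[of \<theta> \<phi>] c by (simp add: Kce_eqI)
 next
  case (8 \<theta> \<phi>)
  then have c: "\<theta> \<in> sq_cells C" "\<phi> \<in> sq_cells C" "scod (csrc \<theta>) = sdom (csrc \<phi>)" by simp_all
  have "is_Kce (hcomp arrows \<phi> \<theta>) (Kce \<phi> \<star> Kce \<theta>)"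
   using c(3) arrow_2cellsD[OF c(1)] arrow_2cellsD[OF c(2)] c(1,2)
   by (simp add: is_Kce_def Kar_comp sq_comp_def[of _ "csrc \<phi>" "csrc \<theta>"]) (simp add: sq_comp_def Kar_comp[unfolded sq_comp_def])
  then show ?case
   using A.hcomp_cell[of \<theta> \<phi>] c by (simp add: Kce_eqI)
 qed (auto simp: Kar_id Kar_comp sq_ends)
qed

end

context free_arrows
begin

section \<open>Multiplication, comultiplication and their laws\<close>

definition proj where "proj f = ext (R f) (fr f) (dom_id (R f)) (cod_id f)"

text \<open>The target structure is the composite of the free arrows on \<open>L f\<close> and on
  \<open>f\<close>; its underlying arrow is \<open>R f \<cdot> R (L f)\<close>. This is how the
  composition of structured arrows enters the comonad.\<close>

definition sigma where "sigma f = ext f (cmp (fr f) (fr (L f))) (L (L f)) (cod_id f)"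

abbreviation fr2 where "fr2 f \<equiv> cmp (fr f) (fr (L f))"

lemma fr2:
 assumes "f \<in> carr C"
 shows "fr2 f \<in> S" "fst (fr2 f) = R f \<cdot> R (L f)"
 using assms cmp[of "fr (L f)" "fr f"] by simp_all

lemma
 assumes "f \<in> carr C"
 shows str_proj: "str (fr (R f)) (proj f) (cod_id f) (fr f)"
  and proj_L [simp]: "proj f \<cdot> L (R f) = dom_id (R f)"
 using assms ext[of "R f" "fr f" "dom_id (R f)" "cod_id f"]
 by (simp_all add: proj_def sq_iff)

lemma
 assumes "f \<in> carr C"
 shows proj_carr [simp]: "proj f \<in> carr C"
  and dom_proj [simp]: "cdom C (proj f) = cdom C (R (R f))"
  and cod_proj [simp]: "ccod C (proj f) = cdom C (R f)"
  and R_proj [simp]: "R f \<cdot> proj f = R (R f)"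
 using assms strD[OF str_proj[OF assms]] by simp_all

lemma
 assumes "f \<in> carr C"
 shows str_sigma: "str (fr f) (sigma f) (cod_id f) (fr2 f)"
  and sigma_L [simp]: "sigma f \<cdot> L f = L (L f)"
 using assms ext[of f "fr2 f" "L (L f)" "cod_id f"]
 by (simp_all add: sigma_def sq_iff fr2)

lemma
 assumes "f \<in> carr C"
 shows sigma_carr [simp]: "sigma f \<in> carr C"
  and dom_sigma [simp]: "cdom C (sigma f) = cdom C (R f)"
  and cod_sigma [simp]: "ccod C (sigma f) = cdom C (R (L f))"
  and R_R_sigma [simp]: "R f \<cdot> R (L f) \<cdot> sigma f = R f"
 using assms strD[OF str_sigma[OF assms]] by (simp_all add: fr2)

lemma proj_L_assoc [simp]:
 "f \<in> carr C ==> x \<in> carr C ==> ccod C x = cdom C (R f) ==> proj f \<cdot> L (R f) \<cdot> x = x"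
 using comp_1_assoc_eq[OF proj_L[of f], of x] by simp

lemma sigma_L_assoc [simp]:
 "f \<in> carr C ==> x \<in> carr C ==> ccod C x = cdom C f ==> sigma f \<cdot> L f \<cdot> x = L (L f) \<cdot> x"
 using comp_1_assoc_eq[OF sigma_L[of f], of x] by simp

text \<open>\<open>R (L f)\<close> preserves structure from \<open>fr2 f\<close> to
  \<open>fr f\<close>: by \<open>str_terminal\<close> it is a map from \<open>fr (L f)\<close> to an
  identity, which is pasted with the identity of \<open>fr f\<close>. Hence both sides are
  extensions of \<open>L f\<close> over the free arrow.\<close>

lemma R_sigma [simp]:
 assumes "f \<in> carr C"
 shows "R (L f) \<cdot> sigma f = dom_id (R f)"
proof -
 have t: "str (fr2 f) (R (L f)) (cod_id f) (fr f)"
  using str_cmp[OF str_terminal[of "fr (L f)"], of "fr f" "cod_id f" "fr f"] str_id[of "fr f"] assms cmp_idn_right[of "fr f"]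
  by simp
 show ?thesis
  by (rule ext_unique[OF assms])
   (use str_comp[OF str_sigma[OF assms] t] str_id[of "fr f"] assms in simp_all)
qed

lemma R_sigma_assoc [simp]:
 "f \<in> carr C ==> x \<in> carr C ==> ccod C x = cdom C (R f) ==> R (L f) \<cdot> sigma f \<cdot> x = x"
 using comp_1_assoc_eq[OF R_sigma[of f], of x] by simp

definition lsq where "lsq s = Sq (L (sdom s)) (stop s) (Kar s) (L (scod s))"
definition rsq where "rsq s = Sq (R (sdom s)) (Kar s) (sbot s) (R (scod s))"
definition lcell where "lcell \<theta> = SqCell (lsq (csrc \<theta>)) (ctop \<theta>) (Kce \<theta>) (lsq (ctrg \<theta>))"
definition rcell where "rcell \<theta> = SqCell (rsq (csrc \<theta>)) (Kce \<theta>) (cbot \<theta>) (rsq (ctrg \<theta>))"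

lemma lr_simps [simp]:
 "sdom (lsq s) = L (sdom s)" "stop (lsq s) = stop s" "sbot (lsq s) = Kar s" "scod (lsq s) = L (scod s)"
 "sdom (rsq s) = R (sdom s)" "stop (rsq s) = Kar s" "sbot (rsq s) = sbot s" "scod (rsq s) = R (scod s)"
 "csrc (lcell \<theta>) = lsq (csrc \<theta>)" "ctop (lcell \<theta>) = ctop \<theta>" "cbot (lcell \<theta>) = Kce \<theta>" "ctrg (lcell \<theta>) = lsq (ctrg \<theta>)"
 "csrc (rcell \<theta>) = rsq (csrc \<theta>)" "ctop (rcell \<theta>) = Kce \<theta>" "cbot (rcell \<theta>) = cbot \<theta>" "ctrg (rcell \<theta>) = rsq (ctrg \<theta>)"
 by (simp_all add: lsq_def rsq_def lcell_def rcell_def)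

lemma lsq_1cell [simp]: "s \<in> sqs C ==> lsq s \<in> sqs C"
 using Kar_L[of s] by (subst sq_iff) (simp, simp add: sq_iff)

lemma rsq_1cell [simp]: "s \<in> sqs C ==> rsq s \<in> sqs C"
 using R_Kar[of s] by (subst sq_iff) (simp, simp add: sq_iff)

lemma lcell_2cell [simp]: "\<theta> \<in> sq_cells C ==> lcell \<theta> \<in> sq_cells C"
 using arrow_2cellsD[of \<theta>] by (subst arrow_2cells_iff) simp

lemma rcell_2cell [simp]: "\<theta> \<in> sq_cells C ==> rcell \<theta> \<in> sq_cells C"
 using arrow_2cellsD[of \<theta>] by (subst arrow_2cells_iff) simp

definition AW :: "('o, 'a, 'c) awfs_data" where
 "AW = \<lparr>mid = mid_fun, lft = L, rgt = R, sig = sigma, prj = proj\<rparr>"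

lemma AW_simps [simp]:
 "mid AW = mid_fun" "lft AW = L" "rgt AW = R" "sig AW = sigma" "prj AW = proj"
 "ob_map (Lfun AW) f = L f" "ar_map (Lfun AW) s = lsq s" "ce_map (Lfun AW) \<theta> = lcell \<theta>"
 "ob_map (Rfun AW) f = R f" "ar_map (Rfun AW) s = rsq s" "ce_map (Rfun AW) \<theta> = rcell \<theta>"
 by (simp_all add: AW_def Lfun_def Rfun_def Let_def lcell_def lsq_def rcell_def rsq_def)

lemma two_functor_L: "two_functor arrows arrows (Lfun AW)"
proof -
 interpret K: two_functor "arrows" C mid_fun by (rule two_functor_mid)
 show ?thesis
 proof (rule two_functorI, goal_cases)
  case (3 f) then show ?case using K.map_id[of f] by (simp add: lsq_def) (simp add: sq_id_def)
 next
  case (4 s t) then show ?case using Kar_comp[of s t] by (simp add: lsq_def sq_comp_def)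
 next
  case (6 s) then show ?case using K.map_id2[of s] by (simp add: lcell_def)
 next
  case (7 \<theta> \<phi>) then show ?case using K.map_vcomp[of \<theta> \<phi>] by (simp add: lcell_def)
 next
  case (8 \<theta> \<phi>) then show ?case
   using K.map_hcomp[of \<theta> \<phi>] Kar_comp[of "csrc \<theta>" "csrc \<phi>"] Kar_comp[of "ctrg \<theta>" "ctrg \<phi>"]
    arrow_2cellsD(1-4)[of \<theta>] arrow_2cellsD(1-4)[of \<phi>]
   by (simp add: lcell_def lsq_def sq_comp_def)
 qed (auto simp: sq_ends)
qed

lemma two_functor_R: "two_functor arrows arrows (Rfun AW)"
proof -
 interpret K: two_functor "arrows" C mid_fun by (rule two_functor_mid)
 show ?thesis
 proof (rule two_functorI, goal_cases)
  case (3 f) then show ?case using K.map_id[of f] by (simp add: rsq_def) (simp add: sq_id_def)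
 next
  case (4 s t) then show ?case using Kar_comp[of s t] by (simp add: rsq_def sq_comp_def)
 next
  case (6 s) then show ?case using K.map_id2[of s] by (simp add: rcell_def)
 next
  case (7 \<theta> \<phi>) then show ?case using K.map_vcomp[of \<theta> \<phi>] by (simp add: rcell_def)
 next
  case (8 \<theta> \<phi>) then show ?case
   using K.map_hcomp[of \<theta> \<phi>] Kar_comp[of "csrc \<theta>" "csrc \<phi>"] Kar_comp[of "ctrg \<theta>" "ctrg \<phi>"]
    arrow_2cellsD(1-4)[of \<theta>] arrow_2cellsD(1-4)[of \<phi>]
   by (simp add: rcell_def rsq_def sq_comp_def)
 qed (auto simp: sq_ends)
qed

lemma str_Kar': "s \<in> sqs C ==> f = sdom s ==> g = scod s ==> k = sbot s ==>
  str (fr f) (Kar s) k (fr g)"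
 using str_Kar by simp

lemma str_comp': "str X h k Y ==> str Y h' k' Z ==> l = k' \<cdot> k ==> str X (h' \<cdot> h) l Z"
 using str_comp by simp

lemma sbot_id [simp]: "s \<in> sqs C ==> f = sdom s ==> sbot s \<cdot> cod_id f = sbot s"
 by (simp add: sq_iff)

lemma id_sbot [simp]: "s \<in> sqs C ==> f = scod s ==> cod_id f \<cdot> sbot s = sbot s"
 by (simp add: sq_iff)

lemma str_Kar_lsq:
 assumes "s \<in> sqs C"
 shows "str (fr2 (sdom s)) (Kar (lsq s)) (sbot s) (fr2 (scod s))"
 using str_cmp[OF str_Kar[OF lsq_1cell[OF assms]], of "fr (sdom s)" "sbot s" "fr (scod s)"]
  str_Kar[OF assms] by simp

text \<open>Naturality of \<open>sigma\<close>, and later of \<open>proj\<close>, is uniqueness of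
  extensions: both composites preserve structure and agree after \<open>L\<close>.\<close>

lemma sigma_nat:
 assumes s: "s \<in> sqs C"
 shows "Kar (lsq s) \<cdot> sigma (sdom s) = sigma (scod s) \<cdot> Kar s"
proof (rule ext_unique)
 note c = sq_ends[OF s]
 then show f: "sdom s \<in> carr C" by simp
 show "str (fr (sdom s)) (Kar (lsq s) \<cdot> sigma (sdom s)) (sbot s) (fr2 (scod s))"
  using str_comp'[OF str_sigma[OF f] str_Kar_lsq[OF s]] s by simp
 show "str (fr (sdom s)) (sigma (scod s) \<cdot> Kar s) (sbot s) (fr2 (scod s))"
  using str_comp'[OF str_Kar[OF s] str_sigma] s c by simp
 show "(Kar (lsq s) \<cdot> sigma (sdom s)) \<cdot> L (sdom s) = (sigma (scod s) \<cdot> Kar s) \<cdot> L (sdom s)"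
  using s c by (simp add: sq_iff)
qed

lemma sigma_nat2:
 assumes t: "\<theta> \<in> sq_cells C"
 shows "Kce (lcell \<theta>) \<star> \<iota> (sigma (sdom (csrc \<theta>))) = \<iota> (sigma (scod (csrc \<theta>))) \<star> Kce \<theta>"
proof -
 let ?f = "sdom (csrc \<theta>)" and ?g = "scod (csrc \<theta>)"
 note d = arrow_2cellsD[OF t]
 have s: "str (fr ?f) (Kar (lsq (csrc \<theta>)) \<cdot> sigma ?f) (sbot (csrc \<theta>)) (fr2 ?g)"
  using str_comp'[OF str_sigma str_Kar_lsq[of "csrc \<theta>"]] d by simp
 have e: "Kar (lsq (ctrg \<theta>)) \<cdot> sigma ?f = sigma ?g \<cdot> Kar (ctrg \<theta>)"
  "Kar (lsq (csrc \<theta>)) \<cdot> sigma ?f = sigma ?g \<cdot> Kar (csrc \<theta>)"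
  using sigma_nat[of "ctrg \<theta>"] sigma_nat[of "csrc \<theta>"] d by simp_all
 \<comment> \<open>The composite \<open>R ?g \<cdot> R (L ?g)\<close> underlies
   \<open>fr2 ?g\<close>, so \<open>cell_unique\<close> asks for equality after whiskering with it.
   Both sides become \<open>cbot \<theta> \<star> \<iota> (R ?f)\<close>.\<close>
 have "\<iota> (R ?g \<cdot> R (L ?g)) \<star> Kce (lcell \<theta>) \<star> \<iota> (sigma ?f) = \<iota> (R ?g) \<star> (\<iota> (R (L ?g)) \<star> Kce (lcell \<theta>)) \<star> \<iota> (sigma ?f)"
  using d t by (simp del: R_Kce R_Kce_assoc)
 also have "\<dots> = cbot \<theta> \<star> \<iota> (R ?f)"
  using d t by simp
 also have "\<dots> = (\<iota> (R ?g) \<star> \<iota> (R (L ?g)) \<star> \<iota> (sigma ?g)) \<star> Kce \<theta>"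
  using d t by simp
 also have "\<dots> = \<iota> (R ?g \<cdot> R (L ?g)) \<star> \<iota> (sigma ?g) \<star> Kce \<theta>"
  using d t by simp
 finally have q: "\<iota> (fst (fr2 ?g)) \<star> Kce (lcell \<theta>) \<star> \<iota> (sigma ?f) = \<iota> (fst (fr2 ?g)) \<star> \<iota> (sigma ?g) \<star> Kce \<theta>"
  using d by (simp add: fr2)
 show ?thesis
  by (rule cell_unique[OF _ s _ _ _ _ _ _ q]) (use d t in \<open>simp_all add: e\<close>)
qed

lemma proj_nat:
 assumes s: "s \<in> sqs C"
 shows "Kar s \<cdot> proj (sdom s) = proj (scod s) \<cdot> Kar (rsq s)"
proof (rule ext_unique)
 note c = sq_ends[OF s]
 then show f: "R (sdom s) \<in> carr C" by simp
 show "str (fr (R (sdom s))) (Kar s \<cdot> proj (sdom s)) (sbot s) (fr (scod s))"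
  using str_comp'[OF str_proj str_Kar[OF s]] s c by simp
 show "str (fr (R (sdom s))) (proj (scod s) \<cdot> Kar (rsq s)) (sbot s) (fr (scod s))"
  using str_comp[OF str_Kar[OF rsq_1cell[OF s]], of "proj (scod s)" "cod_id (scod s)" "fr (scod s)"]
   str_proj[of "scod s"] s c by simp
 show "(Kar s \<cdot> proj (sdom s)) \<cdot> L (R (sdom s)) = (proj (scod s) \<cdot> Kar (rsq s)) \<cdot> L (R (sdom s))"
  using s c by simp
qed

lemma proj_nat2:
 assumes t: "\<theta> \<in> sq_cells C"
 shows "Kce \<theta> \<star> \<iota> (proj (sdom (csrc \<theta>))) = \<iota> (proj (scod (csrc \<theta>))) \<star> Kce (rcell \<theta>)"
proof -
 let ?f = "sdom (csrc \<theta>)" and ?g = "scod (csrc \<theta>)"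
 note d = arrow_2cellsD[OF t]
 have s: "str (fr (R ?f)) (Kar (csrc \<theta>) \<cdot> proj ?f) (sbot (csrc \<theta>)) (fr ?g)"
  using str_comp'[OF str_proj str_Kar[of "csrc \<theta>"]] d by simp
 have e: "proj ?g \<cdot> Kar (rsq (ctrg \<theta>)) = Kar (ctrg \<theta>) \<cdot> proj ?f"
  "proj ?g \<cdot> Kar (rsq (csrc \<theta>)) = Kar (csrc \<theta>) \<cdot> proj ?f"
  using proj_nat[of "ctrg \<theta>"] proj_nat[of "csrc \<theta>"] d by simp_all
 show ?thesis
  by (rule cell_unique[OF _ s]) (use d t in \<open>simp_all add: e\<close>)
qed

lemma proj_unit [simp]:
 assumes "f \<in> carr C"
 shows "proj f \<cdot> Kar (unit_sq f) = dom_id (R f)"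
proof (rule ext_unique[OF assms])
 have s: "unit_sq f \<in> sqs C"
  using assms by (simp add: sq_iff)
 show "str (fr f) (proj f \<cdot> Kar (unit_sq f)) (cod_id f) (fr f)"
  using str_comp[OF str_Kar[OF s], of "proj f" "cod_id f" "fr f"] str_proj[OF assms] assms by simp
 show "str (fr f) (dom_id (R f)) (cod_id f) (fr f)"
  using str_id[of "fr f"] assms by simp
qed (use assms in \<open>simp_all add: sq_iff\<close>)

lemma proj_assoc:
 assumes "f \<in> carr C"
 shows "proj f \<cdot> Kar (Sq (R (R f)) (proj f) (cod_id f) (R f)) = proj f \<cdot> proj (R f)"
proof (rule ext_unique)
 have s: "Sq (R (R f)) (proj f) (cod_id f) (R f) \<in> sqs C"
  using assms by (simp add: sq_iff)
 show "R (R f) \<in> carr C" using assms by simp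
 show "str (fr (R (R f))) (proj f \<cdot> Kar (Sq (R (R f)) (proj f) (cod_id f) (R f))) (cod_id f) (fr f)"
  using str_comp[OF str_Kar[OF s], of "proj f" "cod_id f" "fr f"] str_proj[OF assms] assms by simp
 show "str (fr (R (R f))) (proj f \<cdot> proj (R f)) (cod_id f) (fr f)"
  using str_comp'[OF str_proj[of "R f"] str_proj[OF assms]] assms by simp
qed (use assms in \<open>simp_all add: sq_iff\<close>)

lemma sigma_counit [simp]:
 assumes "f \<in> carr C"
 shows "Kar (counit_sq f) \<cdot> sigma f = dom_id (R f)"
proof (rule ext_unique[OF assms])
 have s: "counit_sq f \<in> sqs C"
  using assms by (simp add: sq_iff)
 \<comment> \<open>\<open>Kar (counit_sq f)\<close> lies over \<open>R f\<close>. Pasting it with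
   the terminal map of \<open>fr f\<close> gives a structure preserving map out of the composite
   \<open>fr2 f\<close>.\<close>
 have "str (fr2 f) (Kar (counit_sq f)) (cod_id f) (fr f)"
  using str_cmp[OF str_Kar[OF s], of "fr f" "cod_id f" "idn (ccod C f)"]
   str_terminal[of "fr f"] cmp_idn_left[of "fr f"] assms by simp
 from str_comp[OF str_sigma[OF assms] this] show "str (fr f) (Kar (counit_sq f) \<cdot> sigma f) (cod_id f) (fr f)"
  using assms by simp
 show "str (fr f) (dom_id (R f)) (cod_id f) (fr f)"
  using str_id[of "fr f"] assms by simp
qed (use assms in \<open>simp_all add: sq_iff\<close>)

text \<open>Both sides extend the same arrow into the threefold composite of
  \<open>fr (L (L f))\<close>, \<open>fr (L f)\<close> and \<open>fr f\<close>;
  \<open>cmp_assoc\<close> reconciles the two bracketings.\<close>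

lemma sigma_coassoc:
 assumes "f \<in> carr C"
 shows "sigma (L f) \<cdot> sigma f = Kar (Sq (L f) (dom_id f) (sigma f) (L (L f))) \<cdot> sigma f"
proof (rule ext_unique[OF assms])
 have s: "Sq (L f) (dom_id f) (sigma f) (L (L f)) \<in> sqs C"
  using assms by (simp add: sq_iff)
 have a: "cmp (fr f) (cmp (fr (L f)) (fr (L (L f)))) = cmp (fr2 f) (fr (L (L f)))"
  using assms cmp_assoc[of "fr (L (L f))" "fr (L f)" "fr f"] by simp
 have "str (fr2 f) (sigma (L f)) (cod_id f) (cmp (fr2 f) (fr (L (L f))))"
  using str_cmp[OF str_sigma[of "L f"], of "fr f" "cod_id f" "fr f"] str_id[of "fr f"] assms a by simp
 from str_comp[OF str_sigma[OF assms] this] show "str (fr f) (sigma (L f) \<cdot> sigma f) (cod_id f) (cmp (fr2 f) (fr (L (L f))))"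
  using assms by simp
 have "str (fr2 f) (Kar (Sq (L f) (dom_id f) (sigma f) (L (L f)))) (cod_id f)
   (cmp (fr2 f) (fr (L (L f))))"
  using str_cmp[OF str_Kar[OF s], of "fr f" "cod_id f" "fr2 f"] str_sigma[OF assms] by simp
 from str_comp[OF str_sigma[OF assms] this] show "str (fr f) (Kar (Sq (L f) (dom_id f) (sigma f) (L (L f))) \<cdot> sigma f) (cod_id f)
   (cmp (fr2 f) (fr (L (L f))))"
  using assms by simp
qed (use assms in \<open>simp_all add: sq_iff\<close>)

lemma law_1cell:
 assumes "f \<in> carr C"
 shows "Sq (L (R f)) (sigma f) (proj f) (R (L f)) \<in> sqs C"
 using assms by (simp add: sq_iff)

text \<open>The equation of the distributive law that is not already a law of the monad or the
  comonad. It occurs twice: as the top component of compatibility with the multiplication and as the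
  bottom component for the comultiplication. Both sides extend \<open>sigma f\<close> over the free
  arrow on \<open>R f\<close>.\<close>

lemma law_mult:
 assumes "f \<in> carr C"
 shows "proj (L f) \<cdot> Kar (Sq (L (R f)) (sigma f) (proj f) (R (L f))) \<cdot> sigma (R f) = sigma f \<cdot> proj f"
proof (rule ext_unique)
 note s = law_1cell[OF assms]
 show "R f \<in> carr C" using assms by simp
 have "str (fr (L (R f))) (proj (L f) \<cdot> Kar (Sq (L (R f)) (sigma f) (proj f) (R (L f)))) (proj f) (fr (L f))"
  using str_comp[OF str_Kar[OF s], of "proj (L f)" "dom_id (R f)" "fr (L f)"] str_proj[of "L f"] assms by simp
 then have "str (fr2 (R f)) (proj (L f) \<cdot> Kar (Sq (L (R f)) (sigma f) (proj f) (R (L f)))) (cod_id f) (fr2 f)"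
  using str_cmp str_proj[OF assms] by blast
 from str_comp[OF str_sigma[of "R f"] this] have "str (fr (R f)) ((proj (L f) \<cdot> Kar (Sq (L (R f)) (sigma f) (proj f) (R (L f)))) \<cdot> sigma (R f))
   (cod_id f) (fr2 f)"
  using assms by simp
 then show "str (fr (R f)) (proj (L f) \<cdot> Kar (Sq (L (R f)) (sigma f) (proj f) (R (L f))) \<cdot> sigma (R f))
   (cod_id f) (fr2 f)"
  using assms s by simp
 show "str (fr (R f)) (sigma f \<cdot> proj f) (cod_id f) (fr2 f)"
  using str_comp'[OF str_proj[OF assms] str_sigma[OF assms]] assms by simp
qed (use assms law_1cell[OF assms] in simp_all)

end

lemma structured_twocat_all_cells:
 assumes "\<And>X u Y \<theta> u'. (X, u, Y) \<in> structured_1cells D S M ==> (X, u', Y) \<in> structured_1cells D S M ==>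
  \<theta> \<in> cell D ==> src D \<theta> = u ==> trg D \<theta> = u' ==> N X \<theta> Y"
 shows "structured_twocat D S M N = structured_twocat D S M all_cells"
proof -
 have "cell (structured_twocat D S M N) = cell (structured_twocat D S M all_cells)"
  using assms by (auto simp: structured_twocat_def)
 then show ?thesis by (simp add: structured_twocat_def)
qed

context free_arrows
begin

lemma unit_counit_simps [simp]:
 "Runit C AW f = unit_sq f"
 "Rmult C AW f = Sq (R (R f)) (proj f) (cod_id f) (R f)"
 "Lcounit C AW f = counit_sq f"
 "Lcomult C AW f = Sq (L f) (dom_id f) (sigma f) (L (L f))"
 "LRlaw AW f = Sq (L (R f)) (sigma f) (proj f) (R (L f))"
 by (simp_all add: Runit_def Rmult_def Lcounit_def Lcomult_def LRlaw_def)

lemma lsq_Sq: "lsq (Sq f h k g) = Sq (L f) h (Kar (Sq f h k g)) (L g)"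
 by (simp add: lsq_def)

lemma rsq_Sq: "rsq (Sq f h k g) = Sq (R f) (Kar (Sq f h k g)) k (R g)"
 by (simp add: rsq_def)

lemma sigma_nat': "s \<in> sqs C ==> f = sdom s ==> Kar (lsq s) \<cdot> sigma f = sigma (scod s) \<cdot> Kar s"
 by (simp add: sigma_nat)

lemma proj_nat': "s \<in> sqs C ==> f = sdom s ==> Kar s \<cdot> proj f = proj (scod s) \<cdot> Kar (rsq s)"
 by (simp add: proj_nat)

lemma unit_1cells [simp]:
 assumes "f \<in> carr C"
 shows "unit_sq f \<in> sqs C"
  "Sq (R (R f)) (proj f) (cod_id f) (R f) \<in> sqs C"
  "counit_sq f \<in> sqs C"
  "Sq (L f) (dom_id f) (sigma f) (L (L f)) \<in> sqs C"
  "Sq (L (R f)) (sigma f) (proj f) (R (L f)) \<in> sqs C"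
 using assms by (simp_all add: sq_iff)

lemma comonad: "two_comonad arrows (Lfun AW) (Lcounit C AW) (Lcomult C AW)"
proof -
 interpret A: two_category "arrows" by (rule two_category_arrow)
 interpret G: two_functor "arrows" "arrows" "Lfun AW" by (rule two_functor_L)
 show ?thesis
 proof
  show "two_nat arrows arrows (Lfun AW) tfun_id (Lcounit C AW)"
   unfolding two_nat_def
   by (intro conjI ballI) (auto simp: chom_def sq_ends dest: arrow_2cellsD(1-4),
    auto simp: sq_comp_def arrow_2cells_iff, auto simp: sq_iff)
  show "two_nat arrows arrows (Lfun AW) (tfun_comp (Lfun AW) (Lfun AW)) (Lcomult C AW)"
   unfolding two_nat_def
   by (intro conjI ballI) (auto simp: chom_def sq_ends dest: arrow_2cellsD(1-4),
    auto simp: sq_comp_def sigma_nat' sigma_nat2, auto simp: arrow_2cells_iff sigma_nat', auto simp: sq_iff)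
 qed (auto simp: sq_comp_def sq_id_def lsq_Sq sigma_coassoc)
qed

lemma monad: "two_monad arrows (Rfun AW) (Runit C AW) (Rmult C AW)"
proof -
 interpret A: two_category "arrows" by (rule two_category_arrow)
 interpret G: two_functor "arrows" "arrows" "Rfun AW" by (rule two_functor_R)
 show ?thesis
 proof
  show "two_nat arrows arrows tfun_id (Rfun AW) (Runit C AW)"
   unfolding two_nat_def
   by (intro conjI ballI) (auto simp: chom_def sq_ends dest: arrow_2cellsD(1-4),
    auto simp: sq_comp_def arrow_2cells_iff, auto simp: sq_iff)
  show "two_nat arrows arrows (tfun_comp (Rfun AW) (Rfun AW)) (Rfun AW) (Rmult C AW)"
   unfolding two_nat_def
   by (intro conjI ballI) (auto simp: chom_def sq_ends dest: arrow_2cellsD(1-4),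
    auto simp: sq_comp_def proj_nat' proj_nat2, auto simp: arrow_2cells_iff proj_nat', auto simp: sq_iff)
 qed (auto simp: sq_comp_def sq_id_def rsq_Sq proj_assoc)
qed

lemma distributive: "mixed_distributive_law arrows (Lfun AW) (Lcounit C AW) (Lcomult C AW)
  (Rfun AW) (Runit C AW) (Rmult C AW) (LRlaw AW)"
 unfolding mixed_distributive_law_def two_nat_def
 by (intro conjI ballI) (auto simp: chom_def sq_ends dest: arrow_2cellsD(1-4),
  auto simp: sq_comp_def lsq_Sq rsq_Sq sigma_nat' sigma_nat2 proj_nat' proj_nat2 proj_assoc law_mult
   sigma_coassoc[symmetric] arrow_2cellsD(1-4))

lemma awfs: "awfs C AW"
proof -
 have "two_nat arrows C (arrow_dom C) mid_fun L"
  by (auto simp: two_nat_def chom_def sq_ends arrow_2cellsD)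
 moreover have "two_nat arrows C mid_fun (arrow_cod C) R"
  by (auto simp: two_nat_def chom_def sq_ends arrow_2cellsD)
 ultimately show ?thesis
  using two_category_axioms two_functor_mid comonad monad distributive by (simp add: awfs_def)
qed

section \<open>Lax idempotency\<close>

definition delta where
 "delta f = (SOME \<gamma>. \<gamma> \<in> cell C \<and> src C \<gamma> = Kar (unit_sq f) \<and> trg C \<gamma> = L (R f) \<and>
  \<gamma> \<star> \<iota> (L f) = \<iota> (L (R f) \<cdot> L f) \<and> \<iota> (R (R f)) \<star> \<gamma> = \<iota> (R f))"

text \<open>This is the 2-cell from \<open>T \<eta>\<close> to \<open>\<eta> T\<close> that comes
  with a lax idempotent monad \<open>T\<close>. It exists by \<open>kz\<close>, since
  \<open>Kar (unit_sq f)\<close> preserves structure; its target \<open>L (R f)\<close> is an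
  arbitrary arrow for this purpose.\<close>

lemma delta:
 assumes f: "f \<in> carr C"
 shows delta_cell [simp]: "delta f \<in> cell C"
  and src_delta [simp]: "src C (delta f) = Kar (unit_sq f)"
  and trg_delta [simp]: "trg C (delta f) = L (R f)"
  and delta_L [simp]: "delta f \<star> \<iota> (L f) = \<iota> (L (R f) \<cdot> L f)"
  and R_delta [simp]: "\<iota> (R (R f)) \<star> delta f = \<iota> (R f)"
proof -
 have s: "str (fr f) (Kar (unit_sq f)) (cod_id f) (fr (R f))"
  using str_Kar'[of "unit_sq f"] f by simp
 have "\<exists>!\<gamma>. \<gamma> \<in> cell C \<and> src C \<gamma> = Kar (unit_sq f) \<and> trg C \<gamma> = L (R f) \<and>
  \<gamma> \<star> \<iota> (L f) = \<iota> (L (R f) \<cdot> L f) \<and> \<iota> (fst (fr (R f))) \<star> \<gamma> = \<iota> (R f)"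
  by (rule kz[OF f s]) (use f in simp_all)
 then have "\<exists>\<gamma>. \<gamma> \<in> cell C \<and> src C \<gamma> = Kar (unit_sq f) \<and> trg C \<gamma> = L (R f) \<and>
  \<gamma> \<star> \<iota> (L f) = \<iota> (L (R f) \<cdot> L f) \<and> \<iota> (R (R f)) \<star> \<gamma> = \<iota> (R f)"
  by auto
 from someI_ex[OF this] show "delta f \<in> cell C" "src C (delta f) = Kar (unit_sq f)"
  "trg C (delta f) = L (R f)" "delta f \<star> \<iota> (L f) = \<iota> (L (R f) \<cdot> L f)" "\<iota> (R (R f)) \<star> delta f = \<iota> (R f)"
  unfolding delta_def by blast+
qed

lemma proj_delta:
 assumes f: "f \<in> carr C"
 shows "\<iota> (proj f) \<star> delta f = \<iota> (dom_id (R f))"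
 by (rule cell_unique[OF f str_id[of "fr f"]]) (use f in simp_all)

text \<open>The counit of the adjunction between \<open>T \<eta>\<close> and the multiplication.
  Restricted along \<open>L (R f)\<close>, its source becomes \<open>Kar (unit_sq f)\<close> and its
  target \<open>L (R f)\<close>, so \<open>delta f\<close> is the natural datum for
  \<open>kz\<close>.\<close>

definition epsR where
 "epsR f = (SOME \<gamma>. \<gamma> \<in> cell C \<and> src C \<gamma> = Kar (unit_sq f) \<cdot> proj f \<and>
  trg C \<gamma> = dom_id (R (R f)) \<and> \<gamma> \<star> \<iota> (L (R f)) = delta f \<and> \<iota> (R (R f)) \<star> \<gamma> = \<iota> (R (R f)))"

lemma str_unit_proj:
 assumes f: "f \<in> carr C"
 shows "str (fr (R f)) (Kar (unit_sq f) \<cdot> proj f) (cod_id f) (fr (R f))"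
 using str_comp'[OF str_proj[OF f] str_Kar'[OF unit_1cells(1)[OF f]]] f by simp

lemma epsR:
 assumes f: "f \<in> carr C"
 shows epsR_cell [simp]: "epsR f \<in> cell C"
  and src_epsR [simp]: "src C (epsR f) = Kar (unit_sq f) \<cdot> proj f"
  and trg_epsR [simp]: "trg C (epsR f) = dom_id (R (R f))"
  and epsR_L [simp]: "epsR f \<star> \<iota> (L (R f)) = delta f"
  and R_epsR [simp]: "\<iota> (R (R f)) \<star> epsR f = \<iota> (R (R f))"
proof -
 have "\<exists>!\<gamma>. \<gamma> \<in> cell C \<and> src C \<gamma> = Kar (unit_sq f) \<cdot> proj f \<and>
  trg C \<gamma> = dom_id (R (R f)) \<and> \<gamma> \<star> \<iota> (L (R f)) = delta f \<and> \<iota> (fst (fr (R f))) \<star> \<gamma> = \<iota> (R (R f))"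
  by (rule kz[OF _ str_unit_proj[OF f]]) (use f in simp_all)
 then have "\<exists>\<gamma>. \<gamma> \<in> cell C \<and> src C \<gamma> = Kar (unit_sq f) \<cdot> proj f \<and>
  trg C \<gamma> = dom_id (R (R f)) \<and> \<gamma> \<star> \<iota> (L (R f)) = delta f \<and> \<iota> (R (R f)) \<star> \<gamma> = \<iota> (R (R f))"
  by auto
 from someI_ex[OF this] show "epsR f \<in> cell C"
  "src C (epsR f) = Kar (unit_sq f) \<cdot> proj f"
  "trg C (epsR f) = dom_id (R (R f))" "epsR f \<star> \<iota> (L (R f)) = delta f"
  "\<iota> (R (R f)) \<star> epsR f = \<iota> (R (R f))"
  unfolding epsR_def by blast+
qed

lemma epsR_L_comp:
 assumes f: "f \<in> carr C" and x: "x \<in> carr C" "ccod C x = cdom C (R f)"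
 shows "epsR f \<star> \<iota> (L (R f) \<cdot> x) = delta f \<star> \<iota> x"
 using comp_2_assoc_eq[OF epsR_L[OF f], of "\<iota> x"] f x by simp

lemma delta_L_comp:
 assumes f: "f \<in> carr C" and x: "x \<in> carr C" "ccod C x = cdom C f"
 shows "delta f \<star> \<iota> (L f \<cdot> x) = \<iota> (L (R f) \<cdot> L f \<cdot> x)"
 using comp_2_assoc_eq[OF delta_L[OF f], of "\<iota> x"] f x by simp

lemma R_delta_assoc:
 assumes f: "f \<in> carr C" and x: "x \<in> cell C" "ccod C (src C x) = cdom C (R f)"
 shows "\<iota> (R (R f)) \<star> delta f \<star> x = \<iota> (R f) \<star> x"
 using comp_2_assoc_eq[OF R_delta[OF f], of x] f x by simp

lemma R_epsR_assoc:
 assumes f: "f \<in> carr C" and x: "x \<in> cell C" "ccod C (src C x) = cdom C (R (R f))"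
 shows "\<iota> (R (R f)) \<star> epsR f \<star> x = \<iota> (R (R f)) \<star> x"
 using comp_2_assoc_eq[OF R_epsR[OF f], of x] f x by simp

lemma proj_unit_assoc [simp]:
 "f \<in> carr C ==> x \<in> carr C ==> ccod C x = cdom C (R f) ==>
  proj f \<cdot> Kar (unit_sq f) \<cdot> x = x"
 using comp_1_assoc_eq[OF proj_unit[of f], of x] by simp

text \<open>With \<open>epsR_unit\<close> this gives the two triangle identities. In each the cells
  start at a structure preserving arrow, so they are compared by \<open>cell_unique\<close>.\<close>

lemma proj_epsR:
 assumes f: "f \<in> carr C"
 shows "\<iota> (proj f) \<star> epsR f = \<iota> (proj f)"
 by (rule cell_unique[OF _ str_proj[OF f]]) (use f proj_delta[OF f] in simp_all)

lemma str_unit: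
 "f \<in> carr C ==> str (fr f) (Kar (unit_sq f)) (cod_id f) (fr (R f))"
 using str_Kar'[of "unit_sq f"] by simp

lemma str_counit:
 "f \<in> carr C ==> str (fr (L f)) (Kar (counit_sq f)) (R f) (fr f)"
 using str_Kar'[of "counit_sq f"] by simp

lemma epsR_unit:
 assumes f: "f \<in> carr C"
 shows "epsR f \<star> \<iota> (Kar (unit_sq f)) = \<iota> (Kar (unit_sq f))"
 by (rule cell_unique[OF f str_unit[OF f]])
  (use f in \<open>simp_all add: epsR_L_comp R_epsR_assoc\<close>)

lemma unit_Kar_nat:
 assumes s: "s \<in> sqs C"
 shows "Kar (unit_sq (scod s)) \<cdot> Kar s =
  Kar (rsq s) \<cdot> Kar (unit_sq (sdom s))"
proof -
 note c = sq_ends[OF s]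
 have "sq_comp C (unit_sq (scod s)) s =
   sq_comp C (rsq s) (unit_sq (sdom s))"
  using s c by (simp add: sq_comp_def)
 then show ?thesis
  using s c Kar_comp[of s "unit_sq (scod s)"]
   Kar_comp[of "unit_sq (sdom s)" "rsq s"] by simp
qed

lemma delta_nat:
 assumes s: "s \<in> sqs C"
 shows "delta (scod s) \<star> \<iota> (Kar s) = \<iota> (Kar (rsq s)) \<star> delta (sdom s)"
proof -
 note c = sq_ends[OF s]
 have t: "str (fr (sdom s)) (Kar (unit_sq (scod s)) \<cdot> Kar s)
   (sbot s) (fr (R (scod s)))"
  using str_comp[OF str_Kar[OF s] str_Kar'[OF unit_1cells(1)[of "scod s"]], of "R (scod s)" "cod_id (scod s)"]
   s c by simp
 have "\<iota> (R (R (scod s))) \<star> \<iota> (Kar (rsq s)) \<star> delta (sdom s) = \<iota> (sbot s) \<star> \<iota> (R (R (sdom s))) \<star> delta (sdom s)"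
  using s c by (simp del: R_delta) (simp add: sq_iff del: R_delta)
 also have "\<dots> = \<iota> (sbot s) \<star> \<iota> (R (sdom s))"
  using c by (simp only: R_delta)
 also have "\<dots> = \<iota> (R (R (scod s))) \<star> delta (scod s) \<star> \<iota> (Kar s)"
  using s c by (simp add: R_delta_assoc) (simp add: sq_iff)
 finally have q: "\<iota> (fst (fr (R (scod s)))) \<star> delta (scod s) \<star> \<iota> (Kar s) =
   \<iota> (fst (fr (R (scod s)))) \<star> \<iota> (Kar (rsq s)) \<star> delta (sdom s)"
  by simp
 show ?thesis
  by (rule cell_unique[OF _ t _ _ _ _ _ _ q])
   (use s c in \<open>simp_all add: delta_L_comp unit_Kar_nat sq_iff\<close>)
qed

lemma unit_proj_nat:
 assumes s: "s \<in> sqs C"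
 shows "Kar (unit_sq (scod s)) \<cdot> proj (scod s) \<cdot> Kar (rsq s) =
  Kar (rsq s) \<cdot> Kar (unit_sq (sdom s)) \<cdot> proj (sdom s)"
 using s sq_ends[OF s] proj_nat[OF s] comp_1_assoc_eq[OF unit_Kar_nat[OF s], of "proj (sdom s)"] by simp

lemma epsR_nat:
 assumes s: "s \<in> sqs C"
 shows "epsR (scod s) \<star> \<iota> (Kar (rsq s)) = \<iota> (Kar (rsq s)) \<star> epsR (sdom s)"
proof -
 note c = sq_ends[OF s]
 let ?u = "Kar (unit_sq (scod s))"
 have t: "str (fr (R (sdom s))) ((?u \<cdot> proj (scod s)) \<cdot> Kar (rsq s)) (sbot s) (fr (R (scod s)))"
  using str_comp[OF str_Kar[OF rsq_1cell[OF s]]] str_unit_proj[of "scod s"] s c by fastforce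
 have "\<iota> (R (R (scod s))) \<star> \<iota> (Kar (rsq s)) \<star> epsR (sdom s) = \<iota> (sbot s) \<star> \<iota> (R (R (sdom s))) \<star> epsR (sdom s)"
  using s c by (simp del: R_epsR) (simp add: sq_iff del: R_epsR)
 also have "\<dots> = \<iota> (sbot s) \<star> \<iota> (R (R (sdom s)))"
  using c by (simp only: R_epsR)
 also have "\<dots> = \<iota> (R (R (scod s))) \<star> epsR (scod s) \<star> \<iota> (Kar (rsq s))"
  using s c by (simp add: R_epsR_assoc) (simp add: sq_iff)
 finally have q: "\<iota> (fst (fr (R (scod s)))) \<star> epsR (scod s) \<star> \<iota> (Kar (rsq s)) =
   \<iota> (fst (fr (R (scod s)))) \<star> \<iota> (Kar (rsq s)) \<star> epsR (sdom s)"
  by simp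
 show ?thesis
  by (rule cell_unique[OF _ t _ _ _ _ _ _ q])
   (use s c delta_nat[OF s] in \<open>simp_all add: unit_proj_nat epsR_L_comp sq_iff\<close>)
qed

lemma lax_idempotent_R: "lax_idempotent_monad arrows (Rfun AW) (Runit C AW) (Rmult C AW)"
proof -
 \<comment> \<open>On the base the unit and the multiplication are identities, so the counit is
   \<open>epsR\<close> on top and an identity below.\<close>
 let ?e = "\<lambda>f. SqCell (sq_comp C (rsq (Runit C AW f)) (Rmult C AW f)) (epsR f) (\<iota> (cod_id f)) (sq_id C (R (R f)))"
 have "?e f \<in> sq_cells C" if "f \<in> carr C" for f
  using that by (simp add: arrow_2cells_iff sq_comp_1cell sq_id_1cell) (simp add: sq_comp_def sq_id_def)
 then show ?thesis
  unfolding lax_idempotent_monad_def adj_id_unit_def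
  using monad
  by (intro conjI exI[of _ ?e] ballI)
   (auto simp: proj_epsR epsR_unit epsR_nat unit_proj_nat sq_ends, auto simp: sq_comp_def sq_id_def rsq_Sq unit_proj_nat sq_ends, auto simp: sq_iff)
qed

text \<open>The counit of the adjunction between \<open>sigma f\<close> and
  \<open>Kar (counit_sq f)\<close>. Its source preserves structure into \<open>fr2 f\<close>, which
  is why the base condition involves the composite \<open>R f \<cdot> R (L f)\<close>.\<close>

definition epsL where
 "epsL f = (SOME \<gamma>. \<gamma> \<in> cell C \<and> src C \<gamma> = sigma f \<cdot> Kar (counit_sq f) \<and>
  trg C \<gamma> = dom_id (R (L f)) \<and> \<gamma> \<star> \<iota> (L (L f)) = \<iota> (L (L f)) \<and>
  \<iota> (R f \<cdot> R (L f)) \<star> \<gamma> = \<iota> (R f \<cdot> R (L f)))"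

lemma str_sigma_counit:
 assumes f: "f \<in> carr C"
 shows "str (fr (L f)) (sigma f \<cdot> Kar (counit_sq f)) (R f) (fr2 f)"
 using str_comp[OF str_Kar[OF unit_1cells(3)[OF f]], of "sigma f" "cod_id f" "fr2 f"]
  str_sigma[OF f] f by simp

lemma epsL:
 assumes f: "f \<in> carr C"
 shows epsL_cell [simp]: "epsL f \<in> cell C"
  and src_epsL [simp]: "src C (epsL f) = sigma f \<cdot> Kar (counit_sq f)"
  and trg_epsL [simp]: "trg C (epsL f) = dom_id (R (L f))"
  and epsL_L [simp]: "epsL f \<star> \<iota> (L (L f)) = \<iota> (L (L f))"
  and R_epsL: "\<iota> (R f \<cdot> R (L f)) \<star> epsL f = \<iota> (R f \<cdot> R (L f))"
proof -
 have "\<exists>!\<gamma>. \<gamma> \<in> cell C \<and> src C \<gamma> = sigma f \<cdot> Kar (counit_sq f) \<and>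
  trg C \<gamma> = dom_id (R (L f)) \<and> \<gamma> \<star> \<iota> (L (L f)) = \<iota> (L (L f)) \<and>
  \<iota> (fst (fr2 f)) \<star> \<gamma> = \<iota> (R f \<cdot> R (L f))"
  by (rule kz[OF _ str_sigma_counit[OF f]]) (use f in \<open>simp_all add: fr2\<close>)
 then have "\<exists>\<gamma>. \<gamma> \<in> cell C \<and> src C \<gamma> = sigma f \<cdot> Kar (counit_sq f) \<and>
  trg C \<gamma> = dom_id (R (L f)) \<and> \<gamma> \<star> \<iota> (L (L f)) = \<iota> (L (L f)) \<and>
  \<iota> (R f \<cdot> R (L f)) \<star> \<gamma> = \<iota> (R f \<cdot> R (L f))"
  using f by (auto simp: fr2)
 from someI_ex[OF this] show "epsL f \<in> cell C"
  "src C (epsL f) = sigma f \<cdot> Kar (counit_sq f)"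
  "trg C (epsL f) = dom_id (R (L f))" "epsL f \<star> \<iota> (L (L f)) = \<iota> (L (L f))"
  "\<iota> (R f \<cdot> R (L f)) \<star> epsL f = \<iota> (R f \<cdot> R (L f))"
  unfolding epsL_def by blast+
qed

lemma epsL_L_comp:
 assumes f: "f \<in> carr C" and x: "x \<in> carr C" "ccod C x = cdom C f"
 shows "epsL f \<star> \<iota> (L (L f) \<cdot> x) = \<iota> (L (L f) \<cdot> x)"
 using comp_2_assoc_eq[OF epsL_L[OF f], of "\<iota> x"] f x by simp

lemma R_epsL_assoc:
 assumes f: "f \<in> carr C" and x: "x \<in> cell C" "ccod C (src C x) = cdom C (R (L f))"
 shows "\<iota> (R f \<cdot> R (L f)) \<star> epsL f \<star> x = \<iota> (R f \<cdot> R (L f)) \<star> x"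
 using comp_2_assoc_eq[OF R_epsL[OF f], of x] f x by simp

lemma epsL_sigma:
 assumes f: "f \<in> carr C"
 shows "epsL f \<star> \<iota> (sigma f) = \<iota> (sigma f)"
 by (rule cell_unique[OF f str_sigma[OF f]])
  (use f epsL_L[OF f] in \<open>simp_all add: fr2 R_epsL_assoc\<close>)

lemma sigma_counit_assoc [simp]:
 "f \<in> carr C ==> x \<in> carr C ==> ccod C x = cdom C (R f) ==>
  Kar (counit_sq f) \<cdot> sigma f \<cdot> x = x"
 using comp_1_assoc_eq[OF sigma_counit[of f], of x] by simp

lemma counit_epsL:
 assumes f: "f \<in> carr C"
 shows "\<iota> (Kar (counit_sq f)) \<star> epsL f = \<iota> (Kar (counit_sq f))"
 by (rule cell_unique[OF _ str_counit[OF f]]) (use f in \<open>simp_all add: R_epsL\<close>)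

lemma counit_Kar_nat:
 assumes s: "s \<in> sqs C"
 shows "Kar (counit_sq (scod s)) \<cdot> Kar (lsq s) =
  Kar s \<cdot> Kar (counit_sq (sdom s))"
proof -
 note c = sq_ends[OF s]
 have "sq_comp C (counit_sq (scod s)) (lsq s) =
   sq_comp C s (counit_sq (sdom s))"
  using s by (simp add: sq_comp_def) (simp add: sq_iff)
 then show ?thesis
  using s c Kar_comp[of "lsq s" "counit_sq (scod s)"]
   Kar_comp[of "counit_sq (sdom s)" s] by simp
qed

lemma sigma_counit_nat:
 assumes s: "s \<in> sqs C"
 shows "sigma (scod s) \<cdot> Kar (counit_sq (scod s)) \<cdot> Kar (lsq s) =
  Kar (lsq s) \<cdot> sigma (sdom s) \<cdot> Kar (counit_sq (sdom s))"
 using s sq_ends[OF s] counit_Kar_nat[OF s] comp_1_assoc_eq[OF sigma_nat[OF s],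
   of "Kar (counit_sq (sdom s))"] by simp

lemma epsL_nat:
 assumes s: "s \<in> sqs C"
 shows "epsL (scod s) \<star> \<iota> (Kar (lsq s)) = \<iota> (Kar (lsq s)) \<star> epsL (sdom s)"
proof -
 note c = sq_ends[OF s]
 let ?f = "sdom s" and ?g = "scod s"
 let ?cf = "Kar (counit_sq ?f)" and ?cg = "Kar (counit_sq ?g)"
 have t: "str (fr (L ?f)) ((sigma ?g \<cdot> ?cg) \<cdot> Kar (lsq s)) (R ?g \<cdot> Kar s) (fr2 ?g)"
  using str_comp[OF str_Kar[OF lsq_1cell[OF s]], of "sigma ?g \<cdot> ?cg" "R ?g" "fr2 ?g"]
   str_sigma_counit[of ?g] s c by simp
 have r: "R ?g \<cdot> R (L ?g) \<cdot> Kar (lsq s) = sbot s \<cdot> R ?f \<cdot> R (L ?f)"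
  using s c by simp
 have "\<iota> (R ?g \<cdot> R (L ?g)) \<star> \<iota> (Kar (lsq s)) \<star> epsL ?f = \<iota> (R ?g \<cdot> R (L ?g) \<cdot> Kar (lsq s)) \<star> epsL ?f"
  using s c by simp
 also have "\<dots> = \<iota> (sbot s) \<star> \<iota> (R ?f \<cdot> R (L ?f)) \<star> epsL ?f"
  unfolding r using s c by (simp add: sq_iff)
 also have "\<dots> = \<iota> (sbot s) \<star> \<iota> (R ?f \<cdot> R (L ?f))"
  using c by (simp only: R_epsL)
 also have "\<dots> = \<iota> (R ?g \<cdot> R (L ?g) \<cdot> Kar (lsq s))"
  unfolding r using s c by (simp add: sq_iff)
 also have "\<dots> = \<iota> (R ?g \<cdot> R (L ?g)) \<star> epsL ?g \<star> \<iota> (Kar (lsq s))"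
  using s c by (simp add: R_epsL_assoc)
 finally have q: "\<iota> (fst (fr2 ?g)) \<star> epsL ?g \<star> \<iota> (Kar (lsq s)) = \<iota> (fst (fr2 ?g)) \<star> \<iota> (Kar (lsq s)) \<star> epsL ?f"
  using c by (simp add: fr2)
 show ?thesis
  by (rule cell_unique[OF _ t _ _ _ _ _ _ q])
   (use s c in \<open>simp_all add: sigma_counit_nat epsL_L_comp sq_iff\<close>)
qed

lemma lax_idempotent_L: "lax_idempotent_comonad arrows (Lfun AW) (Lcounit C AW) (Lcomult C AW)"
proof -
 let ?e = "\<lambda>f. SqCell (sq_comp C (Lcomult C AW f) (lsq (Lcounit C AW f))) (\<iota> (dom_id f)) (epsL f) (sq_id C (L (L f)))"
 have "?e f \<in> sq_cells C" if "f \<in> carr C" for f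
  using that by (simp add: arrow_2cells_iff sq_comp_1cell sq_id_1cell) (simp add: sq_comp_def sq_id_def)
 then show ?thesis
  unfolding lax_idempotent_comonad_def adj_id_unit_def
  using comonad
  by (intro conjI exI[of _ ?e] ballI)
   (auto simp: counit_epsL epsL_sigma epsL_nat sigma_counit_nat sq_ends, auto simp: sq_comp_def sq_id_def lsq_Sq sigma_counit_nat sq_ends, auto simp: sq_iff)
qed

lemma lofs: "lofs C AW"
 using awfs lax_idempotent_R lax_idempotent_L by (simp add: lofs_def)

section \<open>Algebras and structured arrows\<close>

definition alg_of :: "'a \<times> 'x => 'a \<times> 'a sq" where
 "alg_of X = (let f = fst X in
  (f, Sq (R f) (ext f X (dom_id f) (cod_id f)) (cod_id f) f))"

text \<open>The conditions on objects and, in \<open>alg_mor\<close>, on 1-cells from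
  \<open>alg_twocat\<close>, named so that algebras can take the roles of \<open>S\<close> and
  \<open>M\<close> in \<open>structured_arrows\<close>.\<close>

definition algs :: "('a \<times> 'a sq) set" where
 "algs = {(x, a). x \<in> carr C \<and> a \<in> chom arrows (R x) x \<and>
  sq_comp C a (Runit C AW x) = sq_id C x \<and> sq_comp C a (rsq a) = sq_comp C a (Rmult C AW x)}"

definition alg_mor :: "'a \<times> 'a sq => 'a sq => 'a \<times> 'a sq => bool" where
 "alg_mor = (\<lambda>(x, a) u (y, b). sq_comp C u a = sq_comp C b (rsq u))"

text \<open>The unit law forces the base side of the action to be an identity. What remains is an
  arrow \<open>p\<close> over the base with a retraction and an associativity law.\<close>

lemma algs_iff: "A \<in> algs \<longleftrightarrow> (\<exists>f p. A = (f, Sq (R f) p (cod_id f) f) \<and> f \<in> carr C \<and> p \<in> carr C \<and>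
  cdom C p = cdom C (R f) \<and> ccod C p = cdom C f \<and> f \<cdot> p = R f \<and> p \<cdot> L f = dom_id f \<and>
  p \<cdot> Kar (Sq (R f) p (cod_id f) f) = p \<cdot> proj f)" (is "_ \<longleftrightarrow> (\<exists>f p. ?P f p)")
proof
 assume "A \<in> algs"
 then obtain f a where A: "A = (f, a)" "f \<in> carr C" "a \<in> sqs C" "sdom a = R f" "scod a = f"
  "sq_comp C a (Runit C AW f) = sq_id C f" "sq_comp C a (rsq a) = sq_comp C a (Rmult C AW f)"
  by (auto simp: algs_def chom_def)
 have "sbot a \<cdot> cod_id f = cod_id f" "stop a \<cdot> L f = dom_id f"
  using A(6) by (simp_all add: sq_comp_def sq_id_def)
 moreover have "stop a \<cdot> Kar a = stop a \<cdot> proj f"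
  using A(7) by (simp add: sq_comp_def)
 moreover have "a = Sq (R f) (stop a) (sbot a) f"
  using A by (cases a) simp
 ultimately show "\<exists>f p. ?P f p"
  using A by (intro exI[of _ f] exI[of _ "stop a"]) (auto simp: sq_iff)
next
 assume "\<exists>f p. ?P f p"
 then show "A \<in> algs"
  by (auto simp: algs_def chom_def sq_iff sq_comp_def sq_id_def rsq_Sq)
qed

lemma alg_str_ext:
 assumes "X \<in> S"
 shows "str (fr (fst X)) (ext (fst X) X (dom_id (fst X)) (cod_id (fst X))) (cod_id (fst X)) X"
  "ext (fst X) X (dom_id (fst X)) (cod_id (fst X)) \<cdot> L (fst X) = dom_id (fst X)"
 using assms S_carr[OF assms] ext[of "fst X" X] by (simp_all add: sq_iff)

lemma alg_of_in:
 assumes X: "X \<in> S"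
 shows "alg_of X \<in> algs"
proof -
 let ?f = "fst X"
 define p where "p = ext ?f X (dom_id ?f) (cod_id ?f)"
 have f: "?f \<in> carr C" using S_carr[OF X] .
 have p: "str (fr ?f) p (cod_id ?f) X" "p \<cdot> L ?f = dom_id ?f"
  using alg_str_ext[OF X] by (simp_all add: p_def)
 note d = strD[OF p(1)]
 let ?s = "Sq (R ?f) p (cod_id ?f) ?f"
 have s: "?s \<in> sqs C"
  using d f by (simp add: sq_iff)
 \<comment> \<open>Associativity holds because both sides preserve structure and restrict to
   \<open>p\<close> along \<open>L (R ?f)\<close>.\<close>
 have "p \<cdot> Kar ?s = p \<cdot> proj ?f"
 proof (rule ext_unique)
  show "str (fr (R ?f)) (p \<cdot> Kar ?s) (cod_id ?f) X"
   using str_comp[OF str_Kar[OF s], of p "cod_id ?f" X] p(1) f by simp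
  show "str (fr (R ?f)) (p \<cdot> proj ?f) (cod_id ?f) X"
   using str_comp[OF str_proj[OF f] p(1)] f by simp
  show "(p \<cdot> Kar ?s) \<cdot> L (R ?f) = (p \<cdot> proj ?f) \<cdot> L (R ?f)"
   using s d f p(2) comp_1_assoc_eq[OF p(2), of p] by simp
 qed (use f in simp)
 then show ?thesis
  using f d p(2) by (simp add: algs_iff alg_of_def Let_def flip: p_def)
qed

text \<open>Both conditions are compared on the free arrow. If the square preserves structure, then
  \<open>stop s \<cdot> p\<close> and \<open>q \<cdot> Kar s\<close> are extensions of the same
  arrow; conversely, \<open>str_reflect\<close> brings preservation back from the free
  arrow.\<close>

lemma alg_of_mor:
 assumes X: "X \<in> S" and Y: "Y \<in> S" and s: "s \<in> sqs C" "sdom s = fst X" "scod s = fst Y"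
 shows "M X s Y \<longleftrightarrow> alg_mor (alg_of X) s (alg_of Y)"
proof -
 let ?f = "fst X" and ?g = "fst Y"
 define p q where "p = ext ?f X (dom_id ?f) (cod_id ?f)"
  and "q = ext ?g Y (dom_id ?g) (cod_id ?g)"
 have f: "?f \<in> carr C" and g: "?g \<in> carr C" using S_carr X Y by auto
 have p: "str (fr ?f) p (cod_id ?f) X" "p \<cdot> L ?f = dom_id ?f"
  and q: "str (fr ?g) q (cod_id ?g) Y" "q \<cdot> L ?g = dom_id ?g"
  using alg_str_ext[OF X] alg_str_ext[OF Y] by (simp_all add: p_def q_def)
 note d = strD[OF p(1)] strD[OF q(1)]
 have c: "stop s \<in> carr C" "sbot s \<in> carr C" "cdom C (stop s) = cdom C ?f" "ccod C (stop s) = cdom C ?g"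
  "cdom C (sbot s) = ccod C ?f" "ccod C (sbot s) = ccod C ?g"
  using s by (auto simp: sq_iff)
 have sq: "s = Sq ?f (stop s) (sbot s) ?g"
  using s by (cases s) simp
 have M: "M X s Y \<longleftrightarrow> str X (stop s) (sbot s) Y"
  using X Y s sq by (auto simp: str_def strict_iff)
 have qk: "str (fr ?f) (q \<cdot> Kar s) (sbot s) Y"
  using str_comp[OF str_Kar[OF s(1)], of q "cod_id ?g" Y] q(1) s c by simp
 have qL: "(q \<cdot> Kar s) \<cdot> L ?f = (stop s \<cdot> p) \<cdot> L ?f"
  using s c d f g p(2) q(2) comp_1_assoc_eq[OF q(2), of "stop s"] by simp
 have "str X (stop s) (sbot s) Y \<longleftrightarrow> stop s \<cdot> p = q \<cdot> Kar s"
 proof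
  assume "str X (stop s) (sbot s) Y"
  from str_comp[OF p(1) this] have "str (fr ?f) (stop s \<cdot> p) (sbot s) Y"
   using c by simp
  then show "stop s \<cdot> p = q \<cdot> Kar s"
   using ext_unique[OF f _ qk] qL by simp
 next
  assume "stop s \<cdot> p = q \<cdot> Kar s"
  then show "str X (stop s) (sbot s) Y"
   using str_reflect[OF X Y p, of "stop s" "sbot s"] qk s sq by simp
 qed
 then show ?thesis
  using c s by (simp add: M alg_mor_def alg_of_def Let_def sq_comp_def flip: p_def q_def)
qed

text \<open>An action \<open>p\<close> of a lax idempotent monad is left adjoint to the unit
  \<open>L f\<close>. The unit of this adjunction is
  \<open>\<iota> (Kar ?s) \<star> delta f\<close>, and with it \<open>alg_str\<close> recognises
  \<open>p\<close> as coming from a structure.\<close>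

lemma alg_of_surj:
 assumes "A \<in> algs"
 shows "\<exists>X\<in>S. alg_of X = A"
proof -
 obtain f p where A: "A = (f, Sq (R f) p (cod_id f) f)" and f: "f \<in> carr C"
  and p: "p \<in> carr C" "cdom C p = cdom C (R f)" "ccod C p = cdom C f" "f \<cdot> p = R f" "p \<cdot> L f = dom_id f"
  and a: "p \<cdot> Kar (Sq (R f) p (cod_id f) f) = p \<cdot> proj f"
  using assms by (auto simp: algs_iff)
 let ?s = "Sq (R f) p (cod_id f) f" and ?u = "unit_sq f"
 have s: "?s \<in> sqs C"
  using f p by (simp add: sq_iff)
 have "Kar ?s \<cdot> Kar ?u = Kar (sq_comp C ?s ?u)"
  using Kar_comp[OF unit_1cells(1)[OF f] s] by simp
 also have "sq_comp C ?s ?u = sq_id C f"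
  using f p by (simp add: sq_comp_def sq_id_def)
 finally have ku: "Kar ?s \<cdot> Kar ?u = dom_id (R f)"
  using f by (simp add: Kar_id)
 have "p \<cdot> L f \<cdot> x = x" if "x \<in> carr C" "ccod C x = cdom C f" for x
  using comp_1_assoc_eq[OF p(5), of x] that f p by simp
 have sk: "str (fr (R f)) (Kar ?s) (cod_id f) (fr f)"
  using str_Kar[OF s] by simp
 have "\<exists>X. fst X = f \<and> str (fr f) p (cod_id f) X"
 proof (rule alg_str[of f p "\<iota> (Kar ?s) \<star> delta f"])
  show "\<iota> p \<star> \<iota> (Kar ?s) \<star> delta f = \<iota> p"
  proof -
   have "\<iota> p \<star> \<iota> (Kar ?s) \<star> delta f = \<iota> p \<star> \<iota> (proj f) \<star> delta f"
    using f p s a by simp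
   also have "\<dots> = \<iota> p"
    using f p by (simp only: proj_delta) simp
   finally show ?thesis .
  qed
  \<comment> \<open>The conditions determine \<open>q\<close> as \<open>proj f\<close> and
    \<open>r\<close> as the action of \<open>K\<close> on \<open>?s\<close>, so the claim is the
    associativity law of the algebra.\<close>
  show "p \<cdot> q = p \<cdot> r" if "str (fr (fst (fr f))) q (cod_id f) (fr f)"
   "str (fr (fst (fr f))) r (cod_id f) (fr f)" "q \<cdot> L (fst (fr f)) = dom_id (fst (fr f))"
   "r \<cdot> L (fst (fr f)) = L f \<cdot> p" for q r
  proof -
   have "q = proj f"
    using that f by (intro ext_unique[OF _ _ str_proj[OF f]]) simp_all
   moreover have "r = Kar ?s"
    using that f s by (intro ext_unique[OF _ _ sk]) simp_all
   ultimately show ?thesis using a by simp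
  qed
 qed (use f p s ku in simp_all)
 then obtain X where X: "fst X = f" "str (fr f) p (cod_id f) X"
  by blast
 have "X \<in> S" using strD[OF X(2)] by simp
 then have "ext f X (dom_id f) (cod_id f) = p"
  using alg_str_ext[of X] X f p by (intro ext_unique[OF f _ X(2)]) simp_all
 then show ?thesis
  using \<open>X \<in> S\<close> X(1) by (intro bexI[of _ X]) (simp_all add: alg_of_def A)
qed

text \<open>Equal algebras make the identity square preserve structure from \<open>X\<close> to
  \<open>Y\<close>, and \<open>str_id_eq\<close> then identifies the two.\<close>

lemma alg_of_inj:
 assumes "X \<in> S" "Y \<in> S" "alg_of X = alg_of Y"
 shows "X = Y"
proof -
 have e: "fst X = fst Y" using assms(3) by (simp add: alg_of_def Let_def)
 have f: "fst Y \<in> carr C" using S_carr assms(2) by simp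
 have "alg_mor (alg_of X) (sq_id C (fst Y)) (alg_of X)"
  using alg_of_mor[OF assms(1,1) sq_id_1cell] M_id[OF assms(1)] e f by (simp add: sq_id_def)
 then have "M X (sq_id C (fst Y)) Y"
  using alg_of_mor[OF assms(1,2) sq_id_1cell] assms(3) e f by (simp add: sq_id_def)
 then show ?thesis
  using assms e f by (intro str_id_eq) (simp_all add: str_def strict_iff sq_id_def, simp add: sq_iff)
qed

text \<open>The two fillings in \<open>Ralg_comp\<close> appear as \<open>e\<close>, which preserves
  structure into \<open>Y\<close>, and \<open>r\<close>, obtained by pasting a filler into
  \<open>X\<close> on \<open>e\<close> and precomposing with \<open>sigma\<close>. So
  \<open>r\<close> preserves structure into \<open>cmp Y X\<close> and extends the identity, which
  characterises the action on the composite.\<close>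

lemma alg_of_cmp:
 assumes X: "X \<in> S" and Y: "Y \<in> S" and c: "ccod C (fst X) = cdom C (fst Y)"
 shows "alg_of (cmp Y X) = Ralg_comp C AW (alg_of Y) (alg_of X)"
proof -
 let ?f = "fst X" and ?g = "fst Y" and ?h = "fst Y \<cdot> fst X"
 define p q where "p = ext ?f X (dom_id ?f) (cod_id ?f)"
  and "q = ext ?g Y (dom_id ?g) (cod_id ?g)"
 have f: "?f \<in> carr C" and g: "?g \<in> carr C" using S_carr X Y by auto
 have p: "str (fr ?f) p (cod_id ?f) X" "p \<cdot> L ?f = dom_id ?f"
  and q: "str (fr ?g) q (cod_id ?g) Y" "q \<cdot> L ?g = dom_id ?g"
  using alg_str_ext[OF X] alg_str_ext[OF Y] by (simp_all add: p_def q_def)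
 note d = strD[OF p(1)] strD[OF q(1)]
 let ?s = "Sq ?h ?f (cod_id ?g) ?g"
 have h: "?h \<in> carr C" using f g c by simp
 have s: "?s \<in> sqs C" using f g c by (simp add: sq_iff)
 define e where "e = q \<cdot> Kar ?s"
 have e: "str (fr ?h) e (cod_id ?g) Y"
  using str_comp[OF str_Kar[OF s], of q "cod_id ?g" Y] q(1) g by (simp add: e_def)
 have eL: "e \<cdot> L ?h = ?f"
  using s d f g c h q(2) comp_1_assoc_eq[OF q(2), of ?f] by (simp add: e_def)
 let ?t = "Sq (L ?h) (dom_id ?f) e ?f"
 have t: "?t \<in> sqs C" using strD[OF e] eL f g c h by (simp add: sq_iff)
 define r where "r = p \<cdot> Kar ?t \<cdot> sigma ?h"
 have "str (fr (L ?h)) (p \<cdot> Kar ?t) e X"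
  using str_comp[OF str_Kar[OF t], of p "cod_id ?f" X] p(1) strD[OF e] c f by simp
 from str_cmp[OF this e] have "str (fr2 ?h) (p \<cdot> Kar ?t) (cod_id ?g) (cmp Y X)" .
 from str_comp[OF str_sigma[OF h] this] have r: "str (fr ?h) r (cod_id ?g) (cmp Y X)"
  using t d f g c h by (simp add: r_def)
 have rL: "r \<cdot> L ?h = dom_id ?f"
  using t d f g c h p(2) by (simp add: r_def)
 have XY: "cmp Y X \<in> S" "fst (cmp Y X) = ?h"
  using cmp[OF X Y c] by simp_all
 have "ext ?h (cmp Y X) (dom_id ?f) (cod_id ?g) = r"
  using alg_str_ext[OF XY(1)] XY(2) f g c h rL by (intro ext_unique[OF h _ r]) simp_all
 then have "alg_of (cmp Y X) = (?h, Sq (R ?h) r (cod_id ?g) ?h)"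
  using f g c by (simp add: alg_of_def Let_def XY)
 also have "\<dots> = Ralg_comp C AW (alg_of Y) (alg_of X)"
  using f g c by (simp add: Ralg_comp_def alg_of_def Let_def r_def e_def p_def q_def)
 finally show ?thesis .
qed

text \<open>The action lies over the base, so on an identity arrow it can only be
  \<open>R (cid C x)\<close>.\<close>

lemma alg_of_idn:
 assumes "x \<in> cobj C"
 shows "alg_of (idn x) = Ralg_id C AW x"
proof -
 have i: "idn x \<in> S" "fst (idn x) = cid C x" using idn[OF assms] by simp_all
 have "ext (cid C x) (idn x) (cid C x) (cid C x) = R (cid C x)"
  using strD[OF alg_str_ext(1)[OF i(1)]] i assms by simp
 then show ?thesis
  using assms i by (simp add: alg_of_def Ralg_id_def Let_def)
qed

text \<open>For a lax idempotent monad, compatibility of a 2-cell with the actions is automatic. The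
  two cells to be compared start at \<open>q \<cdot> Kar u\<close>, which preserves structure, and
  they agree along \<open>L f\<close> and over the base.\<close>

lemma Ralg_eq: "Ralg C AW = structured_twocat arrows algs alg_mor all_cells"
proof -
 have "Ralg C AW = structured_twocat arrows algs alg_mor
  (\<lambda>(x, a) \<theta> (y, b). hcomp arrows \<theta> (id2 arrows a) =
    hcomp arrows (id2 arrows b) (rcell \<theta>))"
  by (simp add: Ralg_def alg_twocat_def algs_def alg_mor_def)
 also have "\<dots> = structured_twocat arrows algs alg_mor all_cells"
 proof (rule structured_twocat_all_cells)
  fix A u B \<theta> u'
  assume u: "(A, u, B) \<in> structured_1cells arrows algs alg_mor"
   "(A, u', B) \<in> structured_1cells arrows algs alg_mor"
   and \<theta>: "\<theta> \<in> cell arrows" "src arrows \<theta> = u" "trg arrows \<theta> = u'"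
  obtain f p g q where A: "A = (f, Sq (R f) p (cod_id f) f)" and B: "B = (g, Sq (R g) q (cod_id g) g)"
   and f: "f \<in> carr C" and g: "g \<in> carr C"
   and p: "p \<in> carr C" "cdom C p = cdom C (R f)" "ccod C p = cdom C f" "f \<cdot> p = R f" "p \<cdot> L f = dom_id f"
   and q: "q \<in> carr C" "cdom C q = cdom C (R g)" "ccod C q = cdom C g" "g \<cdot> q = R g" "q \<cdot> L g = dom_id g"
   using u(1) by (auto simp: strict_1cell_iff algs_iff)
  \<comment> \<open>\<open>cell_unique\<close> speaks of structured arrows, so the target algebra is
    first recognised as one.\<close>
  obtain Y where Y: "Y \<in> S" "alg_of Y = B"
   using alg_of_surj[of B] u(1) by (auto simp: strict_1cell_iff)
  have "fst Y = g" "str (fr g) q (cod_id g) Y"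
   using Y(2) alg_str_ext(1)[OF Y(1)] by (auto simp: alg_of_def Let_def B)
  have t: "\<theta> \<in> sq_cells C" "csrc \<theta> = u" "ctrg \<theta> = u'" "sdom u = f" "scod u = g" "sdom u' = f" "scod u' = g"
   using u \<theta> by (auto simp: strict_1cell_iff A B)
  note d = arrow_2cellsD[OF t(1)]
  have e: "stop u \<cdot> p = q \<cdot> Kar u" "stop u' \<cdot> p = q \<cdot> Kar u'"
  proof -
   have "alg_mor A u B" "alg_mor A u' B"
    using u by (simp_all add: strict_1cell_iff)
   then show "stop u \<cdot> p = q \<cdot> Kar u" "stop u' \<cdot> p = q \<cdot> Kar u'"
    by (simp_all add: alg_mor_def A B sq_comp_def)
  qed
  have s: "str (fr f) (q \<cdot> Kar u) (sbot u) Y"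
  proof -
   have "str (fr f) (q \<cdot> Kar u) (cod_id g \<cdot> sbot u) Y"
    using str_comp[OF str_Kar'[of u f g "sbot u"] \<open>str (fr g) q (cod_id g) Y\<close>] d(1) t by simp
   then show ?thesis using d t by simp
  qed
  have q1: "\<iota> (fst Y) \<star> ctop \<theta> \<star> \<iota> p = \<iota> (fst Y) \<star> \<iota> q \<star> Kce \<theta>"
  proof -
   have "\<iota> g \<star> ctop \<theta> \<star> \<iota> p = (cbot \<theta> \<star> \<iota> f) \<star> \<iota> p"
    using d t p by (intro comp_2_assoc_eq) simp_all
   also have "\<dots> = \<iota> (R g) \<star> Kce \<theta>"
    using d t p f by simp
   also have "\<dots> = \<iota> g \<star> \<iota> q \<star> Kce \<theta>"
    using d t q g by (simp del: R_Kce)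
   finally show ?thesis by (simp add: \<open>fst Y = g\<close>)
  qed
  have q2: "(ctop \<theta> \<star> \<iota> p) \<star> \<iota> (L f) = (\<iota> q \<star> Kce \<theta>) \<star> \<iota> (L f)"
   using d t p q f g by simp
  have "ctop \<theta> \<star> \<iota> p = \<iota> q \<star> Kce \<theta>"
   by (rule cell_unique[OF f s _ _ _ _ _ q2 q1]) (use d t p q f g e in simp_all)
  then show "(\<lambda>(x, a) \<theta> (y, b). hcomp arrows \<theta> (id2 arrows a) =
    hcomp arrows (id2 arrows b) (rcell \<theta>)) A \<theta> B"
   using u d t by (simp add: A B strict_1cell_iff alg_mor_def)
 qed
 finally show ?thesis .
qed

lemma structured_iso_alg:
 "structured_iso C S M idn cmp algs alg_mor (Ralg_id C AW) (Ralg_comp C AW) alg_of"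
proof -
 have "bij_betw alg_of S algs"
  by (rule bij_betwI') (use alg_of_in alg_of_surj alg_of_inj in \<open>blast, blast, metis\<close>)
 then show ?thesis
  by (auto simp: structured_iso_def alg_of_idn alg_of_cmp alg_of_mor) (simp_all add: alg_of_def Let_def)
qed

end

section \<open>The 2-category of multicategories\<close>

abbreviation "mfcomp \<equiv> multifun_comp"
abbreviation "mfid \<equiv> multifun_id"
abbreviation "funs \<equiv> small_multifuns"
abbreviation "mcats \<equiv> small_multicats"
abbreviation "opcart \<equiv> opcartesian_lifting"
abbreviation "lprob \<equiv> lifting_problem"

lemma map2_map_same: "map2 h (map f xs) (map g xs) = map (\<lambda>x. h (f x) (g x)) xs"
 by (induction xs) auto

context multicategory
begin

lemma composableI: "g \<in> marr A ==> set fs \<subseteq> marr A ==> map (mcod A) fs = mdom A g ==> composable A g fs"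
 by (simp add: composable_def)

lemma
 assumes "g \<in> marr A" "set fs \<subseteq> marr A" "map (mcod A) fs = mdom A g"
 shows mcomp_arr: "mcomp A g fs \<in> marr A"
  and mcomp_dom: "mdom A (mcomp A g fs) = concat (map (mdom A) fs)"
  and mcomp_cod: "mcod A (mcomp A g fs) = mcod A g"
 using mcomp_in[OF composableI[OF assms]] by simp_all

lemma
 assumes "g \<in> marr A" "f \<in> marr A" "mdom A g = [mcod A f]"
 shows mcomp1_arr [simp]: "mcomp A g [f] \<in> marr A"
  and mcomp1_dom [simp]: "mdom A (mcomp A g [f]) = mdom A f"
  and mcomp1_cod [simp]: "mcod A (mcomp A g [f]) = mcod A g"
 using mcomp_arr[of g "[f]"] mcomp_dom[of g "[f]"] mcomp_cod[of g "[f]"] assms by simp_all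

lemma
 assumes "g \<in> marr A" "\<And>x. x \<in> set xs ==> f x \<in> marr A" "map (\<lambda>x. mcod A (f x)) xs = mdom A g"
 shows mcomp_map_arr: "mcomp A g (map f xs) \<in> marr A"
  and mcomp_map_dom: "mdom A (mcomp A g (map f xs)) = concat (map (\<lambda>x. mdom A (f x)) xs)"
  and mcomp_map_cod: "mcod A (mcomp A g (map f xs)) = mcod A g"
 using mcomp_arr[of g "map f xs"] mcomp_dom[of g "map f xs"] mcomp_cod[of g "map f xs"] assms
 by (auto simp: comp_def)

text \<open>Naturality squares are pasted with two special cases of associativity: a unary outer map
  here, unary middle maps in \<open>mcomp_assoc_map\<close>.\<close>

lemma mcomp_assoc1:
 assumes "h \<in> marr A" "g \<in> marr A" "mdom A h = [mcod A g]" "set fs \<subseteq> marr A" "map (mcod A) fs = mdom A g"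
 shows "mcomp A (mcomp A h [g]) fs = mcomp A h [mcomp A g fs]"
 using mcomp_assoc[of h "[g]" "[fs]"] assms by (simp add: composable_def)

lemma mcomp_assoc_map:
 assumes "h \<in> marr A" "map (\<lambda>x. mcod A (g x)) xs = mdom A h"
  "\<And>x. x \<in> set xs ==> g x \<in> marr A \<and> f x \<in> marr A \<and> mdom A (g x) = [mcod A (f x)]"
 shows "mcomp A (mcomp A h (map g xs)) (map f xs) = mcomp A h (map (\<lambda>x. mcomp A (g x) [f x]) xs)"
proof -
 have "concat (map (\<lambda>x. [f x]) xs) = map f xs" by (induction xs) auto
 then show ?thesis
  using mcomp_assoc[of h "map g xs" "map (\<lambda>x. [f x]) xs"] assms
  by (auto simp: composable_def comp_def list.rel_map list.rel_refl_strong map2_map_same)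
qed

lemma ident_arr [simp]: "x \<in> mobj A ==> mident A x \<in> marr A"
 and ident_dom [simp]: "x \<in> mobj A ==> mdom A (mident A x) = [x]"
 and ident_cod [simp]: "x \<in> mobj A ==> mcod A (mident A x) = x"
 using mident_in by simp_all

lemma ident_left [simp]: "f \<in> marr A ==> x = mcod A f ==> mcomp A (mident A x) [f] = f"
 by (simp add: mcomp_mident_left)

lemma ident_right [simp]: "f \<in> marr A ==> mdom A f = [x] ==> mcomp A f [mident A x] = f"
 using mcomp_mident_right[of f] by simp

end

lemma mcatsD: "A \<in> mcats ==> multicategory A"
 by (simp add: small_multicats_def)

lemma funsD:
 assumes "F \<in> funs"
 shows "multifunctor F" "fdom F \<in> mcats" "fcod F \<in> mcats"
  "multicategory (fdom F)" "multicategory (fcod F)"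
 using assms by (simp_all add: small_multifuns_def small_multicats_def)

context multifunctor
begin

lemma
 assumes "f \<in> marr (fdom F)"
 shows farr_arr [simp]: "farr F f \<in> marr (fcod F)"
  and farr_dom [simp]: "mdom (fcod F) (farr F f) = map (fobj F) (mdom (fdom F) f)"
  and farr_cod [simp]: "mcod (fcod F) (farr F f) = fobj F (mcod (fdom F) f)"
 using farr_in[OF assms] by simp_all

lemma farr_comp:
 assumes "g \<in> marr (fdom F)" "set fs \<subseteq> marr (fdom F)" "map (mcod (fdom F)) fs = mdom (fdom F) g"
 shows "farr F (mcomp (fdom F) g fs) = mcomp (fcod F) (farr F g) (map (farr F) fs)"
 using farr_mcomp assms by (simp add: composable_def)

lemma composable_map:
 assumes "composable (fdom F) g fs"
 shows "composable (fcod F) (farr F g) (map (farr F) fs)"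
proof -
 have "map (mcod (fcod F)) (map (farr F) fs) = map (fobj F) (map (mcod (fdom F)) fs)"
 proof -
  have "set fs \<subseteq> marr (fdom F)" using assms by (simp add: composable_def)
  then show ?thesis by auto
 qed
 then show ?thesis
  using assms by (auto simp: composable_def simp del: map_map)
qed

declare fobj_in [simp] farr_mident [simp]

end

lemma multifun_eqI:
 assumes "multifunctor F" "multifunctor G" "fdom F = fdom G" "fcod F = fcod G"
  "\<And>x. x \<in> mobj (fdom F) ==> fobj F x = fobj G x" "\<And>f. f \<in> marr (fdom F) ==> farr F f = farr G f"
 shows "F = G"
proof -
 interpret F: multifunctor F by fact
 interpret G: multifunctor G by fact
 show ?thesis
  using assms(3-) F.extensionality G.extensionality
  by (intro multifun.equality) (auto intro: extensionalityI)
qed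

lemma mtrans_eqI:
 assumes "multitransformation s" "multitransformation t" "tsrc s = tsrc t" "ttrg s = ttrg t"
  "\<And>x. x \<in> mobj (fdom (tsrc s)) ==> tcmp s x = tcmp t x"
 shows "s = t"
proof -
 interpret s: multitransformation s by fact
 interpret t: multitransformation t by fact
 show ?thesis
  using assms(3-) s.extensionality t.extensionality
  by (intro multitrans.equality) (auto intro: extensionalityI)
qed

lemma MCat_simps [simp]:
 "cobj MCat = mcats" "carr MCat = funs" "cdom MCat = fdom" "ccod MCat = fcod"
 "cid MCat = mfid" "ccomp MCat = mfcomp" "src MCat = tsrc" "trg MCat = ttrg"
 by (simp_all add: MCat_def)

text \<open>This and the next three definitions name the 2-cells of \<open>MCat\<close> and their
  operations, so that simplification of \<open>MCat\<close> stops there instead of unfolding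
  records.\<close>

definition mtrans :: "('u, 'u) multitrans set" where
 "mtrans = {t. multitransformation t \<and> tsrc t \<in> funs \<and> ttrg t \<in> funs}"

definition idt :: "('u, 'u) multifun => ('u, 'u) multitrans" where
 "idt F = \<lparr>tsrc = F, ttrg = F, tcmp = (\<lambda>x\<in>mobj (fdom F). mident (fcod F) (fobj F x))\<rparr>"

definition vct :: "('u, 'u) multitrans => ('u, 'u) multitrans => ('u, 'u) multitrans" where
 "vct t' t = \<lparr>tsrc = tsrc t, ttrg = ttrg t',
  tcmp = (\<lambda>x\<in>mobj (fdom (tsrc t)). mcomp (fcod (tsrc t)) (tcmp t' x) [tcmp t x])\<rparr>"

definition hct :: "('u, 'u) multitrans => ('u, 'u) multitrans => ('u, 'u) multitrans" where
 "hct t' t = \<lparr>tsrc = mfcomp (tsrc t') (tsrc t), ttrg = mfcomp (ttrg t') (ttrg t),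
  tcmp = (\<lambda>x\<in>mobj (fdom (tsrc t)).
   mcomp (fcod (tsrc t')) (tcmp t' (fobj (ttrg t) x)) [farr (tsrc t') (tcmp t x)])\<rparr>"

lemma MCat_simps2 [simp]:
 "cell MCat = mtrans" "id2 MCat = idt" "vcomp MCat = vct" "hcomp MCat = hct"
 by (simp_all add: MCat_def mtrans_def idt_def vct_def hct_def fun_eq_iff)

lemma mtrans_simps [simp]:
 "tsrc (idt F) = F" "ttrg (idt F) = F"
 "x \<in> mobj (fdom F) ==> tcmp (idt F) x = mident (fcod F) (fobj F x)"
 "tsrc (vct t' t) = tsrc t" "ttrg (vct t' t) = ttrg t'"
 "x \<in> mobj (fdom (tsrc t)) ==> tcmp (vct t' t) x = mcomp (fcod (tsrc t)) (tcmp t' x) [tcmp t x]"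
 "tsrc (hct t' t) = mfcomp (tsrc t') (tsrc t)"
 "ttrg (hct t' t) = mfcomp (ttrg t') (ttrg t)"
 "x \<in> mobj (fdom (tsrc t)) ==> tcmp (hct t' t) x =
  mcomp (fcod (tsrc t')) (tcmp t' (fobj (ttrg t) x)) [farr (tsrc t') (tcmp t x)]"
 by (simp_all add: idt_def vct_def hct_def)

lemma multifun_simps [simp]:
 "fdom (mfid A) = A" "fcod (mfid A) = A"
 "x \<in> mobj A ==> fobj (mfid A) x = x" "f \<in> marr A ==> farr (mfid A) f = f"
 "fdom (mfcomp G F) = fdom F" "fcod (mfcomp G F) = fcod G"
 "x \<in> mobj (fdom F) ==> fobj (mfcomp G F) x = fobj G (fobj F x)"
 "f \<in> marr (fdom F) ==> farr (mfcomp G F) f = farr G (farr F f)"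
 by (simp_all add: multifun_id_def multifun_comp_def compose_eq)

section \<open>Identities and composites of multifunctors\<close>

lemma multifun_id_small: "A \<in> mcats ==> mfid A \<in> funs"
proof -
 assume A: "A \<in> mcats"
 interpret multicategory A by (rule mcatsD[OF A])
 have "multifunctor (mfid A)"
 proof
  fix f assume "f \<in> marr (fdom (mfid A))"
  then show "farr (mfid A) f \<in> marr (fcod (mfid A)) \<and>
    mdom (fcod (mfid A)) (farr (mfid A) f) = map (fobj (mfid A)) (mdom (fdom (mfid A)) f) \<and>
    mcod (fcod (mfid A)) (farr (mfid A) f) = fobj (mfid A) (mcod (fdom (mfid A)) f)"
   using mdom_in[of f] mcod_in[of f] by (auto intro!: map_idI[symmetric])
 next
  fix g fs assume c: "composable (fdom (mfid A)) g fs"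
  then have "map (farr (mfid A)) fs = fs"
   by (auto simp: composable_def intro!: map_idI)
  then show "farr (mfid A) (mcomp (fdom (mfid A)) g fs) =
    mcomp (fcod (mfid A)) (farr (mfid A) g) (map (farr (mfid A)) fs)"
   using c mcomp_in[of g fs] by (simp add: composable_def)
 qed (auto simp: multifun_id_def)
 then show ?thesis
  using A by (simp add: small_multifuns_def)
qed

lemma multifun_comp_small:
 assumes F: "F \<in> funs" and G: "G \<in> funs" and c: "fcod F = fdom G"
 shows "mfcomp G F \<in> funs"
proof -
 interpret F: multifunctor F by (rule funsD[OF F])
 interpret G: multifunctor G by (rule funsD[OF G])
 interpret A: multicategory "fdom F" by (rule funsD[OF F])
 have "multifunctor (mfcomp G F)"
 proof
  fix f assume "f \<in> marr (fdom (mfcomp G F))"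
  then show "farr (mfcomp G F) f \<in> marr (fcod (mfcomp G F)) \<and>
    mdom (fcod (mfcomp G F)) (farr (mfcomp G F) f) =
     map (fobj (mfcomp G F)) (mdom (fdom (mfcomp G F)) f) \<and>
    mcod (fcod (mfcomp G F)) (farr (mfcomp G F) f) =
     fobj (mfcomp G F) (mcod (fdom (mfcomp G F)) f)"
   using A.mdom_in[of f] A.mcod_in[of f] F.farr_in[of f] G.farr_in[of "farr F f"] c by auto
 next
  fix g fs assume a: "composable (fdom (mfcomp G F)) g fs"
  then have m: "map (farr (mfcomp G F)) fs = map (farr G) (map (farr F) fs)"
   by (auto simp: composable_def)
  have "composable (fdom F) g fs" using a by simp
  moreover from this have "composable (fdom G) (farr F g) (map (farr F) fs)"
   using F.composable_map c by simp
  ultimately show "farr (mfcomp G F) (mcomp (fdom (mfcomp G F)) g fs) =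
    mcomp (fcod (mfcomp G F)) (farr (mfcomp G F) g) (map (farr (mfcomp G F)) fs)"
   unfolding m using A.mcomp_in[of g fs] F.farr_mcomp[of g fs] G.farr_mcomp[of "farr F g" "map (farr F) fs"] c
   by (simp add: composable_def)
 qed (use c F.fobj_in[unfolded c] in \<open>auto simp: multifun_comp_def compose_eq\<close>)
 then show ?thesis
  using F G by (simp add: small_multifuns_def)
qed

lemma category_MCat: "category MCat"
proof (rule categoryI, goal_cases)
 case (1 F) then show ?case using funsD[of F] by simp
next
 case (2 A) then show ?case by (simp add: multifun_id_small)
next
 case (3 F G) then show ?case by (simp add: multifun_comp_small)
next
 case (4 F)
 then show ?case
  using funsD[of F] multifun_comp_small[of F "mfid (fcod F)"] multifun_id_small[of "fcod F"]
  by (simp, intro multifun_eqI)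
   (auto simp: small_multifuns_def multifunctor.fobj_in multifunctor.farr_in)
next
 case (5 F)
 then show ?case
  using funsD[of F] multifun_comp_small[of "mfid (fdom F)" F] multifun_id_small[of "fdom F"]
  by (simp, intro multifun_eqI)
   (auto simp: small_multifuns_def multifunctor.fobj_in multifunctor.farr_in)
next
 case (6 F G H)
 then have *: "mfcomp H G \<in> funs" "mfcomp G F \<in> funs"
  by (simp_all add: multifun_comp_small)
 then have "multifunctor (mfcomp (mfcomp H G) F)" "multifunctor (mfcomp H (mfcomp G F))"
  using 6 multifun_comp_small[of F "mfcomp H G"] multifun_comp_small[of "mfcomp G F" H]
  by (auto intro!: funsD(1))
 then show ?case
  using 6 multifunctor.fobj_in[of F] multifunctor.farr_in[of F] funsD(1)[of F]
  by simp (rule multifun_eqI, simp_all)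
qed

section \<open>Transformations and their two compositions\<close>

lemma mtransD:
 assumes "t \<in> mtrans"
 shows "multitransformation t" "tsrc t \<in> funs" "ttrg t \<in> funs"
  "multifunctor (tsrc t)" "multifunctor (ttrg t)" "multicategory (fdom (tsrc t))" "multicategory (fcod (tsrc t))"
  "fdom (ttrg t) = fdom (tsrc t)" "fcod (ttrg t) = fcod (tsrc t)"
  "\<And>x. x \<in> mobj (fdom (tsrc t)) ==> tcmp t x \<in> marr (fcod (tsrc t))"
  "\<And>x. x \<in> mobj (fdom (tsrc t)) ==> mdom (fcod (tsrc t)) (tcmp t x) = [fobj (tsrc t) x]"
  "\<And>x. x \<in> mobj (fdom (tsrc t)) ==> mcod (fcod (tsrc t)) (tcmp t x) = fobj (ttrg t) x"
 using assms multitransformation.parallel[of t] multitransformation.tcmp_in[of t]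
 by (auto simp: mtrans_def small_multifuns_def small_multicats_def)

lemma mtransI:
 assumes "tsrc t \<in> funs" "ttrg t \<in> funs"
  "fdom (tsrc t) = fdom (ttrg t)" "fcod (tsrc t) = fcod (ttrg t)" "tcmp t \<in> extensional (mobj (fdom (tsrc t)))"
  "\<And>x. x \<in> mobj (fdom (tsrc t)) ==> tcmp t x \<in> marr (fcod (tsrc t)) \<and>
   mdom (fcod (tsrc t)) (tcmp t x) = [fobj (tsrc t) x] \<and> mcod (fcod (tsrc t)) (tcmp t x) = fobj (ttrg t) x"
  "\<And>f. f \<in> marr (fdom (tsrc t)) ==>
   mcomp (fcod (tsrc t)) (tcmp t (mcod (fdom (tsrc t)) f)) [farr (tsrc t) f] =
   mcomp (fcod (tsrc t)) (farr (ttrg t) f) (map (tcmp t) (mdom (fdom (tsrc t)) f))"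
 shows "t \<in> mtrans"
 using assms unfolding mtrans_def by (auto intro!: multitransformation.intro)

lemma mtrans_id_in:
 assumes F: "F \<in> funs"
 shows "idt F \<in> mtrans"
proof (rule mtransI)
 interpret F: multifunctor F by (rule funsD[OF F])
 interpret A: multicategory "fdom F" by (rule funsD[OF F])
 interpret B: multicategory "fcod F" by (rule funsD[OF F])
 fix f assume "f \<in> marr (fdom (tsrc (idt F)))"
 then have f: "f \<in> marr (fdom F)" by simp
 then have "map (tcmp (idt F)) (mdom (fdom F) f) = map (mident (fcod F)) (mdom (fcod F) (farr F f))"
  using A.mdom_in[OF f] by auto
 then show "mcomp (fcod (tsrc (idt F))) (tcmp (idt F) (mcod (fdom (tsrc (idt F))) f))
   [farr (tsrc (idt F)) f] =
   mcomp (fcod (tsrc (idt F))) (farr (ttrg (idt F)) f)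
    (map (tcmp (idt F)) (mdom (fdom (tsrc (idt F))) f))"
  using f A.mcod_in[OF f] B.mcomp_mident_right[of "farr F f"] by (simp del: F.farr_dom)
qed (use F funsD[OF F] in \<open>auto simp: idt_def multifunctor.fobj_in multicategory.mident_in\<close>)

text \<open>Naturality of \<open>s\<close> and of \<open>t\<close> at \<open>f\<close> are pasted;
  associativity first moves the component of \<open>t\<close> at the codomain outwards and then
  merges the components of \<open>s\<close> and \<open>t\<close> at each input.\<close>

lemma mtrans_vcomp_in:
 assumes s: "s \<in> mtrans" and t: "t \<in> mtrans" and c: "ttrg s = tsrc t"
 shows "vct t s \<in> mtrans"
proof (rule mtransI)
 note s' = mtransD[OF s] and t' = mtransD[OF t]
 let ?F = "tsrc s" and ?G = "tsrc t" and ?H = "ttrg t"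
 interpret F: multifunctor ?F by (rule s')
 interpret G: multifunctor ?G by (rule t')
 interpret H: multifunctor ?H by (rule t')
 interpret A: multicategory "fdom ?F" by (rule s')
 interpret B: multicategory "fcod ?F" by (rule s')
 have d: "fdom ?G = fdom ?F" "fcod ?G = fcod ?F" using c s'(8,9) by simp_all
 fix f assume "f \<in> marr (fdom (tsrc (vct t s)))"
 then have f: "f \<in> marr (fdom ?F)" by simp
 have dom: "x \<in> mobj (fdom ?F)" if "x \<in> set (mdom (fdom ?F) f)" for x
  using A.mdom_in[OF f] that by auto
 let ?xs = "mdom (fdom ?F) f" and ?y = "mcod (fdom ?F) f"
 have y: "?y \<in> mobj (fdom ?F)" using A.mcod_in[OF f] .
 have n1: "mcomp (fcod ?F) (tcmp s ?y) [farr ?F f] = mcomp (fcod ?F) (farr ?G f) (map (tcmp s) ?xs)"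
  using multitransformation.naturality[OF s'(1), of f] f c by simp
 have n2: "mcomp (fcod ?F) (tcmp t ?y) [farr ?G f] = mcomp (fcod ?F) (farr ?H f) (map (tcmp t) ?xs)"
  using multitransformation.naturality[OF t'(1), of f] f d by simp
 have "mcomp (fcod ?F) (mcomp (fcod ?F) (tcmp t ?y) [tcmp s ?y]) [farr ?F f] =
   mcomp (fcod ?F) (tcmp t ?y) [mcomp (fcod ?F) (farr ?G f) (map (tcmp s) ?xs)]"
  using y f s'(10-12)[OF y] t'(10-12)[of ?y] d c n1 by (simp add: B.mcomp_assoc1)
 also have "\<dots> = mcomp (fcod ?F) (mcomp (fcod ?F) (tcmp t ?y) [farr ?G f]) (map (tcmp s) ?xs)"
  using y f s'(10-12) t'(10-12)[of ?y] d c dom G.farr_in[of f]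
  by (intro B.mcomp_assoc1[symmetric]) auto
 also have "\<dots> = mcomp (fcod ?F) (farr ?H f) (map (\<lambda>x. mcomp (fcod ?F) (tcmp t x) [tcmp s x]) ?xs)"
  unfolding n2 using f s'(10-12) t'(8-12) d c dom H.farr_in[of f] by (intro B.mcomp_assoc_map) auto
 also have "map (\<lambda>x. mcomp (fcod ?F) (tcmp t x) [tcmp s x]) ?xs = map (tcmp (vct t s)) ?xs"
  using dom by simp
 finally show "mcomp (fcod (tsrc (vct t s)))
   (tcmp (vct t s) (mcod (fdom (tsrc (vct t s))) f)) [farr (tsrc (vct t s)) f] =
   mcomp (fcod (tsrc (vct t s))) (farr (ttrg (vct t s)) f)
    (map (tcmp (vct t s)) (mdom (fdom (tsrc (vct t s))) f))"
  using y by simp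
next
 note s' = mtransD[OF s] and t' = mtransD[OF t]
 interpret B: multicategory "fcod (tsrc s)" by (rule s')
 have d: "fdom (tsrc t) = fdom (tsrc s)" "fcod (tsrc t) = fcod (tsrc s)" using c s'(8,9) by simp_all
 show "tcmp (vct t s) x \<in> marr (fcod (tsrc (vct t s))) \<and>
   mdom (fcod (tsrc (vct t s))) (tcmp (vct t s) x) = [fobj (tsrc (vct t s)) x] \<and>
   mcod (fcod (tsrc (vct t s))) (tcmp (vct t s) x) = fobj (ttrg (vct t s)) x"
  if "x \<in> mobj (fdom (tsrc (vct t s)))" for x
  using that s'(10-12)[of x] t'(10-12)[of x] d c by simp
 show "fdom (tsrc (vct t s)) = fdom (ttrg (vct t s))"
  "fcod (tsrc (vct t s)) = fcod (ttrg (vct t s))"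
  using s'(8,9) t'(8,9) c by simp_all
qed (use mtransD[OF s] mtransD[OF t] in \<open>auto simp: vct_def\<close>)

text \<open>Naturality of \<open>s\<close> at \<open>f\<close>, mapped by \<open>tsrc t\<close>, is
  pasted with naturality of \<open>t\<close> at the image of \<open>f\<close> under
  \<open>ttrg s\<close>.\<close>

lemma mtrans_hcomp_in:
 assumes s: "s \<in> mtrans" and t: "t \<in> mtrans" and c: "fcod (tsrc s) = fdom (tsrc t)"
 shows "hct t s \<in> mtrans"
proof (rule mtransI)
 note s' = mtransD[OF s] and t' = mtransD[OF t]
 let ?F = "tsrc s" and ?G = "ttrg s" and ?H = "tsrc t" and ?K = "ttrg t"
 interpret F: multifunctor ?F by (rule s')
 interpret G: multifunctor ?G by (rule s')
 interpret H: multifunctor ?H by (rule t')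
 interpret K: multifunctor ?K by (rule t')
 interpret A: multicategory "fdom ?F" by (rule s')
 interpret B: multicategory "fcod ?F" by (rule s')
 interpret C: multicategory "fcod ?H" by (rule t')
 fix f assume "f \<in> marr (fdom (tsrc (hct t s)))"
 then have f: "f \<in> marr (fdom ?F)" by simp
 let ?xs = "mdom (fdom ?F) f" and ?y = "mcod (fdom ?F) f"
 have y: "?y \<in> mobj (fdom ?F)" using A.mcod_in[OF f] .
 have dom: "x \<in> mobj (fdom ?F)" if "x \<in> set ?xs" for x
  using A.mdom_in[OF f] that by auto
 have obG: "fobj ?G x \<in> mobj (fdom ?H)" if "x \<in> mobj (fdom ?F)" for x
  using that G.fobj_in[of x] s'(8,9) c by simp
 have Gf: "farr ?G f \<in> marr (fdom ?H)" "mdom (fdom ?H) (farr ?G f) = map (fobj ?G) ?xs"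
  "mcod (fdom ?H) (farr ?G f) = fobj ?G ?y" "farr ?F f \<in> marr (fdom ?H)"
  "mdom (fdom ?H) (farr ?F f) = map (fobj ?F) ?xs" "mcod (fdom ?H) (farr ?F f) = fobj ?F ?y"
  using f s'(8,9) c G.farr_in[of f] F.farr_in[of f] by simp_all
 have s'': "tcmp s x \<in> marr (fdom ?H)" "mdom (fdom ?H) (tcmp s x) = [fobj ?F x]"
  "mcod (fdom ?H) (tcmp s x) = fobj ?G x" if "x \<in> mobj (fdom ?F)" for x
  using s'(10-12)[OF that] c by simp_all
 have n1: "mcomp (fdom ?H) (tcmp s ?y) [farr ?F f] = mcomp (fdom ?H) (farr ?G f) (map (tcmp s) ?xs)"
  using multitransformation.naturality[OF s'(1), of f] f c by simp
 have n2: "mcomp (fcod ?H) (tcmp t (fobj ?G ?y)) [farr ?H (farr ?G f)] =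
   mcomp (fcod ?H) (farr ?K (farr ?G f)) (map (\<lambda>x. tcmp t (fobj ?G x)) ?xs)"
  using multitransformation.naturality[OF t'(1), of "farr ?G f"] Gf by (simp add: comp_def)
 have "mcomp (fcod ?H) (mcomp (fcod ?H) (tcmp t (fobj ?G ?y)) [farr ?H (tcmp s ?y)]) [farr ?H (farr ?F f)] =
   mcomp (fcod ?H) (tcmp t (fobj ?G ?y)) [mcomp (fcod ?H) (farr ?H (tcmp s ?y)) [farr ?H (farr ?F f)]]"
  using y f s''[OF y] t'(10-12)[OF obG[OF y]] Gf by (intro C.mcomp_assoc1) simp_all
 also have "mcomp (fcod ?H) (farr ?H (tcmp s ?y)) [farr ?H (farr ?F f)] =
   mcomp (fcod ?H) (farr ?H (farr ?G f)) (map (\<lambda>x. farr ?H (tcmp s x)) ?xs)"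
  using H.farr_comp[of "tcmp s ?y" "[farr ?F f]"] H.farr_comp[of "farr ?G f" "map (tcmp s) ?xs"] n1
   s'' y dom Gf by (auto simp: comp_def)
 also have "mcomp (fcod ?H) (tcmp t (fobj ?G ?y)) [mcomp (fcod ?H) (farr ?H (farr ?G f)) (map (\<lambda>x. farr ?H (tcmp s x)) ?xs)] =
   mcomp (fcod ?H) (mcomp (fcod ?H) (tcmp t (fobj ?G ?y)) [farr ?H (farr ?G f)]) (map (\<lambda>x. farr ?H (tcmp s x)) ?xs)"
  using y f s'' t'(10-12)[OF obG[OF y]] Gf dom by (intro C.mcomp_assoc1[symmetric]) auto
 also have "\<dots> = mcomp (fcod ?H) (farr ?K (farr ?G f))
   (map (\<lambda>x. mcomp (fcod ?H) (tcmp t (fobj ?G x)) [farr ?H (tcmp s x)]) ?xs)"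
  unfolding n2 using f s'' t'(8-12) Gf dom obG K.farr_in[of "farr ?G f"] by (intro C.mcomp_assoc_map) auto
 also have "map (\<lambda>x. mcomp (fcod ?H) (tcmp t (fobj ?G x)) [farr ?H (tcmp s x)]) ?xs = map (tcmp (hct t s)) ?xs"
  using dom by simp
 finally show "mcomp (fcod (tsrc (hct t s)))
   (tcmp (hct t s) (mcod (fdom (tsrc (hct t s))) f)) [farr (tsrc (hct t s)) f] =
   mcomp (fcod (tsrc (hct t s))) (farr (ttrg (hct t s)) f)
    (map (tcmp (hct t s)) (mdom (fdom (tsrc (hct t s))) f))"
  using y f s'(8) by simp
next
 note s' = mtransD[OF s] and t' = mtransD[OF t]
 show "tsrc (hct t s) \<in> funs" "ttrg (hct t s) \<in> funs"
  using multifun_comp_small[OF s'(2) t'(2)] multifun_comp_small[OF s'(3) t'(3)] s'(8,9) t'(8,9) c by simp_all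
 interpret C: multicategory "fcod (tsrc t)" by (rule t')
 interpret H: multifunctor "tsrc t" by (rule t')
 interpret G: multifunctor "ttrg s" by (rule s')
 show "tcmp (hct t s) x \<in> marr (fcod (tsrc (hct t s))) \<and>
   mdom (fcod (tsrc (hct t s))) (tcmp (hct t s) x) = [fobj (tsrc (hct t s)) x] \<and>
   mcod (fcod (tsrc (hct t s))) (tcmp (hct t s) x) = fobj (ttrg (hct t s)) x"
  if "x \<in> mobj (fdom (tsrc (hct t s)))" for x
  using that s'(8,9) s'(10-12)[of x] t'(10-12)[of "fobj (ttrg s) x"] H.farr_in[of "tcmp s x"] G.fobj_in[of x] c by simp
 show "fdom (tsrc (hct t s)) = fdom (ttrg (hct t s))"
  "fcod (tsrc (hct t s)) = fcod (ttrg (hct t s))"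
  using s'(8,9) t'(8,9) by simp_all
qed (auto simp: hct_def)

lemma two_category_MCat: "two_category MCat"
proof (rule two_categoryI, goal_cases)
 case 1 show ?case by (rule category_MCat)
next
 case 2 show ?case
 proof (rule categoryI, goal_cases)
  case (4 t)
  then have t: "t \<in> mtrans" by (simp add: vcat_def)
  note t' = mtransD[OF t]
  interpret B: multicategory "fcod (tsrc t)" by (rule t')
  have "vct (idt (ttrg t)) t = t"
   using t t' by (intro mtrans_eqI mtransD(1)[OF mtrans_vcomp_in]) (auto intro: mtrans_id_in)
  then show ?case by (simp add: vcat_def)
 next
  case (5 t)
  then have t: "t \<in> mtrans" by (simp add: vcat_def)
  note t' = mtransD[OF t]
  interpret B: multicategory "fcod (tsrc t)" by (rule t')
  have "vct t (idt (tsrc t)) = t"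
   using t t' by (intro mtrans_eqI mtransD(1)[OF mtrans_vcomp_in]) (auto intro: mtrans_id_in)
  then show ?case by (simp add: vcat_def)
 next
  case (6 r s t)
  then have m: "r \<in> mtrans" "s \<in> mtrans" "t \<in> mtrans" "ttrg r = tsrc s" "ttrg s = tsrc t"
   by (simp_all add: vcat_def)
  note r' = mtransD[OF m(1)] and s' = mtransD[OF m(2)] and t' = mtransD[OF m(3)]
  interpret B: multicategory "fcod (tsrc r)" by (rule r')
  have d: "fdom (tsrc s) = fdom (tsrc r)" "fcod (tsrc s) = fcod (tsrc r)" "fdom (tsrc t) = fdom (tsrc r)"
   "fcod (tsrc t) = fcod (tsrc r)"
   using r'(8,9) s'(8,9) m(4,5) by simp_all
  have "vct (vct t s) r = vct t (vct s r)"
   using m r'(10-12) s'(10-12) t'(10-12) d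
   by (intro mtrans_eqI mtransD(1)[OF mtrans_vcomp_in])
    (auto simp: B.mcomp_assoc1 intro: mtrans_vcomp_in)
  then show ?case by (simp add: vcat_def)
 qed (auto simp: vcat_def mtrans_id_in mtrans_vcomp_in mtransD)
next
 case (3 t) then show ?case using mtransD[of t] by simp
next
 case (4 s t) then show ?case by (simp add: mtrans_hcomp_in)
next
 case (5 t)
 then have t: "t \<in> mtrans" by simp
 note t' = mtransD[OF t]
 interpret B: multicategory "fcod (tsrc t)" by (rule t')
 interpret G: multifunctor "ttrg t" by (rule t')
 have "fcod (tsrc t) \<in> mcats" using funsD(3)[OF t'(2)] .
 moreover have "mfcomp (mfid (fcod (tsrc t))) (tsrc t) = tsrc t"
  "mfcomp (mfid (fcod (tsrc t))) (ttrg t) = ttrg t"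
  using category.id_left'[OF category_MCat, of "tsrc t"] category.id_left'[OF category_MCat, of "ttrg t"] t' by simp_all
 moreover have "fobj (ttrg t) x \<in> mobj (fcod (tsrc t))" if "x \<in> mobj (fdom (tsrc t))" for x
  using G.fobj_in[of x] that t'(8,9) by simp
 ultimately have "hct (idt (mfid (fcod (tsrc t)))) t = t"
  using t t' by (intro mtrans_eqI mtransD(1)[OF mtrans_hcomp_in])
   (auto intro: mtrans_id_in multifun_id_small)
 then show ?case by simp
next
 case (6 t)
 then have t: "t \<in> mtrans" by simp
 note t' = mtransD[OF t]
 interpret B: multicategory "fcod (tsrc t)" by (rule t')
 interpret F: multifunctor "tsrc t" by (rule t')
 have "fdom (tsrc t) \<in> mcats" using funsD(2)[OF t'(2)] .
 moreover have "mfcomp (tsrc t) (mfid (fdom (tsrc t))) = tsrc t"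
  "mfcomp (ttrg t) (mfid (fdom (tsrc t))) = ttrg t"
  using category.id_right'[OF category_MCat, of "tsrc t"] category.id_right'[OF category_MCat, of "ttrg t"] t' by simp_all
 ultimately have "hct t (idt (mfid (fdom (tsrc t)))) = t"
  using t t' by (intro mtrans_eqI mtransD(1)[OF mtrans_hcomp_in])
   (auto intro: mtrans_id_in multifun_id_small)
 then show ?case by simp
next
 case (7 r s t)
 then have m: "r \<in> mtrans" "s \<in> mtrans" "t \<in> mtrans"
  "fcod (tsrc r) = fdom (tsrc s)" "fcod (tsrc s) = fdom (tsrc t)"
  by simp_all
 note r' = mtransD[OF m(1)] and s' = mtransD[OF m(2)] and t' = mtransD[OF m(3)]
 interpret D: multicategory "fcod (tsrc t)" by (rule t')
 interpret H: multifunctor "tsrc t" by (rule t')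
 interpret G: multifunctor "tsrc s" by (rule s')
 interpret G': multifunctor "ttrg s" by (rule s')
 interpret F': multifunctor "ttrg r" by (rule r')
 have f: "mfcomp (mfcomp (tsrc t) (tsrc s)) (tsrc r) = mfcomp (tsrc t) (mfcomp (tsrc s) (tsrc r))"
  "mfcomp (mfcomp (ttrg t) (ttrg s)) (ttrg r) = mfcomp (ttrg t) (mfcomp (ttrg s) (ttrg r))"
  using category.assoc'[OF category_MCat, of "tsrc r" "tsrc s" "tsrc t"]
   category.assoc'[OF category_MCat, of "ttrg r" "ttrg s" "ttrg t"] m r' s' t' by simp_all
 have "hct (hct t s) r = hct t (hct s r)"
 proof (rule mtrans_eqI)
  fix x assume "x \<in> mobj (fdom (tsrc (hct (hct t s) r)))"
  then have x: "x \<in> mobj (fdom (tsrc r))" by simp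
  have x1: "fobj (ttrg r) x \<in> mobj (fdom (tsrc s))" "tcmp r x \<in> marr (fdom (tsrc s))"
   "mdom (fdom (tsrc s)) (tcmp r x) = [fobj (tsrc r) x]" "mcod (fdom (tsrc s)) (tcmp r x) = fobj (ttrg r) x"
   using F'.fobj_in[of x] r'(8,9) r'(10-12)[of x] x m(4) by simp_all
  have x2: "fobj (ttrg s) (fobj (ttrg r) x) \<in> mobj (fdom (tsrc t))"
   "tcmp s (fobj (ttrg r) x) \<in> marr (fdom (tsrc t))"
   "mdom (fdom (tsrc t)) (tcmp s (fobj (ttrg r) x)) = [fobj (tsrc s) (fobj (ttrg r) x)]"
   "mcod (fdom (tsrc t)) (tcmp s (fobj (ttrg r) x)) = fobj (ttrg s) (fobj (ttrg r) x)"
   "farr (tsrc s) (tcmp r x) \<in> marr (fdom (tsrc t))"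
   "mcod (fdom (tsrc t)) (farr (tsrc s) (tcmp r x)) = fobj (tsrc s) (fobj (ttrg r) x)"
   using G'.fobj_in[of "fobj (ttrg r) x"] s'(8,9) s'(10-12)[of "fobj (ttrg r) x"] x1 m(5) G.farr_in[of "tcmp r x"] by simp_all
  show "tcmp (hct (hct t s) r) x = tcmp (hct t (hct s r)) x"
   using x x1 x2 m t'(10-12)[of "fobj (ttrg s) (fobj (ttrg r) x)"] r'(8,9)
    H.farr_comp[of "tcmp s (fobj (ttrg r) x)" "[farr (tsrc s) (tcmp r x)]"]
    H.farr_in[of "tcmp s (fobj (ttrg r) x)"] H.farr_in[of "farr (tsrc s) (tcmp r x)"]
   by (simp add: D.mcomp_assoc1)
 qed (use m f in \<open>auto intro!: mtransD(1) mtrans_hcomp_in\<close>)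
 then show ?case by simp
next
 case (8 F G)
 then have m: "F \<in> funs" "G \<in> funs" "fcod F = fdom G" by simp_all
 interpret F: multifunctor F by (rule funsD[OF m(1)])
 interpret G: multifunctor G by (rule funsD[OF m(2)])
 interpret D: multicategory "fcod G" by (rule funsD[OF m(2)])
 have o: "fobj F x \<in> mobj (fdom G)" if "x \<in> mobj (fdom F)" for x
  using F.fobj_in[OF that] m(3) by simp
 have "hct (idt G) (idt F) = idt (mfcomp G F)"
  by (rule mtrans_eqI[OF mtransD(1)[OF mtrans_hcomp_in] mtransD(1)[OF mtrans_id_in]])
   (use m o in \<open>auto intro: mtrans_id_in multifun_comp_small\<close>)
 then show ?case by simp
next
 case (9 s s' t t')
 then have m: "s \<in> mtrans" "s' \<in> mtrans" "t \<in> mtrans" "t' \<in> mtrans"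
  "ttrg s = tsrc s'" "ttrg t = tsrc t'" "fcod (tsrc s) = fdom (tsrc t)"
  by simp_all
 note sD = mtransD[OF m(1)] and s'D = mtransD[OF m(2)]
  and tD = mtransD[OF m(3)] and t'D = mtransD[OF m(4)]
 interpret D: multicategory "fcod (tsrc t)" by (rule tD)
 interpret H: multifunctor "tsrc t" by (rule tD)
 interpret H': multifunctor "tsrc t'" by (rule t'D)
 interpret F': multifunctor "tsrc s'" by (rule s'D)
 interpret F'': multifunctor "ttrg s'" by (rule s'D)
 have d: "fdom (tsrc s') = fdom (tsrc s)" "fcod (tsrc s') = fdom (tsrc t)" "fdom (tsrc t') = fdom (tsrc t)"
  "fcod (tsrc t') = fcod (tsrc t)"
  using sD(8,9) tD(8,9) m(5-7) by simp_all
 have "hct (vct t' t) (vct s' s) = vct (hct t' s') (hct t s)"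
 proof (rule mtrans_eqI)
  fix x assume "x \<in> mobj (fdom (tsrc (hct (vct t' t) (vct s' s))))"
  then have x: "x \<in> mobj (fdom (tsrc s))" by simp
  let ?y = "fobj (tsrc s') x" and ?z = "fobj (ttrg s') x"
  have z: "?y \<in> mobj (fdom (tsrc t))" "?z \<in> mobj (fdom (tsrc t))"
   using x F'.fobj_in[of x] F''.fobj_in[of x] s'D(8,9) d by simp_all
  have sx: "tcmp s x \<in> marr (fdom (tsrc t))" "mcod (fdom (tsrc t)) (tcmp s x) = ?y"
   "tcmp s' x \<in> marr (fdom (tsrc t))" "mdom (fdom (tsrc t)) (tcmp s' x) = [?y]"
   "mcod (fdom (tsrc t)) (tcmp s' x) = ?z"
   using x sD(10-12)[of x] s'D(10-12)[of x] d m(5,7) by simp_all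
  note ty = tD(10-12)[OF z(1)] tD(10-12)[OF z(2)] t'D(10-12)[of ?y] t'D(10-12)[of ?z]
  note hf = H.farr_in[OF sx(1)] H.farr_in[OF sx(3)] H'.farr_in[of "tcmp s' x"] H'.farr_in[of "tcmp s x"]
  let ?c = "mcomp (fcod (tsrc t))"
  \<comment> \<open>The interchange law comes down to naturality of \<open>t\<close> at the
    component of \<open>s'\<close>.\<close>
  have nat: "?c (tcmp t ?z) [farr (tsrc t) (tcmp s' x)] = ?c (farr (tsrc t') (tcmp s' x)) [tcmp t ?y]"
   using multitransformation.naturality[OF tD(1) sx(3)] sx m(6) by simp
  have "?c (?c (tcmp t' ?z) [tcmp t ?z]) [?c (farr (tsrc t) (tcmp s' x)) [farr (tsrc t) (tcmp s x)]] =
    ?c (tcmp t' ?z) [?c (?c (tcmp t ?z) [farr (tsrc t) (tcmp s' x)]) [farr (tsrc t) (tcmp s x)]]"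
   using z sx ty hf d m(6) by (simp add: D.mcomp_assoc1)
  also have "\<dots> = ?c (?c (tcmp t' ?z) [farr (tsrc t') (tcmp s' x)]) [?c (tcmp t ?y) [farr (tsrc t) (tcmp s x)]]"
   unfolding nat using z sx ty hf d m(6) by (simp add: D.mcomp_assoc1)
  finally show "tcmp (hct (vct t' t) (vct s' s)) x =
    tcmp (vct (hct t' s') (hct t s)) x"
   using x d z sx m(5-7) H.farr_comp[of "tcmp s' x" "[tcmp s x]"] by simp
 qed (use m d in \<open>auto intro!: mtransD(1) mtrans_hcomp_in mtrans_vcomp_in\<close>)
 then show ?case by simp
qed

section \<open>Cloven opfibrations\<close>

interpretation MCat: two_category' MCat
 by (rule two_category'.intro, rule two_category_MCat)

lemma MCat_squareD:
 assumes "s \<in> sqs MCat"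
 shows "sdom s \<in> funs" "stop s \<in> funs" "sbot s \<in> funs" "scod s \<in> funs"
  "fdom (stop s) = fdom (sdom s)" "fcod (stop s) = fdom (scod s)"
  "fdom (sbot s) = fcod (sdom s)" "fcod (sbot s) = fcod (scod s)"
  "\<And>x. x \<in> mobj (fdom (sdom s)) ==> fobj (scod s) (fobj (stop s) x) = fobj (sbot s) (fobj (sdom s) x)"
  "\<And>f. f \<in> marr (fdom (sdom s)) ==> farr (scod s) (farr (stop s) f) = farr (sbot s) (farr (sdom s) f)"
proof -
 have e: "mfcomp (scod s) (stop s) = mfcomp (sbot s) (sdom s)"
  and d: "fdom (stop s) = fdom (sdom s)"
  using assms by (simp_all add: MCat.sq_iff)
 show "fobj (scod s) (fobj (stop s) x) = fobj (sbot s) (fobj (sdom s) x)" if "x \<in> mobj (fdom (sdom s))" for x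
  using arg_cong[OF e, of "\<lambda>F. fobj F x"] that d by simp
 show "farr (scod s) (farr (stop s) f) = farr (sbot s) (farr (sdom s) f)" if "f \<in> marr (fdom (sdom s))" for f
  using arg_cong[OF e, of "\<lambda>F. farr F f"] that d by simp
qed (use assms in \<open>simp_all add: MCat.sq_iff\<close>)

lemma lifting_problem_map:
 assumes s: "s \<in> sqs MCat" and l: "lprob (sdom s) es f"
 shows "lprob (scod s) (map (fobj (stop s)) es) (farr (sbot s) f)"
proof -
 note d = MCat_squareD[OF s]
 interpret h: multifunctor "stop s" by (rule funsD[OF d(2)])
 interpret k: multifunctor "sbot s" by (rule funsD[OF d(3)])
 have es: "set es \<subseteq> mobj (fdom (sdom s))" using l by (simp add: lifting_problem_def)
 then have "map (fobj (scod s)) (map (fobj (stop s)) es) = map (fobj (sbot s)) (map (fobj (sdom s)) es)"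
  using d(9) by auto
 then show ?thesis
  using l es k.farr_in[of f] h.fobj_in d by (auto simp: lifting_problem_def simp del: map_map)
qed

lemma opcartI:
 assumes "l \<in> marr (fdom P)" "mdom (fdom P) l = es" "farr P l = f"
  "\<And>g w. g \<in> marr (fdom P) ==> mdom (fdom P) g = es ==> w \<in> marr (fcod P) ==>
   mdom (fcod P) w = [mcod (fcod P) f] ==> mcod (fcod P) w = fobj P (mcod (fdom P) g) ==>
   farr P g = mcomp (fcod P) w [f] ==>
   \<exists>!v. v \<in> marr (fdom P) \<and> mdom (fdom P) v = [mcod (fdom P) l] \<and>
    mcod (fdom P) v = mcod (fdom P) g \<and> mcomp (fdom P) v [l] = g \<and> farr P v = w"
 shows "opcart P es f l"
 using assms by (simp add: opcartesian_lifting_def)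

lemma opcart_ex1:
 assumes "opcart P es f l" "g \<in> marr (fdom P)" "mdom (fdom P) g = es" "w \<in> marr (fcod P)"
  "mdom (fcod P) w = [mcod (fcod P) f]" "mcod (fcod P) w = fobj P (mcod (fdom P) g)"
  "farr P g = mcomp (fcod P) w [f]"
 shows "\<exists>!v. v \<in> marr (fdom P) \<and> mdom (fdom P) v = [mcod (fdom P) l] \<and> mcod (fdom P) v = mcod (fdom P) g \<and>
  mcomp (fdom P) v [l] = g \<and> farr P v = w"
 using assms by (simp add: opcartesian_lifting_def)

lemma opcartD:
 assumes "opcart P es f l" "multifunctor P"
 shows "l \<in> marr (fdom P)" "mdom (fdom P) l = es" "farr P l = f"
  "fobj P (mcod (fdom P) l) = mcod (fcod P) f"
 using assms multifunctor.farr_in[OF assms(2), of l] by (auto simp: opcartesian_lifting_def)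

text \<open>A form in which the codomains of \<open>v\<close> and \<open>v'\<close> are not compared
  beforehand: equality of the composites with \<open>l\<close> already forces them to agree.\<close>

lemma opcart_unique:
 assumes o: "opcart P es f l" and F: "multifunctor P" "multicategory (fdom P)"
  and v: "v \<in> marr (fdom P)" "mdom (fdom P) v = [mcod (fdom P) l]"
  and v': "v' \<in> marr (fdom P)" "mdom (fdom P) v' = [mcod (fdom P) l]"
  and e: "mcomp (fdom P) v [l] = mcomp (fdom P) v' [l]" "farr P v = farr P v'"
 shows "v = v'"
proof -
 interpret P: multifunctor P by fact
 interpret E: multicategory "fdom P" by fact
 note l = opcartD[OF o F(1)]
 have c: "mcod (fdom P) v' = mcod (fdom P) v"
  using arg_cong[OF e(1), of "mcod (fdom P)"] v v' l by simp
 have "\<exists>!u. u \<in> marr (fdom P) \<and> mdom (fdom P) u = [mcod (fdom P) l] \<and>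
   mcod (fdom P) u = mcod (fdom P) (mcomp (fdom P) v [l]) \<and> mcomp (fdom P) u [l] = mcomp (fdom P) v [l] \<and>
   farr P u = farr P v"
  by (rule opcart_ex1[OF o]) (use v l P.farr_comp[of v "[l]"] in simp_all)
 then show ?thesis
  using v v' l e c by auto
qed

lemma cleavageD: "cleavage P c ==> lprob P es f ==> opcart P es f (c (es, f))"
 by (simp add: cleavage_def)

lemma cleavage_eqI:
 assumes "cleavage P c" "cleavage P c'" "\<And>es f. lprob P es f ==> c (es, f) = c' (es, f)"
 shows "c = c'"
 using assms by (intro extensionalityI[of _ "{(es, f). lprob P es f}"]) (auto simp: cleavage_def)

definition cloven :: "(('u, 'u) multifun \<times> ('u list \<times> 'u => 'u)) set" where
 "cloven = {(P, c). P \<in> carr MCat \<and> cleavage P c}"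

lemma cloven_iff: "X \<in> cloven \<longleftrightarrow> fst X \<in> funs \<and> cleavage (fst X) (snd X)"
 by (auto simp: cloven_def)

text \<open>Every multimorphism is its own lift along an identity, hence \<open>snd\<close>.\<close>

definition cloven_idn :: "('u, 'u) multicat => ('u, 'u) multifun \<times> ('u list \<times> 'u => 'u)" where
 "cloven_idn A = (mfid A, restrict snd {(es, f). lprob (mfid A) es f})"

definition cloven_cmp where
 "cloven_cmp Y X = (mfcomp (fst Y) (fst X),
  \<lambda>(es, f)\<in>{(es, f). lprob (mfcomp (fst Y) (fst X)) es f}.
   snd X (es, snd Y (map (fobj (fst X)) es, f)))"

lemma preserves_iff: "cleavage_preserving X s Y \<longleftrightarrow> (\<forall>es f. lprob (fst X) es f \<longrightarrow>
  farr (stop s) (snd X (es, f)) = snd Y (map (fobj (stop s)) es, farr (sbot s) f))"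
 by (simp add: cleavage_preserving_def split: prod.split)

lemma lifting_problem_id:
 "lprob (mfid A) es f \<longleftrightarrow> set es \<subseteq> mobj A \<and> f \<in> marr A \<and> mdom A f = es"
proof -
 have "map (fobj (mfid A)) es = es" if "set es \<subseteq> mobj A"
  using that by (auto intro!: map_idI)
 then show ?thesis by (auto simp: lifting_problem_def)
qed

lemma lifting_problem_comp:
 assumes "multifunctor P" "fcod P = fdom Q"
 shows "lprob (mfcomp Q P) es f \<longleftrightarrow>
  set es \<subseteq> mobj (fdom P) \<and> lprob Q (map (fobj P) es) f"
proof -
 have "map (fobj (mfcomp Q P)) es = map (fobj Q) (map (fobj P) es)" if "set es \<subseteq> mobj (fdom P)"
  using that by auto
 then show ?thesis
  using assms multifunctor.fobj_in[OF assms(1)] by (auto simp: lifting_problem_def)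
qed

lemma cloven_idn: "A \<in> mcats ==> cloven_idn A \<in> cloven"
proof -
 assume A: "A \<in> mcats"
 interpret multicategory A by (rule mcatsD[OF A])
 have "opcart (mfid A) es f f" if "lprob (mfid A) es f" for es f
 proof -
  have f: "f \<in> marr A" "mdom A f = es" using that by (simp_all add: lifting_problem_id)
  have ex1: "\<exists>!v. v \<in> marr A \<and> mdom A v = [mcod A f] \<and> mcod A v = mcod A g \<and> mcomp A v [f] = g \<and>
    farr (mfid A) v = w"
   if "g \<in> marr A" "mdom A g = es" "w \<in> marr A" "mdom A w = [mcod A f]"
    "mcod A w = fobj (mfid A) (mcod A g)" "farr (mfid A) g = mcomp A w [f]" for g w
  proof -
   have g: "g = mcomp A w [f]" using that by simp
   show ?thesis
   proof (rule ex1I[of _ w])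
    fix v assume "v \<in> marr A \<and> mdom A v = [mcod A f] \<and> mcod A v = mcod A g \<and> mcomp A v [f] = g \<and>
     farr (mfid A) v = w"
    then have "v \<in> marr A" "farr (mfid A) v = w" by blast+
    then show "v = w" by simp
   qed (use that(3,4) f in \<open>simp add: g\<close>)
  qed
  show ?thesis
   by (rule opcartI; (unfold multifun_simps(1,2))?) (fact f(1), fact f(2), simp add: f, rule ex1)
 qed
 then show ?thesis
  using A by (auto simp: cloven_iff cloven_idn_def cleavage_def multifun_id_small)
qed

lemma lifting_problem_second:
 assumes X: "X \<in> cloven" and Y: "Y \<in> cloven" and c: "fcod (fst X) = fdom (fst Y)"
  and l: "lprob (mfcomp (fst Y) (fst X)) es f"
 shows "lprob (fst X) es (snd Y (map (fobj (fst X)) es, f))"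
  and "lprob (fst Y) (map (fobj (fst X)) es) f"
proof -
 have F: "multifunctor (fst X)" "multifunctor (fst Y)" using X Y funsD by (auto simp: cloven_iff)
 show l2: "lprob (fst Y) (map (fobj (fst X)) es) f"
  using l lifting_problem_comp[OF F(1) c] by simp
 have "opcart (fst Y) (map (fobj (fst X)) es) f (snd Y (map (fobj (fst X)) es, f))"
  using Y l2 by (auto simp: cloven_iff intro: cleavageD)
 from opcartD[OF this F(2)] show "lprob (fst X) es (snd Y (map (fobj (fst X)) es, f))"
  using l lifting_problem_comp[OF F(1) c] c by (simp add: lifting_problem_def)
qed

text \<open>Opcartesian lifts compose. A factorisation is found in two stages, \<open>u\<close> in
  the middle multicategory through the lift \<open>m\<close> and then \<open>v\<close> over
  \<open>u\<close> through \<open>k\<close>; uniqueness is traced back through the same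
  stages.\<close>

lemma cloven_cmp:
 assumes X: "X \<in> cloven" and Y: "Y \<in> cloven" and c: "fcod (fst X) = fdom (fst Y)"
 shows "cloven_cmp Y X \<in> cloven"
proof -
 obtain P c where XP: "X = (P, c)" by (cases X)
 obtain Q d where YQ: "Y = (Q, d)" by (cases Y)
 have PQ: "P \<in> funs" "Q \<in> funs" "cleavage P c" "cleavage Q d" "fcod P = fdom Q"
  using X Y c by (simp_all add: XP YQ cloven_iff)
 interpret P: multifunctor P by (rule funsD[OF PQ(1)])
 interpret Q: multifunctor Q by (rule funsD[OF PQ(2)])
 interpret E: multicategory "fdom P" by (rule funsD[OF PQ(1)])
 interpret D: multicategory "fdom Q" by (rule funsD[OF PQ(2)])
 interpret B: multicategory "fcod Q" by (rule funsD[OF PQ(2)])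
 have "opcart (mfcomp Q P) es f (c (es, d (map (fobj P) es, f)))"
  if l: "lprob (mfcomp Q P) es f" for es f
 proof -
  define m where "m = d (map (fobj P) es, f)"
  define k where "k = c (es, m)"
  have lp: "lprob P es m" "lprob Q (map (fobj P) es) f"
   using lifting_problem_second[OF X Y, of es f] l PQ(5) by (simp_all add: XP YQ m_def)
  have o1: "opcart Q (map (fobj P) es) f m" and o2: "opcart P es m k"
   using lp cleavageD[OF PQ(4)] cleavageD[OF PQ(3)] by (simp_all add: m_def k_def)
  note m = opcartD[OF o1 Q.multifunctor_axioms] and k = opcartD[OF o2 P.multifunctor_axioms]
  have ex1: "\<exists>!v. v \<in> marr (fdom P) \<and> mdom (fdom P) v = [mcod (fdom P) k] \<and> mcod (fdom P) v = mcod (fdom P) g \<and>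
    mcomp (fdom P) v [k] = g \<and> farr (mfcomp Q P) v = w"
   if g: "g \<in> marr (fdom P)" "mdom (fdom P) g = es" "w \<in> marr (fcod Q)" "mdom (fcod Q) w = [mcod (fcod Q) f]"
    "mcod (fcod Q) w = fobj (mfcomp Q P) (mcod (fdom P) g)"
    "farr (mfcomp Q P) g = mcomp (fcod Q) w [f]" for g w
  proof -
   have Pg: "farr P g \<in> marr (fdom Q)" "mdom (fdom Q) (farr P g) = map (fobj P) es"
    "mcod (fdom Q) (farr P g) = fobj P (mcod (fdom P) g)"
    using g(1,2) P.farr_in[of g] PQ(5) by simp_all
   have "\<exists>!u. u \<in> marr (fdom Q) \<and> mdom (fdom Q) u = [mcod (fdom Q) m] \<and>
     mcod (fdom Q) u = mcod (fdom Q) (farr P g) \<and> mcomp (fdom Q) u [m] = farr P g \<and> farr Q u = w"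
    by (rule opcart_ex1[OF o1]) (use g Pg E.mcod_in[of g] in simp_all)
   then obtain u where u: "u \<in> marr (fdom Q)" "mdom (fdom Q) u = [mcod (fdom Q) m]"
    "mcod (fdom Q) u = mcod (fdom Q) (farr P g)" "mcomp (fdom Q) u [m] = farr P g" "farr Q u = w"
    by blast
   have "\<exists>!v. v \<in> marr (fdom P) \<and> mdom (fdom P) v = [mcod (fdom P) k] \<and> mcod (fdom P) v = mcod (fdom P) g \<and>
     mcomp (fdom P) v [k] = g \<and> farr P v = u"
    by (rule opcart_ex1[OF o2]) (use g Pg u PQ(5) in simp_all)
   then obtain v where v: "v \<in> marr (fdom P)" "mdom (fdom P) v = [mcod (fdom P) k]"
    "mcod (fdom P) v = mcod (fdom P) g" "mcomp (fdom P) v [k] = g" "farr P v = u"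
    by blast
   show ?thesis
   proof (rule ex1I[of _ v])
    fix v' assume v': "v' \<in> marr (fdom P) \<and> mdom (fdom P) v' = [mcod (fdom P) k] \<and>
     mcod (fdom P) v' = mcod (fdom P) g \<and> mcomp (fdom P) v' [k] = g \<and> farr (mfcomp Q P) v' = w"
    then have w: "v' \<in> marr (fdom P)" "farr (mfcomp Q P) v' = w" by blast+
    then have "farr Q (farr P v') = w" by simp
    have "farr P v' = u"
    proof (rule opcart_unique[OF o1])
     show "mcomp (fdom Q) (farr P v') [m] = mcomp (fdom Q) u [m]"
      using P.farr_comp[of v' "[k]"] v' k u(4) PQ(5) by simp
    qed (use \<open>farr Q (farr P v') = w\<close> v' u P.farr_in[of v'] k PQ(5) Q.multifunctor_axioms D.multicategory_axioms in simp_all)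
    then show "v' = v"
     using v v' by - (rule opcart_unique[OF o2 P.multifunctor_axioms E.multicategory_axioms], simp_all)
   qed (use v u in simp)
  qed
  have fk: "farr (mfcomp Q P) k = f" using k m by simp
  show ?thesis
   unfolding m_def[symmetric] k_def[symmetric]
   by (rule opcartI; (unfold multifun_simps(5,6))?) (fact k(1), fact k(2), fact fk, rule ex1)
 qed
 then show ?thesis
  using PQ by (auto simp: cloven_iff cloven_cmp_def XP YQ cleavage_def multifun_comp_small)
qed

lemma cleavage_preserving_cmp:
 assumes s: "(X, s, X') \<in> structured_1cells (arrow_twocat MCat) cloven cleavage_preserving"
  and t: "(Y, t, Y') \<in> structured_1cells (arrow_twocat MCat) cloven cleavage_preserving"
  and c: "sbot s = stop t"
 shows "cleavage_preserving (cloven_cmp Y X) (sq_paste MCat t s) (cloven_cmp Y' X')"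
proof -
 have s': "X \<in> cloven" "X' \<in> cloven" "s \<in> sqs MCat" "sdom s = fst X" "scod s = fst X'" "cleavage_preserving X s X'"
  and t': "Y \<in> cloven" "Y' \<in> cloven" "t \<in> sqs MCat" "sdom t = fst Y" "scod t = fst Y'" "cleavage_preserving Y t Y'"
  using s t by (simp_all add: strict_1cell_iff)
 note sd = MCat_squareD[OF s'(3)] and td = MCat_squareD[OF t'(3)]
 have XY: "fcod (fst X) = fdom (fst Y)" "fcod (fst X') = fdom (fst Y')"
  using sd td c s' t' by simp_all
 have p: "sq_paste MCat t s \<in> sqs MCat"
  using MCat.sq_paste_1cell s'(3) t'(3) c by blast
 show ?thesis
  unfolding preserves_iff
 proof (intro allI impI)
  fix es f assume "lprob (fst (cloven_cmp Y X)) es f"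
  then have l: "lprob (mfcomp (fst Y) (fst X)) es f" by (simp add: cloven_cmp_def)
  note l1 = lifting_problem_second[OF s'(1) t'(1) XY(1) l]
  have es: "set es \<subseteq> mobj (fdom (fst X))" using l1(1) by (simp add: lifting_problem_def)
  have l': "lprob (mfcomp (fst Y') (fst X')) (map (fobj (stop s)) es) (farr (sbot t) f)"
   using lifting_problem_map[OF p, of es f] l s'(4,5) t'(4,5) by (simp add: sq_paste_def)
  have "map (fobj (stop t)) (map (fobj (fst X)) es) = map (fobj (fst X')) (map (fobj (stop s)) es)"
   using es sd(9) s'(4,5) c by auto
  then have "farr (stop s) (snd X (es, snd Y (map (fobj (fst X)) es, f))) =
    snd X' (map (fobj (stop s)) es, snd Y' (map (fobj (fst X')) (map (fobj (stop s)) es), farr (sbot t) f))"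
   using s'(6) t'(6) l1 c by (simp add: preserves_iff del: map_map)
  then show "farr (stop (sq_paste MCat t s)) (snd (cloven_cmp Y X) (es, f)) =
    snd (cloven_cmp Y' X') (map (fobj (stop (sq_paste MCat t s))) es, farr (sbot (sq_paste MCat t s)) f)"
   using l l' by (simp add: cloven_cmp_def sq_paste_def del: map_map)
 qed
qed

lemma cloven_eqI:
 assumes "X \<in> cloven" "Y \<in> cloven" "fst X = fst Y"
  "\<And>es f. lprob (fst X) es f ==> snd X (es, f) = snd Y (es, f)"
 shows "X = Y"
 using assms cleavage_eqI[of "fst X" "snd X" "snd Y"] by (auto simp: cloven_iff prod_eq_iff)

lemma structured_arrows_cloven:
 "structured_arrows MCat cloven cleavage_preserving cloven_idn cloven_cmp"
proof (unfold_locales, goal_cases)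
 case (1 X) then show ?case by (simp add: cloven_iff)
next
 case (2 X)
 then have X: "fst X \<in> funs" "cleavage (fst X) (snd X)" by (simp_all add: cloven_iff)
 interpret P: multifunctor "fst X" by (rule funsD[OF X(1)])
 show ?case
  unfolding preserves_iff
 proof (intro allI impI)
  fix es f assume l: "lprob (fst X) es f"
  have "snd X (es, f) \<in> marr (fdom (fst X))"
   using opcartD(1)[OF cleavageD[OF X(2) l] P.multifunctor_axioms] .
  moreover have "map (fobj (mfid (fdom (fst X)))) es = es"
   using l by (auto simp: lifting_problem_def intro!: map_idI)
  ultimately show "farr (stop (sq_id MCat (fst X))) (snd X (es, f)) =
    snd X (map (fobj (stop (sq_id MCat (fst X)))) es, farr (sbot (sq_id MCat (fst X))) f)"
   using l by (simp add: sq_id_def lifting_problem_def)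
 qed
next
 case (3 X s Y t Z)
 then have s: "s \<in> sqs MCat" "sdom s = fst X" "scod s = fst Y" "t \<in> sqs MCat" "sdom t = fst Y"
  "cleavage_preserving X s Y" "cleavage_preserving Y t Z" "X \<in> cloven"
  by (simp_all add: strict_1cell_iff)
 note d = MCat_squareD[OF s(1)]
 interpret P: multifunctor "fst X" using funsD(1)[OF d(1)] s(2) by simp
 show ?case
  unfolding preserves_iff
 proof (intro allI impI)
  fix es f assume l: "lprob (fst X) es f"
  have "snd X (es, f) \<in> marr (fdom (fst X))"
   using opcartD(1)[OF cleavageD[OF _ l] P.multifunctor_axioms] s(8) by (simp add: cloven_iff)
  moreover have "map (fobj (mfcomp (stop t) (stop s))) es = map (fobj (stop t)) (map (fobj (stop s)) es)"
   using l d s(2) by (auto simp: lifting_problem_def)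
  moreover have "lprob (fst Y) (map (fobj (stop s)) es) (farr (sbot s) f)"
   using lifting_problem_map[OF s(1)] l s(2,3) by simp
  ultimately show "farr (stop (sq_comp MCat t s)) (snd X (es, f)) =
    snd Z (map (fobj (stop (sq_comp MCat t s))) es, farr (sbot (sq_comp MCat t s)) f)"
   using l s d by (simp add: sq_comp_def preserves_iff lifting_problem_def del: map_map)
 qed
next
 case (4 A) then show ?case using cloven_idn[of A] by (simp add: cloven_idn_def)
next
 case (5 h)
 then have h: "h \<in> funs" by simp
 interpret h: multifunctor h by (rule funsD[OF h])
 show ?case
  using h.fobj_in h.farr_in by (auto simp: preserves_iff cloven_idn_def lifting_problem_id sq_vid_def)
next
 case (6 X Y) then show ?case using cloven_cmp[of X Y] by (simp add: cloven_cmp_def)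
next
 case (7 X s X' Y t Y') then show ?case by (rule cleavage_preserving_cmp)
next
 case (8 X)
 then have X: "fst X \<in> funs" by (simp add: cloven_iff)
 note D = funsD[OF X]
 have e: "fst (cloven_cmp (cloven_idn (fcod (fst X))) X) = fst X"
  using category.id_left'[OF category_MCat, of "fst X"] X by (simp add: cloven_cmp_def cloven_idn_def)
 have i: "cloven_idn (fcod (fst X)) \<in> cloven" "fcod (fst X) = fdom (fst (cloven_idn (fcod (fst X))))"
  using cloven_idn D by (simp_all add: cloven_idn_def)
 show ?case
 proof (rule cloven_eqI)
  fix es f assume "lprob (fst (cloven_cmp (cloven_idn (ccod MCat (fst X))) X)) es f"
  then have l: "lprob (fst X) es f" using e by simp
  then have l': "lprob (mfcomp (mfid (fcod (fst X))) (fst X)) es f"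
   using e by (simp add: cloven_cmp_def cloven_idn_def)
  have "lprob (mfid (fcod (fst X))) (map (fobj (fst X)) es) f"
   using lifting_problem_second(2)[OF 8 i, of es f] l' by (simp add: cloven_idn_def)
  then show "snd (cloven_cmp (cloven_idn (ccod MCat (fst X))) X) (es, f) = snd X (es, f)"
   using l' by (simp add: cloven_cmp_def cloven_idn_def)
 qed (use 8 e i cloven_cmp[OF 8 i] in simp_all)
next
 case (9 X)
 then have X: "fst X \<in> funs" by (simp add: cloven_iff)
 note D = funsD[OF X]
 have e: "fst (cloven_cmp X (cloven_idn (fdom (fst X)))) = fst X"
  using category.id_right'[OF category_MCat, of "fst X"] X by (simp add: cloven_cmp_def cloven_idn_def)
 have i: "cloven_idn (fdom (fst X)) \<in> cloven" "fcod (fst (cloven_idn (fdom (fst X)))) = fdom (fst X)"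
  using cloven_idn D by (simp_all add: cloven_idn_def)
 show ?case
 proof (rule cloven_eqI)
  fix es f assume "lprob (fst (cloven_cmp X (cloven_idn (cdom MCat (fst X))))) es f"
  then have l: "lprob (fst X) es f" using e by simp
  then have l': "lprob (mfcomp (fst X) (mfid (fdom (fst X)))) es f"
   using e by (simp add: cloven_cmp_def cloven_idn_def)
  have "map (fobj (mfid (fdom (fst X)))) es = es"
   using l by (auto simp: lifting_problem_def intro!: map_idI)
  moreover have "lprob (mfid (fdom (fst X))) es (snd X (map (fobj (mfid (fdom (fst X)))) es, f))"
   using lifting_problem_second(1)[OF i(1) 9 i(2), of es f] l' by (simp add: cloven_idn_def)
  ultimately show "snd (cloven_cmp X (cloven_idn (cdom MCat (fst X)))) (es, f) = snd X (es, f)"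
   using l' by (simp add: cloven_cmp_def cloven_idn_def)
 qed (use 9 e i cloven_cmp[OF i(1) 9 i(2)] in simp_all)
next
 case (10 X Y Z)
 then have c: "fcod (fst X) = fdom (fst Y)" "fcod (fst Y) = fdom (fst Z)"
  and S: "fst X \<in> funs" "fst Y \<in> funs" "fst Z \<in> funs"
  by (simp_all add: cloven_iff)
 have e: "mfcomp (mfcomp (fst Z) (fst Y)) (fst X) = mfcomp (fst Z) (mfcomp (fst Y) (fst X))"
  using category.assoc'[OF category_MCat, of "fst X" "fst Y" "fst Z"] S c by simp
 have YX: "cloven_cmp Y X \<in> cloven" "fst (cloven_cmp Y X) = mfcomp (fst Y) (fst X)"
  and ZY: "cloven_cmp Z Y \<in> cloven" "fst (cloven_cmp Z Y) = mfcomp (fst Z) (fst Y)"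
  using cloven_cmp[of X Y] cloven_cmp[of Y Z] 10 c by (simp_all add: cloven_cmp_def)
 show ?case
 proof (rule cloven_eqI)
  show "cloven_cmp (cloven_cmp Z Y) X \<in> cloven" "cloven_cmp Z (cloven_cmp Y X) \<in> cloven"
   using cloven_cmp[OF _ ZY(1)] cloven_cmp[OF YX(1)] 10 c YX(2) ZY(2) by simp_all
  show "fst (cloven_cmp (cloven_cmp Z Y) X) = fst (cloven_cmp Z (cloven_cmp Y X))"
   using e YX ZY by (simp add: cloven_cmp_def[of _ "cloven_cmp Y X"] cloven_cmp_def[of "cloven_cmp Z Y"])
  fix es f assume "lprob (fst (cloven_cmp (cloven_cmp Z Y) X)) es f"
  then have l: "lprob (mfcomp (fst (cloven_cmp Z Y)) (fst X)) es f"
   by (simp add: cloven_cmp_def)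
  then have l2: "lprob (mfcomp (fst Z) (fst (cloven_cmp Y X))) es f"
   using e YX ZY by simp
  have l3: "lprob (mfcomp (fst Z) (fst Y)) (map (fobj (fst X)) es) f"
   using lifting_problem_second(2)[OF 10(1) ZY(1) _ l] c ZY(2) by simp
  have "map (fobj (fst (cloven_cmp Y X))) es = map (fobj (fst Y)) (map (fobj (fst X)) es)"
   using l by (auto simp: lifting_problem_def YX)
  moreover from this have "lprob (mfcomp (fst Y) (fst X)) es
    (snd Z (map (fobj (fst Y)) (map (fobj (fst X)) es), f))"
   using lifting_problem_second(1)[OF YX(1) 10(3) _ l2] c YX(2) by (simp del: map_map)
  ultimately have "snd (cloven_cmp Z (cloven_cmp Y X)) (es, f) =
    snd X (es, snd Y (map (fobj (fst X)) es, snd Z (map (fobj (fst Y)) (map (fobj (fst X)) es), f)))"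
   using l2 by (simp add: cloven_cmp_def del: map_map)
  moreover have "snd (cloven_cmp (cloven_cmp Z Y) X) (es, f) =
    snd X (es, snd Y (map (fobj (fst X)) es, snd Z (map (fobj (fst Y)) (map (fobj (fst X)) es), f)))"
   using l l3 by (simp add: cloven_cmp_def del: map_map)
  ultimately show "snd (cloven_cmp (cloven_cmp Z Y) X) (es, f) = snd (cloven_cmp Z (cloven_cmp Y X)) (es, f)"
   by simp
 qed
qed

unbundle cardinal_syntax

section \<open>The free cloven opfibration\<close>

text \<open>\<open>Push os f\<close> is the codomain of the lift \<open>Lift os f\<close>, and \<open>Fill os f g w\<close> is the factorisation of
  \<open>g\<close> through \<open>Lift os f\<close> over \<open>w\<close>.\<close>

datatype 'u ob = In 'u | Push "'u ob list" 'u

datatype 'u tm = Gen 'u | Idn "'u ob" | Lift "'u ob list" 'u | Fill "'u ob list" 'u "'u tm" 'u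
 | Comp "'u tm" "'u tm list"

section \<open>Coding terms in the universe\<close>

primrec enc_list :: "('u => 'u => 'u) => (nat => 'u) => 'u list => 'u" where
 "enc_list p t [] = p (t 0) (t 0)"
| "enc_list p t (x # xs) = p (t 1) (p x (enc_list p t xs))"

text \<open>Here \<open>p\<close> is meant as a pairing and \<open>t\<close> as a supply of distinct
  tags, one for each constructor. Codes then stay inside any set that contains the tags and is
  closed under \<open>p\<close>.\<close>

primrec enc_ob :: "('u => 'u => 'u) => (nat => 'u) => 'u ob => 'u" where
 "enc_ob p t (In x) = p (t 0) x"
| "enc_ob p t (Push os f) = p (t 1) (p (enc_list p t (map (enc_ob p t) os)) f)"

primrec enc_tm :: "('u => 'u => 'u) => (nat => 'u) => 'u tm => 'u" where
 "enc_tm p t (Gen u) = p (t 0) u"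
| "enc_tm p t (Idn a) = p (t 1) (enc_ob p t a)"
| "enc_tm p t (Lift os f) = p (t 2) (p (enc_list p t (map (enc_ob p t) os)) f)"
| "enc_tm p t (Fill os f g w) =
  p (t 3) (p (enc_list p t (map (enc_ob p t) os)) (p f (p (enc_tm p t g) w)))"
| "enc_tm p t (Comp g gs) = p (t 4) (p (enc_tm p t g) (enc_list p t (map (enc_tm p t) gs)))"

text \<open>An injection of \<open>Z \<times> Z\<close> into the infinite set \<open>Z\<close>
  serves as pairing, a sequence in \<open>Z\<close> as tags. With \<open>Z\<close> the whole type
  this codes terms as elements of \<open>'u\<close>; with a smaller \<open>Z\<close> it bounds the
  number of terms over \<open>Z\<close>.\<close>

lemma encodings_exist:
 assumes "infinite (Z :: 'u set)"
 shows "\<exists>eo et. inj_on eo {a. set_ob a \<subseteq> Z} \<and> eo ` {a. set_ob a \<subseteq> Z} \<subseteq> Z \<and>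
  inj_on et {t. set_tm t \<subseteq> Z} \<and> et ` {t. set_tm t \<subseteq> Z} \<subseteq> Z"
proof -
 have "|Z \<times> Z| \<le>o |Z|" using card_of_Times_same_infinite[OF assms] ordIso_imp_ordLeq by blast
 then obtain q where q: "inj_on q (Z \<times> Z)" "q ` (Z \<times> Z) \<subseteq> Z" by (auto simp: card_of_ordLeq[symmetric])
 define p where "p = curry q"
 have pin: "p x y \<in> Z" if "x \<in> Z" "y \<in> Z" for x y using q that by (auto simp: p_def)
 have pinj: "p x y = p x' y' \<longleftrightarrow> x = x' \<and> y = y'" if "x \<in> Z" "y \<in> Z" "x' \<in> Z" "y' \<in> Z" for x y x' y'
  using q(1) that by (auto simp: p_def inj_on_def)
 obtain t :: "nat => 'u" where t: "inj t" "range t \<subseteq> Z" using infinite_countable_subset[OF assms] by blast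
 have tin: "t n \<in> Z" for n using t by auto
 have tinj: "t m = t n \<longleftrightarrow> m = n" for m n using t by (auto simp: inj_def)
 have lin: "enc_list p t xs \<in> Z" if "set xs \<subseteq> Z" for xs
  using that by (induction xs) (auto intro!: pin tin)
 have linj: "enc_list p t xs = enc_list p t ys ==> xs = ys" if "set xs \<subseteq> Z" "set ys \<subseteq> Z" for xs ys
  using that
 proof (induction xs arbitrary: ys)
  case Nil then show ?case by (cases ys) (auto simp: pinj pin tin lin tinj)
 next
  case (Cons x xs) then show ?case by (cases ys) (auto simp: pinj pin tin lin tinj)
 qed
 have oin: "enc_ob p t a \<in> Z" if "set_ob a \<subseteq> Z" for a
  using that by (induction a) (auto intro!: pin tin lin simp: SUP_le_iff)
 have olin: "enc_list p t (map (enc_ob p t) os) \<in> Z" if "\<Union> (set_ob ` set os) \<subseteq> Z" for os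
  using that by (intro lin) (auto intro!: oin)
 have oinj: "o' = o''" if "set_ob o' \<subseteq> Z" "set_ob o'' \<subseteq> Z" "enc_ob p t o' = enc_ob p t o''" for o' o''
  using that
 proof (induction o' arbitrary: o'')
  case (In x) then show ?case
   by (cases o'') (auto simp: pinj pin tin tinj olin SUP_le_iff)
 next
  case (Push os f)
  then obtain os' f' where o'': "o'' = Push os' f'"
   by (cases o'') (auto simp: pinj pin tin tinj olin SUP_le_iff)
  then have e: "enc_list p t (map (enc_ob p t) os) = enc_list p t (map (enc_ob p t) os')" "f = f'"
   using Push.prems by (auto simp: pinj pin tin tinj olin SUP_le_iff)
  have "map (enc_ob p t) os = map (enc_ob p t) os'"
   by (rule linj[OF _ _ e(1)]) (use Push.prems o'' in \<open>auto intro!: oin\<close>)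
  then have "os = os'"
  proof (rule list.inj_map_strong[rotated])
   fix z za assume "z \<in> set os" "za \<in> set os'" "enc_ob p t z = enc_ob p t za"
   then show "z = za" using Push.IH[of z za] Push.prems o'' by auto
  qed
  then show ?case using e o'' by simp
 qed
 have olinj: "os = os'" if "\<Union> (set_ob ` set os) \<subseteq> Z" "\<Union> (set_ob ` set os') \<subseteq> Z"
  "enc_list p t (map (enc_ob p t) os) = enc_list p t (map (enc_ob p t) os')" for os os'
 proof -
  have "map (enc_ob p t) os = map (enc_ob p t) os'"
   by (rule linj[OF _ _ that(3)]) (use that in \<open>auto intro!: oin\<close>)
  then show ?thesis
  proof (rule list.inj_map_strong[rotated])
   fix z za assume "z \<in> set os" "za \<in> set os'" "enc_ob p t z = enc_ob p t za"
   then show "z = za" using oinj[of z za] that by auto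
  qed
 qed
 have min: "enc_tm p t m \<in> Z" if "set_tm m \<subseteq> Z" for m
  using that by (induction m) (auto intro!: pin tin lin oin olin simp: SUP_le_iff)
 have mlin: "enc_list p t (map (enc_tm p t) ms) \<in> Z" if "\<Union> (set_tm ` set ms) \<subseteq> Z" for ms
  using that by (intro lin) (auto intro!: min)
 have minj: "m = m'" if "set_tm m \<subseteq> Z" "set_tm m' \<subseteq> Z" "enc_tm p t m = enc_tm p t m'" for m m'
  using that
 proof (induction m arbitrary: m')
  case (Gen u) then show ?case
   by (cases m') (auto simp: pinj pin tin tinj olin oin min mlin)
 next
  case (Idn x) then show ?case
   by (cases m') (auto simp: pinj pin tin tinj olin oin min mlin intro: oinj)
 next
  case (Lift os f) then show ?case
   by (cases m') (auto simp: pinj pin tin tinj olin oin min mlin intro: olinj)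
 next
  case (Fill os f g w) then show ?case
   by (cases m') (auto simp: pinj pin tin tinj olin oin min mlin intro: olinj)
 next
  case (Comp g gs)
  then obtain g' gs' where m': "m' = Comp g' gs'"
   by (cases m') (auto simp: pinj pin tin tinj olin oin min mlin)
  have s: "set_tm g \<subseteq> Z" "\<Union> (set_tm ` set gs) \<subseteq> Z" "set_tm g' \<subseteq> Z" "\<Union> (set_tm ` set gs') \<subseteq> Z"
   using Comp.prems by (auto simp: m')
  then have e: "enc_tm p t g = enc_tm p t g'"
   "enc_list p t (map (enc_tm p t) gs) = enc_list p t (map (enc_tm p t) gs')"
   using Comp.prems(3) by (simp_all add: m' pinj pin tin tinj min mlin)
  have "map (enc_tm p t) gs = map (enc_tm p t) gs'"
   by (rule linj[OF _ _ e(2)]) (use s in \<open>auto intro!: min\<close>)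
  then have "gs = gs'"
  proof (rule list.inj_map_strong[rotated])
   fix z za assume "z \<in> set gs" "za \<in> set gs'" "enc_tm p t z = enc_tm p t za"
   then show "z = za" using Comp.IH(2)[of z za] s by (auto simp: SUP_le_iff)
  qed
  then show ?case using Comp.IH(1)[OF s(1,3) e(1)] m' by simp
 qed
 show ?thesis
  using oin oinj min minj by (intro exI[of _ "enc_ob p t"] exI[of _ "enc_tm p t"]) (auto simp: inj_on_def)
qed

text \<open>A multicategory in \<open>MCat\<close> has elements of \<open>'u\<close> as objects and
  arrows, so terms have to be represented there. Any injective code will do.\<close>

definition ob_code :: "'u ob => 'u" where "ob_code = (SOME f. inj f)"
definition tm_code :: "'u tm => 'u" where "tm_code = (SOME f. inj f)"

text \<open>The free multicategory on a finite \<open>P\<close> can be countably infinite, as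
  \<open>Push\<close> may be iterated. Uncountability of the universe makes countable sets
  small.\<close>

locale uncountable_universe =
 fixes U :: "'u itself"
 assumes uncountable: "uncountable (UNIV :: 'u set)"
begin

lemma infinite_universe: "infinite (UNIV :: 'u set)"
 using uncountable uncountable_infinite by blast

lemma inj_ob_code: "inj (ob_code :: 'u ob => 'u)"
 unfolding ob_code_def using encodings_exist[OF infinite_universe]
 by (intro someI_ex[of inj]) (auto simp: inj_on_def inj_def)

lemma inj_tm_code: "inj (tm_code :: 'u tm => 'u)"
 unfolding tm_code_def using encodings_exist[OF infinite_universe]
 by (intro someI_ex[of inj]) (auto simp: inj_on_def inj_def)

lemma ob_code_eq [simp]: "ob_code (a :: 'u ob) = ob_code b \<longleftrightarrow> a = b"
 using inj_ob_code by (auto simp: inj_def)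

lemma map_ob_code_eq [simp]: "map ob_code (as :: 'u ob list) = map ob_code bs \<longleftrightarrow> as = bs"
 using inj_ob_code by (auto simp: inj_map_eq_map)

lemma small_Un: "small (A :: 'u set) ==> small B ==> small (A \<union> B)"
 using infinite_universe by (simp add: small_def card_of_Un_ordLess_infinite)

lemma small_countable:
 assumes "countable (A :: 'u set)"
 shows "small A"
proof (rule ccontr)
 assume "\<not> small A"
 then have "|UNIV :: 'u set| \<le>o |A|"
  unfolding small_def using ordLess_or_ordLeq card_of_Well_order by blast
 then obtain f where "inj_on f (UNIV :: 'u set)" "f ` UNIV \<subseteq> A"
  by (auto simp: card_of_ordLeq[symmetric])
 then have "countable (UNIV :: 'u set)"
  using assms by (meson countable_image_inj_on countable_subset)
 then show False using uncountable by simp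
qed

lemma small_terms:
 assumes "small (Z :: 'u set)" "infinite Z"
 shows "small ((f :: 'u ob => 'u) ` {a. set_ob a \<subseteq> Z})" "small ((g :: 'u tm => 'u) ` {t. set_tm t \<subseteq> Z})"
proof -
 obtain eo et where "inj_on eo {a. set_ob a \<subseteq> Z}" "eo ` {a. set_ob a \<subseteq> Z} \<subseteq> Z"
  "inj_on et {t. set_tm t \<subseteq> Z}" "et ` {t. set_tm t \<subseteq> Z} \<subseteq> Z"
  using encodings_exist[OF assms(2)] by blast
 then have "|{a. set_ob a \<subseteq> Z}| \<le>o |Z|" "|{t. set_tm t \<subseteq> Z}| \<le>o |Z|"
  by (auto simp: card_of_ordLeq[symmetric])
 then have c: "|f ` {a. set_ob a \<subseteq> Z}| \<le>o |Z|" "|g ` {t. set_tm t \<subseteq> Z}| \<le>o |Z|"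
  using card_of_image ordLeq_transitive by blast+
 show "small (f ` {a. set_ob a \<subseteq> Z})" "small (g ` {t. set_tm t \<subseteq> Z})"
  using ordLeq_ordLess_trans[OF c(1)] ordLeq_ordLess_trans[OF c(2)] assms(1) by (simp_all add: small_def)
qed

lemma small_subset: "small (B :: 'u set) ==> A \<subseteq> B ==> small A"
 unfolding small_def using card_of_mono1 ordLeq_ordLess_trans by blast

end

section \<open>Well-formed terms and their evaluation\<close>

fun ob_proj :: "('u, 'u) multifun => 'u ob => 'u" where
 "ob_proj P (In x) = fobj P x"
| "ob_proj P (Push os f) = mcod (fcod P) f"

text \<open>The detour through \<open>list_all id\<close> and \<open>map\<close> keeps the recursion
  through lists primitive; \<open>wf_ob_Push\<close> replaces it by a bounded quantifier. The same
  device is used in \<open>wf_tm\<close>.\<close>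

primrec wf_ob :: "('u, 'u) multifun => 'u ob => bool" where
 "wf_ob P (In x) \<longleftrightarrow> x \<in> mobj (fdom P)"
| "wf_ob P (Push os f) \<longleftrightarrow> list_all id (map (wf_ob P) os) \<and> f \<in> marr (fcod P) \<and>
  mdom (fcod P) f = map (ob_proj P) os"

lemma wf_ob_Push: "wf_ob P (Push os f) \<longleftrightarrow> (\<forall>a\<in>set os. wf_ob P a) \<and> f \<in> marr (fcod P) \<and>
  mdom (fcod P) f = map (ob_proj P) os"
 by (auto simp: list_all_iff)

primrec tm_cod :: "('u, 'u) multifun => 'u tm => 'u ob" where
 "tm_cod P (Gen u) = In (mcod (fdom P) u)"
| "tm_cod P (Idn a) = a"
| "tm_cod P (Lift os f) = Push os f"
| "tm_cod P (Fill os f g w) = tm_cod P g"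
| "tm_cod P (Comp g gs) = tm_cod P g"

primrec tm_dom :: "('u, 'u) multifun => 'u tm => 'u ob list" where
 "tm_dom P (Gen u) = map In (mdom (fdom P) u)"
| "tm_dom P (Idn a) = [a]"
| "tm_dom P (Lift os f) = os"
| "tm_dom P (Fill os f g w) = [Push os f]"
| "tm_dom P (Comp g gs) = concat (map (tm_dom P) gs)"

primrec tm_proj :: "('u, 'u) multifun => 'u tm => 'u" where
 "tm_proj P (Gen u) = farr P u"
| "tm_proj P (Idn a) = mident (fcod P) (ob_proj P a)"
| "tm_proj P (Lift os f) = f"
| "tm_proj P (Fill os f g w) = w"
| "tm_proj P (Comp g gs) = mcomp (fcod P) (tm_proj P g) (map (tm_proj P) gs)"

text \<open>A term \<open>Fill os f g w\<close> carries the factorisation problem that it solves.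
  Its last conjunct says that \<open>g\<close> lies over \<open>w\<close> after \<open>f\<close>,
  which is what provides a filler in every target.\<close>

primrec wf_tm :: "('u, 'u) multifun => 'u tm => bool" where
 "wf_tm P (Gen u) \<longleftrightarrow> u \<in> marr (fdom P)"
| "wf_tm P (Idn a) \<longleftrightarrow> wf_ob P a"
| "wf_tm P (Lift os f) \<longleftrightarrow> wf_ob P (Push os f)"
| "wf_tm P (Fill os f g w) \<longleftrightarrow> wf_ob P (Push os f) \<and> wf_tm P g \<and> tm_dom P g = os \<and> w \<in> marr (fcod P) \<and>
  mdom (fcod P) w = [mcod (fcod P) f] \<and> mcod (fcod P) w = ob_proj P (tm_cod P g) \<and>
  tm_proj P g = mcomp (fcod P) w [f]"
| "wf_tm P (Comp g gs) \<longleftrightarrow> wf_tm P g \<and> list_all id (map (wf_tm P) gs) \<and> map (tm_cod P) gs = tm_dom P g"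

lemma wf_tm_Comp: "wf_tm P (Comp g gs) \<longleftrightarrow> wf_tm P g \<and> (\<forall>t\<in>set gs. wf_tm P t) \<and> map (tm_cod P) gs = tm_dom P g"
 by (auto simp: list_all_iff)

declare wf_ob.simps(2) [simp del] wf_tm.simps(5) [simp del]
declare wf_ob_Push [simp] wf_tm_Comp [simp]

text \<open>A target consists of a cloven opfibration together with a square \<open>(h, k)\<close> from \<open>P\<close> to it.\<close>

type_synonym 'u target = "(('u, 'u) multifun \<times> ('u list \<times> 'u => 'u)) \<times> ('u, 'u) multifun \<times> ('u, 'u) multifun"

definition target :: "('u, 'u) multifun => 'u target => bool" where
 "target P = (\<lambda>(X, h, k). X \<in> cloven \<and> Sq P h k (fst X) \<in> sqs MCat)"

primrec ob_val :: "'u target => 'u ob => 'u" where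
 "ob_val \<tau> (In x) = fobj (fst (snd \<tau>)) x"
| "ob_val \<tau> (Push os f) = mcod (fdom (fst (fst \<tau>))) (snd (fst \<tau>) (map (ob_val \<tau>) os, farr (snd (snd \<tau>)) f))"

definition lift_val :: "'u target => 'u ob list => 'u => 'u" where
 "lift_val \<tau> os f = snd (fst \<tau>) (map (ob_val \<tau>) os, farr (snd (snd \<tau>)) f)"

text \<open>The description in the case of \<open>Fill\<close> denotes the factorisation through the
  chosen lift in the target; for well-formed terms it is justified by
  \<open>fill_ex1\<close>.\<close>

primrec tm_val :: "'u target => 'u tm => 'u" where
 "tm_val \<tau> (Gen u) = farr (fst (snd \<tau>)) u"
| "tm_val \<tau> (Idn a) = mident (fdom (fst (fst \<tau>))) (ob_val \<tau> a)"
| "tm_val \<tau> (Lift os f) = lift_val \<tau> os f"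
| "tm_val \<tau> (Fill os f g w) = (THE v. v \<in> marr (fdom (fst (fst \<tau>))) \<and>
  mdom (fdom (fst (fst \<tau>))) v = [ob_val \<tau> (Push os f)] \<and>
  mcod (fdom (fst (fst \<tau>))) v = mcod (fdom (fst (fst \<tau>))) (tm_val \<tau> g) \<and>
  mcomp (fdom (fst (fst \<tau>))) v [lift_val \<tau> os f] = tm_val \<tau> g \<and>
  farr (fst (fst \<tau>)) v = farr (snd (snd \<tau>)) w)"
| "tm_val \<tau> (Comp g gs) = mcomp (fdom (fst (fst \<tau>))) (tm_val \<tau> g) (map (tm_val \<tau>) gs)"

lemma ob_val_Push: "ob_val \<tau> (Push os f) = mcod (fdom (fst (fst \<tau>))) (lift_val \<tau> os f)"
 by (simp add: lift_val_def)

declare ob_val.simps(2) [simp del]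

locale arrow_in_MCat = uncountable_universe U for U :: "'u itself" +
 fixes P :: "('u, 'u) multifun"
 assumes P: "P \<in> funs"
begin

sublocale P: multifunctor P by (rule funsD[OF P])
sublocale E: multicategory "fdom P" by (rule funsD[OF P])
sublocale B: multicategory "fcod P" by (rule funsD[OF P])

lemma ob_proj_in: "wf_ob P a ==> ob_proj P a \<in> mobj (fcod P)"
 by (cases a) (auto intro: B.mcod_in)

lemma tm_typing:
 assumes "wf_tm P t"
 shows "(\<forall>a\<in>set (tm_dom P t). wf_ob P a) \<and> wf_ob P (tm_cod P t) \<and> tm_proj P t \<in> marr (fcod P) \<and>
  mdom (fcod P) (tm_proj P t) = map (ob_proj P) (tm_dom P t) \<and> mcod (fcod P) (tm_proj P t) = ob_proj P (tm_cod P t)"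
 using assms
proof (induction t)
 case (Gen u) then show ?case using E.mdom_in[of u] E.mcod_in[of u] by auto
next
 case (Comp g gs)
 have a: "set (map (tm_proj P) gs) \<subseteq> marr (fcod P)"
  using Comp by auto
 have "mcod (fcod P) (tm_proj P t) = ob_proj P (tm_cod P t)" if "t \<in> set gs" for t
  using Comp that by simp
 then have "map (mcod (fcod P)) (map (tm_proj P) gs) = map (ob_proj P) (map (tm_cod P) gs)"
  by simp
 then have b: "map (mcod (fcod P)) (map (tm_proj P) gs) = mdom (fcod P) (tm_proj P g)"
  using Comp by (simp del: map_map)
 have "concat (map (mdom (fcod P)) (map (tm_proj P) gs)) = map (ob_proj P) (concat (map (tm_dom P) gs))"
  using Comp by (auto simp: map_concat intro!: arg_cong[of _ _ concat])
 then show ?case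
  using Comp B.mcomp_arr[OF _ a b] B.mcomp_dom[OF _ a b] B.mcomp_cod[OF _ a b] by auto
qed (auto simp: ob_proj_in)

context
 fixes Q c h k
 assumes target: "target P ((Q, c), h, k)"
begin

abbreviation "tgt \<equiv> ((Q, c), h, k)"

lemma target_facts:
 shows "cleavage Q c" "Q \<in> funs" "h \<in> funs" "k \<in> funs"
  "fdom h = fdom P" "fcod h = fdom Q" "fdom k = fcod P" "fcod k = fcod Q"
  "\<And>x. x \<in> mobj (fdom P) ==> fobj Q (fobj h x) = fobj k (fobj P x)"
  "\<And>u. u \<in> marr (fdom P) ==> farr Q (farr h u) = farr k (farr P u)"
 using target MCat_squareD[of "Sq P h k Q"] by (auto simp: target_def cloven_iff)

interpretation Q: multifunctor Q by (rule funsD[OF target_facts(2)])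
interpretation D: multicategory "fdom Q" by (rule funsD[OF target_facts(2)])
interpretation A: multicategory "fcod Q" by (rule funsD[OF target_facts(2)])
interpretation h: multifunctor h by (rule funsD[OF target_facts(3)])
interpretation k: multifunctor k by (rule funsD[OF target_facts(4)])

lemma k_facts:
 "f \<in> marr (fcod P) ==> farr k f \<in> marr (fcod Q) \<and> mdom (fcod Q) (farr k f) = map (fobj k) (mdom (fcod P) f) \<and>
  mcod (fcod Q) (farr k f) = fobj k (mcod (fcod P) f)"
 "g \<in> marr (fcod P) ==> set fs \<subseteq> marr (fcod P) ==> map (mcod (fcod P)) fs = mdom (fcod P) g ==>
  farr k (mcomp (fcod P) g fs) = mcomp (fcod Q) (farr k g) (map (farr k) fs)"
 "x \<in> mobj (fcod P) ==> farr k (mident (fcod P) x) = mident (fcod Q) (fobj k x)"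
 using k.farr_in[of f] k.farr_comp[of g fs] k.farr_mident[of x] target_facts(7,8) by simp_all

text \<open>The typing of the inputs is a premise, because the lemma serves in the induction that
  establishes this typing.\<close>

lemma lift_val_opcartesian:
 assumes "wf_ob P (Push os f)" "\<forall>a\<in>set os. ob_val tgt a \<in> mobj (fdom Q) \<and> fobj Q (ob_val tgt a) = fobj k (ob_proj P a)"
 shows "opcart Q (map (ob_val tgt) os) (farr k f) (lift_val tgt os f)"
proof -
 have "map (fobj Q) (map (ob_val tgt) os) = map (fobj k) (map (ob_proj P) os)"
  using assms(2) by auto
 then have "lprob Q (map (ob_val tgt) os) (farr k f)"
  using assms k_facts(1)[of f] by (auto simp: lifting_problem_def)
 then show ?thesis
  using cleavageD[OF target_facts(1)] by (simp add: lift_val_def)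
qed

lemma ob_val_typing: "wf_ob P a ==> ob_val tgt a \<in> mobj (fdom Q) \<and> fobj Q (ob_val tgt a) = fobj k (ob_proj P a)"
proof (induction a)
 case (In x) then show ?case using h.fobj_in[of x] target_facts(5,6,9) by simp
next
 case (Push os f)
 then have "opcart Q (map (ob_val tgt) os) (farr k f) (lift_val tgt os f)"
  by (intro lift_val_opcartesian) auto
 note l = opcartD[OF this Q.multifunctor_axioms]
 show ?case
  using D.mcod_in[OF l(1)] l(4) k_facts(1)[of f] Push.prems by (simp add: ob_val_Push)
qed

lemma lift_val:
 assumes "wf_ob P (Push os f)"
 shows "opcart Q (map (ob_val tgt) os) (farr k f) (lift_val tgt os f)"
  "lift_val tgt os f \<in> marr (fdom Q)" "mdom (fdom Q) (lift_val tgt os f) = map (ob_val tgt) os"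
  "mcod (fdom Q) (lift_val tgt os f) = ob_val tgt (Push os f)" "farr Q (lift_val tgt os f) = farr k f"
proof -
 show o: "opcart Q (map (ob_val tgt) os) (farr k f) (lift_val tgt os f)"
  using assms ob_val_typing by (intro lift_val_opcartesian) auto
 from opcartD[OF o Q.multifunctor_axioms]
 show "lift_val tgt os f \<in> marr (fdom Q)" "mdom (fdom Q) (lift_val tgt os f) = map (ob_val tgt) os"
  "mcod (fdom Q) (lift_val tgt os f) = ob_val tgt (Push os f)" "farr Q (lift_val tgt os f) = farr k f"
  by (simp_all add: ob_val_Push)
qed

text \<open>The typing of the value of \<open>g\<close> is again a premise, supplied by the
  induction hypothesis in \<open>tm_val_typing\<close>.\<close>

lemma fill_ex1:
 assumes wf: "wf_tm P (Fill os f g w)"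
  and g: "tm_val tgt g \<in> marr (fdom Q)" "mdom (fdom Q) (tm_val tgt g) = map (ob_val tgt) (tm_dom P g)"
   "mcod (fdom Q) (tm_val tgt g) = ob_val tgt (tm_cod P g)" "farr Q (tm_val tgt g) = farr k (tm_proj P g)"
 shows "\<exists>!v. v \<in> marr (fdom Q) \<and> mdom (fdom Q) v = [ob_val tgt (Push os f)] \<and>
  mcod (fdom Q) v = mcod (fdom Q) (tm_val tgt g) \<and> mcomp (fdom Q) v [lift_val tgt os f] = tm_val tgt g \<and>
  farr Q v = farr k w"
proof -
 have p: "wf_ob P (Push os f)" using wf by simp
 show ?thesis
  unfolding lift_val(4)[OF p, symmetric]
 proof (rule opcart_ex1[OF lift_val(1)[OF p]])
  show "farr Q (tm_val tgt g) = mcomp (fcod Q) (farr k w) [farr k f]"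
   using g(4) wf k_facts(2)[of w "[f]"] by simp
 qed (use wf g k_facts(1)[of w] k_facts(1)[of f] ob_val_typing[of "tm_cod P g"] tm_typing[of g] in simp_all)
qed

lemma tm_val_typing:
 "wf_tm P t ==> tm_val tgt t \<in> marr (fdom Q) \<and> mdom (fdom Q) (tm_val tgt t) = map (ob_val tgt) (tm_dom P t) \<and>
  mcod (fdom Q) (tm_val tgt t) = ob_val tgt (tm_cod P t) \<and> farr Q (tm_val tgt t) = farr k (tm_proj P t)"
proof (induction t)
 case (Gen u) then show ?case using h.farr_in[of u] target_facts(5,6,10) by simp
next
 case (Idn a) then show ?case using ob_val_typing[of a] ob_proj_in[of a] k_facts(3) by simp
next
 case (Lift os f) then show ?case using lift_val[of os f] by simp
next
 case (Fill os f g w)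
 from Fill.prems have "wf_tm P g" by simp
 from theI'[OF fill_ex1[OF Fill.prems]] Fill.IH[OF this] show ?case
  by (simp add: ob_val_Push lift_val(4))
next
 case (Comp g gs)
 have g: "tm_val tgt g \<in> marr (fdom Q)" "mdom (fdom Q) (tm_val tgt g) = map (ob_val tgt) (map (tm_cod P) gs)"
  using Comp by auto
 have a: "set (map (tm_val tgt) gs) \<subseteq> marr (fdom Q)" using Comp by auto
 have b: "map (mcod (fdom Q)) (map (tm_val tgt) gs) = mdom (fdom Q) (tm_val tgt g)"
 proof -
  have "mcod (fdom Q) (tm_val tgt t) = ob_val tgt (tm_cod P t)" if "t \<in> set gs" for t
   using Comp that by simp
  then show ?thesis unfolding g(2) by simp
 qed
 have c: "concat (map (mdom (fdom Q)) (map (tm_val tgt) gs)) = map (ob_val tgt) (concat (map (tm_dom P) gs))"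
  using Comp by (auto simp: map_concat intro!: arg_cong[of _ _ concat])
 have d: "map (farr Q) (map (tm_val tgt) gs) = map (farr k) (map (tm_proj P) gs)"
  using Comp by auto
 have t: "set (map (tm_proj P) gs) \<subseteq> marr (fcod P)" "tm_proj P g \<in> marr (fcod P)"
  using Comp.prems tm_typing by auto
 have "map (mcod (fcod P)) (map (tm_proj P) gs) = map (ob_proj P) (map (tm_cod P) gs)"
 proof -
  have "mcod (fcod P) (tm_proj P t) = ob_proj P (tm_cod P t)" if "t \<in> set gs" for t
   using Comp.prems that tm_typing[of t] by simp
  then show ?thesis by simp
 qed
 then have "map (mcod (fcod P)) (map (tm_proj P) gs) = mdom (fcod P) (tm_proj P g)"
  using Comp.prems tm_typing[of g] by (simp del: map_map)
 from k_facts(2)[OF t(2,1) this] Q.farr_comp[OF g(1) a b]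
 have "farr Q (tm_val tgt (Comp g gs)) = farr k (tm_proj P (Comp g gs))"
  using d Comp by (simp del: map_map)
 then show ?case
  using Comp D.mcomp_arr[OF g(1) a b] D.mcomp_dom[OF g(1) a b] D.mcomp_cod[OF g(1) a b] c by (simp del: map_map)
qed

lemma fill_val:
 assumes "wf_tm P (Fill os f g w)"
 shows "mcomp (fdom Q) (tm_val tgt (Fill os f g w)) [lift_val tgt os f] = tm_val tgt g"
proof -
 from assms have "wf_tm P g" by simp
 from theI'[OF fill_ex1[OF assms]] tm_val_typing[OF this] show ?thesis
  by (simp add: ob_val_Push lift_val(4))
qed

end

end

text \<open>Terms are identified when every target evaluates them equally. Compared with the congruence
  generated by the axioms, this makes the required equations immediate, and only the uniqueness of
  functors out of the quotient needs an induction on terms.\<close>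

definition tm_eqv :: "('u, 'u) multifun => 'u tm => 'u tm => bool" where
 "tm_eqv P s t \<longleftrightarrow> wf_tm P s \<and> wf_tm P t \<and> tm_dom P s = tm_dom P t \<and> tm_cod P s = tm_cod P t \<and>
  tm_proj P s = tm_proj P t \<and> (\<forall>\<tau>. target P \<tau> \<longrightarrow> tm_val \<tau> s = tm_val \<tau> t)"

text \<open>A class of terms is not an element of \<open>'u\<close>; the code of a representative
  chosen uniformly for the whole class takes its place.\<close>

definition cls :: "('u, 'u) multifun => 'u tm => 'u" where
 "cls P t = tm_code (SOME s. tm_eqv P s t)"

definition repr :: "('u, 'u) multifun => 'u => 'u tm" where
 "repr P m = (SOME t. wf_tm P t \<and> cls P t = m)"

definition ob_decode :: "'u => 'u ob" where "ob_decode = inv ob_code"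

section \<open>The free multicategory and its cloven opfibration\<close>

definition free_multicat :: "('u, 'u) multifun => ('u, 'u) multicat" where
 "free_multicat P = (let obs = ob_code ` {a. wf_ob P a}; ars = cls P ` {t. wf_tm P t};
  md = (\<lambda>m\<in>ars. map ob_code (tm_dom P (repr P m))); mc = (\<lambda>m\<in>ars. ob_code (tm_cod P (repr P m)))
 in \<lparr>mobj = obs, marr = ars, mdom = md, mcod = mc, mident = (\<lambda>y\<in>obs. cls P (Idn (ob_decode y))),
  mcomp = (\<lambda>g fs. if g \<in> ars \<and> set fs \<subseteq> ars \<and> map mc fs = md g
   then cls P (Comp (repr P g) (map (repr P) fs)) else undefined)\<rparr>)"

definition free_L :: "('u, 'u) multifun => ('u, 'u) multifun" where
 "free_L P = \<lparr>fdom = fdom P, fcod = free_multicat P, fobj = (\<lambda>x\<in>mobj (fdom P). ob_code (In x)),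
  farr = (\<lambda>u\<in>marr (fdom P). cls P (Gen u))\<rparr>"

definition free_R :: "('u, 'u) multifun => ('u, 'u) multifun" where
 "free_R P = \<lparr>fdom = free_multicat P, fcod = fcod P,
  fobj = (\<lambda>y\<in>mobj (free_multicat P). ob_proj P (ob_decode y)),
  farr = (\<lambda>m\<in>marr (free_multicat P). tm_proj P (repr P m))\<rparr>"

definition free_cloven :: "('u, 'u) multifun => ('u, 'u) multifun \<times> ('u list \<times> 'u => 'u)" where
 "free_cloven P = (free_R P, \<lambda>(es, f)\<in>{(es, f). lprob (free_R P) es f}.
  cls P (Lift (map ob_decode es) f))"

definition free_ext :: "('u, 'u) multifun => 'u target => ('u, 'u) multifun" where
 "free_ext P \<tau> = \<lparr>fdom = free_multicat P, fcod = fdom (fst (fst \<tau>)),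
  fobj = (\<lambda>y\<in>mobj (free_multicat P). ob_val \<tau> (ob_decode y)),
  farr = (\<lambda>m\<in>marr (free_multicat P). tm_val \<tau> (repr P m))\<rparr>"

context arrow_in_MCat
begin

lemma ob_decode [simp]: "ob_decode (ob_code (a :: 'u ob)) = a"
 using inj_ob_code by (simp add: ob_decode_def)

lemma val_multicat: "target P \<tau> ==> multicategory (fdom (fst (fst \<tau>)))"
 using funsD(4) by (auto simp: target_def cloven_iff split: prod.splits)

lemma val_multifun: "target P \<tau> ==> multifunctor (fst (fst \<tau>))"
 using funsD(1) by (auto simp: target_def cloven_iff split: prod.splits)

lemma val_ob: "target P \<tau> ==> wf_ob P a ==> ob_val \<tau> a \<in> mobj (fdom (fst (fst \<tau>)))"
 "target P \<tau> ==> wf_ob P a ==> fobj (fst (fst \<tau>)) (ob_val \<tau> a) = fobj (snd (snd \<tau>)) (ob_proj P a)"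
 using ob_val_typing by (cases \<tau>; auto)+

lemma val_tm:
 assumes "target P \<tau>" "wf_tm P t"
 shows "tm_val \<tau> t \<in> marr (fdom (fst (fst \<tau>)))"
  and "mdom (fdom (fst (fst \<tau>))) (tm_val \<tau> t) = map (ob_val \<tau>) (tm_dom P t)"
  and "mcod (fdom (fst (fst \<tau>))) (tm_val \<tau> t) = ob_val \<tau> (tm_cod P t)"
  and "farr (fst (fst \<tau>)) (tm_val \<tau> t) = farr (snd (snd \<tau>)) (tm_proj P t)"
 using assms tm_val_typing by (cases \<tau>; auto)+

lemma val_lift:
 assumes "target P \<tau>" "wf_ob P (Push os f)"
 shows "opcart (fst (fst \<tau>)) (map (ob_val \<tau>) os) (farr (snd (snd \<tau>)) f) (lift_val \<tau> os f)"
  and "mcod (fdom (fst (fst \<tau>))) (lift_val \<tau> os f) = ob_val \<tau> (Push os f)"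
 using assms lift_val by (cases \<tau>; auto)+

lemma val_fill:
 assumes "target P \<tau>" "wf_tm P (Fill os f g w)"
 shows "mcomp (fdom (fst (fst \<tau>))) (tm_val \<tau> (Fill os f g w)) [lift_val \<tau> os f] = tm_val \<tau> g"
 using assms fill_val by (cases \<tau>; auto)+

lemmas dom_wf = tm_typing[THEN conjunct1, rule_format]
lemmas cod_wf = tm_typing[THEN conjunct2, THEN conjunct1]
lemmas proj_arr = tm_typing[THEN conjunct2, THEN conjunct2, THEN conjunct1]
lemmas proj_dom = tm_typing[THEN conjunct2, THEN conjunct2, THEN conjunct2, THEN conjunct1]
lemmas proj_cod = tm_typing[THEN conjunct2, THEN conjunct2, THEN conjunct2, THEN conjunct2]

lemma eqvI:
 assumes "wf_tm P s" "wf_tm P t" "tm_dom P s = tm_dom P t" "tm_cod P s = tm_cod P t" "tm_proj P s = tm_proj P t"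
  "\<And>\<tau>. target P \<tau> ==> tm_val \<tau> s = tm_val \<tau> t"
 shows "tm_eqv P s t"
 unfolding tm_eqv_def using assms by blast

lemma eqv_val: "tm_eqv P s t ==> target P \<tau> ==> tm_val \<tau> s = tm_val \<tau> t"
 unfolding tm_eqv_def by blast

lemma eqv_refl: "wf_tm P t ==> tm_eqv P t t"
 by (simp add: tm_eqv_def)

lemma eqv_sym: "tm_eqv P s t ==> tm_eqv P t s"
 by (simp add: tm_eqv_def)

lemma eqv_trans: "tm_eqv P r s ==> tm_eqv P s t ==> tm_eqv P r t"
 by (simp add: tm_eqv_def)

lemma eqv_wf: "tm_eqv P s t ==> wf_tm P s" "tm_eqv P s t ==> wf_tm P t"
 by (simp_all add: tm_eqv_def)

text \<open>Equivalent terms satisfy the same predicate under \<open>SOME\<close>, hence share the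
  representative. Conversely a common representative is equivalent to both.\<close>

lemma cls_eq_iff:
 assumes "wf_tm P s" "wf_tm P t"
 shows "cls P s = cls P t \<longleftrightarrow> tm_eqv P s t"
proof
 have e: "tm_eqv P (SOME s'. tm_eqv P s' s) s" "tm_eqv P (SOME s'. tm_eqv P s' t) t"
  using eqv_refl assms by (blast intro: someI[of "\<lambda>s'. tm_eqv P s' _"])+
 assume "cls P s = cls P t"
 then have "(SOME s'. tm_eqv P s' s) = (SOME s'. tm_eqv P s' t)"
  using inj_tm_code by (simp add: cls_def inj_eq)
 then show "tm_eqv P s t"
  using e by (metis eqv_sym eqv_trans)
next
 assume "tm_eqv P s t"
 then have "(\<lambda>s'. tm_eqv P s' s) = (\<lambda>s'. tm_eqv P s' t)"
  using eqv_sym eqv_trans by blast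
 then show "cls P s = cls P t" by (simp add: cls_def)
qed

lemma eqv_Comp:
 assumes g: "tm_eqv P g g'" and gs: "list_all2 (tm_eqv P) gs gs'" and wf: "wf_tm P (Comp g gs)"
 shows "tm_eqv P (Comp g gs) (Comp g' gs')"
proof -
 have m: "map (tm_cod P) gs = map (tm_cod P) gs'" "map (tm_dom P) gs = map (tm_dom P) gs'"
  "map (tm_proj P) gs = map (tm_proj P) gs'" "\<forall>t\<in>set gs'. wf_tm P t"
  "\<forall>\<tau>. target P \<tau> \<longrightarrow> map (tm_val \<tau>) gs = map (tm_val \<tau>) gs'"
  using gs by (induction rule: list_all2_induct) (simp_all add: tm_eqv_def)
 show ?thesis
  using g wf m unfolding tm_eqv_def by (simp del: map_eq_conv)
qed

lemma repr:
 assumes "m \<in> cls P ` {t. wf_tm P t}"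
 shows "wf_tm P (repr P m)" "cls P (repr P m) = m"
proof -
 have "\<exists>t. wf_tm P t \<and> cls P t = m" using assms by auto
 from someI_ex[OF this] show "wf_tm P (repr P m)" "cls P (repr P m) = m"
  by (simp_all add: repr_def)
qed

lemma repr_cls: "wf_tm P t ==> tm_eqv P (repr P (cls P t)) t"
 using repr[of "cls P t"] cls_eq_iff by auto

lemma repr_cls_simps [simp]:
 assumes "wf_tm P t"
 shows "wf_tm P (repr P (cls P t))" "tm_dom P (repr P (cls P t)) = tm_dom P t"
  "tm_cod P (repr P (cls P t)) = tm_cod P t" "tm_proj P (repr P (cls P t)) = tm_proj P t"
  "target P \<tau> ==> tm_val \<tau> (repr P (cls P t)) = tm_val \<tau> t"
 using repr_cls[OF assms] eqv_val[OF repr_cls[OF assms]] by (simp_all add: tm_eqv_def)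

abbreviation "K \<equiv> free_multicat P"

lemma mobj_K: "mobj K = ob_code ` {a. wf_ob P a}"
 and marr_K: "marr K = cls P ` {t. wf_tm P t}"
 by (simp_all add: free_multicat_def Let_def)

lemma K_simps [simp]:
 "ob_code a \<in> mobj K \<longleftrightarrow> wf_ob P a" "wf_tm P t ==> cls P t \<in> marr K"
 "wf_tm P t ==> mdom K (cls P t) = map ob_code (tm_dom P t)"
 "wf_tm P t ==> mcod K (cls P t) = ob_code (tm_cod P t)"
 "wf_ob P a ==> mident K (ob_code a) = cls P (Idn a)"
 by (auto simp: free_multicat_def Let_def)

lemma marr_KE:
 assumes "m \<in> marr K"
 obtains t where "wf_tm P t" "m = cls P t"
 using assms by (auto simp: marr_K)

lemma marr_K_list:
 assumes "set ms \<subseteq> marr K"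
 obtains ts where "\<forall>t\<in>set ts. wf_tm P t" "ms = map (cls P) ts"
proof
 show "\<forall>t\<in>set (map (repr P) ms). wf_tm P t" using assms repr by (auto simp: marr_K)
 show "ms = map (cls P) (map (repr P) ms)" using assms repr by (auto simp: marr_K subset_iff intro!: map_idI[symmetric])
qed

lemma mobj_K_list:
 assumes "set ys \<subseteq> mobj K"
 obtains as where "\<forall>a\<in>set as. wf_ob P a" "ys = map ob_code as"
proof
 show "\<forall>a\<in>set (map ob_decode ys). wf_ob P a" using assms by (auto simp: mobj_K)
 show "ys = map ob_code (map ob_decode ys)" using assms by (auto simp: mobj_K subset_iff intro!: map_idI[symmetric])
qed

lemma composable_K:
 assumes "wf_tm P g" "\<forall>t\<in>set gs. wf_tm P t"
 shows "composable K (cls P g) (map (cls P) gs) \<longleftrightarrow> wf_tm P (Comp g gs)"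
proof -
 have "map (mcod K) (map (cls P) gs) = map ob_code (map (tm_cod P) gs)"
  using assms by simp
 moreover have "map ob_code (map (tm_cod P) gs) = map ob_code (tm_dom P g) \<longleftrightarrow> map (tm_cod P) gs = tm_dom P g"
  by (rule map_ob_code_eq)
 ultimately show ?thesis
  using assms by (auto simp: composable_def simp del: map_map)
qed

lemma mcomp_K:
 assumes "wf_tm P (Comp g gs)"
 shows "mcomp K (cls P g) (map (cls P) gs) = cls P (Comp g gs)"
proof -
 have wf: "wf_tm P g" "\<forall>t\<in>set gs. wf_tm P t" using assms by simp_all
 have "list_all2 (tm_eqv P) gs (map (repr P) (map (cls P) gs))"
  using wf(2) repr_cls eqv_sym by (auto simp: list.rel_map intro!: list.rel_refl_strong)
 then have e: "tm_eqv P (Comp g gs) (Comp (repr P (cls P g)) (map (repr P) (map (cls P) gs)))"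
  using eqv_Comp assms repr_cls eqv_sym wf(1) by blast
 have "composable K (cls P g) (map (cls P) gs)" using composable_K wf assms by blast
 then have "mcomp K (cls P g) (map (cls P) gs) = cls P (Comp (repr P (cls P g)) (map (repr P) (map (cls P) gs)))"
  by (simp add: composable_def free_multicat_def Let_def)
 then show ?thesis
  using e cls_eq_iff assms eqv_wf by metis
qed

lemma mcomp_K1:
 "wf_tm P g ==> wf_tm P t ==> tm_dom P g = [tm_cod P t] ==> mcomp K (cls P g) [cls P t] = cls P (Comp g [t])"
 using mcomp_K[of g "[t]"] by simp

lemma eqv_ident_right:
 assumes t: "wf_tm P t"
 shows "tm_eqv P (Comp t (map Idn (tm_dom P t))) t"
proof -
 have wf: "wf_tm P (Comp t (map Idn (tm_dom P t)))"
  using t dom_wf[OF t] by (auto simp: comp_def)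
 have d: "concat (map (\<lambda>a. [a]) as) = as" for as :: "'u ob list" by (induction as) auto
 have "mcomp (fcod P) (tm_proj P t) (map (\<lambda>a. mident (fcod P) (ob_proj P a)) (tm_dom P t)) = tm_proj P t"
  using B.mcomp_mident_right[OF proj_arr[OF t]] proj_dom[OF t] by (simp add: comp_def)
 moreover have "mcomp (fdom (fst (fst \<tau>))) (tm_val \<tau> t) (map (\<lambda>a. mident (fdom (fst (fst \<tau>))) (ob_val \<tau> a)) (tm_dom P t)) =
   tm_val \<tau> t" if "target P \<tau>" for \<tau>
  using multicategory.mcomp_mident_right[OF val_multicat[OF that] val_tm(1)[OF that t]] val_tm(2)[OF that t]
  by (simp add: comp_def)
 ultimately show ?thesis
  using wf t by (auto simp: tm_eqv_def comp_def d)
qed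

lemma eqv_ident_left:
 assumes t: "wf_tm P t"
 shows "tm_eqv P (Comp (Idn (tm_cod P t)) [t]) t"
proof (rule eqvI)
 show "tm_val \<tau> (Comp (Idn (tm_cod P t)) [t]) = tm_val \<tau> t" if "target P \<tau>" for \<tau>
  using multicategory.mcomp_mident_left[OF val_multicat[OF that] val_tm(1)[OF that t]] val_tm(3)[OF that t] by simp
qed (use t cod_wf[OF t] proj_arr[OF t] proj_cod[OF t] B.mcomp_mident_left[of "tm_proj P t"] in simp_all)

lemma wf_Comp_typing:
 assumes "wf_tm P (Comp g gs)"
 shows "composable (fcod P) (tm_proj P g) (map (tm_proj P) gs)"
  "target P \<tau> ==> composable (fdom (fst (fst \<tau>))) (tm_val \<tau> g) (map (tm_val \<tau>) gs)"
proof -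
 have wf: "wf_tm P g" "\<And>t. t \<in> set gs ==> wf_tm P t" and c: "map (tm_cod P) gs = tm_dom P g"
  using assms by auto
 have "map (mcod (fcod P)) (map (tm_proj P) gs) = map (ob_proj P) (map (tm_cod P) gs)"
  using wf(2) proj_cod by simp
 then show "composable (fcod P) (tm_proj P g) (map (tm_proj P) gs)"
  using wf proj_arr proj_dom[OF wf(1)] c by (auto simp: composable_def simp del: map_map)
 assume \<tau>: "target P \<tau>"
 have "map (mcod (fdom (fst (fst \<tau>)))) (map (tm_val \<tau>) gs) = map (ob_val \<tau>) (map (tm_cod P) gs)"
  using wf(2) val_tm(3)[OF \<tau>] by simp
 then show "composable (fdom (fst (fst \<tau>))) (tm_val \<tau> g) (map (tm_val \<tau>) gs)"
  using wf val_tm(1)[OF \<tau>] val_tm(2)[OF \<tau> wf(1)] c by (auto simp: composable_def simp del: map_map)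
qed

text \<open>Apart from the boundaries, the law is read off twice: in the base for
  \<open>tm_proj\<close> and in each target for \<open>tm_val\<close>.\<close>

lemma eqv_assoc:
 assumes h: "wf_tm P (Comp h gs)" and gs: "list_all2 (\<lambda>g ts. wf_tm P (Comp g ts)) gs tss"
 shows "tm_eqv P (Comp (Comp h gs) (concat tss)) (Comp h (map2 Comp gs tss))"
proof -
 have m: "map (tm_cod P) (concat tss) = concat (map (tm_dom P) gs)" "\<forall>t\<in>set (concat tss). wf_tm P t"
  "\<forall>t\<in>set (map2 Comp gs tss). wf_tm P t" "map (tm_cod P) (map2 Comp gs tss) = map (tm_cod P) gs"
  "concat (map (tm_dom P) (concat tss)) = concat (map (tm_dom P) (map2 Comp gs tss))"
  "map (tm_proj P) (map2 Comp gs tss) = map2 (mcomp (fcod P)) (map (tm_proj P) gs) (map (map (tm_proj P)) tss)"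
  "\<And>\<tau>. map (tm_val \<tau>) (map2 Comp gs tss) =
   map2 (mcomp (fdom (fst (fst \<tau>)))) (map (tm_val \<tau>) gs) (map (map (tm_val \<tau>)) tss)"
  using gs by (induction rule: list_all2_induct) auto
 have "list_all2 (composable (fcod P)) (map (tm_proj P) gs) (map (map (tm_proj P)) tss)"
  unfolding list.rel_map by (rule list_all2_mono[OF gs]) (rule wf_Comp_typing(1))
 from B.mcomp_assoc[OF wf_Comp_typing(1)[OF h] this]
 have p: "mcomp (fcod P) (mcomp (fcod P) (tm_proj P h) (map (tm_proj P) gs)) (map (tm_proj P) (concat tss)) =
   mcomp (fcod P) (tm_proj P h) (map (tm_proj P) (map2 Comp gs tss))"
  by (simp only: m(6) map_concat)
 have v: "mcomp (fdom (fst (fst \<tau>))) (mcomp (fdom (fst (fst \<tau>))) (tm_val \<tau> h) (map (tm_val \<tau>) gs)) (map (tm_val \<tau>) (concat tss)) =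
   mcomp (fdom (fst (fst \<tau>))) (tm_val \<tau> h) (map (tm_val \<tau>) (map2 Comp gs tss))" if \<tau>: "target P \<tau>" for \<tau>
 proof -
  have "list_all2 (composable (fdom (fst (fst \<tau>)))) (map (tm_val \<tau>) gs) (map (map (tm_val \<tau>)) tss)"
   unfolding list.rel_map by (rule list_all2_mono[OF gs]) (rule wf_Comp_typing(2)[OF _ \<tau>])
  from multicategory.mcomp_assoc[OF val_multicat[OF \<tau>] wf_Comp_typing(2)[OF h \<tau>] this]
  show ?thesis by (simp only: m(7) map_concat)
 qed
 show ?thesis
 proof (rule eqvI)
  show "wf_tm P (Comp (Comp h gs) (concat tss))" using h m(1,2) by simp
  show "wf_tm P (Comp h (map2 Comp gs tss))" using h m(3,4) by (simp only: wf_tm_Comp)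
  show "tm_dom P (Comp (Comp h gs) (concat tss)) = tm_dom P (Comp h (map2 Comp gs tss))"
   by (simp only: tm_dom.simps m(5))
  show "tm_proj P (Comp (Comp h gs) (concat tss)) = tm_proj P (Comp h (map2 Comp gs tss))"
   by (simp only: tm_proj.simps p)
  show "tm_val \<tau> (Comp (Comp h gs) (concat tss)) = tm_val \<tau> (Comp h (map2 Comp gs tss))" if "target P \<tau>" for \<tau>
   by (simp only: tm_val.simps v[OF that])
 qed simp
qed

lemma eqv_Gen_ident: "x \<in> mobj (fdom P) ==> tm_eqv P (Gen (mident (fdom P) x)) (Idn (In x))"
proof -
 assume x: "x \<in> mobj (fdom P)"
 have "farr h (mident (fdom P) x) = mident (fdom Q) (fobj h x)" if "target P ((Q, c), h, k)" for Q c h k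
  using multifunctor.farr_mident[OF funsD(1)[OF target_facts(3)[OF that]], of x]
   target_facts(5,6)[OF that] x by simp
 then show ?thesis using x by (auto simp: tm_eqv_def)
qed

lemma eqv_Gen_comp:
 assumes c: "composable (fdom P) g fs"
 shows "tm_eqv P (Gen (mcomp (fdom P) g fs)) (Comp (Gen g) (map Gen fs))"
proof -
 note m = E.mcomp_in[OF c]
 have wf: "wf_tm P (Comp (Gen g) (map Gen fs))"
 proof -
  have "map (tm_cod P) (map Gen fs) = map In (map (mcod (fdom P)) fs)" by simp
  then show ?thesis using c by (auto simp: composable_def simp del: map_map)
 qed
 have "farr h (mcomp (fdom P) g fs) = mcomp (fdom Q) (farr h g) (map (farr h) fs)"
  if "target P ((Q, c'), h, k)" for Q c' h k
  using multifunctor.farr_mcomp[OF funsD(1)[OF target_facts(3)[OF that]], of g fs]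
   target_facts(5,6)[OF that] c by simp
 then show ?thesis
  using wf m P.farr_mcomp[OF c] by (auto simp: tm_eqv_def comp_def map_concat)
qed

lemma eqv_Fill:
 assumes "wf_tm P (Fill os f g w)"
 shows "tm_eqv P (Comp (Fill os f g w) [Lift os f]) g"
 using assms val_fill[OF _ assms] by (auto simp: tm_eqv_def)

text \<open>The value of \<open>Lift os f\<close> is opcartesian in every target, so there the
  values of \<open>s\<close> and \<open>t\<close> coincide. Equality in all targets is equivalence
  of terms.\<close>

lemma eqv_Fill_unique:
 assumes s: "wf_tm P s" "tm_dom P s = [Push os f]" and t: "wf_tm P t" "tm_dom P t = [Push os f]"
  and p: "tm_proj P s = tm_proj P t" and e: "tm_eqv P (Comp s [Lift os f]) (Comp t [Lift os f])"
 shows "tm_eqv P s t"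
proof -
 have o: "wf_ob P (Push os f)" using dom_wf[OF s(1)] s(2) by simp
 have "tm_val \<tau> s = tm_val \<tau> t" if \<tau>: "target P \<tau>" for \<tau>
 proof (rule opcart_unique[OF val_lift(1)[OF \<tau> o] val_multifun[OF \<tau>] val_multicat[OF \<tau>]])
  show "mcomp (fdom (fst (fst \<tau>))) (tm_val \<tau> s) [lift_val \<tau> os f] = mcomp (fdom (fst (fst \<tau>))) (tm_val \<tau> t) [lift_val \<tau> os f]"
   using eqv_val[OF e \<tau>] by simp
 qed (use val_tm[OF \<tau> s(1)] val_tm[OF \<tau> t(1)] s t p val_lift(2)[OF \<tau> o] in simp_all)
 then show ?thesis
  using s t p e by (simp add: tm_eqv_def)
qed

lemma multicategory_K: "multicategory K"
proof
 fix m assume "m \<in> marr K"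
 then obtain t where t: "wf_tm P t" "m = cls P t" by (rule marr_KE)
 show "set (mdom K m) \<subseteq> mobj K" using t dom_wf[OF t(1)] by auto
 show "mcod K m \<in> mobj K" using t cod_wf[OF t(1)] by simp
 have "mcomp K (cls P t) (map (cls P) (map Idn (tm_dom P t))) = cls P t"
  using eqv_ident_right[OF t(1)] mcomp_K[OF eqv_wf(1)] cls_eq_iff eqv_wf by metis
 moreover have "map (cls P) (map Idn (tm_dom P t)) = map (mident K) (mdom K m)"
  using t dom_wf[OF t(1)] by auto
 ultimately show "mcomp K m (map (mident K) (mdom K m)) = m" using t by (simp del: map_map map_eq_conv)
 have "mcomp K (cls P (Idn (tm_cod P t))) [cls P t] = cls P t"
  using mcomp_K1[of "Idn (tm_cod P t)" t] eqv_ident_left[OF t(1)] t cod_wf[OF t(1)] cls_eq_iff eqv_wf by auto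
 then show "mcomp K (mident K (mcod K m)) [m] = m"
  using t cod_wf[OF t(1)] by simp
next
 fix y assume "y \<in> mobj K"
 then show "mident K y \<in> marr K \<and> mdom K (mident K y) = [y] \<and> mcod K (mident K y) = y"
  by (auto simp: mobj_K)
next
 fix g fs assume c: "composable K g fs"
 then obtain t where t: "wf_tm P t" "g = cls P t" by (auto simp: composable_def elim: marr_KE)
 from c obtain ts where ts: "\<forall>t\<in>set ts. wf_tm P t" "fs = map (cls P) ts"
  by (auto simp: composable_def elim: marr_K_list)
 have wf: "wf_tm P (Comp t ts)" using c composable_K t ts by simp
 have "map (mdom K) fs = map (map ob_code) (map (tm_dom P) ts)" using ts by simp
 then show "mcomp K g fs \<in> marr K \<and> mdom K (mcomp K g fs) = concat (map (mdom K) fs) \<and> mcod K (mcomp K g fs) = mcod K g"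
  using wf mcomp_K[OF wf] t ts by (simp add: map_concat del: map_map wf_tm_Comp)
next
 fix h gs fss assume h: "composable K h gs" and gs: "list_all2 (composable K) gs fss"
 obtain th where th: "wf_tm P th" "h = cls P th" using h by (auto simp: composable_def elim: marr_KE)
 from h obtain tgs where tgs: "\<forall>t\<in>set tgs. wf_tm P t" "gs = map (cls P) tgs"
  by (auto simp: composable_def elim: marr_K_list)
 define tss where "tss = map (map (repr P)) fss"
 have "\<forall>fs\<in>set fss. set fs \<subseteq> marr K"
  using gs by (auto simp: list_all2_conv_all_nth composable_def in_set_conv_nth) (metis subsetD nth_mem)
 then have tss: "fss = map (map (cls P)) tss" "\<forall>ts\<in>set tss. \<forall>t\<in>set ts. wf_tm P t"
  using repr by (auto simp: tss_def marr_K subset_iff comp_def intro!: map_idI[symmetric] map_idI)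
 have wf: "wf_tm P (Comp th tgs)" using h composable_K th tgs by simp
 have l: "list_all2 (\<lambda>g ts. wf_tm P (Comp g ts)) tgs tss"
  using gs unfolding tgs(2) tss(1) list.rel_map list_all2_conv_all_nth
  using tgs(1) tss(2) by (auto intro!: composable_K[THEN iffD1] simp del: wf_tm_Comp)
 have e: "tm_eqv P (Comp (Comp th tgs) (concat tss)) (Comp th (map2 Comp tgs tss))"
  by (rule eqv_assoc[OF wf l])
 have "map2 (mcomp K) gs fss = map (cls P) (map2 Comp tgs tss)"
  unfolding tgs(2) tss(1) using l by (induction rule: list_all2_induct) (auto simp: mcomp_K)
 moreover have "concat fss = map (cls P) (concat tss)"
  unfolding tss(1) by (simp add: map_concat)
 ultimately show "mcomp K (mcomp K h gs) (concat fss) = mcomp K h (map2 (mcomp K) gs fss)"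
  using mcomp_K[OF wf] mcomp_K[OF eqv_wf(1)[OF e]] mcomp_K[OF eqv_wf(2)[OF e]] cls_eq_iff[OF eqv_wf[OF e]] e th tgs
  by simp
qed (auto simp: free_multicat_def Let_def composable_def)

lemma wf_ob_labels: "wf_ob P a ==> set_ob a \<subseteq> mobj (fdom P) \<union> marr (fcod P)"
 by (induction a) auto

lemma wf_tm_labels: "wf_tm P t ==> set_tm t \<subseteq> mobj (fdom P) \<union> marr (fdom P) \<union> marr (fcod P)"
proof (induction t)
 case (Fill os f g w) then show ?case using wf_ob_labels[of "Push os f"] by auto
next
 case (Lift os f) then show ?case using wf_ob_labels[of "Push os f"] by auto
next
 case (Idn a) then show ?case using wf_ob_labels[of a] by auto
qed auto

lemma small_K: "K \<in> mcats"
proof -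
 \<comment> \<open>The labels of \<open>P\<close> may be finite in number, whereas the count of
   terms requires an infinite set of labels. A countably infinite set is therefore added.\<close>
 obtain Z0 :: "'u set" where Z0: "countable Z0" "infinite Z0"
  using infinite_countable_subset'[OF infinite_universe] by blast
 define Z where "Z = mobj (fdom P) \<union> marr (fdom P) \<union> marr (fcod P) \<union> Z0"
 have "small Z"
  using funsD(2,3)[OF P] small_countable[OF Z0(1)] by (simp add: Z_def small_Un small_multicats_def)
 moreover have "infinite Z" using Z0 by (simp add: Z_def)
 ultimately have s: "small (ob_code ` {a :: 'u ob. set_ob a \<subseteq> Z})" "small (tm_code ` {t :: 'u tm. set_tm t \<subseteq> Z})"
  using small_terms by blast+
 have "small (mobj K)"
  by (rule small_subset[OF s(1)]) (use wf_ob_labels in \<open>auto simp: mobj_K Z_def\<close>)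
 moreover have "marr K \<subseteq> tm_code ` {t. set_tm t \<subseteq> Z}"
 proof
  fix m assume "m \<in> marr K"
  then obtain t where t: "wf_tm P t" "m = cls P t" by (rule marr_KE)
  \<comment> \<open>An arrow is the code of the chosen representative, which is itself well-formed
    and so has its labels in \<open>Z\<close>.\<close>
  have "tm_eqv P (SOME s. tm_eqv P s t) t" using eqv_refl[OF t(1)] by (rule someI)
  then show "m \<in> tm_code ` {t. set_tm t \<subseteq> Z}"
   using t wf_tm_labels eqv_wf(1) by (auto simp: cls_def Z_def intro!: imageI)
 qed
 ultimately show ?thesis
  using multicategory_K small_subset[OF s(2)] by (simp add: small_multicats_def)
qed

sublocale K: multicategory K by (rule multicategory_K)

lemma L_simps [simp]:
 "fdom (free_L P) = fdom P" "fcod (free_L P) = K"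
 "x \<in> mobj (fdom P) ==> fobj (free_L P) x = ob_code (In x)"
 "u \<in> marr (fdom P) ==> farr (free_L P) u = cls P (Gen u)"
 by (simp_all add: free_L_def)

lemma R_simps [simp]:
 "fdom (free_R P) = K" "fcod (free_R P) = fcod P"
 "wf_ob P a ==> fobj (free_R P) (ob_code a) = ob_proj P a"
 "wf_tm P t ==> farr (free_R P) (cls P t) = tm_proj P t"
 by (simp_all add: free_R_def)

lemma map_R: "\<forall>a\<in>set as. wf_ob P a ==> map (fobj (free_R P)) (map ob_code as) = map (ob_proj P) as"
 by simp

lemma free_L_small: "free_L P \<in> funs"
proof -
 have "multifunctor (free_L P)"
 proof
  fix u assume "u \<in> marr (fdom (free_L P))"
  then show "farr (free_L P) u \<in> marr (fcod (free_L P)) \<and>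
    mdom (fcod (free_L P)) (farr (free_L P) u) = map (fobj (free_L P)) (mdom (fdom (free_L P)) u) \<and>
    mcod (fcod (free_L P)) (farr (free_L P) u) = fobj (free_L P) (mcod (fdom (free_L P)) u)"
   using E.mdom_in[of u] E.mcod_in[of u] by auto
 next
  fix x assume "x \<in> mobj (fdom (free_L P))"
  then show "farr (free_L P) (mident (fdom (free_L P)) x) = mident (fcod (free_L P)) (fobj (free_L P) x)"
   using eqv_Gen_ident[of x] cls_eq_iff eqv_wf by auto
 next
  fix g fs assume "composable (fdom (free_L P)) g fs"
  then have c: "composable (fdom P) g fs" by simp
  note e = eqv_Gen_comp[OF c]
  have "map (farr (free_L P)) fs = map (cls P) (map Gen fs)" using c by (auto simp: composable_def)
  then show "farr (free_L P) (mcomp (fdom (free_L P)) g fs) =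
    mcomp (fcod (free_L P)) (farr (free_L P) g) (map (farr (free_L P)) fs)"
   using c E.mcomp_in[OF c] mcomp_K[OF eqv_wf(2)[OF e]] cls_eq_iff[OF eqv_wf[OF e]] e
   by (simp add: composable_def del: map_map)
 qed (auto simp: free_L_def)
 then show ?thesis
  using small_K funsD[OF P] by (simp add: small_multifuns_def)
qed

lemma free_R_small: "free_R P \<in> funs"
proof -
 have "multifunctor (free_R P)"
 proof
  fix m assume "m \<in> marr (fdom (free_R P))"
  then obtain t where t: "wf_tm P t" "m = cls P t" by (auto elim: marr_KE)
  have "map (fobj (free_R P)) (map ob_code (tm_dom P t)) = map (ob_proj P) (tm_dom P t)"
   using map_R dom_wf[OF t(1)] by blast
  then show "farr (free_R P) m \<in> marr (fcod (free_R P)) \<and>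
    mdom (fcod (free_R P)) (farr (free_R P) m) = map (fobj (free_R P)) (mdom (fdom (free_R P)) m) \<and>
    mcod (fcod (free_R P)) (farr (free_R P) m) = fobj (free_R P) (mcod (fdom (free_R P)) m)"
   using t cod_wf[OF t(1)] proj_arr[OF t(1)] proj_dom[OF t(1)] proj_cod[OF t(1)] by (simp del: map_map)
 next
  fix g fs assume "composable (fdom (free_R P)) g fs"
  then have c: "composable K g fs" by simp
  then obtain t where t: "wf_tm P t" "g = cls P t" by (auto simp: composable_def elim: marr_KE)
  from c obtain ts where ts: "\<forall>t\<in>set ts. wf_tm P t" "fs = map (cls P) ts"
   by (auto simp: composable_def elim: marr_K_list)
  have wf: "wf_tm P (Comp t ts)" using c composable_K t ts by simp
  have "map (farr (free_R P)) fs = map (tm_proj P) ts" using ts by simp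
  then show "farr (free_R P) (mcomp (fdom (free_R P)) g fs) =
    mcomp (fcod (free_R P)) (farr (free_R P) g) (map (farr (free_R P)) fs)"
   using mcomp_K[OF wf] wf t ts by (simp del: map_map wf_tm_Comp)
 next
  show "fobj (free_R P) \<in> extensional (mobj (fdom (free_R P)))" "farr (free_R P) \<in> extensional (marr (fdom (free_R P)))"
   by (simp_all add: free_R_def)
 qed (auto simp: mobj_K ob_proj_in)
 then show ?thesis
  using small_K funsD[OF P] by (simp add: small_multifuns_def)
qed

sublocale R: multifunctor "free_R P" by (rule funsD[OF free_R_small])
sublocale L: multifunctor "free_L P" by (rule funsD[OF free_L_small])

lemma R_L: "mfcomp (free_R P) (free_L P) = P"
 by (rule multifun_eqI)
  (use funsD(1)[OF multifun_comp_small[OF free_L_small free_R_small]] P.multifunctor_axioms in simp_all)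

lemma lifting_problem_R:
 "lprob (free_R P) es f \<longleftrightarrow> (\<exists>as. es = map ob_code as \<and> wf_ob P (Push as f))"
proof
 assume l: "lprob (free_R P) es f"
 then obtain as where as: "\<forall>a\<in>set as. wf_ob P a" "es = map ob_code as"
  by (auto simp: lifting_problem_def elim: mobj_K_list)
 then show "\<exists>as. es = map ob_code as \<and> wf_ob P (Push as f)"
  using l map_R[OF as(1)] by (auto simp: lifting_problem_def simp del: map_map)
next
 assume "\<exists>as. es = map ob_code as \<and> wf_ob P (Push as f)"
 then show "lprob (free_R P) es f"
  using map_R by (auto simp: lifting_problem_def)
qed

lemma free_cloven_simps [simp]:
 "fst (free_cloven P) = free_R P"
 "wf_ob P (Push as f) ==> snd (free_cloven P) (map ob_code as, f) = cls P (Lift as f)"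
proof -
 show "snd (free_cloven P) (map ob_code as, f) = cls P (Lift as f)" if "wf_ob P (Push as f)"
 proof -
  have "lprob (free_R P) (map ob_code as) f" using that lifting_problem_R by blast
  then show ?thesis by (simp add: free_cloven_def comp_def)
 qed
qed (simp add: free_cloven_def)

text \<open>The constructor \<open>Fill\<close> was introduced for existence of factorisations;
  their uniqueness is \<open>eqv_Fill_unique\<close>.\<close>

lemma Lift_opcartesian:
 assumes o: "wf_ob P (Push as f)"
 shows "opcart (free_R P) (map ob_code as) f (cls P (Lift as f))"
proof (rule opcartI)
 fix g w assume "g \<in> marr (fdom (free_R P))" and gd: "mdom (fdom (free_R P)) g = map ob_code as"
  and w: "w \<in> marr (fcod (free_R P))" "mdom (fcod (free_R P)) w = [mcod (fcod (free_R P)) f]"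
   "mcod (fcod (free_R P)) w = fobj (free_R P) (mcod (fdom (free_R P)) g)"
  and e: "farr (free_R P) g = mcomp (fcod (free_R P)) w [f]"
 then obtain t where t: "wf_tm P t" "g = cls P t" by (auto elim: marr_KE)
 have td: "tm_dom P t = as" using gd t by simp
 have wf: "wf_tm P (Fill as f t w)"
  using t w e td o cod_wf[OF t(1)] by simp
 note eq = eqv_Fill[OF wf]
 have l: "wf_tm P (Lift as f)" using o by simp
 show "\<exists>!v. v \<in> marr (fdom (free_R P)) \<and> mdom (fdom (free_R P)) v = [mcod (fdom (free_R P)) (cls P (Lift as f))] \<and>
   mcod (fdom (free_R P)) v = mcod (fdom (free_R P)) g \<and> mcomp (fdom (free_R P)) v [cls P (Lift as f)] = g \<and>
   farr (free_R P) v = w"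
 proof (rule ex1I[of _ "cls P (Fill as f t w)"])
  have "mcomp K (cls P (Fill as f t w)) [cls P (Lift as f)] = cls P t"
   using mcomp_K1[OF wf l] cls_eq_iff[OF eqv_wf[OF eq]] eq by simp
  then show "cls P (Fill as f t w) \<in> marr (fdom (free_R P)) \<and>
   mdom (fdom (free_R P)) (cls P (Fill as f t w)) = [mcod (fdom (free_R P)) (cls P (Lift as f))] \<and>
   mcod (fdom (free_R P)) (cls P (Fill as f t w)) = mcod (fdom (free_R P)) g \<and>
   mcomp (fdom (free_R P)) (cls P (Fill as f t w)) [cls P (Lift as f)] = g \<and>
   farr (free_R P) (cls P (Fill as f t w)) = w"
   using wf l t by (simp del: wf_tm.simps)
 next
  fix v assume v: "v \<in> marr (fdom (free_R P)) \<and> mdom (fdom (free_R P)) v = [mcod (fdom (free_R P)) (cls P (Lift as f))] \<and>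
   mcod (fdom (free_R P)) v = mcod (fdom (free_R P)) g \<and> mcomp (fdom (free_R P)) v [cls P (Lift as f)] = g \<and>
   farr (free_R P) v = w"
  then obtain s where s: "wf_tm P s" "v = cls P s" by (auto elim: marr_KE)
  have sd: "tm_dom P s = [Push as f]"
   using v s l map_ob_code_eq[of "tm_dom P s" "[Push as f]"] by (simp del: wf_tm.simps)
  have "cls P (Comp s [Lift as f]) = cls P t"
   using v mcomp_K1[OF s(1) l] sd s t by (simp del: wf_tm.simps)
  then have "tm_eqv P (Comp s [Lift as f]) t"
   using s sd l t cls_eq_iff[of "Comp s [Lift as f]" t] by simp
  then have "tm_eqv P s (Fill as f t w)"
   using v s sd wf by - (rule eqv_Fill_unique[OF s(1) sd wf _ _ eqv_trans[OF _ eqv_sym[OF eq]]], simp_all)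
  then show "v = cls P (Fill as f t w)"
   using s wf cls_eq_iff by blast
 qed
qed (use o in simp_all)

lemma free_cloven_in: "free_cloven P \<in> cloven"
proof -
 have "snd (free_cloven P) \<in> extensional {(es, f). lprob (free_R P) es f}"
  by (simp add: free_cloven_def)
 moreover have "opcart (free_R P) es f (snd (free_cloven P) (es, f))" if "lprob (free_R P) es f" for es f
  using that unfolding lifting_problem_R using Lift_opcartesian free_cloven_simps(2) by auto
 ultimately show ?thesis
  using free_R_small by (simp add: cloven_iff cleavage_def)
qed

end

section \<open>The universal property in dimensions one and two\<close>

interpretation clv: structured_arrows MCat cloven cleavage_preserving cloven_idn cloven_cmp
 by (rule structured_arrows_cloven)

lemma tcmp_whisker_left [simp]:
 assumes t: "t \<in> mtrans" and G: "G \<in> funs" and c: "fdom G = fcod (tsrc t)"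
  and x: "x \<in> mobj (fdom (tsrc t))"
 shows "tcmp (hct (idt G) t) x = farr G (tcmp t x)"
proof -
 note d = mtransD[OF t]
 interpret G: multifunctor G by (rule funsD[OF G])
 interpret B: multicategory "fcod G" by (rule funsD[OF G])
 interpret H: multifunctor "ttrg t" by (rule d)
 show ?thesis
  using x d(8-9) d(10-12)[OF x] H.fobj_in[of x] G.farr_in[of "tcmp t x"] c by simp
qed

lemma tcmp_whisker_right [simp]:
 assumes t: "t \<in> mtrans" and F: "F \<in> funs" and c: "fcod F = fdom (tsrc t)"
  and x: "x \<in> mobj (fdom F)"
 shows "tcmp (hct t (idt F)) x = tcmp t (fobj F x)"
proof -
 note d = mtransD[OF t]
 interpret F: multifunctor F by (rule funsD[OF F])
 interpret H: multifunctor "tsrc t" by (rule d)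
 interpret B: multicategory "fcod (tsrc t)" by (rule d)
 have "fobj F x \<in> mobj (fdom (tsrc t))" using F.fobj_in[OF x] c by simp
 then show ?thesis
  using x d(10-12)[of "fobj F x"] H.farr_mident[of "fobj F x"] c by simp
qed

text \<open>Components of the cell required by \<open>kz\<close>. On generators they are those of
  \<open>\<alpha>\<close>. At \<open>Push as f\<close> naturality at \<open>Lift as f\<close>
  prescribes the composite with the image of that lift under \<open>t\<close>, and the component is
  the factorisation over \<open>\<beta>\<close> through this image.\<close>

primrec kz_val :: "('u, 'u) multifun => ('u, 'u) multifun => ('u, 'u) multifun => ('u, 'u) multifun =>
  ('u => 'u) => ('u => 'u) => 'u ob => 'u" where
 "kz_val P Q t t' \<alpha> \<beta> (In x) = \<alpha> x"
| "kz_val P Q t t' \<alpha> \<beta> (Push as f) = (THE v. v \<in> marr (fdom Q) \<and>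
  mdom (fdom Q) v = [mcod (fdom Q) (farr t (cls P (Lift as f)))] \<and>
  mcod (fdom Q) v = mcod (fdom Q) (mcomp (fdom Q) (farr t' (cls P (Lift as f))) (map (kz_val P Q t t' \<alpha> \<beta>) as)) \<and>
  mcomp (fdom Q) v [farr t (cls P (Lift as f))] =
   mcomp (fdom Q) (farr t' (cls P (Lift as f))) (map (kz_val P Q t t' \<alpha> \<beta>) as) \<and>
  farr Q v = \<beta> (ob_code (Push as f)))"

declare kz_val.simps(2) [simp del]

context arrow_in_MCat
begin

lemma free_ext_simps [simp]:
 "fdom (free_ext P \<tau>) = K" "fcod (free_ext P \<tau>) = fdom (fst (fst \<tau>))"
 "wf_ob P a ==> fobj (free_ext P \<tau>) (ob_code a) = ob_val \<tau> a"
 "target P \<tau> ==> wf_tm P t ==> farr (free_ext P \<tau>) (cls P t) = tm_val \<tau> t"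
 by (simp_all add: free_ext_def)

lemma mcomp_Fill_Lift:
 assumes "wf_tm P (Fill as f g w)"
 shows "mcomp K (cls P (Fill as f g w)) [cls P (Lift as f)] = cls P g"
proof -
 note e = eqv_Fill[OF assms]
 show ?thesis
  using mcomp_K1[OF assms, of "Lift as f"] cls_eq_iff[OF eqv_wf[OF e]] e assms by simp
qed

lemma target_small:
 assumes "target P ((Q, c), h, k)"
 shows "Q \<in> funs" "fdom Q \<in> mcats"
 using target_facts(2)[OF assms] funsD by auto

lemma free_ext_small:
 assumes \<tau>: "target P \<tau>"
 shows "free_ext P \<tau> \<in> funs"
proof -
 let ?D = "fdom (fst (fst \<tau>))"
 interpret D: multicategory ?D by (rule val_multicat[OF \<tau>])
 have "multifunctor (free_ext P \<tau>)"
 proof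
  fix m assume "m \<in> marr (fdom (free_ext P \<tau>))"
  then obtain t where t: "wf_tm P t" "m = cls P t" by (auto elim: marr_KE)
  have "map (fobj (free_ext P \<tau>)) (map ob_code (tm_dom P t)) = map (ob_val \<tau>) (tm_dom P t)"
   using dom_wf[OF t(1)] by simp
  then show "farr (free_ext P \<tau>) m \<in> marr (fcod (free_ext P \<tau>)) \<and>
    mdom (fcod (free_ext P \<tau>)) (farr (free_ext P \<tau>) m) = map (fobj (free_ext P \<tau>)) (mdom (fdom (free_ext P \<tau>)) m) \<and>
    mcod (fcod (free_ext P \<tau>)) (farr (free_ext P \<tau>) m) = fobj (free_ext P \<tau>) (mcod (fdom (free_ext P \<tau>)) m)"
   using t \<tau> cod_wf[OF t(1)] val_tm[OF \<tau> t(1)] by (simp del: map_map)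
 next
  fix g fs assume "composable (fdom (free_ext P \<tau>)) g fs"
  then have c: "composable K g fs" by simp
  then obtain t where t: "wf_tm P t" "g = cls P t" by (auto simp: composable_def elim: marr_KE)
  from c obtain ts where ts: "\<forall>t\<in>set ts. wf_tm P t" "fs = map (cls P) ts"
   by (auto simp: composable_def elim: marr_K_list)
  have wf: "wf_tm P (Comp t ts)" using c composable_K t ts by simp
  have "map (farr (free_ext P \<tau>)) fs = map (tm_val \<tau>) ts" using ts \<tau> by simp
  then show "farr (free_ext P \<tau>) (mcomp (fdom (free_ext P \<tau>)) g fs) =
    mcomp (fcod (free_ext P \<tau>)) (farr (free_ext P \<tau>) g) (map (farr (free_ext P \<tau>)) fs)"
   using mcomp_K[OF wf] wf t ts \<tau> by (simp del: map_map wf_tm_Comp)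
 next
  show "fobj (free_ext P \<tau>) \<in> extensional (mobj (fdom (free_ext P \<tau>)))"
   "farr (free_ext P \<tau>) \<in> extensional (marr (fdom (free_ext P \<tau>)))"
   by (simp_all add: free_ext_def)
 qed (use val_ob[OF \<tau>] \<tau> in \<open>auto simp: mobj_K\<close>)
 then show ?thesis
  using small_K target_small(2) \<tau> by (cases \<tau>) (auto simp: small_multifuns_def)
qed

lemma str_freeI:
 assumes "X \<in> cloven" "t \<in> funs" "k \<in> funs" "fdom t = K" "fcod t = fdom (fst X)"
  "fdom k = fcod P" "fcod k = fcod (fst X)" "mfcomp (fst X) t = mfcomp k (free_R P)"
  "\<And>as f. wf_ob P (Push as f) ==> farr t (cls P (Lift as f)) = snd X (map (fobj t) (map ob_code as), farr k f)"
 shows "clv.str (free_cloven P) t k X"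
proof -
 have "cleavage_preserving (free_cloven P) (Sq (free_R P) t k (fst X)) X"
  using assms(9) by (auto simp: preserves_iff lifting_problem_R simp del: map_map wf_ob_Push)
 then show ?thesis
  using assms free_cloven_in by (simp add: clv.str_iff)
qed

lemma str_freeD:
 assumes "clv.str (free_cloven P) t k X" "wf_ob P (Push as f)"
 shows "farr t (cls P (Lift as f)) = snd X (map (fobj t) (map ob_code as), farr k f)"
proof -
 have l: "lprob (free_R P) (map ob_code as) f" using assms(2) lifting_problem_R by blast
 have "\<forall>es f. lprob (free_R P) es f \<longrightarrow> farr t (snd (free_cloven P) (es, f)) = snd X (map (fobj t) es, farr k f)"
  using assms(1) by (simp add: clv.str_iff preserves_iff)
 from this[rule_format, OF l] show ?thesis
  using assms(2) by (simp del: map_map wf_ob_Push)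
qed

lemma free_ext_L:
 assumes "target P (X, h, k)"
 shows "mfcomp (free_ext P (X, h, k)) (free_L P) = h"
proof -
 obtain Q c where X: "X = (Q, c)" by (cases X)
 note d = target_facts[OF assms[unfolded X]]
 show ?thesis
  by (rule multifun_eqI)
   (use d funsD(1)[OF d(3)] funsD(1)[OF multifun_comp_small[OF free_L_small free_ext_small[OF assms]]]
    assms in \<open>simp_all add: X\<close>)
qed

lemma str_free_ext:
 assumes \<tau>: "target P (X, h, k)"
 shows "clv.str (free_cloven P) (free_ext P (X, h, k)) k X"
proof -
 obtain Q c where X: "X = (Q, c)" by (cases X)
 note d = target_facts[OF \<tau>[unfolded X]]
 show ?thesis
 proof (rule str_freeI)
  show "X \<in> cloven" using \<tau> by (simp add: target_def)
  show "free_ext P (X, h, k) \<in> funs" by (rule free_ext_small[OF \<tau>])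
  show "mfcomp (fst X) (free_ext P (X, h, k)) = mfcomp k (free_R P)"
  proof (rule multifun_eqI)
   show "multifunctor (mfcomp (fst X) (free_ext P (X, h, k)))" "multifunctor (mfcomp k (free_R P))"
    using funsD(1)[OF multifun_comp_small[OF free_ext_small[OF \<tau>], of Q]]
     funsD(1)[OF multifun_comp_small[OF free_R_small d(4)]] d by (simp_all add: X)
  next
   fix y assume "y \<in> mobj (fdom (mfcomp (fst X) (free_ext P (X, h, k))))"
   then show "fobj (mfcomp (fst X) (free_ext P (X, h, k))) y = fobj (mfcomp k (free_R P)) y"
    using val_ob(2)[OF \<tau>] by (auto simp: mobj_K)
  next
   fix m assume "m \<in> marr (fdom (mfcomp (fst X) (free_ext P (X, h, k))))"
   then obtain t where "wf_tm P t" "m = cls P t" by (auto elim: marr_KE)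
   then show "farr (mfcomp (fst X) (free_ext P (X, h, k))) m = farr (mfcomp k (free_R P)) m"
    using val_tm(4)[OF \<tau>] \<tau> by simp
  qed (use d in \<open>simp_all add: X\<close>)
  fix as f assume o: "wf_ob P (Push as f)"
  then have "map (fobj (free_ext P (X, h, k))) (map ob_code as) = map (ob_val (X, h, k)) as" by simp
  then show "farr (free_ext P (X, h, k)) (cls P (Lift as f)) =
    snd X (map (fobj (free_ext P (X, h, k))) (map ob_code as), farr k f)"
   using o \<tau> by (simp add: lift_val_def del: map_map)
 qed (use d in \<open>simp_all add: X\<close>)
qed

lemma str_free_props:
 assumes s: "clv.str (free_cloven P) t k X"
 shows "t \<in> funs" "k \<in> funs" "fdom t = K" "fcod t = fdom (fst X)" "fdom k = fcod P"
  "fcod k = fcod (fst X)" "X \<in> cloven"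
  "\<And>y. y \<in> mobj K ==> fobj (fst X) (fobj t y) = fobj k (fobj (free_R P) y)"
  "\<And>m. m \<in> marr K ==> farr (fst X) (farr t m) = farr k (farr (free_R P) m)"
proof -
 have "Sq (free_R P) t k (fst X) \<in> sqs MCat"
  using s free_R_small by (simp add: clv.str_iff MCat.sq_iff cloven_iff)
 from MCat_squareD[OF this]
 show "\<And>y. y \<in> mobj K ==> fobj (fst X) (fobj t y) = fobj k (fobj (free_R P) y)"
  "\<And>m. m \<in> marr K ==> farr (fst X) (farr t m) = farr k (farr (free_R P) m)" by simp_all
qed (use clv.strD[OF s] in simp_all)

text \<open>Restriction along \<open>free_L P\<close> turns a structure preserving functor into a
  target. This target is among those that define the equivalence of terms, so
  \<open>free_ext\<close> can be compared with the given functor.\<close>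

lemma str_free_target:
 assumes s: "clv.str (free_cloven P) t k X"
 shows "target P (X, mfcomp t (free_L P), k)"
proof -
 note d = str_free_props[OF s]
 have m: "mfcomp t (free_L P) \<in> funs" using multifun_comp_small[OF free_L_small d(1)] d by simp
 have X: "fst X \<in> funs" using d(7) by (simp add: cloven_iff)
 have "mfcomp (fst X) (mfcomp t (free_L P)) = mfcomp k P"
 proof (rule multifun_eqI)
  show "multifunctor (mfcomp (fst X) (mfcomp t (free_L P)))" "multifunctor (mfcomp k P)"
   using funsD(1)[OF multifun_comp_small[OF m X]] funsD(1)[OF multifun_comp_small[OF P d(2)]]
    d by simp_all
  fix x assume "x \<in> mobj (fdom (mfcomp (fst X) (mfcomp t (free_L P))))"
  then show "fobj (mfcomp (fst X) (mfcomp t (free_L P))) x = fobj (mfcomp k P) x"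
   using d(8)[of "ob_code (In x)"] by simp
 next
  fix u assume "u \<in> marr (fdom (mfcomp (fst X) (mfcomp t (free_L P))))"
  then show "farr (mfcomp (fst X) (mfcomp t (free_L P))) u = farr (mfcomp k P) u"
   using d(9)[of "cls P (Gen u)"] by simp
 qed (use d in simp_all)
 then show ?thesis
  using d m X P by (simp add: target_def MCat.sq_iff)
qed

text \<open>A functor that preserves chosen lifts agrees with evaluation of terms. Objects come
  first, since the lift at \<open>Push as f\<close> depends on the images of \<open>as\<close>; for
  terms, the case of \<open>Fill\<close> holds because both values are factorisations through the
  same opcartesian lift.\<close>

lemma str_free_eq:
 assumes s: "clv.str (free_cloven P) T k X"
 shows "T = free_ext P (X, mfcomp T (free_L P), k)"
proof -
 let ?\<tau> = "(X, mfcomp T (free_L P), k)"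
 have \<tau>: "target P ?\<tau>" by (rule str_free_target[OF s])
 note d = str_free_props[OF s]
 interpret T: multifunctor T by (rule funsD[OF d(1)])
 interpret Q: multifunctor "fst X" using val_multifun[OF \<tau>] by simp
 interpret D: multicategory "fdom (fst X)" using val_multicat[OF \<tau>] by simp
 have ob: "fobj T (ob_code a) = ob_val ?\<tau> a" if "wf_ob P a" for a
  using that
 proof (induction a)
  case (In x) then show ?case by simp
 next
  case (Push as f)
  then have "map (fobj T) (map ob_code as) = map (ob_val ?\<tau>) as" by auto
  then have "farr T (cls P (Lift as f)) = lift_val ?\<tau> as f"
   using str_freeD[OF s Push.prems] by (simp add: lift_val_def del: map_map)
  then have "mcod (fdom (fst X)) (farr T (cls P (Lift as f))) = ob_val ?\<tau> (Push as f)"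
   by (simp add: ob_val_Push)
  then show ?case
   using T.farr_cod[of "cls P (Lift as f)"] Push.prems d(3,4) by simp
 qed
 have obs: "map (fobj T) (map ob_code as) = map (ob_val ?\<tau>) as" if "\<forall>a\<in>set as. wf_ob P a" for as
  using that ob by simp
 have T_arr: "farr T m \<in> marr (fdom (fst X))" "mdom (fdom (fst X)) (farr T m) = map (fobj T) (mdom K m)"
  "mcod (fdom (fst X)) (farr T m) = fobj T (mcod K m)" if "m \<in> marr K" for m
  using T.farr_in[of m] that d(3,4) by simp_all
 have tm: "farr T (cls P t) = tm_val ?\<tau> t" if "wf_tm P t" for t
  using that
 proof (induction t)
  case (Gen u) then show ?case by simp
 next
  case (Idn a) then show ?case using T.farr_mident[of "ob_code a"] ob[of a] d(3,4) by simp
 next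
  case (Lift as f)
  then show ?case
   using str_freeD[OF s, of as f] obs[of as] by (simp add: lift_val_def del: map_map)
 next
  case (Fill as f g w)
  have o: "wf_ob P (Push as f)" and g: "wf_tm P g" and l: "wf_tm P (Lift as f)" using Fill.prems by simp_all
  have lv: "farr T (cls P (Lift as f)) = lift_val ?\<tau> as f"
   using str_freeD[OF s o] obs[of as] o by (simp add: lift_val_def del: map_map)
  have e: "mcomp K (cls P (Fill as f g w)) [cls P (Lift as f)] = cls P g"
   by (rule mcomp_Fill_Lift[OF Fill.prems])
  show ?case
  proof (rule opcart_unique[OF val_lift(1)[OF \<tau> o] val_multifun[OF \<tau>] val_multicat[OF \<tau>]])
   have "mcomp (fdom (fst X)) (farr T (cls P (Fill as f g w))) [farr T (cls P (Lift as f))] = farr T (cls P g)"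
    using T.farr_comp[of "cls P (Fill as f g w)" "[cls P (Lift as f)]"] e Fill.prems d(3,4) by simp
   then show "mcomp (fdom (fst (fst ?\<tau>))) (farr T (cls P (Fill as f g w))) [lift_val ?\<tau> as f] =
     mcomp (fdom (fst (fst ?\<tau>))) (tm_val ?\<tau> (Fill as f g w)) [lift_val ?\<tau> as f]"
    using val_fill[OF \<tau> Fill.prems] Fill.IH g lv by simp
   show "farr (fst (fst ?\<tau>)) (farr T (cls P (Fill as f g w))) = farr (fst (fst ?\<tau>)) (tm_val ?\<tau> (Fill as f g w))"
    using d(9)[of "cls P (Fill as f g w)"] val_tm(4)[OF \<tau> Fill.prems] Fill.prems by simp
  qed (use T_arr[of "cls P (Fill as f g w)"] val_tm[OF \<tau> Fill.prems] Fill.prems ob[OF o] val_lift(2)[OF \<tau> o]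
    in \<open>simp_all del: tm_val.simps\<close>)
 next
  case (Comp g gs)
  have wf: "wf_tm P g" "\<forall>t\<in>set gs. wf_tm P t" using Comp.prems by simp_all
  have "composable K (cls P g) (map (cls P) gs)" using composable_K wf Comp.prems by blast
  then have "farr T (cls P (Comp g gs)) = mcomp (fdom (fst X)) (farr T (cls P g)) (map (farr T) (map (cls P) gs))"
   using T.farr_mcomp[of "cls P g" "map (cls P) gs"] mcomp_K[OF Comp.prems] d(3,4) by simp
  moreover have "map (farr T) (map (cls P) gs) = map (tm_val ?\<tau>) gs" using wf(2) Comp.IH(2) by simp
  ultimately show ?case using Comp.IH(1)[OF wf(1)] by (simp del: map_map)
 qed
 show ?thesis
 proof (rule multifun_eqI)
  show "multifunctor (free_ext P ?\<tau>)" by (rule funsD[OF free_ext_small[OF \<tau>]])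
  show "fobj T y = fobj (free_ext P ?\<tau>) y" if "y \<in> mobj (fdom T)" for y
   using that d(3) ob by (auto simp: mobj_K)
  show "farr T m = farr (free_ext P ?\<tau>) m" if "m \<in> marr (fdom T)" for m
   using that d(3) tm \<tau> by (auto elim!: marr_KE)
 qed (use d T.multifunctor_axioms in simp_all)
qed

text \<open>The components \<open>gm\<close> are built by recursion on objects, and naturality is
  proved by induction on terms. In the case of \<open>Fill\<close> the image of a lift under
  \<open>t\<close> is cancelled, which its opcartesianness permits; the images under
  \<open>t'\<close> are never cancelled.\<close>

lemma free_kz:
 assumes s: "clv.str (free_cloven P) t k X" and t': "t' \<in> funs" "fdom t' = K" "fcod t' = fdom (fst X)"
  and \<alpha>: "\<alpha> \<in> mtrans" "tsrc \<alpha> = mfcomp t (free_L P)" "ttrg \<alpha> = mfcomp t' (free_L P)"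
  and \<beta>: "\<beta> \<in> mtrans" "tsrc \<beta> = mfcomp (fst X) t" "ttrg \<beta> = mfcomp (fst X) t'"
  and \<alpha>\<beta>: "hct \<beta> (idt (free_L P)) = hct (idt (fst X)) \<alpha>"
 shows "\<exists>!\<gamma>. \<gamma> \<in> mtrans \<and> tsrc \<gamma> = t \<and> ttrg \<gamma> = t' \<and> hct \<gamma> (idt (free_L P)) = \<alpha> \<and>
  hct (idt (fst X)) \<gamma> = \<beta>"
proof -
 note d = str_free_props[OF s]
 let ?Q = "fst X" and ?D = "fdom (fst X)"
 have Q: "?Q \<in> funs" "cleavage ?Q (snd X)" using d(7) by (simp_all add: cloven_iff)
 interpret Q: multifunctor ?Q by (rule funsD[OF Q(1)])
 interpret D: multicategory ?D by (rule funsD[OF Q(1)])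
 interpret A: multicategory "fcod ?Q" by (rule funsD[OF Q(1)])
 interpret T: multifunctor t by (rule funsD[OF d(1)])
 interpret T': multifunctor t' by (rule funsD[OF t'(1)])
 have \<alpha>c: "tcmp \<alpha> x \<in> marr ?D" "mdom ?D (tcmp \<alpha> x) = [fobj t (ob_code (In x))]"
  "mcod ?D (tcmp \<alpha> x) = fobj t' (ob_code (In x))" if "x \<in> mobj (fdom P)" for x
  using mtransD(10-12)[OF \<alpha>(1), of x] that \<alpha>(2,3) d(4) by simp_all
 have \<beta>c: "tcmp \<beta> y \<in> marr (fcod ?Q)" "mdom (fcod ?Q) (tcmp \<beta> y) = [fobj ?Q (fobj t y)]"
  "mcod (fcod ?Q) (tcmp \<beta> y) = fobj ?Q (fobj t' y)" if "y \<in> mobj K" for y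
  using mtransD(10-12)[OF \<beta>(1), of y] that \<beta>(2,3) d(3) t'(2) by simp_all
 have \<beta>n: "mcomp (fcod ?Q) (tcmp \<beta> (mcod K m)) [farr ?Q (farr t m)] =
   mcomp (fcod ?Q) (farr ?Q (farr t' m)) (map (tcmp \<beta>) (mdom K m))" if "m \<in> marr K" for m
  using multitransformation.naturality[OF mtransD(1)[OF \<beta>(1)], of m] that \<beta>(2,3) d(3) t'(2) by simp
 have \<alpha>\<beta>c: "tcmp \<beta> (ob_code (In x)) = farr ?Q (tcmp \<alpha> x)" if "x \<in> mobj (fdom P)" for x
  using tcmp_whisker_left[OF \<alpha>(1) Q(1), of x] tcmp_whisker_right[OF \<beta>(1) free_L_small, of x] \<alpha>\<beta> \<alpha>(2) \<beta>(2) d(3,4) that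
  by simp
 have t_arr: "farr t m \<in> marr ?D" "mdom ?D (farr t m) = map (fobj t) (mdom K m)"
  "mcod ?D (farr t m) = fobj t (mcod K m)" "farr t' m \<in> marr ?D" "mdom ?D (farr t' m) = map (fobj t') (mdom K m)"
  "mcod ?D (farr t' m) = fobj t' (mcod K m)" if "m \<in> marr K" for m
  using T.farr_in[of m] T'.farr_in[of m] that d(3,4) t'(2,3) by simp_all
 have t_comp: "farr t (mcomp K g fs) = mcomp ?D (farr t g) (map (farr t) fs)"
  "farr t' (mcomp K g fs) = mcomp ?D (farr t' g) (map (farr t') fs)" if "composable K g fs" for g fs
  using T.farr_mcomp[of g fs] T'.farr_mcomp[of g fs] that d(3,4) t'(2,3) by simp_all
 \<comment> \<open>Preservation of the chosen lifts by \<open>t\<close> enters at this point: it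
   makes the image of a formal lift a chosen lift of \<open>X\<close>.\<close>
 have lift: "opcart ?Q (map (fobj t) (map ob_code as)) (farr k f) (farr t (cls P (Lift as f)))"
  if o: "wf_ob P (Push as f)" for as f
 proof -
  have sq: "Sq (free_R P) t k ?Q \<in> sqs MCat"
   using s free_R_small Q(1) by (simp add: clv.str_iff MCat.sq_iff)
  have "lprob (free_R P) (map ob_code as) f" using o lifting_problem_R by blast
  then have "lprob ?Q (map (fobj t) (map ob_code as)) (farr k f)"
   using lifting_problem_map[OF sq, of "map ob_code as" f] by (simp del: map_map)
  then show ?thesis
   unfolding str_freeD[OF s o] by (rule cleavageD[OF Q(2)])
 qed
 define gm where "gm = kz_val P ?Q t t' (tcmp \<alpha>) (tcmp \<beta>)"
 have gm_In: "gm (In x) = tcmp \<alpha> x" for x by (simp add: gm_def)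
 define typed where "typed a \<longleftrightarrow> gm a \<in> marr ?D \<and> mdom ?D (gm a) = [fobj t (ob_code a)] \<and>
  mcod ?D (gm a) = fobj t' (ob_code a) \<and> farr ?Q (gm a) = tcmp \<beta> (ob_code a)" for a
 define rhs where "rhs as f = mcomp ?D (farr t' (cls P (Lift as f))) (map gm as)" for as f
 have gm_Push: "mdom ?D (gm (Push as f)) = [fobj t (ob_code (Push as f))] \<and> gm (Push as f) \<in> marr ?D \<and>
   mcod ?D (gm (Push as f)) = fobj t' (ob_code (Push as f)) \<and> farr ?Q (gm (Push as f)) = tcmp \<beta> (ob_code (Push as f)) \<and>
   mcomp ?D (gm (Push as f)) [farr t (cls P (Lift as f))] = rhs as f"
  if o: "wf_ob P (Push as f)" and IH: "\<forall>a\<in>set as. typed a" for as f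
 proof -
  have l: "cls P (Lift as f) \<in> marr K" "mdom K (cls P (Lift as f)) = map ob_code as"
   "mcod K (cls P (Lift as f)) = ob_code (Push as f)" using o by simp_all
  have gms: "set (map gm as) \<subseteq> marr ?D" "map (mcod ?D) (map gm as) = mdom ?D (farr t' (cls P (Lift as f)))"
   "concat (map (mdom ?D) (map gm as)) = map (fobj t) (map ob_code as)"
   "map (farr ?Q) (map gm as) = map (tcmp \<beta>) (map ob_code as)"
  proof -
   show "map (mcod ?D) (map gm as) = mdom ?D (farr t' (cls P (Lift as f)))"
    using IH t_arr(5)[OF l(1)] l(2) by (simp add: typed_def)
   show "concat (map (mdom ?D) (map gm as)) = map (fobj t) (map ob_code as)"
    using IH by (induction as) (auto simp: typed_def)
  qed (use IH in \<open>auto simp: typed_def\<close>)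
  note r = D.mcomp_arr[OF t_arr(4)[OF l(1)] gms(1,2)] D.mcomp_dom[OF t_arr(4)[OF l(1)] gms(1,2)]
   D.mcomp_cod[OF t_arr(4)[OF l(1)] gms(1,2)]
  \<comment> \<open>Naturality of \<open>\<beta>\<close> at the formal lift shows that
    \<open>rhs as f\<close> lies over the component of \<open>\<beta>\<close> after the base map, as
    a factorisation problem demands.\<close>
  have "farr ?Q (rhs as f) = mcomp (fcod ?Q) (farr ?Q (farr t' (cls P (Lift as f)))) (map (farr ?Q) (map gm as))"
   unfolding rhs_def using Q.farr_comp[OF t_arr(4)[OF l(1)] gms(1,2)] .
  also have "\<dots> = mcomp (fcod ?Q) (tcmp \<beta> (ob_code (Push as f))) [farr ?Q (farr t (cls P (Lift as f)))]"
   unfolding gms(4) using \<beta>n[OF l(1)] l by simp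
  finally have Qr: "farr ?Q (rhs as f) =
    mcomp (fcod ?Q) (tcmp \<beta> (ob_code (Push as f))) [farr k f]"
   using d(9)[OF l(1)] o by simp
  have pk: "ob_code (Push as f) \<in> mobj K" using o by simp
  have kf: "fobj ?Q (fobj t (ob_code (Push as f))) = mcod (fcod ?Q) (farr k f)"
   using opcartD(4)[OF lift[OF o] Q.multifunctor_axioms] t_arr(3)[OF l(1)] l(3) by simp
  have "\<exists>!v. v \<in> marr ?D \<and> mdom ?D v = [mcod ?D (farr t (cls P (Lift as f)))] \<and> mcod ?D v = mcod ?D (rhs as f) \<and>
   mcomp ?D v [farr t (cls P (Lift as f))] = rhs as f \<and> farr ?Q v = tcmp \<beta> (ob_code (Push as f))"
   by (rule opcart_ex1[OF lift[OF o]])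
    (use r gms(3) \<beta>c[OF pk] kf Qr t_arr(6)[OF l(1)] l(3) in \<open>simp_all add: rhs_def del: map_map\<close>)
  from theI'[OF this] show ?thesis
   using r t_arr(3,6)[OF l(1)] l(3) unfolding gm_def rhs_def kz_val.simps by simp
 qed
 have ty: "typed a" if "wf_ob P a" for a
  using that
 proof (induction a)
  case (In x) then show ?case using \<alpha>c[of x] \<alpha>\<beta>c[of x] by (simp add: typed_def gm_In)
 next
  case (Push as f) then have "\<forall>a\<in>set as. typed a" by auto
  from gm_Push[OF Push.prems this] show ?case by (simp add: typed_def)
 qed
 have Push_eq: "mcomp ?D (gm (Push as f)) [farr t (cls P (Lift as f))] = rhs as f" if "wf_ob P (Push as f)" for as f
  using gm_Push[OF that] ty that by simp
 have gms: "set (map gm as) \<subseteq> marr ?D" "map (mcod ?D) (map gm as) = map (fobj t') (map ob_code as)"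
  "map (farr ?Q) (map gm as) = map (tcmp \<beta>) (map ob_code as)" if "\<forall>a\<in>set as. wf_ob P a" for as
  using that ty by (auto simp: typed_def)
 have nat: "mcomp ?D (gm (tm_cod P m)) [farr t (cls P m)] = mcomp ?D (farr t' (cls P m)) (map gm (tm_dom P m))"
  if "wf_tm P m" for m
  using that
 proof (induction m)
  case (Gen u)
  then have "mcomp ?D (tcmp \<alpha> (mcod (fdom P) u)) [farr t (cls P (Gen u))] =
    mcomp ?D (farr t' (cls P (Gen u))) (map (tcmp \<alpha>) (mdom (fdom P) u))"
   using multitransformation.naturality[OF mtransD(1)[OF \<alpha>(1)], of u] \<alpha>(2,3) d(4) by simp
  then show ?case by (simp add: gm_In comp_def)
 next
  case (Idn a)
  then show ?case
   using ty[of a] T.farr_mident[of "ob_code a"] T'.farr_mident[of "ob_code a"] d(3,4) t'(2,3)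
   by (simp add: typed_def)
 next
  case (Lift as f) then show ?case using Push_eq[of as f] by (simp add: rhs_def)
 next
  case (Fill as f g w)
  have o: "wf_ob P (Push as f)" and g: "wf_tm P g" "tm_dom P g = as" and l: "wf_tm P (Lift as f)"
   using Fill.prems by simp_all
  let ?m = "cls P (Fill as f g w)" and ?l = "cls P (Lift as f)"
  have mK: "?m \<in> marr K" "mdom K ?m = [ob_code (Push as f)]" "mcod K ?m = ob_code (tm_cod P g)"
   and lK: "?l \<in> marr K" "mdom K ?l = map ob_code as" "mcod K ?l = ob_code (Push as f)"
   using Fill.prems o by (simp_all del: wf_tm.simps(4))
  have c: "composable K ?m [?l]" using mK lK by (simp add: composable_def)
  have e: "mcomp K ?m [?l] = cls P g"
   by (rule mcomp_Fill_Lift[OF Fill.prems])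
  have x: "mcomp ?D (farr t ?m) [farr t ?l] = farr t (cls P g)" "mcomp ?D (farr t' ?m) [farr t' ?l] = farr t' (cls P g)"
   using t_comp[OF c] e by simp_all
  note tg = ty[OF cod_wf[OF g(1)], unfolded typed_def] and tp = ty[OF o, unfolded typed_def]
  note ta = t_arr[OF mK(1), unfolded mK] t_arr[OF lK(1), unfolded lK]
  have as: "\<forall>a\<in>set as. wf_ob P a" using o by simp
  show ?case
   unfolding tm_cod.simps tm_dom.simps list.map
  proof (rule opcart_unique[OF lift[OF o] Q.multifunctor_axioms D.multicategory_axioms])
   \<comment> \<open>After composition with the lift, both sides reduce to naturality at
     \<open>g\<close>, given by the induction hypothesis, and the defining equation of
     \<open>gm\<close> at \<open>Push as f\<close>.\<close>
   have "mcomp ?D (mcomp ?D (gm (tm_cod P g)) [farr t ?m]) [farr t ?l] = mcomp ?D (gm (tm_cod P g)) [farr t (cls P g)]"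
    using tg ta x(1) by (simp add: D.mcomp_assoc1)
   also have "\<dots> = mcomp ?D (mcomp ?D (farr t' ?m) [farr t' ?l]) (map gm as)"
    using Fill.IH[OF g(1)] g(2) x(2) by simp
   also have "\<dots> = mcomp ?D (farr t' ?m) [mcomp ?D (farr t' ?l) (map gm as)]"
    using ta gms[OF as] by (intro D.mcomp_assoc1) (simp_all del: map_map)
   also have "\<dots> = mcomp ?D (mcomp ?D (farr t' ?m) [gm (Push as f)]) [farr t ?l]"
    using Push_eq[OF o] tp ta by (simp add: rhs_def D.mcomp_assoc1)
   finally show "mcomp ?D (mcomp ?D (gm (tm_cod P g)) [farr t ?m]) [farr t ?l] =
    mcomp ?D (mcomp ?D (farr t' ?m) [gm (Push as f)]) [farr t ?l]" .
   show "farr ?Q (mcomp ?D (gm (tm_cod P g)) [farr t ?m]) = farr ?Q (mcomp ?D (farr t' ?m) [gm (Push as f)])"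
    using Q.farr_comp[of "gm (tm_cod P g)" "[farr t ?m]"] Q.farr_comp[of "farr t' ?m" "[gm (Push as f)]"]
     \<beta>n[OF mK(1)] mK tg tp ta by simp
  qed (use tg tp ta in simp_all)
 next
  case (Comp g gs)
  have wf: "wf_tm P g" "\<forall>t\<in>set gs. wf_tm P t" and cd: "map (tm_cod P) gs = tm_dom P g" using Comp.prems by simp_all
  have c: "composable K (cls P g) (map (cls P) gs)" using composable_K wf Comp.prems by blast
  have gK: "cls P g \<in> marr K" "mdom K (cls P g) = map ob_code (map (tm_cod P) gs)" "mcod K (cls P g) = ob_code (tm_cod P g)"
   using wf(1) cd by simp_all
  note ta = t_arr[OF gK(1), unfolded gK]
  note tg = ty[OF cod_wf[OF wf(1)], unfolded typed_def]
  have gsK: "farr t (cls P m) \<in> marr ?D" "mcod ?D (farr t (cls P m)) = fobj t (ob_code (tm_cod P m))"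
   "farr t' (cls P m) \<in> marr ?D" "mcod ?D (farr t' (cls P m)) = fobj t' (ob_code (tm_cod P m))"
   "mdom ?D (farr t' (cls P m)) = map (fobj t') (map ob_code (tm_dom P m))"
   "gm (tm_cod P m) \<in> marr ?D" "mdom ?D (gm (tm_cod P m)) = [fobj t (ob_code (tm_cod P m))]"
   "mcod ?D (gm (tm_cod P m)) = fobj t' (ob_code (tm_cod P m))" if "m \<in> set gs" for m
   using t_arr[of "cls P m"] ty[OF cod_wf, of m] wf(2) that by (simp_all add: typed_def)
  let ?ts = "map (\<lambda>m. farr t (cls P m)) gs"
  \<comment> \<open>The component is moved past the outer map \<open>g\<close> first, then past each
    of the arguments.\<close>
  have "mcomp ?D (gm (tm_cod P g)) [mcomp ?D (farr t (cls P g)) ?ts] = mcomp ?D (mcomp ?D (gm (tm_cod P g)) [farr t (cls P g)]) ?ts"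
   using tg ta gsK by (intro D.mcomp_assoc1[symmetric]) (auto simp: comp_def)
  also have "\<dots> = mcomp ?D (mcomp ?D (farr t' (cls P g)) (map (\<lambda>m. gm (tm_cod P m)) gs)) ?ts"
   using Comp.IH(1)[OF wf(1), folded cd] by (simp add: comp_def)
  also have "\<dots> = mcomp ?D (farr t' (cls P g)) (map (\<lambda>m. mcomp ?D (gm (tm_cod P m)) [farr t (cls P m)]) gs)"
   using ta gsK by (intro D.mcomp_assoc_map) (auto simp: comp_def)
  also have "map (\<lambda>m. mcomp ?D (gm (tm_cod P m)) [farr t (cls P m)]) gs =
    map2 (mcomp ?D) (map (\<lambda>m. farr t' (cls P m)) gs) (map (\<lambda>m. map gm (tm_dom P m)) gs)"
   using Comp.IH(2) wf(2) by (simp add: map2_map_same)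
  also have "mcomp ?D (farr t' (cls P g)) \<dots> =
    mcomp ?D (mcomp ?D (farr t' (cls P g)) (map (\<lambda>m. farr t' (cls P m)) gs)) (concat (map (\<lambda>m. map gm (tm_dom P m)) gs))"
  proof (rule D.mcomp_assoc[symmetric])
   show "composable ?D (farr t' (cls P g)) (map (\<lambda>m. farr t' (cls P m)) gs)"
    using ta gsK by (auto simp: composable_def comp_def)
   show "list_all2 (composable ?D) (map (\<lambda>m. farr t' (cls P m)) gs) (map (\<lambda>m. map gm (tm_dom P m)) gs)"
    unfolding list.rel_map
   proof (rule list.rel_refl_strong)
    fix m assume m: "m \<in> set gs"
    have "\<forall>a\<in>set (tm_dom P m). wf_ob P a" using dom_wf wf(2) m by blast
    from gms[OF this] gsK[OF m] show "composable ?D (farr t' (cls P m)) (map gm (tm_dom P m))"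
     by (simp add: composable_def del: map_map)
   qed
  qed
  finally show ?case
   using t_comp[OF c] mcomp_K[OF Comp.prems] by (simp add: comp_def map_concat)
 qed
 define \<gamma> where "\<gamma> = \<lparr>tsrc = t, ttrg = t', tcmp = (\<lambda>y\<in>mobj K. gm (ob_decode y))\<rparr>"
 have \<gamma>s: "tsrc \<gamma> = t" "ttrg \<gamma> = t'" "\<And>a. wf_ob P a ==> tcmp \<gamma> (ob_code a) = gm a"
  by (simp_all add: \<gamma>_def)
 have \<gamma>: "\<gamma> \<in> mtrans"
 proof (rule mtransI)
  fix y assume "y \<in> mobj (fdom (tsrc \<gamma>))"
  then obtain a where "wf_ob P a" "y = ob_code a" using d(3) \<gamma>s by (auto simp: mobj_K)
  then show "tcmp \<gamma> y \<in> marr (fcod (tsrc \<gamma>)) \<and> mdom (fcod (tsrc \<gamma>)) (tcmp \<gamma> y) = [fobj (tsrc \<gamma>) y] \<and>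
    mcod (fcod (tsrc \<gamma>)) (tcmp \<gamma> y) = fobj (ttrg \<gamma>) y"
   using ty[of a] d(4) by (simp add: \<gamma>s typed_def)
 next
  fix m assume "m \<in> marr (fdom (tsrc \<gamma>))"
  then obtain u where u: "wf_tm P u" "m = cls P u" using d(3) \<gamma>s by (auto elim: marr_KE)
  have "map (tcmp \<gamma>) (mdom K m) = map gm (tm_dom P u)" using u dom_wf[OF u(1)] \<gamma>s(3) by simp
  then show "mcomp (fcod (tsrc \<gamma>)) (tcmp \<gamma> (mcod (fdom (tsrc \<gamma>)) m)) [farr (tsrc \<gamma>) m] =
    mcomp (fcod (tsrc \<gamma>)) (farr (ttrg \<gamma>) m) (map (tcmp \<gamma>) (mdom (fdom (tsrc \<gamma>)) m))"
   using nat[OF u(1)] u d(3,4) cod_wf[OF u(1)] by (simp add: \<gamma>s del: map_map map_eq_conv)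
 qed (use d t' in \<open>simp_all add: \<gamma>_def\<close>)
 have tc: "fcod (free_L P) = fdom (tsrc \<gamma>)" "fdom ?Q = fcod (tsrc \<gamma>)" using d \<gamma>s by simp_all
 show ?thesis
 proof (rule ex1I[of _ \<gamma>])
  have "hct \<gamma> (idt (free_L P)) = \<alpha>"
  proof (rule mtrans_eqI)
   show "multitransformation (hct \<gamma> (idt (free_L P)))"
    by (rule mtransD(1)[OF mtrans_hcomp_in[OF mtrans_id_in[OF free_L_small] \<gamma>]]) (use tc in simp)
  qed (use \<alpha> \<gamma>s tcmp_whisker_right[OF \<gamma> free_L_small tc(1)] mtransD(1)[OF \<alpha>(1)] gm_In in simp_all)
  moreover have "hct (idt ?Q) \<gamma> = \<beta>"
  proof (rule mtrans_eqI)
   show "multitransformation (hct (idt ?Q) \<gamma>)"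
    by (rule mtransD(1)[OF mtrans_hcomp_in[OF \<gamma> mtrans_id_in[OF Q(1)]]]) (use tc in simp)
   fix y assume "y \<in> mobj (fdom (tsrc (hct (idt ?Q) \<gamma>)))"
   then obtain a where "wf_ob P a" "y = ob_code a" using d(3) \<gamma>s by (auto simp: mobj_K)
   then show "tcmp (hct (idt ?Q) \<gamma>) y = tcmp \<beta> y"
    using ty[of a] \<gamma>s tcmp_whisker_left[OF \<gamma> Q(1) tc(2), of y] d(3) by (simp add: typed_def)
  qed (use \<beta> \<gamma>s mtransD(1)[OF \<beta>(1)] in simp_all)
  ultimately show "\<gamma> \<in> mtrans \<and> tsrc \<gamma> = t \<and> ttrg \<gamma> = t' \<and> hct \<gamma> (idt (free_L P)) = \<alpha> \<and>
   hct (idt ?Q) \<gamma> = \<beta>"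
   using \<gamma> \<gamma>s by simp
 next
  fix \<delta> assume \<delta>: "\<delta> \<in> mtrans \<and> tsrc \<delta> = t \<and> ttrg \<delta> = t' \<and> hct \<delta> (idt (free_L P)) = \<alpha> \<and>
   hct (idt ?Q) \<delta> = \<beta>"
  then have \<delta>t: "\<delta> \<in> mtrans" "tsrc \<delta> = t" "ttrg \<delta> = t'" by simp_all
  note \<delta>c = mtransD(10-12)[OF \<delta>t(1), unfolded \<delta>t(2,3) d(3,4)]
  have \<delta>L: "tcmp \<delta> (ob_code (In x)) = tcmp \<alpha> x" if "x \<in> mobj (fdom P)" for x
   using tcmp_whisker_right[OF \<delta>t(1) free_L_small, of x] that \<delta> d(3) by simp
  have \<delta>Q: "farr ?Q (tcmp \<delta> y) = tcmp \<beta> y" if "y \<in> mobj K" for y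
   using tcmp_whisker_left[OF \<delta>t(1) Q(1), of y] that \<delta> d(3,4) by simp
  have "tcmp \<delta> (ob_code a) = gm a" if "wf_ob P a" for a
   using that
  proof (induction a)
   case (In x) then show ?case using \<delta>L gm_In by simp
  next
   case (Push as f)
   have lK: "cls P (Lift as f) \<in> marr K" "mdom K (cls P (Lift as f)) = map ob_code as"
    "mcod K (cls P (Lift as f)) = ob_code (Push as f)" using Push.prems by simp_all
   have pK: "ob_code (Push as f) \<in> mobj K" using Push.prems by simp
   note tp = ty[OF Push.prems, unfolded typed_def]
   show ?case
   \<comment> \<open>Naturality of \<open>\<delta>\<close> at the formal lift fixes its composite
     with an opcartesian map, and its image in the base is given by \<open>\<beta>\<close>.\<close>
   proof (rule opcart_unique[OF lift[OF Push.prems] Q.multifunctor_axioms D.multicategory_axioms])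
    have "map (tcmp \<delta>) (map ob_code as) = map gm as" using Push by auto
    then show "mcomp ?D (tcmp \<delta> (ob_code (Push as f))) [farr t (cls P (Lift as f))] =
      mcomp ?D (gm (Push as f)) [farr t (cls P (Lift as f))]"
     using multitransformation.naturality[OF mtransD(1)[OF \<delta>t(1)], of "cls P (Lift as f)"]
      Push_eq[OF Push.prems] lK \<delta>t d(3,4) by (simp add: rhs_def del: map_map)
   qed (use \<delta>c[OF pK] tp t_arr(3)[OF lK(1)] lK(3) \<delta>Q[OF pK] in simp_all)
  qed
  then show "\<delta> = \<gamma>"
   using \<delta>t \<gamma>s \<gamma> d(3) by (intro mtrans_eqI mtransD(1)) (auto simp: mobj_K)
 qed
qed

end

lemma multifun_comp_id [simp]:
 assumes "F \<in> funs"
 shows "A = fcod F ==> mfcomp (mfid A) F = F" "A = fdom F ==> mfcomp F (mfid A) = F"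
 using category.id_left'[OF category_MCat, of F] category.id_right'[OF category_MCat, of F] assms by simp_all

text \<open>A chosen lift of \<open>f\<close> lies over \<open>f\<close>, and \<open>f\<close> is
  the chosen lift of itself along the identity.\<close>

lemma str_clv_terminal:
 assumes X: "X \<in> cloven"
 shows "clv.str X (fst X) (mfid (fcod (fst X))) (cloven_idn (fcod (fst X)))"
proof -
 have P: "fst X \<in> funs" "cleavage (fst X) (snd X)" using X by (simp_all add: cloven_iff)
 note d = funsD[OF P(1)]
 interpret P: multifunctor "fst X" by (rule d)
 have "cleavage_preserving X (Sq (fst X) (fst X) (mfid (fcod (fst X))) (mfid (fcod (fst X))))
   (cloven_idn (fcod (fst X)))"
  unfolding preserves_iff
 proof (intro allI impI)
  fix es f assume l: "lprob (fst X) es f"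
  have "farr (fst X) (snd X (es, f)) = f"
   using opcartD(3)[OF cleavageD[OF P(2) l] d(1)] .
  moreover have "lprob (mfid (fcod (fst X))) (map (fobj (fst X)) es) f"
   using l P.fobj_in by (auto simp: lifting_problem_id lifting_problem_def)
  ultimately show "farr (stop (Sq (fst X) (fst X) (mfid (fcod (fst X))) (mfid (fcod (fst X))))) (snd X (es, f)) =
    snd (cloven_idn (fcod (fst X)))
     (map (fobj (stop (Sq (fst X) (fst X) (mfid (fcod (fst X))) (mfid (fcod (fst X)))))) es,
     farr (sbot (Sq (fst X) (fst X) (mfid (fcod (fst X))) (mfid (fcod (fst X))))) f)"
   using l by (simp add: cloven_idn_def lifting_problem_def)
 qed
 then show ?thesis
  using X P d cloven_idn[OF d(3)]
  by (simp add: clv.str_iff cloven_idn_def multifun_id_small)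
qed

lemma str_clv_cleavage:
 assumes "clv.str X h k Y" "lprob (fst X) es f"
 shows "farr h (snd X (es, f)) = snd Y (map (fobj h) es, farr k f)"
 using assms by (simp add: clv.str_iff preserves_iff)

lemma str_clvI:
 assumes "X \<in> cloven" "Y \<in> cloven" "Sq (fst X) h k (fst Y) \<in> sqs MCat"
  "\<And>es f. lprob (fst X) es f ==> farr h (snd X (es, f)) = snd Y (map (fobj h) es, farr k f)"
 shows "clv.str X h k Y"
 using assms by (simp add: clv.str_iff preserves_iff MCat.sq_iff)

section \<open>Reflection of lifts and recognition of algebras\<close>

context arrow_in_MCat
begin

lemma L_square:
 assumes "p \<in> funs" "fdom p = K" "fcod p = fdom P" "mfcomp p (free_L P) = mfid (fdom P)"
 shows "x \<in> mobj (fdom P) ==> fobj p (ob_code (In x)) = x"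
  and "u \<in> marr (fdom P) ==> farr p (cls P (Gen u)) = u"
 using arg_cong[OF assms(4), of "\<lambda>F. fobj F x"] arg_cong[OF assms(4), of "\<lambda>F. farr F u"] by simp_all

lemma lifting_problem_L:
 assumes "lprob P es f"
 shows "wf_ob P (Push (map In es) f)" "map ob_code (map In es) = map (fobj (free_L P)) es"
  "lprob (free_R P) (map ob_code (map In es)) f"
proof -
 show w: "wf_ob P (Push (map In es) f)" using assms by (auto simp: lifting_problem_def)
 show "map ob_code (map In es) = map (fobj (free_L P)) es" using assms by (auto simp: lifting_problem_def)
 show "lprob (free_R P) (map ob_code (map In es)) f" unfolding lifting_problem_R using w by blast
qed

lemma free_cloven_L:
 assumes "lprob P es f"
 shows "snd (free_cloven P) (map (fobj (free_L P)) es, f) = cls P (Lift (map In es) f)"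
 using free_cloven_simps(2)[OF lifting_problem_L(1)[OF assms]] lifting_problem_L(2)[OF assms] by (simp del: map_map)

text \<open>Since \<open>p\<close> is a retraction of the unit and preserves lifts, each chosen lift
  of \<open>X\<close> is the image of a formal lift of generators. Preservation by \<open>h\<close>
  can thus be tested on \<open>mfcomp h p\<close>.\<close>

lemma free_reflect:
 assumes XY: "X \<in> cloven" "Y \<in> cloven" and P: "fst X = P"
  and p: "clv.str (free_cloven P) p (mfid (fcod P)) X" "mfcomp p (free_L P) = mfid (fdom P)"
  and sq: "Sq P h k (fst Y) \<in> sqs MCat" and hp: "clv.str (free_cloven P) (mfcomp h p) k Y"
 shows "clv.str X h k Y"
proof (rule str_clvI[OF XY])
 note d = str_free_props[OF p(1)]
 note pL = L_square[OF d(1,3) _ p(2)]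
 interpret p: multifunctor p by (rule funsD[OF d(1)])
 fix es f assume "lprob (fst X) es f"
 then have l: "lprob P es f" using P by simp
 note lL = lifting_problem_L[OF l]
 have es: "map (fobj p) (map ob_code (map In es)) = es" "map (fobj (mfcomp h p)) (map ob_code (map In es)) = map (fobj h) es"
  using l pL d(3,4) P lL(1) by (auto simp: lifting_problem_def intro!: map_idI)
 have f: "f \<in> marr (fcod P)" using l by (simp add: lifting_problem_def)
 have "farr p (cls P (Lift (map In es) f)) = snd X (es, f)"
  using str_freeD[OF p(1) lL(1)] f unfolding es by simp
 moreover have "farr (mfcomp h p) (cls P (Lift (map In es) f)) = snd Y (map (fobj h) es, farr k f)"
  using str_freeD[OF hp lL(1)] unfolding es .
 moreover have "cls P (Lift (map In es) f) \<in> marr (fdom p)" using lL(1) d(3) by simp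
 ultimately show "farr h (snd X (es, f)) = snd Y (map (fobj h) es, farr k f)" by simp
qed (use P sq in simp)

end

text \<open>Computes structure preserving functors between free opfibrations over one base on formal
  lifts of generators. In \<open>free_alg\<close> it evaluates the two arrows equated by
  associativity.\<close>

lemma (in uncountable_universe) str_free_functor:
 fixes P :: "('u, 'u) multifun"
 assumes P: "P \<in> funs" and l: "lprob P es f"
  and s: "clv.str (free_cloven P) q (mfid (fcod P)) (free_cloven Q)" and c: "fcod P = fcod Q"
 shows "farr q (snd (free_cloven P) (map (fobj (free_L P)) es, f)) =
  snd (free_cloven Q) (map (fobj (mfcomp q (free_L P))) es, f)"
proof -
 interpret P: arrow_in_MCat U P by unfold_locales (rule P)
 note lL = P.lifting_problem_L[OF l]
 have f: "f \<in> marr (fcod P)" using l by (simp add: lifting_problem_def)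
 have "map (fobj q) (map ob_code (map In es)) = map (fobj (mfcomp q (free_L P))) es"
  using l by (auto simp: lifting_problem_def)
 then show ?thesis
  using P.str_freeD[OF s lL(1)] lL(2) f P.free_cloven_L[OF l] by (simp del: map_map)
qed

context arrow_in_MCat
begin

text \<open>The lifts of \<open>P\<close> are images under \<open>p\<close> of formal lifts.
  Factorisations through them exist as images of \<open>Fill\<close>. For uniqueness,
  \<open>\<gamma>\<close> is used as the unit of an adjunction between \<open>p\<close> and
  \<open>free_L P\<close>: it carries a factorisation to the free multicategory, where the formal
  lift is opcartesian, and \<open>p\<close> recovers it from there. That \<open>p\<close> preserves
  lifts is the content of \<open>coeq\<close>.\<close>

lemma free_alg:
 assumes p: "p \<in> funs" "fdom p = K" "fcod p = fdom P" "mfcomp P p = free_R P"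
   "mfcomp p (free_L P) = mfid (fdom P)"
  and \<gamma>: "\<gamma> \<in> mtrans" "tsrc \<gamma> = mfid K" "ttrg \<gamma> = mfcomp (free_L P) p"
   "hct \<gamma> (idt (free_L P)) = idt (free_L P)"
   "hct (idt (free_R P)) \<gamma> = idt (free_R P)"
   "hct (idt p) \<gamma> = idt p"
  and coeq: "\<And>q r. clv.str (free_cloven (free_R P)) q (mfid (fcod P)) (free_cloven P) ==>
   clv.str (free_cloven (free_R P)) r (mfid (fcod P)) (free_cloven P) ==>
   mfcomp q (free_L (free_R P)) = mfid K ==>
   mfcomp r (free_L (free_R P)) = mfcomp (free_L P) p ==> mfcomp p q = mfcomp p r"
  and ext: "\<And>h. Sq (free_R P) h (mfid (fcod P)) (free_R P) \<in> sqs MCat ==>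
   \<exists>t. clv.str (free_cloven (free_R P)) t (mfid (fcod P)) (free_cloven P) \<and>
    mfcomp t (free_L (free_R P)) = h"
 shows "\<exists>X. fst X = P \<and> clv.str (free_cloven P) p (mfid (fcod P)) X"
proof -
 interpret p: multifunctor p by (rule funsD[OF p(1)])
 note pL = L_square[OF p(1-3,5)]
 have Pp: "fobj P (fobj p y) = fobj (free_R P) y" "farr P (farr p m) = farr (free_R P) m"
  if "y \<in> mobj K" "m \<in> marr K" for y m
  using arg_cong[OF p(4), of "\<lambda>F. fobj F y"] arg_cong[OF p(4), of "\<lambda>F. farr F m"] that p(2) by simp_all
 have Pp2: "farr P (farr p m) = farr (free_R P) m" if "m \<in> marr K" for m
  using arg_cong[OF p(4), of "\<lambda>F. farr F m"] that p(2) by simp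
 have p_arr: "farr p m \<in> marr (fdom P)" "mdom (fdom P) (farr p m) = map (fobj p) (mdom K m)"
  "mcod (fdom P) (farr p m) = fobj p (mcod K m)" if "m \<in> marr K" for m
  using p.farr_in[of m] that p(2,3) by simp_all
 have p_ob: "fobj p y \<in> mobj (fdom P)" if "y \<in> mobj K" for y using p.fobj_in[of y] that p(2,3) by simp
 have p_comp: "farr p (mcomp K g [m]) = mcomp (fdom P) (farr p g) [farr p m]"
  if "g \<in> marr K" "m \<in> marr K" "mdom K g = [mcod K m]" for g m
  using p.farr_comp[of g "[m]"] that p(2,3) by simp
 note \<gamma>c = mtransD(10-12)[OF \<gamma>(1), unfolded \<gamma>(2,3) multifun_simps]
 have \<gamma>t: "tcmp \<gamma> y \<in> marr K" "mdom K (tcmp \<gamma> y) = [y]" "mcod K (tcmp \<gamma> y) = ob_code (In (fobj p y))" if "y \<in> mobj K" for y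
  using \<gamma>c[of y] that p(2) p_ob by simp_all
 have \<gamma>L: "tcmp \<gamma> (ob_code (In x)) = cls P (Idn (In x))" if "x \<in> mobj (fdom P)" for x
  using tcmp_whisker_right[OF \<gamma>(1) free_L_small, of x] \<gamma>(2,4) that by simp
 have \<gamma>R: "farr (free_R P) (tcmp \<gamma> y) = mident (fcod P) (fobj (free_R P) y)" if "y \<in> mobj K" for y
  using tcmp_whisker_left[OF \<gamma>(1) free_R_small, of y] \<gamma>(2,5) that by simp
 have \<gamma>p: "farr p (tcmp \<gamma> y) = mident (fdom P) (fobj p y)" if "y \<in> mobj K" for y
  using tcmp_whisker_left[OF \<gamma>(1) p(1), of y] \<gamma>(2,6) that p(2,3) by simp
 have \<gamma>n: "mcomp K (tcmp \<gamma> (mcod K m)) [m] = mcomp K (cls P (Gen (farr p m))) (map (tcmp \<gamma>) (mdom K m))"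
  if "m \<in> marr K" for m
  using multitransformation.naturality[OF mtransD(1)[OF \<gamma>(1)], of m] \<gamma>(2,3) that p(2) p_arr by simp
 \<comment> \<open>The formal lift whose inputs are generators; its image under \<open>p\<close>
   will be the chosen lift.\<close>
 define l0 where "l0 es f = cls P (Lift (map In es) f)" for es f
 define c where "c = (\<lambda>(es, f)\<in>{(es, f). lprob P es f}. farr p (l0 es f))"
 have opc: "opcart P es f (farr p (l0 es f))" if l: "lprob P es f" for es f
 proof (rule opcartI)
  note lL = lifting_problem_L[OF l]
  have es: "set es \<subseteq> mobj (fdom P)" "map (fobj p) (map ob_code (map In es)) = es"
   using l pL by (auto simp: lifting_problem_def intro!: map_idI)
  let ?y = "ob_code (Push (map In es) f)"
  have l0K: "l0 es f \<in> marr K" "mdom K (l0 es f) = map ob_code (map In es)" "mcod K (l0 es f) = ?y"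
   using lL(1) by (simp_all add: l0_def)
  have yK: "?y \<in> mobj K" using lL(1) by simp
  have l0o: "opcart (free_R P) (map ob_code (map In es)) f (l0 es f)"
   unfolding l0_def by (rule Lift_opcartesian[OF lL(1)])
  have R0: "farr (free_R P) (l0 es f) = f" using lL(1) by (simp add: l0_def)
  show lE: "farr p (l0 es f) \<in> marr (fdom P)" "mdom (fdom P) (farr p (l0 es f)) = es" "farr P (farr p (l0 es f)) = f"
   using p_arr[OF l0K(1)] l0K(2) es(2) Pp2[OF l0K(1)] R0 by simp_all
  fix g w assume g: "g \<in> marr (fdom P)" "mdom (fdom P) g = es" and w: "w \<in> marr (fcod P)"
   "mdom (fcod P) w = [mcod (fcod P) f]" "mcod (fcod P) w = fobj P (mcod (fdom P) g)" "farr P g = mcomp (fcod P) w [f]"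
  have wf: "wf_tm P (Fill (map In es) f (Gen g) w)" using g w lL(1) by simp
  let ?v = "cls P (Fill (map In es) f (Gen g) w)"
  have vK: "?v \<in> marr K" "mdom K ?v = [?y]" "mcod K ?v = ob_code (In (mcod (fdom P) g))" "farr (free_R P) ?v = w"
   using wf by (simp_all del: wf_tm.simps(4))
  show "\<exists>!v. v \<in> marr (fdom P) \<and> mdom (fdom P) v = [mcod (fdom P) (farr p (l0 es f))] \<and>
   mcod (fdom P) v = mcod (fdom P) g \<and> mcomp (fdom P) v [farr p (l0 es f)] = g \<and> farr P v = w"
  proof (rule ex_ex1I)
   have "mcomp (fdom P) (farr p ?v) [farr p (l0 es f)] = farr p (cls P (Gen g))"
    using p_comp[OF vK(1) l0K(1)] vK(2) l0K(3) mcomp_Fill_Lift[OF wf] by (simp add: l0_def)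
   then show "\<exists>v. v \<in> marr (fdom P) \<and> mdom (fdom P) v = [mcod (fdom P) (farr p (l0 es f))] \<and>
     mcod (fdom P) v = mcod (fdom P) g \<and> mcomp (fdom P) v [farr p (l0 es f)] = g \<and> farr P v = w"
    using p_arr[OF vK(1)] vK p_arr(3)[OF l0K(1)] l0K(3) Pp2[OF vK(1)] pL g E.mcod_in[OF g(1)]
    by (intro exI[of _ "farr p ?v"]) simp
  next
   \<comment> \<open>The transpose of \<open>v\<close>: the component of \<open>\<gamma>\<close>
     leads from the formal codomain \<open>?y\<close> to the generator on the image of
     \<open>?y\<close> under \<open>p\<close>, where \<open>v\<close> can be applied. As
     \<open>p\<close> maps components of \<open>\<gamma>\<close> to identities, it sends
     \<open>u v\<close> back to \<open>v\<close>.\<close>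
   define u where "u v = mcomp K (cls P (Gen v)) [tcmp \<gamma> ?y]" for v
   have u: "u v \<in> marr K" "mdom K (u v) = [mcod K (l0 es f)]" "mcomp K (u v) [l0 es f] = cls P (Gen g)"
    "farr (free_R P) (u v) = w" "farr p (u v) = v"
    if v: "v \<in> marr (fdom P)" "mdom (fdom P) v = [mcod (fdom P) (farr p (l0 es f))]"
     "mcomp (fdom P) v [farr p (l0 es f)] = g" "farr P v = w" for v
   proof -
    have vK: "cls P (Gen v) \<in> marr K" "mdom K (cls P (Gen v)) = [ob_code (In (fobj p ?y))]" "farr (free_R P) (cls P (Gen v)) = w"
     using v p_arr(3)[OF l0K(1)] l0K(3) by simp_all
    have cK: "cls P (Gen (farr p (l0 es f))) \<in> marr K"
     "mdom K (cls P (Gen (farr p (l0 es f)))) = map ob_code (map In es)"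
     "mcod K (cls P (Gen (farr p (l0 es f)))) = ob_code (In (fobj p ?y))"
     using lE p_arr(3)[OF l0K(1)] l0K(3) by simp_all
    note \<gamma>y = \<gamma>t[OF yK]
    show "u v \<in> marr K" "mdom K (u v) = [mcod K (l0 es f)]"
     using vK \<gamma>y l0K by (simp_all add: u_def)
    have "map (tcmp \<gamma>) (mdom K (l0 es f)) = map (mident K) (map ob_code (map In es))"
     unfolding l0K(2) using \<gamma>L es(1) by auto
    then have "mcomp K (tcmp \<gamma> ?y) [l0 es f] = cls P (Gen (farr p (l0 es f)))"
     using \<gamma>n[OF l0K(1)] l0K(3) K.mcomp_mident_right[OF cK(1)] cK(2) by (simp del: map_map)
    then have "mcomp K (u v) [l0 es f] = mcomp K (cls P (Gen v)) [cls P (Gen (farr p (l0 es f)))]"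
     using vK \<gamma>y l0K by (simp add: u_def K.mcomp_assoc1)
    also have "\<dots> = farr (free_L P) (mcomp (fdom P) v [farr p (l0 es f)])"
     using L.farr_comp[of v "[farr p (l0 es f)]"] v lE by simp
    finally show "mcomp K (u v) [l0 es f] = cls P (Gen g)" using v(3) g(1) by simp
    have wd: "mdom (fcod P) w = [fobj (free_R P) ?y]" using w(2) lL(1) by simp
    show "farr (free_R P) (u v) = w"
     using R.farr_comp[of "cls P (Gen v)" "[tcmp \<gamma> ?y]"] vK \<gamma>y \<gamma>R[OF yK] w(1) wd B.ident_right[OF w(1) wd]
     by (simp add: u_def del: R_simps(3,4))
    show "farr p (u v) = v"
     using p_comp[OF vK(1) \<gamma>y(1)] vK(2) \<gamma>y(3) pL(2)[OF v(1)] \<gamma>p[OF yK] v p_arr(3)[OF l0K(1)] l0K(3)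
     by (simp add: u_def)
   qed
   fix v v' assume v: "v \<in> marr (fdom P) \<and> mdom (fdom P) v = [mcod (fdom P) (farr p (l0 es f))] \<and>
     mcod (fdom P) v = mcod (fdom P) g \<and> mcomp (fdom P) v [farr p (l0 es f)] = g \<and> farr P v = w"
    and v': "v' \<in> marr (fdom P) \<and> mdom (fdom P) v' = [mcod (fdom P) (farr p (l0 es f))] \<and>
     mcod (fdom P) v' = mcod (fdom P) g \<and> mcomp (fdom P) v' [farr p (l0 es f)] = g \<and> farr P v' = w"
   have "u v = u v'"
    by (rule opcart_unique[OF l0o R.multifunctor_axioms])
     (use u[of v] u[of v'] v v' K.multicategory_axioms in simp_all)
   then show "v = v'" using u(5)[of v] u(5)[of v'] v v' by metis
  qed
 qed
 have X: "(P, c) \<in> cloven"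
  using opc P by (auto simp: cloven_iff cleavage_def c_def)
 interpret RR: arrow_in_MCat U "free_R P" by unfold_locales (rule free_R_small)
 have Lp: "mfcomp (free_L P) p \<in> funs"
  using multifun_comp_small[OF p(1) free_L_small] p(3) by simp
 \<comment> \<open>The arrows compared by associativity are produced as extensions:
   \<open>q\<close>, the multiplication, extends the identity of \<open>K\<close>, and
   \<open>r\<close>, the image of the action under the monad, extends
   \<open>mfcomp (free_L P) p\<close>.\<close>
 have "Sq (free_R P) (mfid K) (mfid (fcod P)) (free_R P) \<in> sqs MCat"
  using free_R_small by (simp add: MCat.sq_iff multifun_id_small small_K funsD[OF P])
 from ext[OF this] obtain q where q: "clv.str (free_cloven (free_R P)) q (mfid (fcod P)) (free_cloven P)"
  "mfcomp q (free_L (free_R P)) = mfid K" by blast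
 have "mfcomp (free_R P) (mfcomp (free_L P) p) = mfcomp (mfcomp (free_R P) (free_L P)) p"
  using category.assoc'[OF category_MCat, of p "free_L P" "free_R P"] p free_L_small free_R_small by simp
 then have "Sq (free_R P) (mfcomp (free_L P) p) (mfid (fcod P)) (free_R P) \<in> sqs MCat"
  using free_R_small Lp p R_L by (simp add: MCat.sq_iff multifun_id_small funsD[OF P])
 from ext[OF this] obtain r where r: "clv.str (free_cloven (free_R P)) r (mfid (fcod P)) (free_cloven P)"
  "mfcomp r (free_L (free_R P)) = mfcomp (free_L P) p" by blast
 have pqr: "mfcomp p q = mfcomp p r"
  by (rule coeq[OF q(1) r(1) q(2) r(2)])
 have cp: "cleavage_preserving (free_cloven P) (Sq (free_R P) p (mfid (fcod P)) P) (P, c)"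
  unfolding preserves_iff
 proof (intro allI impI)
  fix es f assume "lprob (fst (free_cloven P)) es f"
  then have l: "lprob (free_R P) es f" by simp
  then have es: "set es \<subseteq> mobj K" and f: "f \<in> marr (fcod P)" by (simp_all add: lifting_problem_def)
  define m where "m = snd (free_cloven (free_R P)) (map (fobj (free_L (free_R P))) es, f)"
  have m: "m \<in> marr (fdom q)" "m \<in> marr (fdom r)"
   using RR.lifting_problem_L(1)[OF l] RR.free_cloven_L[OF l] RR.str_free_props(3)[OF q(1)[folded R_simps(2)]]
    RR.str_free_props(3)[OF r(1)[folded R_simps(2)]]
   unfolding m_def by (simp_all del: map_map wf_ob_Push)
  have "map (fobj (mfid K)) es = es" using es by (auto intro!: map_idI)
  then have mq: "farr q m = snd (free_cloven P) (es, f)"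
   using str_free_functor[OF free_R_small l _ R_simps(2), of q] q by (simp add: m_def)
  have "map (fobj (mfcomp (free_L P) p)) es = map (fobj (free_L P)) (map (fobj p) es)"
   using es p(2) by auto
  then have mr: "farr r m = snd (free_cloven P) (map (fobj (free_L P)) (map (fobj p) es), f)"
   using str_free_functor[OF free_R_small l _ R_simps(2), of r] r by (simp add: m_def del: map_map)
  have sq: "Sq (free_R P) p (mfid (fcod P)) P \<in> sqs MCat"
   using free_R_small p P by (simp add: MCat.sq_iff multifun_id_small funsD[OF P])
  have l': "lprob P (map (fobj p) es) f"
   using lifting_problem_map[OF sq, of es f] l f by simp
  \<comment> \<open>\<open>m\<close> is the formal lift of \<open>es\<close> taken as generators
    over \<open>free_R P\<close>. On it \<open>q\<close> gives the chosen lift of \<open>es\<close>,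
    while \<open>r\<close> gives the formal lift of the images of \<open>es\<close> under
    \<open>p\<close>.\<close>
  have "farr p (farr q m) = farr p (farr r m)"
   using arg_cong[OF pqr, of "\<lambda>F. farr F m"] m by simp
  then have "farr p (snd (free_cloven P) (es, f)) = farr p (l0 (map (fobj p) es) f)"
   using lifting_problem_L[OF l'] unfolding mq mr l0_def by (simp add: free_cloven_L[OF l'] del: map_map wf_ob_Push)
  then show "farr (stop (Sq (free_R P) p (mfid (fcod P)) P)) (snd (free_cloven P) (es, f)) =
    snd (P, c) (map (fobj (stop (Sq (free_R P) p (mfid (fcod P)) P))) es,
     farr (sbot (Sq (free_R P) p (mfid (fcod P)) P)) f)"
   using l' f by (simp add: c_def)
 qed
 have "clv.str (free_cloven P) p (mfid (fcod P)) (P, c)"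
  using cp X free_cloven_in p P by (simp add: clv.str_iff multifun_id_small funsD[OF P] free_R_small)
 then show ?thesis by (intro exI[of _ "(P, c)"]) simp
qed

lemma free_ext_ex:
 assumes "X \<in> cloven" "Sq P h k (fst X) \<in> sqs MCat"
 shows "\<exists>t. clv.str (free_cloven P) t k X \<and> mfcomp t (free_L P) = h"
 using assms str_free_ext[of X h k] free_ext_L[of X h k] by (auto simp: target_def)

lemma free_ext_unique:
 assumes "clv.str (free_cloven P) t k X" "clv.str (free_cloven P) t' k X"
  "mfcomp t (free_L P) = mfcomp t' (free_L P)"
 shows "t = t'"
 using str_free_eq[OF assms(1)] str_free_eq[OF assms(2)] assms(3) by simp

end

lemma (in uncountable_universe) free_arrows_MCat:
 "free_arrows (MCat :: (('u, 'u) multicat, ('u, 'u) multifun, ('u, 'u) multitrans) twocat)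
  cloven cleavage_preserving cloven_idn cloven_cmp free_L free_cloven"
proof -
 have aim: "arrow_in_MCat P" if "P \<in> funs" for P :: "('u, 'u) multifun"
  by unfold_locales (rule that)
 show ?thesis
 proof (unfold_locales, goal_cases)
  case (1 f) then show ?case using arrow_in_MCat.free_cloven_in[OF aim] by simp
 next
  case (2 f) then show ?case using arrow_in_MCat.free_L_small[OF aim] by simp
 next
  case (3 f) then show ?case using arrow_in_MCat.L_simps(1)[OF aim] by simp
 next
  case (4 f) then show ?case
   using arrow_in_MCat.L_simps(2)[OF aim] arrow_in_MCat.R_simps(1)[OF aim] arrow_in_MCat.free_cloven_simps(1)[OF aim] by simp
 next
  case (5 f) then show ?case
   using arrow_in_MCat.R_simps(2)[OF aim] arrow_in_MCat.free_cloven_simps(1)[OF aim] by simp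
 next
  case (6 f) then show ?case
   using arrow_in_MCat.R_L[OF aim] arrow_in_MCat.free_cloven_simps(1)[OF aim] by simp
 next
  case (7 f X h k) then show ?case using arrow_in_MCat.free_ext_ex[OF aim] by simp
 next
  case (8 f t k X t') then show ?case using arrow_in_MCat.free_ext_unique[OF aim] by simp
 next
  case (9 f t k X t' \<alpha> \<beta>) then show ?case
   using arrow_in_MCat.free_kz[OF aim, of f t k X t' \<alpha> \<beta>] arrow_in_MCat.R_simps(1)[OF aim]
    arrow_in_MCat.free_cloven_simps(1)[OF aim] by simp
 next
  case (10 X) then show ?case using str_clv_terminal by simp
 next
  case (11 X Y p h k)
  then show ?case
   using arrow_in_MCat.free_reflect[OF aim, of "fst X" X Y p h k] by (simp add: cloven_iff)
 next
  case (12 X Y)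
  then have s: "X \<in> cloven" "Y \<in> cloven" "fst Y = fst X" using clv.strD[OF 12(1)] by simp_all
  have "snd X (es, f) = snd Y (es, f)" if l: "lprob (fst X) es f" for es f
  proof -
   have "snd X (es, f) \<in> marr (fdom (fst X))"
    using s l by (intro opcartD(1)[OF cleavageD]) (auto simp: cloven_iff intro: funsD)
   moreover have "map (fobj (mfid (fdom (fst X)))) es = es" "f \<in> marr (fcod (fst X))"
    using l by (auto simp: lifting_problem_def intro!: map_idI)
   ultimately show ?thesis
    using str_clv_cleavage[OF 12(1) l] by simp
  qed
  then show ?case using s by (intro cloven_eqI) simp_all
 next
  case (13 f p \<gamma>)
  then have f: "f \<in> funs" by simp
  interpret arrow_in_MCat U f by (rule aim[OF f])
  have "\<exists>X. fst X = f \<and> clv.str (free_cloven f) p (mfid (fcod f)) X"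
   by (rule free_alg[of p \<gamma>])
    (use 13 arrow_in_MCat.free_ext_ex[OF aim[OF free_R_small], of "free_cloven f"] free_cloven_in in simp_all)
  then show ?case by simp
 qed
qed

section \<open>Adjunctions with identity unit\<close>

text \<open>An adjunction with identity unit is determined by the object part of the left adjoint, which
 is an arbitrary choice of universal arrows over identities.\<close>

definition universal_choice :: "('o, 'm, 'y) cat_scheme => ('p, 'n, 'z) cat_scheme => ('o, 'm, 'p, 'n) cfun =>
  ('p => 'o) => bool" where
 "universal_choice A B P l \<longleftrightarrow> (\<forall>b\<in>cobj B. l b \<in> cobj A \<and> ob_map P (l b) = b \<and>
  (\<forall>a\<in>cobj A. \<forall>v\<in>chom B b (ob_map P a). \<exists>!u. u \<in> chom A (l b) a \<and> ar_map P u = v))"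

text \<open>The canonical structure of a universal choice. The restrictions provide the extensional
  components that \<open>rali_structure\<close> demands, so that structures can be compared as
  values.\<close>

definition crali :: "('o, 'm, 'y) cat_scheme => ('p, 'n, 'z) cat_scheme => ('o, 'm, 'p, 'n) cfun =>
  ('p => 'o) => ('o, 'm, 'p, 'n) rali" where
 "crali A B P l = \<lparr>ladj = \<lparr>ob_map = restrict l (cobj B),
  ar_map = (\<lambda>v\<in>carr B. THE u. u \<in> chom A (l (cdom B v)) (l (ccod B v)) \<and> ar_map P u = v)\<rparr>,
  counit = (\<lambda>a\<in>cobj A. THE u. u \<in> chom A (l (ob_map P a)) a \<and> ar_map P u = cid B (ob_map P a))\<rparr>"

locale rali_context = A: category A + B: category B + P: functor_on A B P
 for A :: "('o, 'm, 'y) cat_scheme" and B :: "('p, 'n, 'z) cat_scheme" and P :: "('o, 'm, 'p, 'n) cfun"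
begin

abbreviation choice where "choice \<equiv> universal_choice A B P"

lemma choice_ob: "choice l ==> b \<in> cobj B ==> l b \<in> cobj A \<and> ob_map P (l b) = b"
 by (simp add: universal_choice_def)

lemma choice_ex1: "choice l ==> b \<in> cobj B ==> a \<in> cobj A ==> v \<in> chom B b (ob_map P a) ==>
  \<exists>!u. u \<in> chom A (l b) a \<and> ar_map P u = v"
 by (simp add: universal_choice_def)

lemma choice_unique:
 assumes l: "choice l" "b \<in> cobj B" and u: "u \<in> chom A (l b) a" "u' \<in> chom A (l b) a" "ar_map P u = ar_map P u'"
 shows "u = u'"
proof -
 have a: "a \<in> cobj A" using A.cod_in u(1) by (auto simp: chom_def)
 then have "ar_map P u \<in> chom B b (ob_map P a)"
  using P.ar_map[OF u(1)] choice_ob[OF l] by simp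
 from choice_ex1[OF l a this] show ?thesis using u by metis
qed

text \<open>The arrow that corresponds to \<open>v\<close> is its usual transpose, the counit after
  the left adjoint of \<open>v\<close>. It lies over \<open>v\<close> because the unit and the image
  of the counit are identities.\<close>

lemma rali_choice:
 assumes "rali_structure A B P Q"
 shows "choice (ob_map (ladj Q))"
proof -
 let ?l = "ob_map (ladj Q)"
 have F: "functor_on B A (ladj Q)" and e1: "\<And>b. b \<in> cobj B ==> ob_map P (?l b) = b"
  and e2: "\<And>v. v \<in> carr B ==> ar_map P (ar_map (ladj Q) v) = v"
  and c: "\<And>a. a \<in> cobj A ==> counit Q a \<in> chom A (?l (ob_map P a)) a"
  and n: "\<And>u. u \<in> carr A ==> ccomp A u (counit Q (cdom A u)) = ccomp A (counit Q (ccod A u)) (ar_map (ladj Q) (ar_map P u))"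
  and t1: "\<And>a. a \<in> cobj A ==> ar_map P (counit Q a) = cid B (ob_map P a)"
  and t2: "\<And>b. b \<in> cobj B ==> counit Q (?l b) = cid A (?l b)"
  using assms by (simp_all add: rali_structure_def)
 interpret F: functor_on B A "ladj Q" by fact
 have "\<exists>!u. u \<in> chom A (?l b) a \<and> ar_map P u = v" if b: "b \<in> cobj B" and a: "a \<in> cobj A" and v: "v \<in> chom B b (ob_map P a)" for a b v
 proof (rule ex1I[of _ "ccomp A (counit Q a) (ar_map (ladj Q) v)"])
  have Fv: "ar_map (ladj Q) v \<in> chom A (?l b) (?l (ob_map P a))"
   using F.ar_map[OF v b] P.ob_map[OF a] by simp
  have "ar_map P (ccomp A (counit Q a) (ar_map (ladj Q) v)) = ccomp B (ar_map P (counit Q a)) (ar_map P (ar_map (ladj Q) v))"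
   using P.map_comp[OF Fv c[OF a]] .
  also have "\<dots> = v"
   using B.id_left[OF v] v t1[OF a] e2 by (simp add: chom_def)
  finally show "ccomp A (counit Q a) (ar_map (ladj Q) v) \<in> chom A (?l b) a \<and>
    ar_map P (ccomp A (counit Q a) (ar_map (ladj Q) v)) = v"
   using A.comp_in[OF Fv c[OF a]] by simp
  fix u assume u: "u \<in> chom A (?l b) a \<and> ar_map P u = v"
  \<comment> \<open>The counit at the chosen object \<open>?l b\<close> is an identity, so
    naturality of the counit at \<open>u\<close> expresses \<open>u\<close> through its image
    \<open>v\<close>.\<close>
  then have "ccomp A u (cid A (?l b)) = ccomp A (counit Q a) (ar_map (ladj Q) v)"
   using n[of u] t2[OF b] by (auto simp: chom_def)
  then show "u = ccomp A (counit Q a) (ar_map (ladj Q) v)"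
   using u A.id_right[of u "?l b" a] by simp
 qed
 then show ?thesis
  using F.ob_map e1 by (simp add: universal_choice_def)
qed

lemma crali:
 assumes l: "choice l"
 shows "v \<in> carr B ==> ar_map (ladj (crali A B P l)) v \<in> chom A (l (cdom B v)) (l (ccod B v))"
  and "v \<in> carr B ==> ar_map P (ar_map (ladj (crali A B P l)) v) = v"
  and "a \<in> cobj A ==> counit (crali A B P l) a \<in> chom A (l (ob_map P a)) a"
  and "a \<in> cobj A ==> ar_map P (counit (crali A B P l) a) = cid B (ob_map P a)"
proof -
 show "v \<in> carr B ==> ar_map (ladj (crali A B P l)) v \<in> chom A (l (cdom B v)) (l (ccod B v))"
  "v \<in> carr B ==> ar_map P (ar_map (ladj (crali A B P l)) v) = v"
 proof -
  assume v: "v \<in> carr B"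
  have "\<exists>!u. u \<in> chom A (l (cdom B v)) (l (ccod B v)) \<and> ar_map P u = v"
   using choice_ob[OF l] B.dom_cod_in[OF v] v by (intro choice_ex1[OF l]) (simp_all add: chom_def)
  from theI'[OF this] show "ar_map (ladj (crali A B P l)) v \<in> chom A (l (cdom B v)) (l (ccod B v))"
   "ar_map P (ar_map (ladj (crali A B P l)) v) = v"
   using v by (simp_all add: crali_def)
 qed
 show "a \<in> cobj A ==> counit (crali A B P l) a \<in> chom A (l (ob_map P a)) a"
  "a \<in> cobj A ==> ar_map P (counit (crali A B P l) a) = cid B (ob_map P a)"
 proof -
  assume a: "a \<in> cobj A"
  have "\<exists>!u. u \<in> chom A (l (ob_map P a)) a \<and> ar_map P u = cid B (ob_map P a)"
   using P.ob_map[OF a] a B.id_in by (intro choice_ex1[OF l]) simp_all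
  from theI'[OF this] show "counit (crali A B P l) a \<in> chom A (l (ob_map P a)) a"
   "ar_map P (counit (crali A B P l) a) = cid B (ob_map P a)"
   using a by (simp_all add: crali_def)
 qed
qed

text \<open>Arrows out of a chosen object are determined by their images under \<open>P\<close>. A
  structure whose components have the right ends and images is therefore the canonical one; the
  explicit formulas for identities and composites are identified in this way.\<close>

lemma choice_rali_eqI:
 assumes l: "choice l"
  and o: "ob_map (ladj R) = restrict l (cobj B)" and e: "ar_map (ladj R) \<in> extensional (carr B)" "counit R \<in> extensional (cobj A)"
  and a: "\<And>v. v \<in> carr B ==> ar_map (ladj R) v \<in> chom A (l (cdom B v)) (l (ccod B v)) \<and> ar_map P (ar_map (ladj R) v) = v"
  and c: "\<And>x. x \<in> cobj A ==> counit R x \<in> chom A (l (ob_map P x)) x \<and> ar_map P (counit R x) = cid B (ob_map P x)"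
 shows "R = crali A B P l"
proof -
 note r = crali[OF l]
 have "ar_map (ladj R) = ar_map (ladj (crali A B P l))"
 proof (rule extensionalityI[OF e(1)])
  show "ar_map (ladj (crali A B P l)) \<in> extensional (carr B)" by (simp add: crali_def)
  fix v assume v: "v \<in> carr B"
  show "ar_map (ladj R) v = ar_map (ladj (crali A B P l)) v"
   using a[OF v] r(1,2)[OF v] B.dom_cod_in[OF v] by (intro choice_unique[OF l, of "cdom B v"]) auto
 qed
 moreover have "counit R = counit (crali A B P l)"
 proof (rule extensionalityI[OF e(2)])
  show "counit (crali A B P l) \<in> extensional (cobj A)" by (simp add: crali_def)
  fix x assume x: "x \<in> cobj A"
  show "counit R x = counit (crali A B P l) x"
   using c[OF x] r(3,4)[OF x] P.ob_map[OF x] by (intro choice_unique[OF l, of "ob_map P x"]) auto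
 qed
 ultimately show ?thesis
  using o by (intro rali.equality cfun.equality) (simp_all add: crali_def)
qed

lemma rali_eq_choice_rali:
 assumes "rali_structure A B P Q"
 shows "Q = crali A B P (ob_map (ladj Q))"
proof (rule choice_rali_eqI[OF rali_choice[OF assms]])
 interpret F: functor_on B A "ladj Q" using assms by (simp add: rali_structure_def)
 show "ob_map (ladj Q) = restrict (ob_map (ladj Q)) (cobj B)"
  using assms by (simp add: rali_structure_def extensional_restrict)
 show "ar_map (ladj Q) v \<in> chom A (ob_map (ladj Q) (cdom B v)) (ob_map (ladj Q) (ccod B v)) \<and>
   ar_map P (ar_map (ladj Q) v) = v" if "v \<in> carr B" for v
  using F.ar_props[OF that] B.dom_cod_in[OF that] assms that by (simp add: chom_def rali_structure_def)
qed (use assms in \<open>simp_all add: rali_structure_def\<close>)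

text \<open>Functoriality, naturality of the counit and the triangle law all equate parallel arrows
  out of chosen objects, so it suffices to compare their images under \<open>P\<close>.\<close>

lemma rali_choice_rali:
 assumes l: "choice l"
 shows "rali_structure A B P (crali A B P l)"
proof -
 note r = crali[OF l]
 let ?Q = "crali A B P l"
 have ob: "ob_map (ladj ?Q) b = l b" if "b \<in> cobj B" for b using that by (simp add: crali_def)
 have F: "functor_on B A (ladj ?Q)"
 proof (rule functor_onI)
  show "ob_map (ladj ?Q) b \<in> cobj A" if "b \<in> cobj B" for b using that ob choice_ob[OF l] by simp
  show "ar_map (ladj ?Q) v \<in> carr A \<and> cdom A (ar_map (ladj ?Q) v) = ob_map (ladj ?Q) (cdom B v) \<and>
    ccod A (ar_map (ladj ?Q) v) = ob_map (ladj ?Q) (ccod B v)" if "v \<in> carr B" for v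
   using r(1)[OF that] ob B.dom_cod_in[OF that] by (simp add: chom_def)
  show "ar_map (ladj ?Q) (cid B b) = cid A (ob_map (ladj ?Q) b)" if b: "b \<in> cobj B" for b
  proof (rule choice_unique[OF l b])
   show "ar_map (ladj ?Q) (cid B b) \<in> chom A (l b) (l b)"
    using r(1)[of "cid B b"] B.id_props[OF b] by simp
   show "cid A (ob_map (ladj ?Q) b) \<in> chom A (l b) (l b)" using ob[OF b] A.id_in choice_ob[OF l b] by simp
   show "ar_map P (ar_map (ladj ?Q) (cid B b)) = ar_map P (cid A (ob_map (ladj ?Q) b))"
    using r(2)[of "cid B b"] B.id_props[OF b] ob[OF b] P.map_id choice_ob[OF l b] by simp
  qed
  show "ar_map (ladj ?Q) (ccomp B w v) = ccomp A (ar_map (ladj ?Q) w) (ar_map (ladj ?Q) v)"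
   if v: "v \<in> carr B" and w: "w \<in> carr B" and vw: "ccod B v = cdom B w" for v w
  proof (rule choice_unique[OF l, of "cdom B v"])
   note c = B.comp_props[OF v w vw]
   show "ar_map (ladj ?Q) (ccomp B w v) \<in> chom A (l (cdom B v)) (l (ccod B w))"
    using r(1)[of "ccomp B w v"] c by simp
   show "ccomp A (ar_map (ladj ?Q) w) (ar_map (ladj ?Q) v) \<in> chom A (l (cdom B v)) (l (ccod B w))"
    using A.comp_in[OF r(1)[OF v]] r(1)[OF w] vw by simp
   show "ar_map P (ar_map (ladj ?Q) (ccomp B w v)) = ar_map P (ccomp A (ar_map (ladj ?Q) w) (ar_map (ladj ?Q) v))"
    using P.map_comp[OF r(1)[OF v]] r(1)[OF w] vw r(2) v w c by simp
  qed (use B.dom_cod_in[OF v] in simp)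
 qed
 interpret F: functor_on B A "ladj ?Q" by (rule F)
 have n: "ccomp A u (counit ?Q (cdom A u)) = ccomp A (counit ?Q (ccod A u)) (ar_map (ladj ?Q) (ar_map P u))"
  if u: "u \<in> carr A" for u
 proof (rule choice_unique[OF l, of "ob_map P (cdom A u)"])
  have d: "cdom A u \<in> cobj A" "ccod A u \<in> cobj A" using A.dom_cod_in[OF u] by simp_all
  have uh: "u \<in> chom A (cdom A u) (ccod A u)" using u by (simp add: chom_def)
  have Pu: "ar_map P u \<in> chom B (ob_map P (cdom A u)) (ob_map P (ccod A u))"
   using P.ar_map[OF uh d] .
  have lP: "ar_map (ladj ?Q) (ar_map P u) \<in> chom A (l (ob_map P (cdom A u))) (l (ob_map P (ccod A u)))"
   using r(1)[of "ar_map P u"] Pu by (simp add: chom_def)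
  show "ob_map P (cdom A u) \<in> cobj B" using P.ob_map[OF d(1)] .
  show "ccomp A u (counit ?Q (cdom A u)) \<in> chom A (l (ob_map P (cdom A u))) (ccod A u)"
   using A.comp_in[OF r(3)[OF d(1)] uh] .
  show "ccomp A (counit ?Q (ccod A u)) (ar_map (ladj ?Q) (ar_map P u)) \<in> chom A (l (ob_map P (cdom A u))) (ccod A u)"
   using A.comp_in[OF lP r(3)[OF d(2)]] .
  show "ar_map P (ccomp A u (counit ?Q (cdom A u))) = ar_map P (ccomp A (counit ?Q (ccod A u)) (ar_map (ladj ?Q) (ar_map P u)))"
   using P.map_comp[OF r(3)[OF d(1)] uh] P.map_comp[OF lP r(3)[OF d(2)]] r(2)[of "ar_map P u"] r(4)[OF d(1)] r(4)[OF d(2)]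
    B.id_left[OF Pu] B.id_right[OF Pu] Pu by (simp add: chom_def)
 qed
 have t2: "counit ?Q (ob_map (ladj ?Q) b) = cid A (ob_map (ladj ?Q) b)" if b: "b \<in> cobj B" for b
  unfolding ob[OF b]
 proof (rule choice_unique[OF l b])
  note lb = choice_ob[OF l b]
  show "counit ?Q (l b) \<in> chom A (l b) (l b)" using r(3)[of "l b"] lb by simp
  show "cid A (l b) \<in> chom A (l b) (l b)" using A.id_in lb by simp
  show "ar_map P (counit ?Q (l b)) = ar_map P (cid A (l b))" using r(4)[of "l b"] P.map_id[of "l b"] lb by simp
 qed
 have c: "counit ?Q a \<in> chom A (ob_map (ladj ?Q) (ob_map P a)) a" if "a \<in> cobj A" for a
  using r(3)[OF that] ob[OF P.ob_map[OF that]] by simp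
 have e: "ob_map (ladj ?Q) \<in> extensional (cobj B)" "ar_map (ladj ?Q) \<in> extensional (carr B)" "counit ?Q \<in> extensional (cobj A)"
  by (simp_all add: crali_def)
 show ?thesis
  unfolding rali_structure_def using F e r(2,4) c n t2 ob choice_ob[OF l] by simp
qed

lemma choice_rali_cong: "(\<And>b. b \<in> cobj B ==> l b = l' b) ==> crali A B P l = crali A B P l'"
 using B.dom_cod_in P.ob_map by (simp add: crali_def cong: restrict_cong)

end

text \<open>Compatibility with the chosen objects implies compatibility with the left adjoints on
  arrows and with the counits, again by comparison of images. It reduces \<open>kz_morphism\<close>
  to its first clause.\<close>

lemma rali_morphism:
 assumes "rali_context A B P" "rali_context A' B' P'" and l: "universal_choice A B P l" and l': "universal_choice A' B' P' l'"
  and H: "functor_on A A' H" and G: "functor_on B B' G"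
  and ob: "\<And>a. a \<in> cobj A ==> ob_map P' (ob_map H a) = ob_map G (ob_map P a)"
  and ar: "\<And>u. u \<in> carr A ==> ar_map P' (ar_map H u) = ar_map G (ar_map P u)"
  and c: "\<And>b. b \<in> cobj B ==> ob_map H (l b) = l' (ob_map G b)"
 shows "v \<in> carr B ==> ar_map H (ar_map (ladj (crali A B P l)) v) = ar_map (ladj (crali A' B' P' l')) (ar_map G v)"
  and "a \<in> cobj A ==> ar_map H (counit (crali A B P l) a) = counit (crali A' B' P' l') (ob_map H a)"
proof -
 interpret X: rali_context A B P by fact
 interpret Y: rali_context A' B' P' by fact
 interpret H: functor_on A A' H by fact
 interpret G: functor_on B B' G by fact
 note r = X.crali[OF l] and r' = Y.crali[OF l']
 show "ar_map H (ar_map (ladj (crali A B P l)) v) = ar_map (ladj (crali A' B' P' l')) (ar_map G v)"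
  if v: "v \<in> carr B"
 proof (rule Y.choice_unique[OF l', of "ob_map G (cdom B v)"])
  note d = X.B.dom_cod_in[OF v]
  note Gv = G.ar_props[OF v conjunct1[OF d] conjunct2[OF d]]
  show "ob_map G (cdom B v) \<in> cobj B'" using G.ob_map d by simp
  show "ar_map H (ar_map (ladj (crali A B P l)) v) \<in> chom A' (l' (ob_map G (cdom B v))) (l' (ob_map G (ccod B v)))"
   using H.ar_map[OF r(1)[OF v]] X.choice_ob[OF l] c d by simp
  show "ar_map (ladj (crali A' B' P' l')) (ar_map G v) \<in> chom A' (l' (ob_map G (cdom B v))) (l' (ob_map G (ccod B v)))"
   using r'(1)[of "ar_map G v"] Gv by simp
  show "ar_map P' (ar_map H (ar_map (ladj (crali A B P l)) v)) = ar_map P' (ar_map (ladj (crali A' B' P' l')) (ar_map G v))"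
   using ar[of "ar_map (ladj (crali A B P l)) v"] r(1)[OF v] r(2)[OF v] r'(2)[of "ar_map G v"] Gv by (simp add: chom_def)
 qed
 show "ar_map H (counit (crali A B P l) a) = counit (crali A' B' P' l') (ob_map H a)" if a: "a \<in> cobj A"
 proof (rule Y.choice_unique[OF l', of "ob_map G (ob_map P a)"])
  have Pa: "ob_map P a \<in> cobj B" using X.P.ob_map[OF a] .
  have Ha: "ob_map H a \<in> cobj A'" using H.ob_map[OF a] .
  show "ob_map G (ob_map P a) \<in> cobj B'" using G.ob_map[OF Pa] .
  show "ar_map H (counit (crali A B P l) a) \<in> chom A' (l' (ob_map G (ob_map P a))) (ob_map H a)"
   using H.ar_map[OF r(3)[OF a] _ a] X.choice_ob[OF l Pa] c[OF Pa] by simp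
  show "counit (crali A' B' P' l') (ob_map H a) \<in> chom A' (l' (ob_map G (ob_map P a))) (ob_map H a)"
   using r'(3)[OF Ha] ob[OF a] by simp
  show "ar_map P' (ar_map H (counit (crali A B P l) a)) = ar_map P' (counit (crali A' B' P' l') (ob_map H a))"
   using ar[of "counit (crali A B P l) a"] r(3)[OF a] r(4)[OF a] r'(4)[OF Ha] ob[OF a] G.map_id[OF Pa]
   by (simp add: chom_def)
 qed
qed

section \<open>Comparison functors and KZ structures\<close>

lemma hom_cat_simps [simp]:
 "cobj (hom_cat C x y) = chom C x y" "carr (hom_cat C x y) = {\<theta> \<in> cell C. src C \<theta> \<in> chom C x y}"
 "cdom (hom_cat C x y) = src C" "ccod (hom_cat C x y) = trg C" "cid (hom_cat C x y) = id2 C"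
 "ccomp (hom_cat C x y) = vcomp C"
 by (simp_all add: hom_cat_def)

lemma target_simps [simp]:
 "cobj (comparison_target C j f) = {(u, w). u \<in> chom C (cdom C j) (cdom C f) \<and> w \<in> chom C (ccod C j) (ccod C f) \<and>
  ccomp C f u = ccomp C w j}"
 "carr (comparison_target C j f) = {(\<alpha>, \<beta>). \<alpha> \<in> cell C \<and> src C \<alpha> \<in> chom C (cdom C j) (cdom C f) \<and>
  \<beta> \<in> cell C \<and> src C \<beta> \<in> chom C (ccod C j) (ccod C f) \<and> hcomp C (id2 C f) \<alpha> = hcomp C \<beta> (id2 C j)}"
 "cdom (comparison_target C j f) = map_prod (src C) (src C)"
 "ccod (comparison_target C j f) = map_prod (trg C) (trg C)"
 "cid (comparison_target C j f) = map_prod (id2 C) (id2 C)"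
 "ccomp (comparison_target C j f) (\<alpha>', \<beta>') (\<alpha>, \<beta>) = (vcomp C \<alpha>' \<alpha>, vcomp C \<beta>' \<beta>)"
 by (auto simp: comparison_target_def pb_cat_def precomp_def postcomp_def)

lemma comparison_simps [simp]:
 "ob_map (comparison C j f) d = (ccomp C d j, ccomp C f d)"
 "ar_map (comparison C j f) \<theta> = (hcomp C \<theta> (id2 C j), hcomp C (id2 C f) \<theta>)"
 by (simp_all add: comparison_def precomp_def postcomp_def)

context two_category
begin

lemma category_hom_cat: "category (hom_cat C x y)"
 by (rule categoryI) (auto simp: chom_def)

lemma category_comparison_target:
 assumes "j \<in> carr C" "f \<in> carr C"
 shows "category (comparison_target C j f)"
proof (rule categoryI, goal_cases)
 case (1 p)
 then obtain \<alpha> \<beta> where p: "p = (\<alpha>, \<beta>)" "\<alpha> \<in> cell C" "src C \<alpha> \<in> chom C (cdom C j) (cdom C f)" "\<beta> \<in> cell C"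
  "src C \<beta> \<in> chom C (ccod C j) (ccod C f)" and e: "\<iota> f \<star> \<alpha> = \<beta> \<star> \<iota> j"
  by auto
 show ?case
  using p assms arg_cong[OF e, of "src C"] arg_cong[OF e, of "trg C"] by (simp add: chom_def)
next
 case (3 p q) then show ?case
  using assms by (auto simp: chom_def whisker_left_vcomp whisker_right_vcomp)
qed (use assms in \<open>auto simp: chom_def\<close>)

lemma rali_context_comparison:
 assumes "j \<in> carr C" "f \<in> carr C"
 shows "rali_context (hom_cat C (ccod C j) (cdom C f)) (comparison_target C j f) (comparison C j f)"
proof (intro rali_context.intro category_hom_cat category_comparison_target assms functor_onI, goal_cases)
 case (4 \<theta> \<phi>) then show ?case
  using assms by (simp add: chom_def whisker_left_vcomp whisker_right_vcomp)
qed (use assms in \<open>auto simp: chom_def\<close>)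

end

definition kz_choice :: "('o, 'a, 'c) twocat => 'a => 'a => ('a \<times> 'a => 'a) => bool" where
 "kz_choice C j f = universal_choice (hom_cat C (ccod C j) (cdom C f)) (comparison_target C j f) (comparison C j f)"

definition kz_rali :: "('o, 'a, 'c) twocat => 'a => 'a => ('a \<times> 'a => 'a) => ('a, 'c, 'a \<times> 'a, 'c \<times> 'c) rali" where
 "kz_rali C j f = crali (hom_cat C (ccod C j) (cdom C f)) (comparison_target C j f) (comparison C j f)"

context two_category'
begin

lemma kz_choice_ob:
 assumes "j \<in> carr C" "f \<in> carr C" "kz_choice C j f l" "u \<in> carr C" "cdom C u = cdom C j" "ccod C u = cdom C f"
  "w \<in> carr C" "cdom C w = ccod C j" "ccod C w = ccod C f" "f \<cdot> u = w \<cdot> j"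
 shows "l (u, w) \<in> carr C" "cdom C (l (u, w)) = ccod C j" "ccod C (l (u, w)) = cdom C f"
  "l (u, w) \<cdot> j = u" "f \<cdot> l (u, w) = w"
 using rali_context.choice_ob[OF rali_context_comparison[OF assms(1,2)], of l "(u, w)"] assms(3-)
 by (auto simp: kz_choice_def chom_def)

lemma kz_rali_ar:
 assumes "j \<in> carr C" "f \<in> carr C" "kz_choice C j f l"
  and "\<alpha> \<in> cell C" "cdom C (src C \<alpha>) = cdom C j" "ccod C (src C \<alpha>) = cdom C f"
  "\<beta> \<in> cell C" "cdom C (src C \<beta>) = ccod C j" "ccod C (src C \<beta>) = ccod C f" "\<iota> f \<star> \<alpha> = \<beta> \<star> \<iota> j"
 defines "\<gamma> \<equiv> ar_map (ladj (kz_rali C j f l)) (\<alpha>, \<beta>)"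
 shows "\<gamma> \<in> cell C" "src C \<gamma> = l (src C \<alpha>, src C \<beta>)" "trg C \<gamma> = l (trg C \<alpha>, trg C \<beta>)" "\<gamma> \<star> \<iota> j = \<alpha>" "\<iota> f \<star> \<gamma> = \<beta>"
 using rali_context.crali(1,2)[OF rali_context_comparison[OF assms(1,2)], of l "(\<alpha>, \<beta>)"] assms(3-)
 by (auto simp: kz_choice_def kz_rali_def chom_def)

lemma kz_rali_counit:
 assumes "j \<in> carr C" "f \<in> carr C" "kz_choice C j f l" and "d \<in> carr C" "cdom C d = ccod C j" "ccod C d = cdom C f"
 defines "\<gamma> \<equiv> counit (kz_rali C j f l) d"
 shows "\<gamma> \<in> cell C" "src C \<gamma> = l (d \<cdot> j, f \<cdot> d)" "trg C \<gamma> = d" "\<gamma> \<star> \<iota> j = \<iota> (d \<cdot> j)" "\<iota> f \<star> \<gamma> = \<iota> (f \<cdot> d)"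
 using rali_context.crali(3,4)[OF rali_context_comparison[OF assms(1,2)], of l d] assms(3-)
 by (auto simp: kz_choice_def kz_rali_def chom_def)

lemma kz_rali_morphism:
 assumes j: "j \<in> carr C" and s: "s \<in> sqs C" and l: "kz_choice C j (sdom s) l" and l': "kz_choice C j (scod s) l'"
  and c: "\<And>u w. (u, w) \<in> cobj (comparison_target C j (sdom s)) ==> stop s \<cdot> l (u, w) = l' (stop s \<cdot> u, sbot s \<cdot> w)"
 shows "(\<alpha>, \<beta>) \<in> carr (comparison_target C j (sdom s)) ==>
   \<iota> (stop s) \<star> ar_map (ladj (kz_rali C j (sdom s) l)) (\<alpha>, \<beta>) =
   ar_map (ladj (kz_rali C j (scod s) l')) (\<iota> (stop s) \<star> \<alpha>, \<iota> (sbot s) \<star> \<beta>)"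
  and "d \<in> chom C (ccod C j) (cdom C (sdom s)) ==>
   \<iota> (stop s) \<star> counit (kz_rali C j (sdom s) l) d = counit (kz_rali C j (scod s) l') (stop s \<cdot> d)"
proof -
 \<comment> \<open>Postcomposition with the square \<open>s\<close>: \<open>?H\<close> acts on
   fillers and \<open>?G\<close> on the squares to be filled.\<close>
 let ?H = "\<lparr>ob_map = (\<lambda>d. stop s \<cdot> d), ar_map = (\<lambda>\<theta>. \<iota> (stop s) \<star> \<theta>)\<rparr>"
 let ?G = "\<lparr>ob_map = (\<lambda>(u, w). (stop s \<cdot> u, sbot s \<cdot> w)), ar_map = (\<lambda>(\<alpha>, \<beta>). (\<iota> (stop s) \<star> \<alpha>, \<iota> (sbot s) \<star> \<beta>))\<rparr>"
 have d: "sdom s \<in> carr C" "scod s \<in> carr C" "stop s \<in> carr C" "sbot s \<in> carr C"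
  "cdom C (stop s) = cdom C (sdom s)" "ccod C (stop s) = cdom C (scod s)"
  "cdom C (sbot s) = ccod C (sdom s)" "ccod C (sbot s) = ccod C (scod s)"
  and e: "scod s \<cdot> stop s = sbot s \<cdot> sdom s"
  using s by (simp_all add: sq_iff)
 have e1: "scod s \<cdot> stop s \<cdot> u = sbot s \<cdot> sdom s \<cdot> u" if "u \<in> carr C" "ccod C u = cdom C (sdom s)" for u
  using comp_1_assoc_eq[OF e, of u] that d by simp
 have e2: "\<iota> (sbot s \<cdot> sdom s) \<star> \<alpha> = \<iota> (sbot s) \<star> \<iota> (sdom s) \<star> \<alpha>" if "\<alpha> \<in> cell C" "ccod C (src C \<alpha>) = cdom C (sdom s)" for \<alpha>
  using that d by simp
 have H: "functor_on (hom_cat C (ccod C j) (cdom C (sdom s))) (hom_cat C (ccod C j) (cdom C (scod s))) ?H"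
  by (rule functor_onI) (use d in \<open>auto simp: chom_def whisker_left_vcomp\<close>)
 have G: "functor_on (comparison_target C j (sdom s)) (comparison_target C j (scod s)) ?G"
 proof (rule functor_onI, goal_cases)
  case (2 p)
  then obtain \<alpha> \<beta> where p: "p = (\<alpha>, \<beta>)" "\<alpha> \<in> cell C" "src C \<alpha> \<in> chom C (cdom C j) (cdom C (sdom s))" "\<beta> \<in> cell C"
   "src C \<beta> \<in> chom C (ccod C j) (ccod C (sdom s))" and e': "\<iota> (sdom s) \<star> \<alpha> = \<beta> \<star> \<iota> j"
   by auto
  have "\<iota> (scod s) \<star> \<iota> (stop s) \<star> \<alpha> = \<iota> (sbot s) \<star> \<iota> (sdom s) \<star> \<alpha>"
   using p d e e2[of \<alpha>] by (simp add: chom_def)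
  also have "\<dots> = (\<iota> (sbot s) \<star> \<beta>) \<star> \<iota> j"
   unfolding e' using p d j by (simp add: chom_def)
  finally show ?case using p d j by (simp add: chom_def)
 next
  case (4 p q) then show ?case using d by (auto simp: chom_def whisker_left_vcomp)
 qed (use d e1 j in \<open>auto simp: chom_def\<close>)
 note m = rali_morphism[OF rali_context_comparison[OF j d(1)] rali_context_comparison[OF j d(2)]
   l[unfolded kz_choice_def] l'[unfolded kz_choice_def] H G]
 show "\<iota> (stop s) \<star> ar_map (ladj (kz_rali C j (sdom s) l)) (\<alpha>, \<beta>) =
   ar_map (ladj (kz_rali C j (scod s) l')) (\<iota> (stop s) \<star> \<alpha>, \<iota> (sbot s) \<star> \<beta>)"
  if "(\<alpha>, \<beta>) \<in> carr (comparison_target C j (sdom s))"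
  using m(1)[OF _ _ _ that] d e e1 c j by (auto simp: kz_rali_def chom_def)
 show "\<iota> (stop s) \<star> counit (kz_rali C j (sdom s) l) d = counit (kz_rali C j (scod s) l') (stop s \<cdot> d)"
  if "d \<in> chom C (ccod C j) (cdom C (sdom s))" for d
  using m(2)[of d] that d e e1 c j by (auto simp: kz_rali_def chom_def)
qed

text \<open>A square into an identity has its upper side determined by the lower one, which is also
  its only filler. Hence \<open>snd\<close>.\<close>

lemma kz_choice_idn:
 assumes j: "j \<in> carr C" and x: "x \<in> cobj C"
 shows "kz_choice C j (cid C x) snd"
 unfolding kz_choice_def universal_choice_def
proof (intro ballI conjI)
 fix b a v assume b: "b \<in> cobj (comparison_target C j (cid C x))" and a: "a \<in> cobj (hom_cat C (ccod C j) (cdom C (cid C x)))"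
  and v: "v \<in> chom (comparison_target C j (cid C x)) b (ob_map (comparison C j (cid C x)) a)"
 obtain \<alpha> \<beta> where ab: "v = (\<alpha>, \<beta>)" "\<beta> \<in> cell C" "\<alpha> \<in> cell C" by (cases v) (use v in \<open>simp add: chom_def\<close>)
 have s: "ccod C (src C \<alpha>) = x" "src C \<beta> = snd b" "trg C \<beta> = a" "cdom C (src C \<beta>) = ccod C j" "ccod C (src C \<beta>) = x" "\<iota> (cid C x) \<star> \<alpha> = \<beta> \<star> \<iota> j"
  using v x a by (auto simp: ab chom_def)
 have e: "\<alpha> = \<beta> \<star> \<iota> j" using s(1,6) ab x by simp
 show "\<exists>!u. u \<in> chom (hom_cat C (ccod C j) (cdom C (cid C x))) (snd b) a \<and> ar_map (comparison C j (cid C x)) u = v"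
 proof (rule ex1I[of _ \<beta>], goal_cases)
  case 1
  have "src C \<beta> \<in> carr C" using ab(2) by simp
  then show ?case using ab(2) s(2-5) x by (simp add: chom_def ab(1) e)
 next
  case (2 u) then have "\<iota> (cid C x) \<star> u = \<beta>" "u \<in> cell C" "ccod C (src C u) = x"
   using x by (auto simp: chom_def ab(1))
  then show ?case using x by simp
 qed
next
 fix b assume b: "b \<in> cobj (comparison_target C j (cid C x))"
 obtain u w where uw: "b = (u, w)" by (cases b)
 have s: "u \<in> carr C" "ccod C u = x" "w \<in> carr C" "cdom C w = ccod C j" "ccod C w = x" "cid C x \<cdot> u = w \<cdot> j"
  using b x by (simp_all add: uw chom_def)
 have e: "u = w \<cdot> j" using s(1,2,6) x by simp
 show "snd b \<in> cobj (hom_cat C (ccod C j) (cdom C (cid C x)))" using s(3-5) x by (simp add: uw chom_def)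
 show "ob_map (comparison C j (cid C x)) (snd b) = b" using s(3-5) x by (simp add: uw e)
qed

lemma kz_id_eq:
 assumes J: "\<And>i. i \<in> cobj J ==> ob_map U i \<in> carr C" and x: "x \<in> cobj C"
 shows "kz_id C J U x = (cid C x, \<lambda>i\<in>cobj J. kz_rali C (ob_map U i) (cid C x) snd)"
proof -
 have "\<lparr>ladj = \<lparr>ob_map = restrict snd (cobj (comparison_target C j (cid C x))),
       ar_map = restrict snd (carr (comparison_target C j (cid C x)))\<rparr>,
   counit = restrict (id2 C) (chom C (ccod C j) x)\<rparr> = kz_rali C j (cid C x) snd" if j: "j \<in> carr C" for j
  unfolding kz_rali_def
 proof (rule rali_context.choice_rali_eqI[OF rali_context_comparison[OF j]], goal_cases)
  case 2 show ?case using kz_choice_idn[OF j x] by (simp add: kz_choice_def)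
 next
  case (6 v)
  obtain \<alpha> \<beta> where ab: "v = (\<alpha>, \<beta>)" "\<beta> \<in> cell C" "\<alpha> \<in> cell C" by (cases v) (use 6 in simp)
  have s: "ccod C (src C \<alpha>) = x" "cdom C (src C \<beta>) = ccod C j" "ccod C (src C \<beta>) = x" "\<iota> (cid C x) \<star> \<alpha> = \<beta> \<star> \<iota> j"
   using 6 x by (simp_all add: ab chom_def)
  have e: "\<alpha> = \<beta> \<star> \<iota> j" using s(1,4) ab x by simp
  show ?case using 6 s(2,3) x j ab(2) by (simp add: chom_def ab(1) e)
 next
  case (7 d) then show ?case using x j by (simp add: chom_def)
 next
  case 3 show ?case by (simp only: rali.simps cfun.simps)
 next
  case 4 show ?case by (simp only: rali.simps cfun.simps restrict_extensional)
 qed (use x in simp_all)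
 then show ?thesis
  using J by (simp add: kz_id_def cong: restrict_cong)
qed

text \<open>The composed choice fills against \<open>g\<close> first and against \<open>f\<close>
  afterwards. The formulas of \<open>kz_comp\<close> for arrows and counits have the ends and images
  prescribed by this choice, so \<open>choice_rali_eqI\<close> identifies the result with the
  canonical structure.\<close>

lemma kz_comp_eq:
 assumes J: "\<And>i. i \<in> cobj J ==> ob_map U i \<in> carr C"
  and f: "f \<in> carr C" and g: "g \<in> carr C" and fg: "ccod C f = cdom C g"
  and l: "\<And>i. i \<in> cobj J ==> kz_choice C (ob_map U i) f (l i)" and l': "\<And>i. i \<in> cobj J ==> kz_choice C (ob_map U i) g (l' i)"
  and m: "\<And>i. i \<in> cobj J ==> kz_choice C (ob_map U i) (g \<cdot> f) (m i)"
  and e: "\<And>i u w. i \<in> cobj J ==> (u, w) \<in> cobj (comparison_target C (ob_map U i) (g \<cdot> f)) ==>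
   m i (u, w) = l i (u, l' i (f \<cdot> u, w))"
 shows "kz_comp C J U (g, \<lambda>i\<in>cobj J. kz_rali C (ob_map U i) g (l' i)) (f, \<lambda>i\<in>cobj J. kz_rali C (ob_map U i) f (l i)) =
  (g \<cdot> f, \<lambda>i\<in>cobj J. kz_rali C (ob_map U i) (g \<cdot> f) (m i))"
proof -
 have "\<lparr>ladj =
   \<lparr>ob_map = (\<lambda>(u, w)\<in>cobj (comparison_target C j (g \<cdot> f)).
     ob_map (ladj (kz_rali C j f l)) (u, ob_map (ladj (kz_rali C j g l')) (f \<cdot> u, w))),
    ar_map = (\<lambda>(\<alpha>, \<gamma>)\<in>carr (comparison_target C j (g \<cdot> f)).
     ar_map (ladj (kz_rali C j f l)) (\<alpha>, ar_map (ladj (kz_rali C j g l')) (\<iota> f \<star> \<alpha>, \<gamma>)))\<rparr>,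
   counit = (\<lambda>d\<in>chom C (ccod C j) (cdom C f).
    counit (kz_rali C j f l) d \<bullet>
     ar_map (ladj (kz_rali C j f l)) (\<iota> (d \<cdot> j), counit (kz_rali C j g l') (f \<cdot> d)))\<rparr> = kz_rali C j (g \<cdot> f) m"
  (is "?R = _")
  if j: "j \<in> carr C" and l: "kz_choice C j f l" and l': "kz_choice C j g l'" and m: "kz_choice C j (g \<cdot> f) m"
   and e: "\<And>u w. (u, w) \<in> cobj (comparison_target C j (g \<cdot> f)) ==> m (u, w) = l (u, l' (f \<cdot> u, w))" for j l l' m
  unfolding kz_rali_def[of _ _ "g \<cdot> f"]
 proof (rule rali_context.choice_rali_eqI[OF rali_context_comparison[OF j]])
  have gf: "g \<cdot> f \<in> carr C" using f g fg by simp
  show "g \<cdot> f \<in> carr C" by fact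
  show "universal_choice (hom_cat C (ccod C j) (cdom C (g \<cdot> f))) (comparison_target C j (g \<cdot> f)) (comparison C j (g \<cdot> f)) m"
   using m by (simp add: kz_choice_def)
  have ob: "ob_map (ladj (kz_rali C j f l)) b = l b" if "b \<in> cobj (comparison_target C j f)" for b
   using that by (simp add: kz_rali_def crali_def)
  have ob': "ob_map (ladj (kz_rali C j g l')) b = l' b" if "b \<in> cobj (comparison_target C j g)" for b
   using that by (simp add: kz_rali_def crali_def)
  show "ob_map (ladj ?R) = restrict m (cobj (comparison_target C j (g \<cdot> f)))"
  proof (rule extensionalityI)
   fix b assume b: "b \<in> cobj (comparison_target C j (g \<cdot> f))"
   then obtain u w where b': "b = (u, w)" "u \<in> carr C" "cdom C u = cdom C j" "ccod C u = cdom C f" "w \<in> carr C"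
    "cdom C w = ccod C j" "ccod C w = ccod C g" "g \<cdot> f \<cdot> u = w \<cdot> j"
    using f g fg by (auto simp: chom_def)
   note o' = kz_choice_ob[OF j g l', of "f \<cdot> u" w]
   have "l' (f \<cdot> u, w) \<in> carr C" "cdom C (l' (f \<cdot> u, w)) = ccod C j" "ccod C (l' (f \<cdot> u, w)) = cdom C g"
    "l' (f \<cdot> u, w) \<cdot> j = f \<cdot> u"
    using o' b' f g fg by simp_all
   then have "(f \<cdot> u, w) \<in> cobj (comparison_target C j g)" "(u, l' (f \<cdot> u, w)) \<in> cobj (comparison_target C j f)"
    using b' f g fg by (auto simp: chom_def)
   then show "ob_map (ladj ?R) b = restrict m (cobj (comparison_target C j (g \<cdot> f))) b"
    using b e[of u w] ob ob' b'(1) by simp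
  qed simp_all
  show "ar_map (ladj ?R) \<in> extensional (carr (comparison_target C j (g \<cdot> f)))"
   "counit ?R \<in> extensional (cobj (hom_cat C (ccod C j) (cdom C (g \<cdot> f))))"
   using f g fg by simp_all
  show "ar_map (ladj ?R) v \<in> chom (hom_cat C (ccod C j) (cdom C (g \<cdot> f))) (m (cdom (comparison_target C j (g \<cdot> f)) v))
    (m (ccod (comparison_target C j (g \<cdot> f)) v)) \<and> ar_map (comparison C j (g \<cdot> f)) (ar_map (ladj ?R) v) = v"
   if v: "v \<in> carr (comparison_target C j (g \<cdot> f))" for v
  proof -
   obtain \<alpha> \<gamma> where v': "v = (\<alpha>, \<gamma>)" "\<alpha> \<in> cell C" "cdom C (src C \<alpha>) = cdom C j" "ccod C (src C \<alpha>) = cdom C f"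
    "\<gamma> \<in> cell C" "cdom C (src C \<gamma>) = ccod C j" "ccod C (src C \<gamma>) = ccod C g" and q: "\<iota> (g \<cdot> f) \<star> \<alpha> = \<gamma> \<star> \<iota> j"
    using v f g fg by (auto simp: chom_def)
   define \<delta> where "\<delta> = ar_map (ladj (kz_rali C j g l')) (\<iota> f \<star> \<alpha>, \<gamma>)"
   have \<delta>: "\<delta> \<in> cell C" "src C \<delta> = l' (f \<cdot> src C \<alpha>, src C \<gamma>)" "trg C \<delta> = l' (f \<cdot> trg C \<alpha>, trg C \<gamma>)" "\<delta> \<star> \<iota> j = \<iota> f \<star> \<alpha>" "\<iota> g \<star> \<delta> = \<gamma>"
    using kz_rali_ar[OF j g l', of "\<iota> f \<star> \<alpha>" \<gamma>] v' q f g fg by (simp_all add: \<delta>_def)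
   have s\<delta>: "cdom C (src C \<delta>) = ccod C j" "ccod C (src C \<delta>) = cdom C g"
   proof -
    have "g \<cdot> f \<cdot> src C \<alpha> = src C \<gamma> \<cdot> j" using arg_cong[OF q, of "src C"] v' f g fg j by simp
    then show "cdom C (src C \<delta>) = ccod C j" "ccod C (src C \<delta>) = cdom C g"
     using kz_choice_ob[OF j g l', of "f \<cdot> src C \<alpha>" "src C \<gamma>"] v' f g fg by (simp_all add: \<delta>(2))
   qed
   define \<epsilon> where "\<epsilon> = ar_map (ladj (kz_rali C j f l)) (\<alpha>, \<delta>)"
   have \<epsilon>: "\<epsilon> \<in> cell C" "src C \<epsilon> = l (src C \<alpha>, src C \<delta>)" "trg C \<epsilon> = l (trg C \<alpha>, trg C \<delta>)" "\<epsilon> \<star> \<iota> j = \<alpha>" "\<iota> f \<star> \<epsilon> = \<delta>"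
    using kz_rali_ar[OF j f l, of \<alpha> \<delta>] v' \<delta> s\<delta> f g fg by (simp_all add: \<epsilon>_def)
   have ob1: "(src C \<alpha>, src C \<gamma>) \<in> cobj (comparison_target C j (g \<cdot> f))" "(trg C \<alpha>, trg C \<gamma>) \<in> cobj (comparison_target C j (g \<cdot> f))"
    using category.dom_cod_in[OF category_comparison_target[OF j gf] v] v'(1) by simp_all
   have s\<epsilon>: "cdom C (src C \<epsilon>) = ccod C j" "ccod C (src C \<epsilon>) = cdom C f"
    using kz_choice_ob[OF j gf m, of "src C \<alpha>" "src C \<gamma>"] ob1(1) e[OF ob1(1)] f g fg
    by (auto simp: chom_def \<epsilon>(2) \<delta>(2))
   have gf\<epsilon>: "\<iota> (g \<cdot> f) \<star> \<epsilon> = \<gamma>"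
    using hcomp_id2_assoc[of f g \<epsilon>] \<epsilon> \<delta>(5) s\<epsilon> f g fg by simp
   have R: "ar_map (ladj ?R) v = \<epsilon>" using v by (simp add: v'(1) \<epsilon>_def \<delta>_def)
   have "src C \<epsilon> \<in> carr C" using \<epsilon>(1) by simp
   with gf\<epsilon> show ?thesis
    unfolding R using \<epsilon> \<delta>(2,3) s\<epsilon> e[OF ob1(1)] e[OF ob1(2)] f g fg by (simp add: v'(1) chom_def)
  qed
  show "counit ?R d \<in> chom (hom_cat C (ccod C j) (cdom C (g \<cdot> f))) (m (ob_map (comparison C j (g \<cdot> f)) d)) d \<and>
    ar_map (comparison C j (g \<cdot> f)) (counit ?R d) = cid (comparison_target C j (g \<cdot> f)) (ob_map (comparison C j (g \<cdot> f)) d)"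
   if "d \<in> cobj (hom_cat C (ccod C j) (cdom C (g \<cdot> f)))" for d
  proof -
   have d: "d \<in> carr C" "cdom C d = ccod C j" "ccod C d = cdom C f" using that f g fg by (auto simp: chom_def)
   define \<delta> where "\<delta> = counit (kz_rali C j g l') (f \<cdot> d)"
   have \<delta>: "\<delta> \<in> cell C" "src C \<delta> = l' (f \<cdot> d \<cdot> j, g \<cdot> f \<cdot> d)" "trg C \<delta> = f \<cdot> d" "\<delta> \<star> \<iota> j = \<iota> (f \<cdot> d \<cdot> j)" "\<iota> g \<star> \<delta> = \<iota> (g \<cdot> f \<cdot> d)"
    using kz_rali_counit[OF j g l', of "f \<cdot> d"] d f g fg j by (simp_all add: \<delta>_def)
   have s\<delta>: "cdom C (src C \<delta>) = ccod C j" "ccod C (src C \<delta>) = cdom C g"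
    using dom_trg[OF \<delta>(1)] cod_trg[OF \<delta>(1)] \<delta>(3) d f fg by simp_all
   define \<epsilon> where "\<epsilon> = ar_map (ladj (kz_rali C j f l)) (\<iota> (d \<cdot> j), \<delta>)"
   have \<epsilon>: "\<epsilon> \<in> cell C" "src C \<epsilon> = l (d \<cdot> j, src C \<delta>)" "trg C \<epsilon> = l (d \<cdot> j, f \<cdot> d)" "\<epsilon> \<star> \<iota> j = \<iota> (d \<cdot> j)" "\<iota> f \<star> \<epsilon> = \<delta>"
    using kz_rali_ar[OF j f l, of "\<iota> (d \<cdot> j)" \<delta>] d \<delta> s\<delta> j f g fg by (simp_all add: \<epsilon>_def)
   define \<kappa> where "\<kappa> = counit (kz_rali C j f l) d"
   have \<kappa>: "\<kappa> \<in> cell C" "src C \<kappa> = l (d \<cdot> j, f \<cdot> d)" "trg C \<kappa> = d" "\<kappa> \<star> \<iota> j = \<iota> (d \<cdot> j)" "\<iota> f \<star> \<kappa> = \<iota> (f \<cdot> d)"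
    using kz_rali_counit[OF j f l, of d] d by (simp_all add: \<kappa>_def)
   have s\<kappa>: "cdom C (src C \<kappa>) = ccod C j" "ccod C (src C \<kappa>) = cdom C f" "cdom C (src C \<epsilon>) = ccod C j" "ccod C (src C \<epsilon>) = cdom C f"
    using dom_trg[OF \<kappa>(1)] cod_trg[OF \<kappa>(1)] dom_trg[OF \<epsilon>(1)] cod_trg[OF \<epsilon>(1)] \<kappa>(2,3) \<epsilon>(3) d by simp_all
   have c: "counit ?R d = \<kappa> \<bullet> \<epsilon>" using d by (simp add: chom_def \<kappa>_def \<epsilon>_def \<delta>_def)
   have "\<iota> f \<star> (\<kappa> \<bullet> \<epsilon>) = \<delta>"
    using whisker_left_vcomp[of f \<epsilon> \<kappa>] \<kappa> \<epsilon> \<delta> s\<kappa> d f by simp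
   then have "\<iota> (g \<cdot> f) \<star> (\<kappa> \<bullet> \<epsilon>) = \<iota> (g \<cdot> f \<cdot> d)"
    using hcomp_id2_assoc[of f g "\<kappa> \<bullet> \<epsilon>"] \<kappa> \<epsilon> \<delta> s\<kappa> f g fg by simp
   moreover have "(\<kappa> \<bullet> \<epsilon>) \<star> \<iota> j = \<iota> (d \<cdot> j)"
    using whisker_right_vcomp[of j \<epsilon> \<kappa>] \<kappa> \<epsilon> s\<kappa> j d by simp
   moreover have "m (d \<cdot> j, g \<cdot> f \<cdot> d) = l (d \<cdot> j, l' (f \<cdot> d \<cdot> j, g \<cdot> f \<cdot> d))"
    by (rule e) (use d f g fg j in \<open>simp add: chom_def\<close>)
   moreover have "src C \<epsilon> \<in> carr C" using \<epsilon>(1) by simp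
   ultimately show ?thesis
    unfolding c using \<kappa> \<epsilon> \<delta>(2) s\<kappa> d f g fg j by (simp add: chom_def)
  qed
 qed
 from this[OF J l l' m e] show ?thesis
  by (simp add: kz_comp_def cong: restrict_cong)
qed

end

section \<open>Cones of multicategories\<close>

lemma discrete_twocat_simps [simp]:
 "cobj (discrete_twocat S) = S" "carr (discrete_twocat S) = S" "cdom (discrete_twocat S) = id"
 "ccod (discrete_twocat S) = id" "cid (discrete_twocat S) = id" "ccomp (discrete_twocat S) y x = x"
 "cell (discrete_twocat S) = S" "src (discrete_twocat S) = id" "trg (discrete_twocat S) = id"
 "id2 (discrete_twocat S) = id" "vcomp (discrete_twocat S) y x = x" "hcomp (discrete_twocat S) y x = x"
 by (simp_all add: discrete_twocat_def)

lemma two_category_discrete: "two_category (discrete_twocat S)"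
 by (rule two_categoryI; (rule categoryI)?) (simp_all add: vcat_def)

context two_category'
begin

lemma two_functor_discrete:
 assumes "\<And>i. i \<in> S ==> ob_map U i \<in> carr C" "\<And>i. i \<in> S ==> ar_map U i = sq_id C (ob_map U i)"
  "\<And>i. i \<in> S ==> ce_map U i = id2 (arrow_twocat C) (sq_id C (ob_map U i))"
 shows "two_functor (discrete_twocat S) (arrow_twocat C) U"
proof -
 interpret A: two_category "arrow_twocat C" by (rule two_category_arrow)
 have i: "sq_id C f \<in> sqs C" "sdom (sq_id C f) = f" "scod (sq_id C f) = f"
  "sq_comp C (sq_id C f) (sq_id C f) = sq_id C f" if "f \<in> carr C" for f
  using A.id_props[of f] A.id_left'[of "sq_id C f"] that by simp_all
 show ?thesis
 proof (rule two_functorI, goal_cases)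
  case (5 n) then show ?case using assms A.v.id_props[of "sq_id C (ob_map U n)"] i by (simp add: vcat_def)
 next
  case (7 m n)
  then show ?case using assms A.v.id_left'[of "id2 (arrow_twocat C) (sq_id C (ob_map U m))"]
    A.v.id_props[of "sq_id C (ob_map U m)"] i by (simp add: vcat_def)
 next
  case (8 m n)
  then show ?case using assms A.hcomp_id[of "sq_id C (ob_map U m)" "ob_map U m" "ob_map U m" "sq_id C (ob_map U m)" "ob_map U m"] i
   by (simp add: chom_def)
 qed (use assms i in simp_all)
qed

text \<open>On a discrete index every 1-cell and 2-cell is an identity, so the naturality clauses of
  \<open>kz_structure\<close> become unit laws and preservation of identities by the left
  adjoint.\<close>

lemma kz_structure_discrete:
 assumes "\<And>i. i \<in> S ==> ob_map U i \<in> carr C" "\<And>i. i \<in> S ==> ar_map U i = sq_id C (ob_map U i)"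
  "\<And>i. i \<in> S ==> ce_map U i = id2 (arrow_twocat C) (sq_id C (ob_map U i))" and f: "f \<in> carr C"
 shows "kz_structure C (discrete_twocat S) U f Q \<longleftrightarrow> Q \<in> extensional S \<and>
  (\<forall>i\<in>S. rali_structure (hom_cat C (ccod C (ob_map U i)) (cdom C f)) (comparison_target C (ob_map U i) f)
   (comparison C (ob_map U i) f) (Q i))" (is "?L \<longleftrightarrow> ?R")
proof
 assume R: ?R
 have "(\<forall>(u, v)\<in>cobj (comparison_target C j f).
     ob_map (ladj q) (u \<cdot> cid C (cdom C j), v \<cdot> cid C (ccod C j)) = ob_map (ladj q) (u, v) \<cdot> cid C (ccod C j)) \<and>
    (\<forall>(\<alpha>, \<beta>)\<in>carr (comparison_target C j f).
     ar_map (ladj q) (\<alpha> \<star> \<iota> (cid C (cdom C j)), \<beta> \<star> \<iota> (cid C (ccod C j))) = ar_map (ladj q) (\<alpha>, \<beta>) \<star> \<iota> (cid C (ccod C j))) \<and>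
    (\<forall>d\<in>chom C (ccod C j) (cdom C f). counit q (d \<cdot> cid C (ccod C j)) = counit q d \<star> \<iota> (cid C (ccod C j))) \<and>
    (\<forall>(u, v)\<in>cobj (comparison_target C j f).
     ar_map (ladj q) (\<iota> u \<star> \<iota> (cid C (cdom C j)), \<iota> v \<star> \<iota> (cid C (ccod C j))) =
      \<iota> (ob_map (ladj q) (u, v)) \<star> \<iota> (cid C (ccod C j)))"
  if j: "j \<in> carr C" and q: "rali_structure (hom_cat C (ccod C j) (cdom C f)) (comparison_target C j f) (comparison C j f) q" for j q
 proof -
  have F: "functor_on (comparison_target C j f) (hom_cat C (ccod C j) (cdom C f)) (ladj q)"
   using q by (simp add: rali_structure_def)
  have c: "counit q d \<in> cell C \<and> src C (counit q d) \<in> chom C (ccod C j) (cdom C f)" if "d \<in> chom C (ccod C j) (cdom C f)" for d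
  proof -
   have "counit q d \<in> carr (hom_cat C (ccod C j) (cdom C f))"
    using q that unfolding rali_structure_def chom_def[of "hom_cat C (ccod C j) (cdom C f)"] hom_cat_simps(1) by blast
   then show ?thesis by simp
  qed
  interpret F: functor_on "comparison_target C j f" "hom_cat C (ccod C j) (cdom C f)" "ladj q" by (rule F)
  have o: "ob_map (ladj q) x \<in> chom C (ccod C j) (cdom C f)" if "x \<in> cobj (comparison_target C j f)" for x
   using F.ob_map[OF that] by simp
  have a: "ar_map (ladj q) x \<in> cell C \<and> src C (ar_map (ladj q) x) \<in> chom C (ccod C j) (cdom C f)"
   if "x \<in> carr (comparison_target C j f)" for x
  proof -
   have "ar_map (ladj q) x \<in> carr (hom_cat C (ccod C j) (cdom C f))"
    using F.ar_props[OF that] category.dom_cod_in[OF category_comparison_target[OF j f] that] by blast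
   then show ?thesis by simp
  qed
  have i: "ar_map (ladj q) (\<iota> u, \<iota> v) = \<iota> (ob_map (ladj q) (u, v))" if "(u, v) \<in> cobj (comparison_target C j f)" for u v
   using F.map_id[OF that] by simp
  show ?thesis
  proof (intro conjI ballI; clarify?)
   show "ob_map (ladj q) (u \<cdot> cid C (cdom C j), v \<cdot> cid C (ccod C j)) = ob_map (ladj q) (u, v) \<cdot> cid C (ccod C j)"
    if "(u, v) \<in> cobj (comparison_target C j f)" for u v
    using o[OF that] that by (simp add: chom_def)
   show "ar_map (ladj q) (\<alpha> \<star> \<iota> (cid C (cdom C j)), \<beta> \<star> \<iota> (cid C (ccod C j))) = ar_map (ladj q) (\<alpha>, \<beta>) \<star> \<iota> (cid C (ccod C j))"
    if "(\<alpha>, \<beta>) \<in> carr (comparison_target C j f)" for \<alpha> \<beta>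
    using a[OF that] that j by (simp add: chom_def)
   show "counit q (d \<cdot> cid C (ccod C j)) = counit q d \<star> \<iota> (cid C (ccod C j))" if "d \<in> chom C (ccod C j) (cdom C f)" for d
    using c[OF that] that j by (simp add: chom_def)
   show "ar_map (ladj q) (\<iota> u \<star> \<iota> (cid C (cdom C j)), \<iota> v \<star> \<iota> (cid C (ccod C j))) =
      \<iota> (ob_map (ladj q) (u, v)) \<star> \<iota> (cid C (ccod C j))" if "(u, v) \<in> cobj (comparison_target C j f)" for u v
    using o[OF that] that i[OF that] j by (simp add: chom_def)
  qed
 qed
 then show ?L
  using R assms by (simp add: kz_structure_def sq_id_def Let_def del: target_simps)
qed (simp add: kz_structure_def)

end

locale cones = uncountable_universe U for U :: "'u itself" +
 fixes e :: "nat => 'u"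
 assumes inj_e: "inj e"
begin

abbreviation "discM n \<equiv> discrete_multicat e n"
abbreviation "coneM n \<equiv> cone_multicat e n"
abbreviation "incl n \<equiv> cone_inclusion e n"
abbreviation "targets n P \<equiv> cobj (comparison_target MCat (incl n) P)"

lemma e_eq [simp]: "e i = e k \<longleftrightarrow> i = k" using inj_e by (simp add: inj_eq)

lemma e_in [simp]: "e i \<in> e ` S \<longleftrightarrow> i \<in> S" using inj_e by (simp add: inj_image_mem_iff)

lemma discrete_simps [simp]:
 "mobj (discM n) = e ` {..<n}" "marr (discM n) = e ` {..<n}"
 "i < n ==> mdom (discM n) (e i) = [e i]" "i < n ==> mcod (discM n) (e i) = e i"
 "i < n ==> mident (discM n) (e i) = e i"
 by (simp_all add: discrete_multicat_def)

lemma cone_simps [simp]: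
 "mobj (coneM n) = e ` {..n}" "marr (coneM n) = e ` {..Suc n}"
 "i \<le> n ==> mdom (coneM n) (e i) = [e i]" "i \<le> n ==> mcod (coneM n) (e i) = e i"
 "mdom (coneM n) (e (Suc n)) = map e [0..<n]" "mcod (coneM n) (e (Suc n)) = e n"
 "i \<le> n ==> mident (coneM n) (e i) = e i"
 by (simp_all add: cone_multicat_def Let_def)

lemma inclusion_simps [simp]:
 "fdom (incl n) = discM n" "fcod (incl n) = coneM n"
 "i < n ==> fobj (incl n) (e i) = e i" "i < n ==> farr (incl n) (e i) = e i"
 by (simp_all add: cone_inclusion_def)

lemma discrete_composable:
 assumes "composable (discM n) g fs"
 obtains i where "i < n" "g = e i" "fs = [e i]" "mcomp (discM n) g fs = e i"
 using assms by (fastforce simp: composable_def discrete_multicat_def)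

lemma discrete_in: "discM n \<in> mcats"
proof -
 have "multicategory (discM n)"
 proof (rule multicategory.intro, goal_cases)
  case (4 g fs) then show ?case by (elim discrete_composable) simp
 next
  case (7 h gs fss)
  from 7(1) obtain i where i: "i < n" "h = e i" "gs = [e i]" "mcomp (discM n) h gs = e i"
   by (rule discrete_composable)
  then obtain fs where fs: "fss = [fs]" "composable (discM n) (e i) fs"
   using 7(2) by (auto simp: list_all2_Cons1)
  from fs(2) have "fs = [e i]" "mcomp (discM n) (e i) fs = e i"
   by (auto elim: discrete_composable)
  then show ?case using i fs by simp
 next
  case (11 g fs) then show ?case by (auto simp: composable_def discrete_multicat_def)
 qed (auto simp: discrete_multicat_def)
 then show ?thesis by (simp add: small_multicats_def small_countable)
qed

lemma cone_arr_cases: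
 assumes "f \<in> marr (coneM n)"
 obtains "f = e (Suc n)" | i where "i \<le> n" "f = e i"
 using assms le_Suc_eq by auto

lemma cone_composable:
 assumes "composable (coneM n) g fs"
 obtains "g = e (Suc n)" "fs = map e [0..<n]" "mcomp (coneM n) g fs = g"
 | i f where "i \<le> n" "g = e i" "fs = [f]" "f \<in> marr (coneM n)" "mcod (coneM n) f = e i"
  "mcomp (coneM n) g fs = f"
proof -
 have c: "g \<in> marr (coneM n)" "set fs \<subseteq> marr (coneM n)" "map (mcod (coneM n)) fs = mdom (coneM n) g"
  using assms by (simp_all only: composable_def)
 have m: "mcomp (coneM n) g fs = (if g = e (Suc n) then g else hd fs)"
  using c by (simp add: cone_multicat_def Let_def)
 from c(1) show ?thesis
 proof (cases rule: cone_arr_cases)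
  case 1
  have "fs ! i = e i" if i: "i < n" for i
  proof -
   have "length fs = n" using arg_cong[OF c(3), of length] 1 by simp
   then have f: "fs ! i \<in> marr (coneM n)" "mcod (coneM n) (fs ! i) = e i"
    using c(2) arg_cong[OF c(3), of "\<lambda>xs. xs ! i"] i 1 by (auto simp: subset_iff)
   show ?thesis by (rule cone_arr_cases[OF f(1)]) (use f(2) i in auto)
  qed
  moreover have "length fs = n" using arg_cong[OF c(3), of length] 1 by simp
  ultimately have "fs = map e [0..<n]" by (intro nth_equalityI) simp_all
  then show ?thesis using that(1) 1 m by simp
 next
  case (2 i)
  then obtain f where "fs = [f]" "mcod (coneM n) f = e i" using c(3) by auto
  then show ?thesis using that(2) 2 c(2) m by auto
 qed
qed

lemma cone_in: "coneM n \<in> mcats"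
proof -
 have d: "set (mdom (coneM n) f) \<subseteq> mobj (coneM n) \<and> mcod (coneM n) f \<in> mobj (coneM n)"
  if "f \<in> marr (coneM n)" for f
  using that by (cases rule: cone_arr_cases) auto
 have r: "composable (coneM n) f (mdom (coneM n) f) \<and> mcomp (coneM n) f (mdom (coneM n) f) = f"
  if "f \<in> marr (coneM n)" for f
  using that by (cases rule: cone_arr_cases) (auto simp: composable_def cone_multicat_def Let_def)
 have i: "map (mident (coneM n)) xs = xs" if "set xs \<subseteq> mobj (coneM n)" for xs
  using that by (intro map_idI) auto
 have l: "mcomp (coneM n) (e i) [f] = f" if "f \<in> marr (coneM n)" "i \<le> n" "mcod (coneM n) f = e i" for i f
  using that by (auto simp: cone_multicat_def Let_def split: if_splits)
 have "multicategory (coneM n)"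
 proof (rule multicategory.intro, goal_cases)
  case (1 f) then show ?case using d by blast
 next
  case (2 f) then show ?case using d by blast
 next
  case (3 x) then show ?case by auto
 next
  case (4 g fs)
  then show ?case
  proof (cases rule: cone_composable)
   case 1
   have "concat (map (\<lambda>k. mdom (coneM n) (e k)) [0..<n]) = concat (map (\<lambda>k. [e k]) [0..<n])"
    by (intro arg_cong[where f = concat] map_cong) simp_all
   with 1 show ?thesis by (simp add: comp_def concat_map_singleton)
  next
   case (2 i f) then show ?thesis by simp
  qed
 next
  case (5 f) then show ?case using r d i by metis
 next
  case (6 f) from d[OF 6] obtain k where "k \<le> n" "mcod (coneM n) f = e k" by auto
  then show ?case using l[OF 6] by simp
 next
  case (7 h gs fss)
  from 7(1) show ?case
  proof (cases rule: cone_composable)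
   case 1
   have l: "length fss = n" using list_all2_lengthD[OF 7(2)] 1 by simp
   have k: "fss ! k = [e k] \<and> mcomp (coneM n) (e k) [e k] = e k" if k: "k < n" for k
   proof -
    have "composable (coneM n) (e k) (fss ! k)" using list_all2_nthD[OF 7(2), of k] 1 k by simp
    then show ?thesis
    proof (cases rule: cone_composable)
     case (2 i f) show ?thesis by (rule cone_arr_cases[OF 2(4)]) (use 2 k in auto)
    qed (use k in simp)
   qed
   have "fss = map (\<lambda>k. [e k]) [0..<n]" using l k by (auto intro: nth_equalityI)
   moreover have "map2 (mcomp (coneM n)) gs fss = gs"
   proof (rule nth_equalityI)
    show "map2 (mcomp (coneM n)) gs fss ! i = gs ! i" if "i < length (map2 (mcomp (coneM n)) gs fss)" for i
     using that l k[of i] 1(2) by simp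
   qed (use l 1(2) in simp)
   ultimately show ?thesis using 1 by (simp add: concat_map_singleton)
  next
   case (2 i f)
   then obtain fs where fs: "fss = [fs]" "composable (coneM n) f fs"
    using 7(2) by (auto simp: list_all2_Cons1)
   have "mcomp (coneM n) f fs \<in> marr (coneM n) \<and>
     mcod (coneM n) (mcomp (coneM n) f fs) = mcod (coneM n) f"
    using fs(2) by (cases rule: cone_composable) (use 2 in auto)
   then show ?thesis using l 2 fs by simp
  qed
 next
  case (11 g fs) then show ?case by (auto simp: composable_def cone_multicat_def Let_def)
 qed (simp_all add: cone_multicat_def Let_def)
 then show ?thesis by (simp add: small_multicats_def small_countable)
qed

lemma inclusion_in [simp]: "incl n \<in> funs"
proof -
 have "multifunctor (incl n)"
 proof (rule multifunctor.intro, goal_cases)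
  case (4 g fs)
  then have "composable (discM n) g fs" by simp
  then show ?case by (cases rule: discrete_composable) (auto simp: cone_multicat_def Let_def)
 qed (auto simp: cone_inclusion_def)
 then show ?thesis using discrete_in cone_in by (simp add: small_multifuns_def)
qed


text \<open>A functor out of \<open>C(n)\<close> is an \<open>n\<close>-ary multimorphism, and a functor out of \<open>n\<close> is a list of \<open>n\<close> objects.\<close>

definition cone_fun :: "('u, 'u) multicat => nat => 'u => ('u, 'u) multifun" where
 "cone_fun E n m = \<lparr>fdom = coneM n, fcod = E,
  fobj = (\<lambda>x\<in>e ` {..n}. if x = e n then mcod E m else mdom E m ! inv e x),
  farr = (\<lambda>f\<in>e ` {..Suc n}. if f = e (Suc n) then m
   else mident E (if f = e n then mcod E m else mdom E m ! inv e f))\<rparr>"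

definition list_fun :: "('u, 'u) multicat => nat => 'u list => ('u, 'u) multifun" where
 "list_fun E n xs = \<lparr>fdom = discM n, fcod = E,
  fobj = (\<lambda>x\<in>e ` {..<n}. xs ! inv e x), farr = (\<lambda>f\<in>e ` {..<n}. mident E (xs ! inv e f))\<rparr>"

definition objs :: "nat => ('u, 'u) multifun => 'u list" where
 "objs n F = map (\<lambda>i. fobj F (e i)) [0..<n]"

abbreviation top_arr :: "nat => ('u, 'u) multifun => 'u" where
 "top_arr n F \<equiv> farr F (e (Suc n))"

lemma inv_e [simp]: "inv e (e i) = i" using inj_e by simp

lemma length_objs [simp]: "length (objs n F) = n" by (simp add: objs_def)

lemma cone_fun_simps [simp]:
 "fdom (cone_fun E n m) = coneM n" "fcod (cone_fun E n m) = E"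
 "i < n ==> fobj (cone_fun E n m) (e i) = mdom E m ! i" "fobj (cone_fun E n m) (e n) = mcod E m"
 "top_arr n (cone_fun E n m) = m"
 "i \<le> n ==> farr (cone_fun E n m) (e i) = mident E (fobj (cone_fun E n m) (e i))"
 by (simp_all add: cone_fun_def)

lemma list_fun_simps [simp]:
 "fdom (list_fun E n xs) = discM n" "fcod (list_fun E n xs) = E"
 "i < n ==> fobj (list_fun E n xs) (e i) = xs ! i" "i < n ==> farr (list_fun E n xs) (e i) = mident E (xs ! i)"
 by (simp_all add: list_fun_def)

lemma cone_fun_in:
 assumes E: "E \<in> mcats" and m: "m \<in> marr E" "length (mdom E m) = n"
 shows "cone_fun E n m \<in> funs"
proof -
 interpret multicategory E by (rule mcatsD[OF E])
 have o: "fobj (cone_fun E n m) (e i) \<in> mobj E" if "i \<le> n" for i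
  using that mdom_in[OF m(1)] mcod_in[OF m(1)] m(2) by (cases "i = n") (auto simp: subset_iff)
 have md: "mdom E m = map (\<lambda>i. fobj (cone_fun E n m) (e i)) [0..<n]"
  by (rule nth_equalityI) (simp_all add: m)
 have a: "farr (cone_fun E n m) f \<in> marr E \<and> mdom E (farr (cone_fun E n m) f) = map (fobj (cone_fun E n m)) (mdom (coneM n) f) \<and>
   mcod E (farr (cone_fun E n m) f) = fobj (cone_fun E n m) (mcod (coneM n) f)"
  if "f \<in> marr (coneM n)" for f
  using that
 proof (cases rule: cone_arr_cases)
  case 1 then show ?thesis using m(1) by (simp add: comp_def flip: md)
 next
  case (2 i) then show ?thesis using o[OF 2(1)] by (simp del: cone_fun_simps(3,4))
 qed
 have "multifunctor (cone_fun E n m)"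
 proof (rule multifunctor.intro, goal_cases)
  case (1 x) then show ?case using o by auto
 next
  case (2 f) then show ?case using a[of f] by simp
 next
  case (4 g fs)
  then have "composable (coneM n) g fs" by simp
  then show ?case
  proof (cases rule: cone_composable)
   case 1
   have "map (farr (cone_fun E n m)) fs = map (mident E) (mdom E m)"
    using 1 by (subst md) (simp add: comp_def del: cone_fun_simps(3,4))
   then show ?thesis using 1 mcomp_mident_right[OF m(1)] by simp
  next
   case (2 i f)
   have "mcomp E (mident E (fobj (cone_fun E n m) (e i))) [farr (cone_fun E n m) f] = farr (cone_fun E n m) f"
    using a[OF 2(4)] 2(5) by simp
   then show ?thesis using 2 by (simp del: cone_fun_simps(3,4))
  qed
 qed (auto simp: cone_fun_def)
 then show ?thesis using E cone_in by (simp add: small_multifuns_def)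
qed

lemma list_fun_in:
 assumes E: "E \<in> mcats" and xs: "set xs \<subseteq> mobj E" "length xs = n"
 shows "list_fun E n xs \<in> funs"
proof -
 interpret multicategory E by (rule mcatsD[OF E])
 have o: "xs ! i \<in> mobj E" if "i < n" for i using that xs by (auto simp: subset_iff)
 have "multifunctor (list_fun E n xs)"
 proof (rule multifunctor.intro, goal_cases)
  case (4 g fs)
  then have "composable (discM n) g fs" by simp
  then show ?case by (cases rule: discrete_composable) (use o in simp)
 qed (use o in \<open>auto simp: list_fun_def\<close>)
 then show ?thesis using E discrete_in by (simp add: small_multifuns_def)
qed

lemma cone_dom:
 assumes F: "F \<in> funs" "fdom F = coneM n"
 shows "top_arr n F \<in> marr (fcod F)" "mdom (fcod F) (top_arr n F) = objs n F" "mcod (fcod F) (top_arr n F) = fobj F (e n)"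
proof -
 interpret multifunctor F by (rule funsD[OF F(1)])
 show "top_arr n F \<in> marr (fcod F)" "mdom (fcod F) (top_arr n F) = objs n F" "mcod (fcod F) (top_arr n F) = fobj F (e n)"
  using farr_in[of "e (Suc n)"] F(2) by (simp_all add: objs_def comp_def)
qed

lemma list_fun_eqI:
 assumes F: "F \<in> funs" "fdom F = discM n" and G: "G \<in> funs" "fdom G = discM n"
  and c: "fcod F = fcod G" and o: "objs n F = objs n G"
 shows "F = G"
proof -
 interpret F: multifunctor F by (rule funsD[OF F(1)])
 interpret G: multifunctor G by (rule funsD[OF G(1)])
 have o': "fobj F (e i) = fobj G (e i)" if "i < n" for i
  using arg_cong[OF o, of "\<lambda>xs. xs ! i"] that by (simp add: objs_def)
 have "farr F (e i) = farr G (e i)" if "i < n" for i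
  using F.farr_mident[of "e i"] G.farr_mident[of "e i"] that F(2) G(2) c o'[OF that] by simp
 then show ?thesis
  using F(2) G(2) c o' by (intro multifun_eqI F.multifunctor_axioms G.multifunctor_axioms) auto
qed

text \<open>The domain and codomain of the named multimorphism give the values on all objects, and
  the other arrows of \<open>C(n)\<close> are identities.\<close>

lemma cone_fun_eqI:
 assumes F: "F \<in> funs" "fdom F = coneM n" and G: "G \<in> funs" "fdom G = coneM n"
  and c: "fcod F = fcod G" and t: "top_arr n F = top_arr n G"
 shows "F = G"
proof -
 interpret F: multifunctor F by (rule funsD[OF F(1)])
 interpret G: multifunctor G by (rule funsD[OF G(1)])
 have o: "objs n F = objs n G" using cone_dom(2)[OF F] cone_dom(2)[OF G] c t by simp
 have o': "fobj F (e i) = fobj G (e i)" if "i \<le> n" for i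
  using arg_cong[OF o, of "\<lambda>xs. xs ! i"] cone_dom(3)[OF F] cone_dom(3)[OF G] c t that
  by (cases "i = n") (simp_all add: objs_def)
 have a: "farr F f = farr G f" if "f \<in> marr (coneM n)" for f
  using that
 proof (cases rule: cone_arr_cases)
  case (2 i) then show ?thesis
   using F.farr_mident[of "e i"] G.farr_mident[of "e i"] F(2) G(2) c o'[OF 2(1)] by simp
 qed (use t in simp)
 show ?thesis
  using F(2) G(2) c o' a by (intro multifun_eqI F.multifunctor_axioms G.multifunctor_axioms) auto
qed

lemma objs_inclusion [simp]: "fdom F = coneM n ==> objs n (mfcomp F (incl n)) = objs n F"
 by (simp add: objs_def)

lemma objs_comp:
 assumes "fdom F = discM n \<or> fdom F = coneM n"
 shows "objs n (mfcomp G F) = map (fobj G) (objs n F)"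
 using assms by (auto simp: objs_def)

lemma top_arr_comp [simp]: "fdom F = coneM n ==> top_arr n (mfcomp G F) = farr G (top_arr n F)"
 by simp

lemma objs_list_fun [simp]: "length xs = n ==> objs n (list_fun E n xs) = xs"
 by (auto simp: objs_def intro: nth_equalityI)

text \<open>Functors out of the discrete \<open>n\<close> are determined by their lists of objects,
  so the square commutes as soon as the list of \<open>u\<close> lies over the domain of the
  multimorphism named by \<open>w\<close>.\<close>

lemma lifting_problem_iff:
 assumes P: "P \<in> funs" and u: "u \<in> funs" "fdom u = discM n" "fcod u = fdom P"
  and w: "w \<in> funs" "fdom w = coneM n" "fcod w = fcod P"
 shows "mfcomp P u = mfcomp w (incl n) \<longleftrightarrow> lprob P (objs n u) (top_arr n w)"
proof -
 interpret u: multifunctor u by (rule funsD[OF u(1)])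
 have o: "set (objs n u) \<subseteq> mobj (fdom P)" using u.fobj_in u(2,3) by (auto simp: objs_def)
 have "objs n (mfcomp P u) = map (fobj P) (objs n u)" using u(2) by (simp add: objs_comp)
 moreover have "objs n (mfcomp w (incl n)) = mdom (fcod P) (top_arr n w)"
  using cone_dom(2)[OF w(1,2)] w(2,3) by simp
 ultimately have "lprob P (objs n u) (top_arr n w) \<longleftrightarrow>
   objs n (mfcomp P u) = objs n (mfcomp w (incl n))"
  using o cone_dom(1)[OF w(1,2)] w(3) by (auto simp: lifting_problem_def)
 moreover have "mfcomp P u \<in> funs" "mfcomp w (incl n) \<in> funs"
  using multifun_comp_small[OF u(1) P u(3)] multifun_comp_small[OF inclusion_in w(1)] w(2) by simp_all
 ultimately show ?thesis
  using list_fun_eqI[of "mfcomp P u" n "mfcomp w (incl n)"] u(2) w(3) by auto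
qed

lemma lifting_problem_funs:
 assumes P: "P \<in> funs" and l: "lprob P es f" and n: "n = length es"
 defines "u \<equiv> list_fun (fdom P) n es" and "w \<equiv> cone_fun (fcod P) n f"
 shows "u \<in> funs" "fdom u = discM n" "fcod u = fdom P" "w \<in> funs"
  "fdom w = coneM n" "fcod w = fcod P" "objs n u = es" "top_arr n w = f"
  "mfcomp P u = mfcomp w (incl n)"
proof -
 note d = funsD[OF P]
 have l': "set es \<subseteq> mobj (fdom P)" "f \<in> marr (fcod P)" "length (mdom (fcod P) f) = n"
  using l n by (simp_all add: lifting_problem_def)
 show *: "u \<in> funs" "fdom u = discM n" "fcod u = fdom P" "w \<in> funs"
  "fdom w = coneM n" "fcod w = fcod P" "objs n u = es" "top_arr n w = f"
  using list_fun_in[OF d(2) l'(1) n[symmetric]] cone_fun_in[OF d(3) l'(2,3)] n by (simp_all add: u_def w_def)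
 show "mfcomp P u = mfcomp w (incl n)"
  using lifting_problem_iff[OF P *(1-6)] l *(7,8) by simp
qed

end

context two_category'
begin

text \<open>Unfolds hom categories and pairs once, so that a choice can be given by conditions on
  single 1-cells and 2-cells. \<open>kz_choice_ex1\<close> is the elimination rule of the same
  form.\<close>

lemma kz_choiceI:
 assumes "j \<in> carr C" "f \<in> carr C"
  and ob: "\<And>u w. u \<in> carr C ==> cdom C u = cdom C j ==> ccod C u = cdom C f ==> w \<in> carr C ==> cdom C w = ccod C j ==>
   ccod C w = ccod C f ==> f \<cdot> u = w \<cdot> j ==>
   l (u, w) \<in> carr C \<and> cdom C (l (u, w)) = ccod C j \<and> ccod C (l (u, w)) = cdom C f \<and> l (u, w) \<cdot> j = u \<and> f \<cdot> l (u, w) = w"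
  and ex1: "\<And>u w d \<alpha> \<beta>. u \<in> carr C ==> cdom C u = cdom C j ==> ccod C u = cdom C f ==> w \<in> carr C ==> cdom C w = ccod C j ==>
   ccod C w = ccod C f ==> f \<cdot> u = w \<cdot> j ==> d \<in> carr C ==> cdom C d = ccod C j ==> ccod C d = cdom C f ==>
   \<alpha> \<in> cell C ==> src C \<alpha> = u ==> trg C \<alpha> = d \<cdot> j ==> \<beta> \<in> cell C ==> src C \<beta> = w ==> trg C \<beta> = f \<cdot> d ==> \<iota> f \<star> \<alpha> = \<beta> \<star> \<iota> j ==>
   \<exists>!\<gamma>. \<gamma> \<in> cell C \<and> src C \<gamma> = l (u, w) \<and> trg C \<gamma> = d \<and> \<gamma> \<star> \<iota> j = \<alpha> \<and> \<iota> f \<star> \<gamma> = \<beta>"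
 shows "kz_choice C j f l"
 unfolding kz_choice_def universal_choice_def
proof (intro ballI conjI)
 fix b assume b: "b \<in> cobj (comparison_target C j f)"
 then obtain u w where uw: "b = (u, w)" "u \<in> carr C" "cdom C u = cdom C j" "ccod C u = cdom C f" "w \<in> carr C"
  "cdom C w = ccod C j" "ccod C w = ccod C f" "f \<cdot> u = w \<cdot> j"
  by (auto simp: chom_def)
 note o = ob[OF uw(2-)]
 show "l b \<in> cobj (hom_cat C (ccod C j) (cdom C f))" using o by (simp add: uw(1) chom_def)
 show "ob_map (comparison C j f) (l b) = b" using o by (simp add: uw(1))
 fix a v assume a: "a \<in> cobj (hom_cat C (ccod C j) (cdom C f))" and v: "v \<in> chom (comparison_target C j f) b (ob_map (comparison C j f) a)"
 obtain \<alpha> \<beta> where ab: "v = (\<alpha>, \<beta>)" by (cases v)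
 have v': "\<alpha> \<in> cell C" "src C \<alpha> = u" "trg C \<alpha> = a \<cdot> j" "\<beta> \<in> cell C" "src C \<beta> = w" "trg C \<beta> = f \<cdot> a" "\<iota> f \<star> \<alpha> = \<beta> \<star> \<iota> j"
  using v by (simp_all add: chom_def ab uw(1))
 have a': "a \<in> carr C" "cdom C a = ccod C j" "ccod C a = cdom C f" using a by (simp_all add: chom_def)
 have "\<gamma> \<in> chom (hom_cat C (ccod C j) (cdom C f)) (l b) a \<and> ar_map (comparison C j f) \<gamma> = v \<longleftrightarrow>
   \<gamma> \<in> cell C \<and> src C \<gamma> = l (u, w) \<and> trg C \<gamma> = a \<and> \<gamma> \<star> \<iota> j = \<alpha> \<and> \<iota> f \<star> \<gamma> = \<beta>" for \<gamma>
  using o by (auto simp: chom_def ab uw(1))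
 then show "\<exists>!\<gamma>. \<gamma> \<in> chom (hom_cat C (ccod C j) (cdom C f)) (l b) a \<and> ar_map (comparison C j f) \<gamma> = v"
  using ex1[OF uw(2-) a' v'] by simp
qed

lemma kz_choice_ex1:
 assumes j: "j \<in> carr C" and f: "f \<in> carr C" and l: "kz_choice C j f l"
  and u: "u \<in> carr C" "cdom C u = cdom C j" "ccod C u = cdom C f" "w \<in> carr C" "cdom C w = ccod C j" "ccod C w = ccod C f" "f \<cdot> u = w \<cdot> j"
  and d: "d \<in> carr C" "cdom C d = ccod C j" "ccod C d = cdom C f"
  and v: "\<alpha> \<in> cell C" "src C \<alpha> = u" "trg C \<alpha> = d \<cdot> j" "\<beta> \<in> cell C" "src C \<beta> = w" "trg C \<beta> = f \<cdot> d" "\<iota> f \<star> \<alpha> = \<beta> \<star> \<iota> j"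
 shows "\<exists>!\<gamma>. \<gamma> \<in> cell C \<and> src C \<gamma> = l (u, w) \<and> trg C \<gamma> = d \<and> \<gamma> \<star> \<iota> j = \<alpha> \<and> \<iota> f \<star> \<gamma> = \<beta>"
proof -
 note o = kz_choice_ob[OF j f l u]
 have b: "(u, w) \<in> cobj (comparison_target C j f)" using u by (simp add: chom_def)
 have "\<exists>!\<gamma>. \<gamma> \<in> chom (hom_cat C (ccod C j) (cdom C f)) (l (u, w)) d \<and> ar_map (comparison C j f) \<gamma> = (\<alpha>, \<beta>)"
  using rali_context.choice_ex1[OF rali_context_comparison[OF j f] l[unfolded kz_choice_def] b, of d "(\<alpha>, \<beta>)"] u d v
  by (simp add: chom_def)
 moreover have "\<gamma> \<in> chom (hom_cat C (ccod C j) (cdom C f)) (l (u, w)) d \<and> ar_map (comparison C j f) \<gamma> = (\<alpha>, \<beta>) \<longleftrightarrow>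
   \<gamma> \<in> cell C \<and> src C \<gamma> = l (u, w) \<and> trg C \<gamma> = d \<and> \<gamma> \<star> \<iota> j = \<alpha> \<and> \<iota> f \<star> \<gamma> = \<beta>" for \<gamma>
  using o by (auto simp: chom_def)
 ultimately show ?thesis by simp
qed

end

context cones
begin

text \<open>A 2-cell between functors out of \<open>C(n)\<close> is a family of \<open>n + 1\<close>
  unary maps, natural at the one multimorphism that is not an identity. The component at index
  \<open>n\<close> belongs to the extra object.\<close>

definition cone_trans :: "nat => ('u, 'u) multifun => ('u, 'u) multifun => (nat => 'u) => ('u, 'u) multitrans" where
 "cone_trans n F G a = \<lparr>tsrc = F, ttrg = G, tcmp = (\<lambda>x\<in>e ` {..n}. a (inv e x))\<rparr>"

lemma cone_trans_simps [simp]: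
 "tsrc (cone_trans n F G a) = F" "ttrg (cone_trans n F G a) = G" "i \<le> n ==> tcmp (cone_trans n F G a) (e i) = a i"
 by (simp_all add: cone_trans_def)

lemma cone_trans_in:
 assumes F: "F \<in> funs" "fdom F = coneM n" and G: "G \<in> funs" "fdom G = coneM n"
  and c: "fcod G = fcod F"
  and a: "\<And>i. i \<le> n ==> a i \<in> marr (fcod F) \<and> mdom (fcod F) (a i) = [fobj F (e i)] \<and> mcod (fcod F) (a i) = fobj G (e i)"
  and nat: "mcomp (fcod F) (a n) [top_arr n F] = mcomp (fcod F) (top_arr n G) (map a [0..<n])"
 shows "cone_trans n F G a \<in> mtrans"
proof (rule mtransI)
 interpret F: multifunctor F by (rule funsD[OF F(1)])
 interpret G: multifunctor G by (rule funsD[OF G(1)])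
 interpret B: multicategory "fcod F" by (rule funsD[OF F(1)])
 let ?t = "cone_trans n F G a"
 fix f assume "f \<in> marr (fdom (tsrc ?t))"
 then have "f \<in> marr (coneM n)" using F(2) by simp
 then show "mcomp (fcod (tsrc ?t)) (tcmp ?t (mcod (fdom (tsrc ?t)) f)) [farr (tsrc ?t) f] =
   mcomp (fcod (tsrc ?t)) (farr (ttrg ?t) f) (map (tcmp ?t) (mdom (fdom (tsrc ?t)) f))"
 proof (cases rule: cone_arr_cases)
  case 1
  have "map (tcmp ?t) (map e [0..<n]) = map a [0..<n]" by simp
  then show ?thesis using 1 nat F(2) by (simp del: map_map)
 next
  case (2 i)
  have "farr F (e i) = mident (fcod F) (fobj F (e i))" "farr G (e i) = mident (fcod F) (fobj G (e i))"
   using F.farr_mident[of "e i"] G.farr_mident[of "e i"] 2(1) F(2) G(2) c by simp_all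
  then show ?thesis using 2 a[OF 2(1)] F(2) by simp
 qed
qed (use F G c a in \<open>auto simp: cone_trans_def\<close>)

lemma cone_natural:
 assumes t: "t \<in> mtrans" and d: "fdom (tsrc t) = coneM n"
 shows "mcomp (fcod (tsrc t)) (tcmp t (e n)) [top_arr n (tsrc t)] =
  mcomp (fcod (tsrc t)) (top_arr n (ttrg t)) (map (\<lambda>i. tcmp t (e i)) [0..<n])"
 using multitransformation.naturality[OF mtransD(1)[OF t], of "e (Suc n)"] d by (simp add: comp_def)

text \<open>With the next two lemmas this turns filling problems for 2-cells into equations of
  components. Restriction along the inclusion forgets the component at the extra object.\<close>

lemma whisker_right_eq_iff:
 assumes t: "t \<in> mtrans" "fdom (tsrc t) = coneM n"
  and a: "\<alpha> \<in> mtrans" "tsrc \<alpha> = mfcomp (tsrc t) (incl n)" "ttrg \<alpha> = mfcomp (ttrg t) (incl n)"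
 shows "hct t (idt (incl n)) = \<alpha> \<longleftrightarrow> (\<forall>i<n. tcmp t (e i) = tcmp \<alpha> (e i))"
proof -
 have w: "tcmp (hct t (idt (incl n))) (e i) = tcmp t (e i)" if "i < n" for i
  using tcmp_whisker_right[OF t(1) inclusion_in, of n "e i"] t(2) that by simp
 have m: "hct t (idt (incl n)) \<in> mtrans"
  using mtrans_hcomp_in[OF mtrans_id_in[OF inclusion_in] t(1)] t(2) by simp
 show ?thesis
 proof
  assume "\<forall>i<n. tcmp t (e i) = tcmp \<alpha> (e i)"
  then show "hct t (idt (incl n)) = \<alpha>"
   using a w by (intro mtrans_eqI mtransD(1)[OF m] mtransD(1)[OF a(1)]) auto
 qed (use w in auto)
qed

lemma whisker_left_eq_iff:
 assumes t: "t \<in> mtrans" "fdom (tsrc t) = coneM n" and P: "P \<in> funs" "fcod (tsrc t) = fdom P"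
  and b: "\<beta> \<in> mtrans" "tsrc \<beta> = mfcomp P (tsrc t)" "ttrg \<beta> = mfcomp P (ttrg t)"
 shows "hct (idt P) t = \<beta> \<longleftrightarrow> (\<forall>i\<le>n. farr P (tcmp t (e i)) = tcmp \<beta> (e i))"
proof -
 have w: "tcmp (hct (idt P) t) (e i) = farr P (tcmp t (e i))" if "i \<le> n" for i
  using tcmp_whisker_left[OF t(1) P(1) P(2)[symmetric], of "e i"] t(2) that by simp
 have m: "hct (idt P) t \<in> mtrans"
  using mtrans_hcomp_in[OF t(1) mtrans_id_in[OF P(1)]] P(2) by simp
 show ?thesis
 proof
  assume "\<forall>i\<le>n. farr P (tcmp t (e i)) = tcmp \<beta> (e i)"
  then show "hct (idt P) t = \<beta>"
   using b w t(2) by (intro mtrans_eqI mtransD(1)[OF m] mtransD(1)[OF b(1)]) auto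
 qed (use w in auto)
qed

lemma whisker_compatible_iff:
 assumes P: "P \<in> funs"
  and a: "\<alpha> \<in> mtrans" "fdom (tsrc \<alpha>) = discM n" "fcod (tsrc \<alpha>) = fdom P"
  and b: "\<beta> \<in> mtrans" "fdom (tsrc \<beta>) = coneM n" "fcod (tsrc \<beta>) = fcod P"
  and s: "mfcomp P (tsrc \<alpha>) = mfcomp (tsrc \<beta>) (incl n)"
   "mfcomp P (ttrg \<alpha>) = mfcomp (ttrg \<beta>) (incl n)"
 shows "hct (idt P) \<alpha> = hct \<beta> (idt (incl n)) \<longleftrightarrow>
  (\<forall>i<n. farr P (tcmp \<alpha> (e i)) = tcmp \<beta> (e i))"
proof -
 have m: "hct (idt P) \<alpha> \<in> mtrans"
  using mtrans_hcomp_in[OF a(1) mtrans_id_in[OF P]] a(3) by simp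
 have w: "tcmp (hct (idt P) \<alpha>) (e i) = farr P (tcmp \<alpha> (e i))" if "i < n" for i
  using tcmp_whisker_left[OF a(1) P a(3)[symmetric], of "e i"] a(2) that by simp
 have "hct \<beta> (idt (incl n)) = hct (idt P) \<alpha> \<longleftrightarrow>
   (\<forall>i<n. tcmp \<beta> (e i) = tcmp (hct (idt P) \<alpha>) (e i))"
  by (rule whisker_right_eq_iff[OF b(1,2) m]) (use s in simp_all)
 then show ?thesis using w by metis
qed

definition cone_choice :: "nat => ('u, 'u) multifun \<times> ('u list \<times> 'u => 'u) => ('u, 'u) multifun \<times> ('u, 'u) multifun => ('u, 'u) multifun" where
 "cone_choice n X = (\<lambda>(u, w). cone_fun (fdom (fst X)) n (snd X (objs n u, top_arr n w)))"

lemma cone_choice_props: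
 assumes X: "X \<in> cloven"
  and u: "u \<in> funs" "fdom u = discM n" "fcod u = fdom (fst X)"
  and w: "w \<in> funs" "fdom w = coneM n" "fcod w = fcod (fst X)"
  and uw: "mfcomp (fst X) u = mfcomp w (incl n)"
 shows "opcart (fst X) (objs n u) (top_arr n w) (snd X (objs n u, top_arr n w))"
  and "cone_choice n X (u, w) \<in> funs" "fdom (cone_choice n X (u, w)) = coneM n"
  "fcod (cone_choice n X (u, w)) = fdom (fst X)" "top_arr n (cone_choice n X (u, w)) = snd X (objs n u, top_arr n w)"
  and "mfcomp (cone_choice n X (u, w)) (incl n) = u" "mfcomp (fst X) (cone_choice n X (u, w)) = w"
proof -
 have P: "fst X \<in> funs" "cleavage (fst X) (snd X)" using X by (simp_all add: cloven_iff)
 note d = funsD[OF P(1)]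
 have lp: "lprob (fst X) (objs n u) (top_arr n w)" using lifting_problem_iff[OF P(1) u w] uw by simp
 show o: "opcart (fst X) (objs n u) (top_arr n w) (snd X (objs n u, top_arr n w))"
  using cleavageD[OF P(2) lp] .
 note l = opcartD[OF o d(1)]
 show c: "cone_choice n X (u, w) \<in> funs" "fdom (cone_choice n X (u, w)) = coneM n"
  "fcod (cone_choice n X (u, w)) = fdom (fst X)" "top_arr n (cone_choice n X (u, w)) = snd X (objs n u, top_arr n w)"
  using cone_fun_in[OF d(2) l(1)] l(2) by (simp_all add: cone_choice_def)
 show "mfcomp (cone_choice n X (u, w)) (incl n) = u"
 proof (rule list_fun_eqI[OF _ _ u(1,2)])
  show "mfcomp (cone_choice n X (u, w)) (incl n) \<in> funs"
   using multifun_comp_small[OF inclusion_in c(1)] c(2) by simp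
  show "objs n (mfcomp (cone_choice n X (u, w)) (incl n)) = objs n u"
   using cone_dom(2)[OF c(1,2)] c l(2) by simp
 qed (use c u(3) in simp_all)
 show "mfcomp (fst X) (cone_choice n X (u, w)) = w"
  using multifun_comp_small[OF c(1) P(1)] c w l(3) by (intro cone_fun_eqI[OF _ _ w(1,2)]) simp_all
qed

text \<open>A 2-cell from the filler to \<open>G\<close> has its components at the inputs prescribed
  by \<open>\<alpha>\<close>. Naturality at the cone arrow makes the last component a factorisation
  through the chosen lift, over the last component of \<open>\<beta>\<close>, so opcartesianness
  gives exactly one.\<close>

lemma kz_choice_cone:
 assumes X: "X \<in> cloven"
 shows "kz_choice MCat (incl n) (fst X) (cone_choice n X)"
proof (rule MCat.kz_choiceI; (unfold MCat_simps MCat_simps2 inclusion_simps(1,2))?)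
 have P: "fst X \<in> funs" using X by (simp add: cloven_iff)
 then show "fst X \<in> funs" "incl n \<in> funs" by simp_all
 interpret P: multifunctor "fst X" by (rule funsD[OF P])
 interpret E: multicategory "fdom (fst X)" by (rule funsD[OF P])
 fix u w
 assume u: "u \<in> funs" "fdom u = discM n" "fcod u = fdom (fst X)"
  and w: "w \<in> funs" "fdom w = coneM n" "fcod w = fcod (fst X)"
  and uw: "mfcomp (fst X) u = mfcomp w (incl n)"
 note l = cone_choice_props[OF X u w uw]
 let ?l = "cone_choice n X (u, w)"
 show "?l \<in> funs \<and> fdom ?l = coneM n \<and> fcod ?l = fdom (fst X) \<and>
   mfcomp ?l (incl n) = u \<and> mfcomp (fst X) ?l = w"
  using l by simp
 fix G \<alpha> \<beta>
 assume G: "G \<in> funs" "fdom G = coneM n" "fcod G = fdom (fst X)"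
  and a: "\<alpha> \<in> mtrans" "tsrc \<alpha> = u" "ttrg \<alpha> = mfcomp G (incl n)"
  and b: "\<beta> \<in> mtrans" "tsrc \<beta> = w" "ttrg \<beta> = mfcomp (fst X) G"
  and ab: "hct (idt (fst X)) \<alpha> = hct \<beta> (idt (incl n))"
 define m where "m = snd X (objs n u, top_arr n w)"
 note o = l(1)[folded m_def] and lt = l(5)[folded m_def]
 note lm = opcartD[OF o P.multifunctor_axioms]
 have Gm: "top_arr n G \<in> marr (fdom (fst X))" "mdom (fdom (fst X)) (top_arr n G) = objs n G"
  "mcod (fdom (fst X)) (top_arr n G) = fobj G (e n)" using cone_dom[OF G(1,2)] G(3) by simp_all
 have lo: "fobj ?l (e n) = mcod (fdom (fst X)) m" using cone_dom(3)[OF l(2,3)] l(4) lt by simp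
 have lu: "fobj ?l (e i) = fobj u (e i)" if "i < n" for i
  using arg_cong[OF l(6), of "\<lambda>F. fobj F (e i)"] that by simp
 have ac: "tcmp \<alpha> (e i) \<in> marr (fdom (fst X))" "mdom (fdom (fst X)) (tcmp \<alpha> (e i)) = [fobj u (e i)]"
  "mcod (fdom (fst X)) (tcmp \<alpha> (e i)) = fobj G (e i)" if "i < n" for i
  using mtransD(10-12)[OF a(1), of "e i"] a(2,3) u(2,3) that by simp_all
 have bc: "tcmp \<beta> (e n) \<in> marr (fcod (fst X))" "mdom (fcod (fst X)) (tcmp \<beta> (e n)) = [fobj w (e n)]"
  "mcod (fcod (fst X)) (tcmp \<beta> (e n)) = fobj (fst X) (fobj G (e n))"
  using mtransD(10-12)[OF b(1), of "e n"] b(2,3) w(2,3) G(2) by simp_all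
 have wn: "fobj w (e n) = mcod (fcod (fst X)) (top_arr n w)" using cone_dom(3)[OF w(1,2)] w(3) by simp
 have abc: "farr (fst X) (tcmp \<alpha> (e i)) = tcmp \<beta> (e i)" if "i < n" for i
  using whisker_compatible_iff[OF P a(1) _ _ b(1), of n] a(2,3) b(2,3) u w uw G P ab that
   category.assoc'[OF category_MCat, of "incl n" G "fst X"]
  by simp
 \<comment> \<open>The multimorphism named by \<open>G\<close>, precomposed with the inputs of
   \<open>\<alpha>\<close>: the map that the last component has to factor through the lift
   \<open>m\<close>.\<close>
 define g where "g = mcomp (fdom (fst X)) (top_arr n G) (map (\<lambda>i. tcmp \<alpha> (e i)) [0..<n])"
 have Go: "map (\<lambda>i. mcod (fdom (fst X)) (tcmp \<alpha> (e i))) [0..<n] = objs n G"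
  using ac(3) by (simp add: objs_def)
 have "concat (map (\<lambda>i. mdom (fdom (fst X)) (tcmp \<alpha> (e i))) [0..<n]) = concat (map (\<lambda>i. [fobj u (e i)]) [0..<n])"
  using ac(2) by (intro arg_cong[where f = concat] map_cong) simp_all
 then have g: "g \<in> marr (fdom (fst X))" "mdom (fdom (fst X)) g = objs n u" "mcod (fdom (fst X)) g = fobj G (e n)"
  using E.mcomp_map_arr[of "top_arr n G" "[0..<n]" "\<lambda>i. tcmp \<alpha> (e i)"] E.mcomp_map_dom[of "top_arr n G" "[0..<n]" "\<lambda>i. tcmp \<alpha> (e i)"]
   E.mcomp_map_cod[of "top_arr n G" "[0..<n]" "\<lambda>i. tcmp \<alpha> (e i)"] Gm ac(1) Go
  by (simp_all add: g_def objs_def concat_map_singleton)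
 have Pg: "farr (fst X) g = mcomp (fcod (fst X)) (tcmp \<beta> (e n)) [top_arr n w]"
 proof -
  have "farr (fst X) g = mcomp (fcod (fst X)) (farr (fst X) (top_arr n G)) (map (\<lambda>i. farr (fst X) (tcmp \<alpha> (e i))) [0..<n])"
   using P.farr_comp[of "top_arr n G" "map (\<lambda>i. tcmp \<alpha> (e i)) [0..<n]"] Gm ac(1) Go by (simp add: g_def comp_def image_subset_iff)
  also have "map (\<lambda>i. farr (fst X) (tcmp \<alpha> (e i))) [0..<n] = map (\<lambda>i. tcmp \<beta> (e i)) [0..<n]" using abc by simp
  finally show ?thesis using cone_natural[OF b(1)] b(2,3) w(2,3) G(2) by simp
 qed
 have "\<exists>!v. v \<in> marr (fdom (fst X)) \<and> mdom (fdom (fst X)) v = [mcod (fdom (fst X)) m] \<and>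
   mcod (fdom (fst X)) v = mcod (fdom (fst X)) g \<and> mcomp (fdom (fst X)) v [m] = g \<and> farr (fst X) v = tcmp \<beta> (e n)"
  by (rule opcart_ex1[OF o g(1,2) bc(1)]) (use bc g wn Pg in simp_all)
 then obtain v where v: "v \<in> marr (fdom (fst X))" "mdom (fdom (fst X)) v = [mcod (fdom (fst X)) m]"
  "mcod (fdom (fst X)) v = fobj G (e n)" "mcomp (fdom (fst X)) v [m] = g" "farr (fst X) v = tcmp \<beta> (e n)"
  using g(3) by auto
 have eqs: "hct \<gamma> (idt (incl n)) = \<alpha> \<and> hct (idt (fst X)) \<gamma> = \<beta> \<longleftrightarrow>
   (\<forall>i<n. tcmp \<gamma> (e i) = tcmp \<alpha> (e i)) \<and> (\<forall>i\<le>n. farr (fst X) (tcmp \<gamma> (e i)) = tcmp \<beta> (e i))"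
  if "\<gamma> \<in> mtrans" "tsrc \<gamma> = ?l" "ttrg \<gamma> = G" for \<gamma>
  using whisker_right_eq_iff[OF that(1) _ a(1)] whisker_left_eq_iff[OF that(1) _ P _ b(1)] that a b l G by simp
 \<comment> \<open>The inputs take the components of \<open>\<alpha>\<close>, the extra object takes
   the factorisation \<open>v\<close>.\<close>
 let ?c = "cone_trans n ?l G (\<lambda>i. if i = n then v else tcmp \<alpha> (e i))"
 have c: "?c \<in> mtrans"
 proof (rule cone_trans_in[OF l(2,3) G(1,2)])
  show "mcomp (fcod ?l) (if n = n then v else tcmp \<alpha> (e n)) [top_arr n ?l] =
   mcomp (fcod ?l) (top_arr n G) (map (\<lambda>i. if i = n then v else tcmp \<alpha> (e i)) [0..<n])"
  proof -
   have "map (\<lambda>i. if i = n then v else tcmp \<alpha> (e i)) [0..<n] = map (\<lambda>i. tcmp \<alpha> (e i)) [0..<n]" by simp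
   then show ?thesis using v(4) lt l(4) by (simp only: g_def if_True refl)
  qed
 qed (use ac v lo lu l(4) G(3) in auto)
 show "\<exists>!\<gamma>. \<gamma> \<in> mtrans \<and> tsrc \<gamma> = ?l \<and> ttrg \<gamma> = G \<and> hct \<gamma> (idt (incl n)) = \<alpha> \<and>
   hct (idt (fst X)) \<gamma> = \<beta>"
 proof (rule ex1I[of _ ?c])
  show "?c \<in> mtrans \<and> tsrc ?c = ?l \<and> ttrg ?c = G \<and> hct ?c (idt (incl n)) = \<alpha> \<and>
   hct (idt (fst X)) ?c = \<beta>"
   using eqs[OF c] c v(5) abc by (simp add: le_eq_less_or_eq)
  fix \<gamma> assume \<gamma>: "\<gamma> \<in> mtrans \<and> tsrc \<gamma> = ?l \<and> ttrg \<gamma> = G \<and> hct \<gamma> (idt (incl n)) = \<alpha> \<and>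
   hct (idt (fst X)) \<gamma> = \<beta>"
  then have \<gamma>': "\<gamma> \<in> mtrans" "tsrc \<gamma> = ?l" "ttrg \<gamma> = G" "\<And>i. i < n ==> tcmp \<gamma> (e i) = tcmp \<alpha> (e i)"
   "farr (fst X) (tcmp \<gamma> (e n)) = tcmp \<beta> (e n)" using eqs by auto
  have "tcmp \<gamma> (e n) = v"
  proof (rule opcart_unique[OF o P.multifunctor_axioms E.multicategory_axioms])
   show "tcmp \<gamma> (e n) \<in> marr (fdom (fst X))" "mdom (fdom (fst X)) (tcmp \<gamma> (e n)) = [mcod (fdom (fst X)) m]"
    using mtransD(10,11)[OF \<gamma>'(1), of "e n"] \<gamma>'(2) l(3,4) lo by simp_all
   show "mcomp (fdom (fst X)) (tcmp \<gamma> (e n)) [m] = mcomp (fdom (fst X)) v [m]"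
   proof -
    have "map (\<lambda>i. tcmp \<gamma> (e i)) [0..<n] = map (\<lambda>i. tcmp \<alpha> (e i)) [0..<n]" using \<gamma>'(4) by simp
    then show ?thesis using cone_natural[OF \<gamma>'(1), of n] \<gamma>'(2,3) l(3,4) lt v(4) by (simp add: g_def del: map_eq_conv)
   qed
  qed (use v \<gamma>'(5) in simp_all)
  then have "tcmp \<gamma> (e i) = tcmp ?c (e i)" if "i \<le> n" for i using \<gamma>'(4)[of i] that by auto
  then show "\<gamma> = ?c"
   using \<gamma>' l(3) by (intro mtrans_eqI mtransD(1)[OF \<gamma>'(1)] mtransD(1)[OF c]) auto
 qed
qed


text \<open>The converse of \<open>kz_choice_cone\<close>. Universality is tested on 2-cells that
  are identities at the inputs; such cells from the filler to the functor naming \<open>g\<close>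
  are the factorisations of \<open>g\<close> through the named multimorphism.\<close>

lemma kz_choice_opcartesian:
 assumes P: "P \<in> funs" and l: "kz_choice MCat (incl n) P l"
  and u: "u \<in> funs" "fdom u = discM n" "fcod u = fdom P"
  and w: "w \<in> funs" "fdom w = coneM n" "fcod w = fcod P"
  and uw: "mfcomp P u = mfcomp w (incl n)"
 shows "opcart P (objs n u) (top_arr n w) (top_arr n (l (u, w)))"
proof -
 note d = funsD[OF P]
 interpret P: multifunctor P by (rule d)
 interpret E: multicategory "fdom P" by (rule d)
 interpret B: multicategory "fcod P" by (rule d)
 interpret u: multifunctor u by (rule funsD[OF u(1)])
 interpret w: multifunctor w by (rule funsD[OF w(1)])
 let ?l = "l (u, w)"
 have lp: "?l \<in> funs" "fdom ?l = coneM n" "fcod ?l = fdom P"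
  "mfcomp ?l (incl n) = u" "mfcomp P ?l = w"
  using MCat.kz_choice_ob[of "incl n" P l u w] P l u w uw by simp_all
 define m where "m = top_arr n ?l"
 have ou: "objs n ?l = objs n u" using objs_inclusion[OF lp(2)] lp(4) by simp
 have m: "m \<in> marr (fdom P)" "mdom (fdom P) m = objs n u" "mcod (fdom P) m = fobj ?l (e n)" "farr P m = top_arr n w"
  using cone_dom[OF lp(1,2)] lp(3) ou top_arr_comp[OF lp(2), of P] lp(5) by (simp_all add: m_def)
 have lu: "fobj ?l (e i) = fobj u (e i)" if "i < n" for i
  using arg_cong[OF lp(4), of "\<lambda>F. fobj F (e i)"] that by simp
 have wP: "fobj w (e i) = fobj P (fobj ?l (e i))" if "i \<le> n" for i
  using arg_cong[OF lp(5), of "\<lambda>F. fobj F (e i)"] lp(2) that by simp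
 have uin: "fobj u (e i) \<in> mobj (fdom P)" if "i < n" for i using u.fobj_in[of "e i"] u(2,3) that by simp
 have win: "fobj w (e i) \<in> mobj (fcod P)" if "i \<le> n" for i using w.fobj_in[of "e i"] w(2,3) that by simp
 have wt: "top_arr n w \<in> marr (fcod P)" "mdom (fcod P) (top_arr n w) = objs n w" "mcod (fcod P) (top_arr n w) = fobj w (e n)"
  using cone_dom[OF w(1,2)] w(3) by simp_all
 show ?thesis
  unfolding m_def[symmetric]
 proof (rule opcartI[OF m(1,2,4)])
  fix g x
  assume g: "g \<in> marr (fdom P)" "mdom (fdom P) g = objs n u" and x: "x \<in> marr (fcod P)"
   "mdom (fcod P) x = [mcod (fcod P) (top_arr n w)]" "mcod (fcod P) x = fobj P (mcod (fdom P) g)"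
   and gx: "farr P g = mcomp (fcod P) x [top_arr n w]"
  define G where "G = cone_fun (fdom P) n g"
  have G: "G \<in> funs" "fdom G = coneM n" "fcod G = fdom P" "top_arr n G = g" "fobj G (e n) = mcod (fdom P) g"
   using cone_fun_in[OF d(2) g(1)] g(2) by (simp_all add: G_def)
  have oG: "objs n G = objs n u" using cone_dom(2)[OF G(1,2)] G(3,4) g(2) by simp
  have Gu: "mfcomp G (incl n) = u"
   using multifun_comp_small[OF inclusion_in G(1)] G u oG by (intro list_fun_eqI[OF _ _ u(1,2)]) simp_all
  have Gi: "fobj G (e i) = fobj u (e i)" if "i < n" for i
   using arg_cong[OF Gu, of "\<lambda>F. fobj F (e i)"] that by simp
  have PG: "mfcomp P G \<in> funs" "fdom (mfcomp P G) = coneM n" "fcod (mfcomp P G) = fcod w"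
   using multifun_comp_small[OF G(1) P] G w by simp_all
  \<comment> \<open>The given 2-cell in the base: identities at the inputs and \<open>x\<close> at
    the extra object. Naturality at the cone arrow is the hypothesis \<open>gx\<close>.\<close>
  define b where "b = cone_trans n w (mfcomp P G) (\<lambda>i. if i = n then x else mident (fcod P) (fobj w (e i)))"
  have b: "b \<in> mtrans"
   unfolding b_def
  proof (rule cone_trans_in[OF w(1,2) PG])
   show "(if i = n then x else mident (fcod P) (fobj w (e i))) \<in> marr (fcod w) \<and>
    mdom (fcod w) (if i = n then x else mident (fcod P) (fobj w (e i))) = [fobj w (e i)] \<and>
    mcod (fcod w) (if i = n then x else mident (fcod P) (fobj w (e i))) = fobj (mfcomp P G) (e i)" if "i \<le> n" for i
    using that win[OF that] wP[OF that] lu Gi x wt(3) w(3) G(2,5) by (cases "i = n") simp_all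
   have "map (\<lambda>i. if i = n then x else mident (fcod P) (fobj w (e i))) [0..<n] = map (mident (fcod P)) (mdom (fcod P) (farr P g))"
    using g u(3) wP lu by (simp add: objs_def comp_def)
   then have "mcomp (fcod P) (farr P g) (map (\<lambda>i. if i = n then x else mident (fcod P) (fobj w (e i))) [0..<n]) = farr P g"
    using B.mcomp_mident_right[OF P.farr_arr[OF g(1)]] by simp
   then show "mcomp (fcod w) (if n = n then x else mident (fcod P) (fobj w (e n))) [top_arr n w] =
    mcomp (fcod w) (top_arr n (mfcomp P G)) (map (\<lambda>i. if i = n then x else mident (fcod P) (fobj w (e i))) [0..<n])"
    unfolding top_arr_comp[OF G(2)] G(4) using gx w(3) by simp
  qed
  have b': "tsrc b = w" "ttrg b = mfcomp P G" by (simp_all add: b_def)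
  have a: "idt u \<in> mtrans" by (rule mtrans_id_in[OF u(1)])
  have assoc: "mfcomp P (mfcomp G (incl n)) = mfcomp (mfcomp P G) (incl n)"
   using category.assoc'[OF category_MCat, of "incl n" G P] P G by simp
  have ab: "hct (idt P) (idt u) = hct b (idt (incl n))"
  proof -
   have "farr P (tcmp (idt u) (e i)) = tcmp b (e i)" if "i < n" for i
    using that u(2,3) uin[OF that] P.farr_mident[OF uin[OF that]] wP[of i] lu by (simp add: b_def)
   then show ?thesis
    using whisker_compatible_iff[OF P a _ _ b, of n] u w uw b' assoc Gu by simp
  qed
  have ex1: "\<exists>!\<gamma>. \<gamma> \<in> mtrans \<and> tsrc \<gamma> = ?l \<and> ttrg \<gamma> = G \<and> hct \<gamma> (idt (incl n)) = idt u \<and>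
    hct (idt P) \<gamma> = b"
   using MCat.kz_choice_ex1[of "incl n" P l u w G "idt u" b] P l u w uw G a b b' ab Gu by simp
  have eqs: "hct \<gamma> (idt (incl n)) = idt u \<and> hct (idt P) \<gamma> = b \<longleftrightarrow>
    (\<forall>i<n. tcmp \<gamma> (e i) = mident (fdom P) (fobj u (e i))) \<and> (\<forall>i\<le>n. farr P (tcmp \<gamma> (e i)) = tcmp b (e i))"
   if "\<gamma> \<in> mtrans" "tsrc \<gamma> = ?l" "ttrg \<gamma> = G" for \<gamma>
  proof -
   have "hct \<gamma> (idt (incl n)) = idt u \<longleftrightarrow> (\<forall>i<n. tcmp \<gamma> (e i) = tcmp (idt u) (e i))"
    by (rule whisker_right_eq_iff[OF that(1) _ a]) (use that lp(2,4) Gu in simp_all)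
   moreover have "hct (idt P) \<gamma> = b \<longleftrightarrow> (\<forall>i\<le>n. farr P (tcmp \<gamma> (e i)) = tcmp b (e i))"
    by (rule whisker_left_eq_iff[OF that(1) _ P _ b]) (use that lp(2,3,5) b' in simp_all)
   ultimately show ?thesis using u(2,3) by simp
  qed
  have gid: "mcomp (fdom P) g (map (\<lambda>i. mident (fdom P) (fobj u (e i))) [0..<n]) = g"
   using E.mcomp_mident_right[OF g(1)] g(2) by (simp add: objs_def comp_def)
  let ?Q = "\<lambda>v. v \<in> marr (fdom P) \<and> mdom (fdom P) v = [mcod (fdom P) m] \<and> mcod (fdom P) v = mcod (fdom P) g \<and>
   mcomp (fdom P) v [m] = g \<and> farr P v = x"
  \<comment> \<open>The factorisations \<open>v\<close> correspond to the universal fillers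
    \<open>\<gamma>\<close> by \<open>?t\<close> and by evaluation at the extra object.\<close>
  let ?t = "\<lambda>v. cone_trans n ?l G (\<lambda>i. if i = n then v else mident (fdom P) (fobj u (e i)))"
  let ?R = "\<lambda>\<gamma>. \<gamma> \<in> mtrans \<and> tsrc \<gamma> = ?l \<and> ttrg \<gamma> = G \<and>
   hct \<gamma> (idt (incl n)) = idt u \<and> hct (idt P) \<gamma> = b"
  have t: "?R (?t v)" if v: "?Q v" for v
  proof -
   have "?t v \<in> mtrans"
   proof (rule cone_trans_in[OF lp(1,2) G(1,2)])
    show "mcomp (fcod ?l) (if n = n then v else mident (fdom P) (fobj u (e n))) [top_arr n ?l] =
     mcomp (fcod ?l) (top_arr n G) (map (\<lambda>i. if i = n then v else mident (fdom P) (fobj u (e i))) [0..<n])"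
    proof -
     have "map (\<lambda>i. if i = n then v else mident (fdom P) (fobj u (e i))) [0..<n] = map (\<lambda>i. mident (fdom P) (fobj u (e i))) [0..<n]"
      by simp
     then show ?thesis using v gid lp(3) G(4) by (simp add: m_def del: map_eq_conv)
    qed
   qed (use v lp(3) G(3,5) m(3) lu Gi uin in auto)
   moreover have "farr P (mident (fdom P) (fobj u (e i))) = tcmp b (e i)" if "i < n" for i
    using that P.farr_mident[OF uin[OF that]] wP[of i] lu by (simp add: b_def)
   ultimately show ?thesis
    using eqs[of "?t v"] v by (simp add: le_eq_less_or_eq b_def)
  qed
  obtain \<gamma> where \<gamma>: "?R \<gamma>" using ex1 by blast
  have "?Q (tcmp \<gamma> (e n))"
  proof -
   have "mcomp (fdom P) (tcmp \<gamma> (e n)) [m] = g"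
   proof -
    have "map (\<lambda>i. tcmp \<gamma> (e i)) [0..<n] = map (\<lambda>i. mident (fdom P) (fobj u (e i))) [0..<n]" using \<gamma> eqs[of \<gamma>] by simp
    then show ?thesis using cone_natural[of \<gamma> n] \<gamma> lp(2,3) G(4) gid by (simp add: m_def del: map_eq_conv)
   qed
   then show ?thesis
    using mtransD(10-12)[of \<gamma> "e n"] \<gamma> eqs[of \<gamma>] lp(2,3) G(5) m(3) by (simp add: b_def)
  qed
  moreover have "v = tcmp \<gamma> (e n)" if "?Q v" for v
  proof -
   have "?t v = \<gamma>" using ex1 t[OF that] \<gamma> by blast
   then have "tcmp (?t v) (e n) = tcmp \<gamma> (e n)" by simp
   then show ?thesis by simp
  qed
  ultimately show "\<exists>!v. ?Q v" by blast
 qed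
qed

end

context cones
begin

section \<open>KZ structures for the cone inclusions and cleavages\<close>

abbreviation J :: "(nat, nat, nat) twocat" where "J \<equiv> discrete_twocat UNIV"

definition kz_of :: "('u, 'u) multifun \<times> ('u list \<times> 'u => 'u) =>
  ('u, 'u) multifun \<times> (nat, ('u, 'u) multifun, ('u, 'u) multitrans) kz_structure" where
 "kz_of X = (fst X, \<lambda>n. kz_rali MCat (incl n) (fst X) (cone_choice n X))"

abbreviation kz_set where "kz_set \<equiv> {(f, Q). f \<in> carr MCat \<and> kz_structure MCat J (cone_family e) f Q}"

lemma cone_family_simps [simp]:
 "ob_map (cone_family e) n = incl n" "ar_map (cone_family e) n = sq_id MCat (incl n)"
 "ce_map (cone_family e) n = id2 (arrow_twocat MCat) (sq_id MCat (incl n))"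
 by (simp_all add: cone_family_def del: arrow_twocat_simps(10))

lemma two_functor_cone_family: "two_functor J (arrow_twocat MCat) (cone_family e)"
 by (rule MCat.two_functor_discrete) simp_all

lemma kz_structure_iff:
 assumes "P \<in> funs"
 shows "kz_structure MCat J (cone_family e) P Q \<longleftrightarrow>
  (\<forall>n. rali_structure (hom_cat MCat (coneM n) (fdom P)) (comparison_target MCat (incl n) P)
   (comparison MCat (incl n) P) (Q n))"
 using MCat.kz_structure_discrete[of UNIV "cone_family e" P Q] assms by simp

lemma rali_context_cone:
 assumes "P \<in> funs"
 shows "rali_context (hom_cat MCat (coneM n) (fdom P)) (comparison_target MCat (incl n) P)
  (comparison MCat (incl n) P)"
 using MCat.rali_context_comparison[of "incl n" P] assms by simp

lemma ob_kz_rali: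
 "b \<in> cobj (comparison_target C j f) ==> ob_map (ladj (kz_rali C j f l)) b = l b"
 by (simp add: kz_rali_def crali_def del: target_simps)

lemma comparison_target_iff:
 "(u, w) \<in> targets n P \<longleftrightarrow>
  u \<in> funs \<and> fdom u = discM n \<and> fcod u = fdom P \<and>
  w \<in> funs \<and> fdom w = coneM n \<and> fcod w = fcod P \<and>
  mfcomp P u = mfcomp w (incl n)"
 by (auto simp: chom_def)

lemma lifting_problem_target:
 assumes "P \<in> funs" "lprob P es f"
 shows "(list_fun (fdom P) (length es) es, cone_fun (fcod P) (length es) f) \<in> cobj (comparison_target MCat (incl (length es)) P)"
  "objs (length es) (list_fun (fdom P) (length es) es) = es" "top_arr (length es) (cone_fun (fcod P) (length es) f) = f"
 using lifting_problem_funs[OF assms refl] unfolding comparison_target_iff by blast+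

lemma kz_of_in:
 assumes X: "X \<in> cloven"
 shows "kz_of X \<in> kz_set"
proof -
 have P: "fst X \<in> funs" using X by (simp add: cloven_iff)
 have "rali_structure (hom_cat MCat (coneM n) (fdom (fst X))) (comparison_target MCat (incl n) (fst X))
   (comparison MCat (incl n) (fst X)) (kz_rali MCat (incl n) (fst X) (cone_choice n X))" for n
  using rali_context.rali_choice_rali[OF rali_context_cone[OF P]] kz_choice_cone[OF X, of n]
  by (simp add: kz_choice_def kz_rali_def)
 then show ?thesis using kz_structure_iff[OF P] P by (simp add: kz_of_def)
qed

lemma top_arr_cone_choice: "top_arr n (cone_choice n X (u, w)) = snd X (objs n u, top_arr n w)"
 by (simp add: cone_choice_def)

text \<open>Recovers a cleavage from its KZ structure by filling the standard square of each lifting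
  problem, which gives injectivity.\<close>

lemma kz_of_lift:
 assumes X: "X \<in> cloven" and l: "lprob (fst X) es f"
 shows "snd X (es, f) = top_arr (length es) (ob_map (ladj (snd (kz_of X) (length es)))
  (list_fun (fdom (fst X)) (length es) es, cone_fun (fcod (fst X)) (length es) f))"
proof -
 have "fst X \<in> funs" using X by (simp add: cloven_iff)
 note t = lifting_problem_target[OF this l]
 show ?thesis using ob_kz_rali[OF t(1)] t(2,3) by (simp add: kz_of_def top_arr_cone_choice)
qed

lemma kz_of_inj:
 assumes "X \<in> cloven" "Y \<in> cloven" "kz_of X = kz_of Y"
 shows "X = Y"
proof (rule cloven_eqI[OF assms(1,2)])
 show "fst X = fst Y" using arg_cong[OF assms(3), of fst] by (simp add: kz_of_def)
 then show "snd X (es, f) = snd Y (es, f)" if "lprob (fst X) es f" for es f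
  using kz_of_lift[OF assms(1), of es f] kz_of_lift[OF assms(2), of es f] assms(3) that by simp
qed

text \<open>A KZ structure amounts to its chosen fillers \<open>l n\<close>, and \<open>c\<close>
  records the multimorphisms that they name. These are opcartesian by
  \<open>kz_choice_opcartesian\<close>, and the fillers are determined by them, so the structure of
  \<open>c\<close> is \<open>Q\<close>.\<close>

lemma kz_of_surj:
 assumes "(P, Q) \<in> kz_set"
 shows "\<exists>X\<in>cloven. kz_of X = (P, Q)"
proof -
 have P: "P \<in> funs" and Q: "\<And>n. rali_structure (hom_cat MCat (coneM n) (fdom P))
   (comparison_target MCat (incl n) P) (comparison MCat (incl n) P) (Q n)"
  using assms kz_structure_iff by auto
 note d = funsD[OF P]
 define l where "l n = ob_map (ladj (Q n))" for n
 have l: "kz_choice MCat (incl n) P (l n)" for n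
  using rali_context.rali_choice[OF rali_context_cone[OF P] Q] by (simp add: kz_choice_def l_def)
 define c where "c = (\<lambda>(es, f)\<in>{(es, f). lprob P es f}.
  top_arr (length es) (l (length es) (list_fun (fdom P) (length es) es, cone_fun (fcod P) (length es) f)))"
 \<comment> \<open>Every square against an inclusion is the standard square of the lifting problem
   that it names, so \<open>c\<close> accounts for all fillers and not only for those used in its
   definition.\<close>
 have lc: "top_arr n (l n (u, w)) = c (objs n u, top_arr n w)" and o: "opcart P (objs n u) (top_arr n w) (top_arr n (l n (u, w)))"
  and lin: "l n (u, w) \<in> funs" "fdom (l n (u, w)) = coneM n" "fcod (l n (u, w)) = fdom P"
  if "(u, w) \<in> targets n P" for n u w
 proof -
  have t: "u \<in> funs" "fdom u = discM n" "fcod u = fdom P"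
   "w \<in> funs" "fdom w = coneM n" "fcod w = fcod P" "mfcomp P u = mfcomp w (incl n)"
   using that unfolding comparison_target_iff by blast+
  have lp: "lprob P (objs n u) (top_arr n w)" using lifting_problem_iff[OF P t(1-6)] t(7) by simp
  have n: "n = length (objs n u)" by simp
  note f = lifting_problem_funs[OF P lp n]
  have "list_fun (fdom P) n (objs n u) = u" by (rule list_fun_eqI) (use f t in auto)
  moreover have "cone_fun (fcod P) n (top_arr n w) = w" by (rule cone_fun_eqI) (use f t in auto)
  ultimately show "top_arr n (l n (u, w)) = c (objs n u, top_arr n w)" using lp by (simp add: c_def)
  show "opcart P (objs n u) (top_arr n w) (top_arr n (l n (u, w)))"
   by (rule kz_choice_opcartesian[OF P l t])
  show "l n (u, w) \<in> funs" "fdom (l n (u, w)) = coneM n" "fcod (l n (u, w)) = fdom P"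
   using MCat.kz_choice_ob[of "incl n" P "l n" u w] P l t by simp_all
 qed
 have "cleavage P c"
  unfolding cleavage_def
 proof (intro conjI allI impI)
  fix es f assume lp: "lprob P es f"
  note t = lifting_problem_target[OF P lp]
  show "opcart P es f (c (es, f))" using lc[OF t(1)] o[OF t(1)] t(2,3) by simp
 qed (simp add: c_def)
 then have X: "(P, c) \<in> cloven" using P by (simp add: cloven_iff)
 have "kz_rali MCat (incl n) P (cone_choice n (P, c)) = Q n" for n
 proof -
  have "cone_choice n (P, c) b = l n b" if "b \<in> targets n P" for b
  proof -
   obtain u w where b: "b = (u, w)" by (cases b)
   have uw: "(u, w) \<in> targets n P" using that b by simp
   note p = cone_choice_props[OF X, of u n w] and uw' = uw[unfolded comparison_target_iff]
   show ?thesis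
    unfolding b
   proof (rule cone_fun_eqI)
    show "top_arr n (cone_choice n (P, c) (u, w)) = top_arr n (l n (u, w))"
     unfolding lc[OF uw] top_arr_cone_choice snd_conv ..
   qed (use p uw' lin[OF uw] in simp_all)
  qed
  then have "crali (hom_cat MCat (coneM n) (fdom P)) (comparison_target MCat (incl n) P)
    (comparison MCat (incl n) P) (cone_choice n (P, c)) =
   crali (hom_cat MCat (coneM n) (fdom P)) (comparison_target MCat (incl n) P)
    (comparison MCat (incl n) P) (l n)"
   by (rule rali_context.choice_rali_cong[OF rali_context_cone[OF P]])
  then show ?thesis
   using rali_context.rali_eq_choice_rali[OF rali_context_cone[OF P] Q] by (simp add: kz_rali_def l_def)
 qed
 then have "kz_of (P, c) = (P, Q)" by (simp add: kz_of_def)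
 then show ?thesis using X by blast
qed

text \<open>Functors out of \<open>C(n)\<close> agree when they name the same multimorphism, so
  preservation of chosen fillers is preservation of chosen lifts. The clauses of
  \<open>kz_morphism\<close> on 2-cells and counits follow by
  \<open>kz_rali_morphism\<close>.\<close>

lemma kz_of_morphism:
 assumes X: "X \<in> cloven" and Y: "Y \<in> cloven" and s: "s \<in> sqs MCat" "sdom s = fst X" "scod s = fst Y"
 shows "cleavage_preserving X s Y \<longleftrightarrow> kz_morphism MCat J (cone_family e) (kz_of X) s (kz_of Y)"
proof -
 note d = MCat_squareD[OF s(1)]
 have P: "fst X \<in> funs" "fst Y \<in> funs" using X Y by (simp_all add: cloven_iff)
 have t: "(mfcomp (stop s) u, mfcomp (sbot s) w) \<in> cobj (comparison_target MCat (incl n) (fst Y))"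
  if "(u, w) \<in> targets n (fst X)" for n u w
 proof -
  note uw = that[unfolded comparison_target_iff]
  have "mfcomp (scod s) (mfcomp (stop s) u) = mfcomp (sbot s) (mfcomp (sdom s) u)"
   using category.assoc'[OF category_MCat, of u "stop s" "scod s"] category.assoc'[OF category_MCat, of u "sdom s" "sbot s"]
    s d uw by (simp add: MCat.sq_iff)
  also have "\<dots> = mfcomp (mfcomp (sbot s) w) (incl n)"
   using category.assoc'[OF category_MCat, of "incl n" w "sbot s"] s d uw by simp
  finally show ?thesis
   unfolding comparison_target_iff using uw d s multifun_comp_small[of u "stop s"] multifun_comp_small[of w "sbot s"] by simp
 qed
 have eq: "mfcomp (stop s) (cone_choice n X (u, w)) = cone_choice n Y (mfcomp (stop s) u, mfcomp (sbot s) w) \<longleftrightarrow>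
   farr (stop s) (snd X (objs n u, top_arr n w)) = snd Y (map (fobj (stop s)) (objs n u), farr (sbot s) (top_arr n w))"
  if "(u, w) \<in> targets n (fst X)" for n u w
 proof -
  note uw = that[unfolded comparison_target_iff] and uw' = t[OF that, unfolded comparison_target_iff]
  have p: "cone_choice n X (u, w) \<in> funs" "fdom (cone_choice n X (u, w)) = coneM n"
   "fcod (cone_choice n X (u, w)) = fdom (fst X)" "top_arr n (cone_choice n X (u, w)) = snd X (objs n u, top_arr n w)"
   using cone_choice_props[OF X, of u n w] uw by simp_all
  let ?v = "(mfcomp (stop s) u, mfcomp (sbot s) w)"
  have q: "cone_choice n Y ?v \<in> funs" "fdom (cone_choice n Y ?v) = coneM n"
   "fcod (cone_choice n Y ?v) = fdom (fst Y)"
   "top_arr n (cone_choice n Y ?v) = snd Y (map (fobj (stop s)) (objs n u), farr (sbot s) (top_arr n w))"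
   using cone_choice_props[OF Y, of "mfcomp (stop s) u" n "mfcomp (sbot s) w"] uw uw' objs_comp[of u n "stop s"]
   by simp_all
  have M: "mfcomp (stop s) (cone_choice n X (u, w)) \<in> funs"
   using multifun_comp_small[OF p(1) d(2)] p(3) d(5) s(2) by simp
  have T: "top_arr n (mfcomp (stop s) (cone_choice n X (u, w))) = farr (stop s) (snd X (objs n u, top_arr n w))"
   unfolding top_arr_comp[OF p(2)] p(4) ..
  have "mfcomp (stop s) (cone_choice n X (u, w)) = cone_choice n Y ?v"
   if "farr (stop s) (snd X (objs n u, top_arr n w)) = snd Y (map (fobj (stop s)) (objs n u), farr (sbot s) (top_arr n w))"
  proof (rule cone_fun_eqI)
   show "top_arr n (mfcomp (stop s) (cone_choice n X (u, w))) = top_arr n (cone_choice n Y ?v)"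
    unfolding T q(4) that ..
  qed (use M p(2) q(1-3) d(6) s(3) in simp_all)
  then show ?thesis using T q(4) by metis
 qed
 show ?thesis
 proof
  assume c: "cleavage_preserving X s Y"
  have m: "mfcomp (stop s) (cone_choice n X (u, w)) = cone_choice n Y (mfcomp (stop s) u, mfcomp (sbot s) w)"
   if "(u, w) \<in> targets n (fst X)" for n u w
  proof -
   have "lprob (fst X) (objs n u) (top_arr n w)"
    using lifting_problem_iff[OF P(1), of u n w] that unfolding comparison_target_iff by blast
   then show ?thesis using eq[OF that] c by (simp add: preserves_iff)
  qed
  note r = MCat.kz_rali_morphism[OF _ s(1), unfolded s(2,3) MCat_simps MCat_simps2, OF inclusion_in kz_choice_cone[OF X] kz_choice_cone[OF Y] m]
  show "kz_morphism MCat J (cone_family e) (kz_of X) s (kz_of Y)"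
   unfolding kz_morphism_def kz_of_def Let_def prod.case MCat_simps MCat_simps2 cone_family_simps
  proof (intro ballI conjI, goal_cases)
   case (1 n b) then show ?case using m ob_kz_rali[OF t] by (cases b) (simp add: ob_kz_rali del: target_simps)
  next
   case (2 n v) then show ?case using r(1) by (cases v) (simp del: target_simps)
  next
   case (3 n d) then show ?case using r(2) by simp
  qed
 next
  assume "kz_morphism MCat J (cone_family e) (kz_of X) s (kz_of Y)"
  then have m: "mfcomp (stop s) (cone_choice n X (u, w)) = cone_choice n Y (mfcomp (stop s) u, mfcomp (sbot s) w)"
   if "(u, w) \<in> targets n (fst X)" for n u w
   using that ob_kz_rali[OF that] ob_kz_rali[OF t[OF that]]
   by (fastforce simp: kz_morphism_def kz_of_def Let_def simp del: target_simps)
  show "cleavage_preserving X s Y"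
   unfolding preserves_iff
  proof (intro allI impI)
   fix es f assume "lprob (fst X) es f"
   note l = lifting_problem_target[OF P(1) this]
   show "farr (stop s) (snd X (es, f)) = snd Y (map (fobj (stop s)) es, farr (sbot s) f)"
    using eq[OF l(1)] m[OF l(1)] l(2,3) by simp
  qed
 qed
qed

lemma kz_of_idn:
 assumes A: "A \<in> mcats"
 shows "kz_of (cloven_idn A) = kz_id MCat J (cone_family e) A"
proof -
 have X: "cloven_idn A \<in> cloven" "fst (cloven_idn A) = mfid A" using cloven_idn[OF A] by (simp_all add: cloven_idn_def)
 have P: "mfid A \<in> funs" by (rule multifun_id_small[OF A])
 have "kz_rali MCat (incl n) (mfid A) (cone_choice n (cloven_idn A)) = kz_rali MCat (incl n) (mfid A) snd" for n
  unfolding kz_rali_def MCat_simps inclusion_simps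
 proof (rule rali_context.choice_rali_cong[OF rali_context_cone[OF P]])
  fix b assume b: "b \<in> cobj (comparison_target MCat (incl n) (mfid A))"
  obtain u w where bu: "b = (u, w)" by (cases b)
  have uw: "u \<in> funs \<and> fdom u = discM n \<and> fcod u = A \<and>
    w \<in> funs \<and> fdom w = coneM n \<and> fcod w = A \<and>
    mfcomp (mfid A) u = mfcomp w (incl n)"
   using b[unfolded bu comparison_target_iff] by simp
  note p = cone_choice_props[OF X(1), of u n w, unfolded X(2) multifun_simps(1,2)]
  have "mfcomp (mfid A) (cone_choice n (cloven_idn A) (u, w)) = w" using p(7) uw by simp
  then show "cone_choice n (cloven_idn A) b = snd b" using p(2,4) uw by (simp add: bu)
 qed
 then show ?thesis
  using MCat.kz_id_eq[of J "cone_family e" A] A X(2) by (simp add: kz_of_def restrict_UNIV)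
qed

text \<open>Lifting in two stages and filling in two stages name the same multimorphism;
  \<open>kz_comp_eq\<close> does the rest.\<close>

lemma kz_of_cmp:
 assumes X: "X \<in> cloven" and Y: "Y \<in> cloven" and c: "fcod (fst X) = fdom (fst Y)"
 shows "kz_of (cloven_cmp Y X) = kz_comp MCat J (cone_family e) (kz_of Y) (kz_of X)"
proof -
 have P: "fst X \<in> funs" "fst Y \<in> funs" using X Y by (simp_all add: cloven_iff)
 have Z: "cloven_cmp Y X \<in> cloven" "fst (cloven_cmp Y X) = mfcomp (fst Y) (fst X)"
  using cloven_cmp[OF X Y c] by (simp_all add: cloven_cmp_def)
 have m: "cone_choice n (cloven_cmp Y X) (u, w) = cone_choice n X (u, cone_choice n Y (mfcomp (fst X) u, w))"
  if "(u, w) \<in> cobj (comparison_target MCat (incl n) (mfcomp (fst Y) (fst X)))" for n u w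
 proof -
  note uw = that[unfolded comparison_target_iff multifun_simps(5,6)]
  have Zu: "lprob (mfcomp (fst Y) (fst X)) (objs n u) (top_arr n w)"
   using lifting_problem_iff[OF multifun_comp_small[OF P c], of u n w] uw by simp
  show ?thesis
   using Zu objs_comp[of u n "fst X"] uw top_arr_cone_choice[of n Y] by (simp add: cone_choice_def cloven_cmp_def)
 qed
 show ?thesis
  using MCat.kz_comp_eq[of J "cone_family e" "fst X" "fst Y" "\<lambda>n. cone_choice n X" "\<lambda>n. cone_choice n Y" "\<lambda>n. cone_choice n (cloven_cmp Y X)"]
   kz_choice_cone[OF X] kz_choice_cone[OF Y] kz_choice_cone[OF Z(1)] P c m Z(2)
  by (simp add: kz_of_def restrict_UNIV del: target_simps)
qed

lemma structured_iso_kz: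
 "structured_iso MCat cloven cleavage_preserving cloven_idn cloven_cmp
  kz_set (kz_morphism MCat J (cone_family e)) (kz_id MCat J (cone_family e)) (kz_comp MCat J (cone_family e)) kz_of"
proof -
 have "bij_betw kz_of cloven kz_set"
 proof (rule bij_betwI')
  show "kz_of X = kz_of Y \<longleftrightarrow> X = Y" if "X \<in> cloven" "Y \<in> cloven" for X Y using kz_of_inj[OF that] by blast
  show "kz_of X \<in> kz_set" if "X \<in> cloven" for X by (rule kz_of_in[OF that])
  show "\<exists>X\<in>cloven. Z = kz_of X" if "Z \<in> kz_set" for Z
   by (cases Z) (use kz_of_surj[of "fst Z" "snd Z"] that in \<open>auto simp: eq_commute[of Z]\<close>)
 qed
 moreover have "fst (kz_of X) = fst X" for X by (simp add: kz_of_def)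
 ultimately show ?thesis
  using kz_of_morphism kz_of_idn kz_of_cmp by (simp add: structured_iso_def)
qed

end

theorem proposition8p4:
  fixes e :: "nat \<Rightarrow> 'u"
  assumes "uncountable (UNIV :: 'u set)" and "inj e"
  shows "\<exists>W :: (('u, 'u) multicat, ('u, 'u) multifun, ('u, 'u) multitrans) awfs_data.
    lofs MCat W \<and>
    cofibrantly_kz_generates MCat (discrete_twocat (UNIV :: nat set)) (cone_family e) W \<and>
    two_iso_over (arrow_twocat MCat) (Ralg MCat W) structured_forget
      cloven_opfibrations structured_forget"
proof -
  interpret cones "TYPE('u)" e by unfold_locales (use assms in simp_all)
  interpret F: free_arrows "MCat :: (('u, 'u) multicat, ('u, 'u) multifun, ('u, 'u) multitrans) twocat"
    cloven cleavage_preserving cloven_idn cloven_cmp free_L free_cloven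
    by (rule free_arrows_MCat)
  \<comment> \<open>Cloven opfibrations are the hub: the comparison with algebras is inverted and
    followed by the one with KZ structures. The axioms of structured arrows reach algebras and KZ
    structures by transfer.\<close>
  note alg = structured_iso_inv[OF structured_arrows_cloven F.structured_iso_alg]
  note Ralg = structured_arrows_transfer[OF structured_arrows_cloven F.structured_iso_alg]
  have kz: "structured_arrows_iso MCat F.algs F.alg_mor (Ralg_id MCat F.AW) (Ralg_comp MCat F.AW)
      kz_set (kz_morphism MCat J (cone_family e)) (kz_id MCat J (cone_family e)) (kz_comp MCat J (cone_family e))
      (kz_of \<circ> inv_into cloven F.alg_of)"
    by (intro structured_arrows_iso.intro structured_arrows_iso_axioms.intro Ralg
        structured_arrows_transfer[OF structured_arrows_cloven structured_iso_kz]
        structured_iso_trans[OF Ralg alg structured_iso_kz])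
  have clv: "structured_arrows_iso MCat F.algs F.alg_mor (Ralg_id MCat F.AW) (Ralg_comp MCat F.AW)
      cloven cleavage_preserving cloven_idn cloven_cmp (inv_into cloven F.alg_of)"
    by (intro structured_arrows_iso.intro structured_arrows_iso_axioms.intro Ralg structured_arrows_cloven alg)
  have "cofibrantly_kz_generates MCat J (cone_family e) F.AW"
    using structured_arrows_iso.internal_iso_over_map[OF kz] two_category_discrete two_functor_cone_family
    by (simp add: cofibrantly_kz_generates_def Ralg_icat_def F.Ralg_eq kz_icat_def kz_twocat_def)
  moreover have "two_iso_over (arrow_twocat MCat) (Ralg MCat F.AW) structured_forget cloven_opfibrations structured_forget"
    unfolding cloven_opfibrations_def cloven_def[symmetric] F.Ralg_eq
    by (rule structured_arrows_iso.two_iso_over_map[OF clv])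
  ultimately show ?thesis using F.lofs by blast
qed

end
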